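(* Let $\hbar\in\mathbb{R}_{>0}\setminus\mathbb{Q}$, let $\Gamma^{(0)}$ be a $\mathcal{D}$-seed of rank $n$ with exchange matrix $\varepsilon^{(0)}$, and let $i,j\in\{1,\dots,n\}$ satisfy $\varepsilon^{(0)}_{ij}=-2\,\varepsilon^{(0)}_{ji}$ and $|\varepsilon^{(0)}_{ij}|=2$. Put $$\Gamma^{(1)}=\mu_i(\Gamma^{(0)}),\ \Gamma^{(2)}=\mu_j(\Gamma^{(1)}),\ \Gamma^{(3)}=\mu_i(\Gamma^{(2)}),\quad \Gamma^{(4)}=\mu_j(\Gamma^{(0)}),\ \Gamma^{(5)}=\mu_i(\Gamma^{(4)}),$$ so that $\Gamma^{(3)}=\mu_j(\Gamma^{(5)})$. Let $c_{B_2}\in\mathrm{U}(1)\subset\mathbb{C}^\times$ be the constant such that $$\mathbf{K}^\hbar_{\Gamma^{(0)}\stackrel{i}{\to}\Gamma^{(1)}}\,\mathbf{K}^\hbar_{\Gamma^{(1)}\stackrel{j}{\to}\Gamma^{(2)}}\,\mathbf{K}^\hbar_{\Gamma^{(2)}\stackrel{i}{\to}\Gamma^{(3)}}=c_{B_2}\cdot\mathbf{K}^\hbar_{\Gamma^{(0)}\stackrel{j}{\to}\Gamma^{(4)}}\,\mathbf{K}^\hbar_{\Gamma^{(4)}\stackrel{i}{\to}\Gamma^{(5)}}\,\mathbf{K}^\hbar_{\Gamma^{(5)}\stackrel{j}{\to}\Gamma^{(3)}}$$ (such a constant exists by a theorem of Fock and Goncharov). Then $c_{B_2}=1$.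
   Context: **Seeds and mutations.** Fix $n\ge1$; $[a]_+=\max(a,0)$. A $\mathcal{D}$-seed $\Gamma$ has an exchange matrix $\varepsilon=(\varepsilon_{ij})\in\mathbb{Z}^{n\times n}$ and a skew-symmetrizer $d=(d_1,\dots,d_n)$ of positive integers such that $\varepsilon_{ij}d_j^{-1}=-\varepsilon_{ji}d_i^{-1}$ for all $i,j$. (It also carries $2n$ formal cluster variables $B_i,X_i$, which play no role in the operators below; all operators depend only on $(\varepsilon,d)$.) The mutated seed $\Gamma'=\mu_k(\Gamma)$ has data $(\varepsilon',d')$ with $d'=d$, $\varepsilon'_{ij}=-\varepsilon_{ij}$ if $i=k$ or $j=k$, and $\varepsilon'_{ij}=\varepsilon_{ij}+\frac12(|\varepsilon_{ik}|\varepsilon_{kj}+\varepsilon_{ik}|\varepsilon_{kj}|)$ otherwise. **Hilbert space and operators.** $\hbar_k:=\hbar/d_k$. To each seed is attached $\mathscr{H}_\Gamma=L^2(\mathbb{R}^n,da_1\cdots da_n)$ and the dense subspace $D_\Gamma$ spanned by the functions $e^{-\sum_i(\alpha_ia_i^2+\beta_ia_i)}P(a_1,\dots,a_n)$ with $\alpha_i,\beta_i\in\mathbb{C}$, $\mathrm{Re}(\alpha_i)>0$, $P$ a complex polynomial. On $D_\Gamma$ put $\widehat{\mathbf q}_i^\hbar=a_i$ (multiplication), $\widehat{\mathbf p}_i^\hbar=2\pi\sqrt{-1}\,\hbar\,\frac{\partial}{\partial a_i}$, and $$\widehat{\mathbf x}^\hbar_{\Gamma;i}=\tfrac12d_i^{-1}\widehat{\mathbf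 p}_i^\hbar-\sum_{j}\varepsilon_{ij}\widehat{\mathbf q}_j^\hbar,\qquad \widehat{\widetilde{\mathbf x}}{}^\hbar_{\Gamma;i}=\tfrac12d_i^{-1}\widehat{\mathbf p}_i^\hbar+\sum_{j}\varepsilon_{ij}\widehat{\mathbf q}_j^\hbar .$$ These are essentially self-adjoint on $D_\Gamma$; the same symbols denote the unique self-adjoint extensions inside functional calculus. **Quantum dilogarithm.** For real $h>0$ and real $z$, $$\Phi^h(z)=\exp\left(-\frac14\int_\Omega\frac{e^{-\sqrt{-1}\,pz}}{\sinh(\pi p)\sinh(\pi hp)}\frac{dp}{p}\right),$$ where $\Omega$ is the real line (oriented left to right) avoiding the origin by a small half circle above it. One has $|\Phi^h(z)|=1$ for real $z$. **Intertwiner.** For $\Gamma'=\mu_k(\Gamma)$, $\mathbf{K}^\hbar_{\Gamma\stackrel{k}{\to}\Gamma'}:\mathscr{H}_{\Gamma'}\to\mathscr{H}_\Gamma$ is the unitary map $$\mathbf{K}^\hbar_{\Gamma\stackrel{k}{\to}\Gamma'}=\Phi^{\hbar_k}(\widehat{\mathbf x}^\hbar_{\Gamma;k})\,\bigl(\Phi^{\hbar_k}(\widehat{\widetilde{\mathbf x}}{}^\hbar_{\Gamma;k})\bigr)^{-1}\circ\mathbf{K}'_{\Gamma\stackrel{k}{\to}\Gamma'},$$ where the first two factors are defined by functional calculus and $(\mathbf{K}'_{\Gamma\stackrel{k}{\to}\Gamma'}f)(a_1,\dots,a_n)=f(a_1',\dots,a_n')$ with $a'_i=a_i$ for $i\ne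 k$ and $a'_k=-a_k+\sum_{j=1}^n[-\varepsilon_{kj}]_+a_j$. *)

theory Defs
  imports "HOL-Complex_Analysis.Complex_Analysis"
begin

section \<open>Seeds and mutations\<close>

text \<open>
  The index set \<open>{1,\<dots>,n}\<close> is a finite type. The formal cluster variables of a seed are
  omitted, since none of the operators depends on them.
\<close>

record 'n seed =
  exch :: "'n \<Rightarrow> 'n \<Rightarrow> int"
  skew :: "'n \<Rightarrow> nat"

definition D_seed :: "'n seed \<Rightarrow> bool" where
  "D_seed \<Gamma> \<longleftrightarrow> (\<forall>i. skew \<Gamma> i > 0) \<and>
     (\<forall>i j. real_of_int (exch \<Gamma> i j) / real (skew \<Gamma> j)
          = - (real_of_int (exch \<Gamma> j i) / real (skew \<Gamma> i)))"

text \<open>The integer division by 2 is exact: \<open>\<bar>x\<bar> * y + x * \<bar>y\<bar>\<close> is \<open>0\<close> or \<open>\<plusminus>2 * x * y\<close>.\<close>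

definition mutate :: "'n \<Rightarrow> 'n seed \<Rightarrow> 'n seed" where
  "mutate k \<Gamma> = \<lparr> exch = (\<lambda>i j.
        if i = k \<or> j = k then - exch \<Gamma> i j
        else exch \<Gamma> i j
             + (\<bar>exch \<Gamma> i k\<bar> * exch \<Gamma> k j + exch \<Gamma> i k * \<bar>exch \<Gamma> k j\<bar>) div 2),
     skew = skew \<Gamma> \<rparr>"

section \<open>The Hilbert space of square-integrable functions\<close>

definition square_integrable :: "(real ^ 'n::finite \<Rightarrow> complex) \<Rightarrow> bool" where
  "square_integrable f \<longleftrightarrow>
     f \<in> borel_measurable lborel \<and> integrable lborel (\<lambda>a. (cmod (f a))\<^sup>2)"

lemma borel_measurable_cnj_mult:
  assumes "square_integrable f" "square_integrable g"
  shows "(\<lambda>a. cnj (f a) * g a) \<in> borel_measurable borel"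
proof -
  have "cnj \<in> borel_measurable borel"
    by (intro borel_measurable_continuous_onI continuous_intros)
  then have "(\<lambda>a. cnj (f a)) \<in> borel_measurable borel"
    using assms(1) by (auto simp: square_integrable_def intro: measurable_compose)
  then show ?thesis
    using assms(2) unfolding square_integrable_def by (intro borel_measurable_times) auto
qed

lemma square_integrable_mult:
  assumes "square_integrable f" "square_integrable g"
  shows "integrable lborel (\<lambda>a. cnj (f a) * g a)"
proof (rule Bochner_Integration.integrable_bound)
  show "integrable lborel (\<lambda>a. (cmod (f a))\<^sup>2 + (cmod (g a))\<^sup>2)"
    using assms by (simp add: square_integrable_def)
  show "(\<lambda>a. cnj (f a) * g a) \<in> borel_measurable lborel"
    using assms by (simp add: borel_measurable_cnj_mult)
  have "x * y \<le> x\<^sup>2 + y\<^sup>2" if "x \<ge> 0" "y \<ge> 0" for x y :: real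
    using sum_squares_bound[of x y] mult_nonneg_nonneg[OF that] by linarith
  then show "AE a in lborel. norm (cnj (f a) * g a) \<le> norm ((cmod (f a))\<^sup>2 + (cmod (g a))\<^sup>2)"
    by (simp add: norm_mult)
qed

lemma square_integrable_0: "square_integrable (\<lambda>_. 0)"
  by (simp add: square_integrable_def)

lemma square_integrable_add:
  assumes "square_integrable f" "square_integrable g"
  shows "square_integrable (\<lambda>a. f a + g a)"
  unfolding square_integrable_def
proof
  have [measurable]: "f \<in> borel_measurable borel" "g \<in> borel_measurable borel"
    using assms by (auto simp: square_integrable_def)
  show "(\<lambda>a. f a + g a) \<in> borel_measurable lborel" by measurable
  show "integrable lborel (\<lambda>a. (cmod (f a + g a))\<^sup>2)"
  proof (rule Bochner_Integration.integrable_bound)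
    show "integrable lborel (\<lambda>a. 2 * (cmod (f a))\<^sup>2 + 2 * (cmod (g a))\<^sup>2)"
      using assms by (simp add: square_integrable_def)
    show "(\<lambda>a. (cmod (f a + g a))\<^sup>2) \<in> borel_measurable lborel" by measurable
    have "(cmod (x + y))\<^sup>2 \<le> 2 * (cmod x)\<^sup>2 + 2 * (cmod y)\<^sup>2" for x y
    proof -
      have "(cmod (x + y))\<^sup>2 \<le> (cmod x + cmod y)\<^sup>2"
        by (intro power_mono norm_triangle_ineq) auto
      also have "\<dots> \<le> 2 * (cmod x)\<^sup>2 + 2 * (cmod y)\<^sup>2"
        using sum_squares_bound[of "cmod x" "cmod y"] by (simp add: power2_sum)
      finally show ?thesis .
    qed
    then show "AE a in lborel. norm ((cmod (f a + g a))\<^sup>2)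
                 \<le> norm (2 * (cmod (f a))\<^sup>2 + 2 * (cmod (g a))\<^sup>2)"
      by simp
  qed
qed

lemma square_integrable_cmult:
  assumes "square_integrable f"
  shows "square_integrable (\<lambda>a. c * f a)"
  using assms by (auto simp: square_integrable_def norm_mult power_mult_distrib)

lemma square_integrable_minus:
  assumes "square_integrable f"
  shows "square_integrable (\<lambda>a. - f a)"
  using square_integrable_cmult[OF assms, of "-1"] by simp

lemma square_integrable_diff:
  assumes "square_integrable f" "square_integrable g"
  shows "square_integrable (\<lambda>a. f a - g a)"
  using square_integrable_add[OF assms(1) square_integrable_minus[OF assms(2)]] by simp

quotient_type 'n l2 = "real ^ ('n::finite) \<Rightarrow> complex" / partial:
  "\<lambda>f g. square_integrable f \<and> square_integrable g \<and> (AE a in lborel. f a = g a)"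
proof (rule part_equivpI)
  show "\<exists>f :: real ^ 'n \<Rightarrow> complex.
          square_integrable f \<and> square_integrable f \<and> (AE a in lborel. f a = f a)"
    using square_integrable_0 by auto
  show "symp (\<lambda>f g :: real ^ 'n \<Rightarrow> complex.
          square_integrable f \<and> square_integrable g \<and> (AE a in lborel. f a = g a))"
    by (rule sympI) (auto elim: eventually_mono)
  show "transp (\<lambda>f g :: real ^ 'n \<Rightarrow> complex.
          square_integrable f \<and> square_integrable g \<and> (AE a in lborel. f a = g a))"
    by (rule transpI) auto
qed

text \<open>
  \<open>cinner\<close> is conjugate-linear in its first argument; \<open>abs_l2 f\<close> is the class of a
  square-integrable function \<open>f\<close> modulo equality almost everywhere.
\<close>

lift_definition cinner :: "('n::finite) l2 \<Rightarrow> 'n l2 \<Rightarrow> complex"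
  is "\<lambda>f g. LINT a|lborel. cnj (f a) * g a"
  by (rule integral_cong_AE) (auto intro: borel_measurable_cnj_mult)

lift_definition cscale :: "complex \<Rightarrow> ('n::finite) l2 \<Rightarrow> 'n l2"
  is "\<lambda>c f a. c * f a"
  by (auto simp: square_integrable_cmult)

instantiation l2 :: (finite) real_inner
begin

lift_definition zero_l2 :: "'a l2" is "\<lambda>_. 0"
  by (simp add: square_integrable_0)

lift_definition plus_l2 :: "'a l2 \<Rightarrow> 'a l2 \<Rightarrow> 'a l2" is "\<lambda>f g a. f a + g a"
  by (auto simp: square_integrable_add)

lift_definition minus_l2 :: "'a l2 \<Rightarrow> 'a l2 \<Rightarrow> 'a l2" is "\<lambda>f g a. f a - g a"
  by (auto simp: square_integrable_diff)

lift_definition uminus_l2 :: "'a l2 \<Rightarrow> 'a l2" is "\<lambda>f a. - f a"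
  by (auto simp: square_integrable_minus)

definition scaleR_l2 :: "real \<Rightarrow> 'a l2 \<Rightarrow> 'a l2" where
  "scaleR_l2 r = cscale (complex_of_real r)"

definition inner_l2 :: "'a l2 \<Rightarrow> 'a l2 \<Rightarrow> real" where
  "inner_l2 f g = Re (cinner f g)"

definition norm_l2 :: "'a l2 \<Rightarrow> real" where
  "norm_l2 f = sqrt (inner f f)"

definition sgn_l2 :: "'a l2 \<Rightarrow> 'a l2" where
  "sgn_l2 f = inverse (norm f) *\<^sub>R f"

definition dist_l2 :: "'a l2 \<Rightarrow> 'a l2 \<Rightarrow> real" where
  "dist_l2 f g = norm (f - g)"

definition uniformity_l2 :: "('a l2 \<times> 'a l2) filter" where
  "uniformity_l2 = (INF e\<in>{0<..}. principal {(f, g). dist f g < e})"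

definition open_l2 :: "'a l2 set \<Rightarrow> bool" where
  "open_l2 U \<longleftrightarrow> (\<forall>f\<in>U. \<forall>\<^sub>F (f', g) in uniformity. f' = f \<longrightarrow> g \<in> U)"

lemma cinner_commute_l2: "cinner f g = cnj (cinner g f)" for f g :: "'a l2"
  by transfer (simp add: mult.commute flip: Bochner_Integration.integral_cnj)

lemma cinner_add_left_l2: "cinner (f + g) h = cinner f h + cinner g h" for f g h :: "'a l2"
  by transfer (simp add: distrib_right square_integrable_mult)

lemma cinner_cscale_left_l2: "cinner (cscale c f) h = cnj c * cinner f h" for f h :: "'a l2"
  by transfer (simp add: mult.assoc)

lemma cinner_self_l2: "cinner f f = of_real (Re (cinner f f))" for f :: "'a l2"
proof -
  have "Im (cinner f f) = - Im (cinner f f)"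
    by (subst cinner_commute_l2) simp
  then show ?thesis
    by (simp add: complex_eq_iff)
qed

lemma Re_cinner_self_l2:
  assumes "square_integrable (f :: real ^ 'a \<Rightarrow> complex)"
  shows "Re (LINT a|lborel. cnj (f a) * f a) = (LINT a|lborel. (cmod (f a))\<^sup>2)"
proof -
  have "(LINT a|lborel. cnj (f a) * f a) = (LINT a|lborel. complex_of_real ((cmod (f a))\<^sup>2))"
    by (intro Bochner_Integration.integral_cong) (simp_all add: complex_norm_square mult.commute del: of_real_power)
  then show ?thesis
    by (simp del: of_real_power)
qed

instance
proof
  fix f g h :: "'a l2" and r s :: real
  show "f + g + h = f + (g + h)"
    by transfer (auto simp: add.assoc square_integrable_add)
  show "f + g = g + f"
    by transfer (auto simp: add.commute square_integrable_add)
  show "0 + f = f"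
    by transfer auto
  show "- f + f = 0"
    by transfer (auto simp: square_integrable_0)
  show "f - g = f + - g"
    by transfer (auto simp: square_integrable_diff)
  show "r *\<^sub>R (f + g) = r *\<^sub>R f + r *\<^sub>R g"
    unfolding scaleR_l2_def
    by transfer (auto simp: distrib_left square_integrable_add square_integrable_cmult)
  show "(r + s) *\<^sub>R f = r *\<^sub>R f + s *\<^sub>R f"
    unfolding scaleR_l2_def
    by transfer (auto simp: distrib_right square_integrable_add square_integrable_cmult
        simp flip: distrib_right)
  show "r *\<^sub>R s *\<^sub>R f = (r * s) *\<^sub>R f"
    unfolding scaleR_l2_def by transfer (auto simp: mult.assoc square_integrable_cmult)
  show "1 *\<^sub>R f = f"
    unfolding scaleR_l2_def by transfer auto
  show "dist f g = norm (f - g)"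
    by (rule dist_l2_def)
  show "sgn f = inverse (norm f) *\<^sub>R f"
    by (rule sgn_l2_def)
  show "uniformity = (INF e\<in>{0<..}. principal {(f :: 'a l2, g). dist f g < e})"
    by (rule uniformity_l2_def)
  show "open U \<longleftrightarrow> (\<forall>f\<in>U. \<forall>\<^sub>F (f', g) in uniformity. f' = f \<longrightarrow> g \<in> U)" for U :: "'a l2 set"
    by (rule open_l2_def)
  show "inner f g = inner g f"
    unfolding inner_l2_def by (subst cinner_commute_l2) simp
  show "inner (f + g) h = inner f h + inner g h"
    by (simp add: inner_l2_def cinner_add_left_l2)
  show "inner (r *\<^sub>R f) g = r * inner f g"
    by (simp add: inner_l2_def scaleR_l2_def cinner_cscale_left_l2)
  show "0 \<le> inner f f"
    unfolding inner_l2_def by transfer (auto simp: Re_cinner_self_l2)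
  show "inner f f = 0 \<longleftrightarrow> f = 0"
    unfolding inner_l2_def
  proof transfer
    fix f :: "real ^ 'a \<Rightarrow> complex"
    assume "square_integrable f \<and> square_integrable f \<and> (AE a in lborel. f a = f a)"
    then have f: "square_integrable f" by simp
    then have "(LINT a|lborel. (cmod (f a))\<^sup>2) = 0 \<longleftrightarrow> (AE a in lborel. (cmod (f a))\<^sup>2 = 0)"
      by (intro integral_nonneg_eq_0_iff_AE) (auto simp: square_integrable_def)
    with f show "Re (LINT a|lborel. cnj (f a) * f a) = 0 \<longleftrightarrow>
        square_integrable f \<and> square_integrable (\<lambda>_ :: real ^ 'a. 0) \<and> (AE a in lborel. f a = 0)"
      by (simp add: Re_cinner_self_l2 square_integrable_0)
  qed
  show "norm f = sqrt (inner f f)"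
    by (rule norm_l2_def)
qed

end

section \<open>Self-adjoint operators and functional calculus\<close>

text \<open>A densely defined operator is represented by its graph.\<close>

definition adjoint_graph :: "(('n::finite) l2 \<times> 'n l2) set \<Rightarrow> ('n l2 \<times> 'n l2) set" where
  "adjoint_graph A = {(f, g). \<forall>(u, v)\<in>A. cinner v f = cinner u g}"

definition self_adjoint :: "(('n::finite) l2 \<times> 'n l2) set \<Rightarrow> bool" where
  "self_adjoint A \<longleftrightarrow> adjoint_graph A = A"

definition sa_extension :: "(('n::finite) l2 \<times> 'n l2) set \<Rightarrow> ('n l2 \<times> 'n l2) set" where
  "sa_extension A = (THE B. A \<subseteq> B \<and> self_adjoint B)"

definition clinear :: "(('n::finite) l2 \<Rightarrow> 'n l2) \<Rightarrow> bool" where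
  "clinear T \<longleftrightarrow> (\<forall>f g. T (f + g) = T f + T g) \<and> (\<forall>c f. T (cscale c f) = cscale c (T f))"

definition orthogonal_projection :: "(('n::finite) l2 \<Rightarrow> 'n l2) \<Rightarrow> bool" where
  "orthogonal_projection P \<longleftrightarrow> clinear P \<and> (\<forall>f. P (P f) = P f) \<and>
     (\<forall>f g. cinner (P f) g = cinner f (P g))"

definition projection_valued_measure :: "(real set \<Rightarrow> ('n::finite) l2 \<Rightarrow> 'n l2) \<Rightarrow> bool" where
  "projection_valued_measure E \<longleftrightarrow>
     (\<forall>S\<in>sets borel. orthogonal_projection (E S)) \<and>
     (\<forall>f. E UNIV f = f) \<and>
     (\<forall>S :: nat \<Rightarrow> real set. range S \<subseteq> sets borel \<and> disjoint_family S \<longrightarrow>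
        (\<forall>f. (\<lambda>k. E (S k) f) sums E (\<Union>k. S k) f))"

text \<open>The finite measure \<open>S \<mapsto> \<langle>f, E S f\<rangle> = \<parallel>E S f\<parallel>\<^sup>2\<close> on the real line.\<close>

definition diagonal_measure ::
    "(real set \<Rightarrow> ('n::finite) l2 \<Rightarrow> 'n l2) \<Rightarrow> 'n l2 \<Rightarrow> real measure" where
  "diagonal_measure E f = measure_of UNIV (sets borel) (\<lambda>S. ennreal (Re (cinner f (E S f))))"

text \<open>
  \<open>spectral_measure A E\<close> says \<open>A = \<integral>t dE(t)\<close>; operators are compared through their domains
  and, by polarization, their quadratic forms.
\<close>

definition spectral_measure ::
    "(('n::finite) l2 \<times> 'n l2) set \<Rightarrow> (real set \<Rightarrow> 'n l2 \<Rightarrow> 'n l2) \<Rightarrow> bool" where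
  "spectral_measure A E \<longleftrightarrow> projection_valued_measure E \<and>
     Domain A = {f. integrable (diagonal_measure E f) (\<lambda>t. t\<^sup>2)} \<and>
     (\<forall>(f, g)\<in>A. cinner f g = of_real (LINT t|diagonal_measure E f. t))"

text \<open>
  \<open>functional_calculus \<phi> A = \<integral>\<phi>(t) dE(t)\<close>, for a self-adjoint operator \<open>A\<close> with spectral
  measure \<open>E\<close> and a bounded Borel function \<open>\<phi>\<close>.
\<close>

definition functional_calculus ::
    "(real \<Rightarrow> complex) \<Rightarrow> (('n::finite) l2 \<times> 'n l2) set \<Rightarrow> 'n l2 \<Rightarrow> 'n l2" where
  "functional_calculus \<phi> A = (THE T. \<exists>E. spectral_measure A E \<and> clinear T \<and> bounded_linear T \<and>
     (\<forall>f. cinner f (T f) = (LINT t|diagonal_measure E f. \<phi> t)))"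

section \<open>The quantized coordinate operators\<close>

text \<open>
  The complex span is written out as finite sums; complex scalars are absorbed into the
  polynomials. A \<^const>\<open>polynomial_function\<close> into the complex numbers is exactly a
  polynomial in the real coordinates with complex coefficients.
\<close>

definition gaussian_domain :: "(real ^ 'n::finite \<Rightarrow> complex) set" where
  "gaussian_domain = {f. \<exists>(N::nat) (\<alpha> :: nat \<Rightarrow> 'n \<Rightarrow> complex) (\<beta> :: nat \<Rightarrow> 'n \<Rightarrow> complex)
        (P :: nat \<Rightarrow> real ^ 'n \<Rightarrow> complex).
      (\<forall>m<N. (\<forall>i. Re (\<alpha> m i) > 0) \<and> polynomial_function (P m)) \<and>
      f = (\<lambda>a. \<Sum>m<N. exp (- (\<Sum>i\<in>UNIV. \<alpha> m i * of_real ((a $ i)\<^sup>2) + \<beta> m i * of_real (a $ i)))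
                         * P m a)}"

definition qhat :: "'n \<Rightarrow> (real ^ 'n::finite \<Rightarrow> complex) \<Rightarrow> real ^ 'n \<Rightarrow> complex" where
  "qhat i f a = of_real (a $ i) * f a"

definition phat :: "real \<Rightarrow> 'n \<Rightarrow> (real ^ 'n::finite \<Rightarrow> complex) \<Rightarrow> real ^ 'n \<Rightarrow> complex" where
  "phat hbar i f a =
     2 * of_real pi * \<i> * of_real hbar
       * vector_derivative (\<lambda>t. f (a + t *\<^sub>R axis i 1)) (at 0)"

definition xhat ::
    "real \<Rightarrow> ('n::finite) seed \<Rightarrow> 'n \<Rightarrow> (real ^ 'n \<Rightarrow> complex) \<Rightarrow> real ^ 'n \<Rightarrow> complex" where
  "xhat hbar \<Gamma> i f a = 1 / 2 * inverse (of_nat (skew \<Gamma> i)) * phat hbar i f a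
     - (\<Sum>j\<in>UNIV. of_int (exch \<Gamma> i j) * qhat j f a)"

definition xhat_tilde ::
    "real \<Rightarrow> ('n::finite) seed \<Rightarrow> 'n \<Rightarrow> (real ^ 'n \<Rightarrow> complex) \<Rightarrow> real ^ 'n \<Rightarrow> complex" where
  "xhat_tilde hbar \<Gamma> i f a = 1 / 2 * inverse (of_nat (skew \<Gamma> i)) * phat hbar i f a
     + (\<Sum>j\<in>UNIV. of_int (exch \<Gamma> i j) * qhat j f a)"

definition sa_operator ::
    "((real ^ 'n::finite \<Rightarrow> complex) \<Rightarrow> real ^ 'n \<Rightarrow> complex) \<Rightarrow> ('n l2 \<times> 'n l2) set" where
  "sa_operator L = sa_extension {(abs_l2 f, abs_l2 (L f)) | f. f \<in> gaussian_domain}"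

section \<open>The quantum dilogarithm\<close>

definition dilog_integrand :: "real \<Rightarrow> real \<Rightarrow> complex \<Rightarrow> complex" where
  "dilog_integrand h z p =
     exp (- \<i> * p * of_real z) / (sinh (of_real pi * p) * sinh (of_real pi * of_real h * p) * p)"

text \<open>
  The nonzero poles of the integrand nearest to the origin have modulus \<open>min 1 (1 / h)\<close>, so
  the choice of a smaller radius does not affect the integral. The circular arc runs from \<open>-r\<close>
  to \<open>r\<close> through the upper half-plane.
\<close>

definition dilog_integral :: "real \<Rightarrow> real \<Rightarrow> complex" where
  "dilog_integral h z = (let r = min 1 (1 / h) / 2 in
     (LINT p:{..- r}|lborel. dilog_integrand h z (of_real p))
     + contour_integral (part_circlepath 0 r pi 0) (dilog_integrand h z)
     + (LINT p:{r..}|lborel. dilog_integrand h z (of_real p)))"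

definition quantum_dilog :: "real \<Rightarrow> real \<Rightarrow> complex" where
  "quantum_dilog h z = exp (- 1 / 4 * dilog_integral h z)"

section \<open>The intertwiners\<close>

definition mutation_coords :: "('n::finite) seed \<Rightarrow> 'n \<Rightarrow> real ^ 'n \<Rightarrow> real ^ 'n" where
  "mutation_coords \<Gamma> k a = (\<chi> i. if i = k
     then - (a $ k) + (\<Sum>j\<in>UNIV. real_of_int (max (- exch \<Gamma> k j) 0) * a $ j)
     else a $ i)"

text \<open>
  For a seed, \<open>mutation_coords \<Gamma> k\<close> is linear of determinant \<open>-1\<close>, so this does not depend on
  the representative.
\<close>

definition K_prime :: "('n::finite) seed \<Rightarrow> 'n \<Rightarrow> 'n l2 \<Rightarrow> 'n l2" where
  "K_prime \<Gamma> k f = abs_l2 (\<lambda>a. rep_l2 f (mutation_coords \<Gamma> k a))"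

text \<open>
  \<open>intertwiner hbar \<Gamma> k\<close> maps the Hilbert space of \<open>mutate k \<Gamma>\<close> to that of \<open>\<Gamma>\<close>; as spaces of
  functions both are the same.
\<close>

definition intertwiner :: "real \<Rightarrow> ('n::finite) seed \<Rightarrow> 'n \<Rightarrow> 'n l2 \<Rightarrow> 'n l2" where
  "intertwiner hbar \<Gamma> k = (let \<Phi> = quantum_dilog (hbar / real (skew \<Gamma> k)) in
     functional_calculus \<Phi> (sa_operator (xhat hbar \<Gamma> k))
     \<circ> inv (functional_calculus \<Phi> (sa_operator (xhat_tilde hbar \<Gamma> k)))
     \<circ> K_prime \<Gamma> k)"

end

theory Submission
  imports Defs "HOL-Probability.Levy"
begin

text \<open>
  Each intertwiner is a dilogarithm factor \<open>\<Phi>(x) \<Phi>(x~)\<^sup>-\<^sup>1\<close> composed with a linear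
  substitution \<open>K'\<close> of determinant \<open>-1\<close>. Substitutions map nonnegative functions to
  nonnegative functions, so they cannot produce a phase. The proof strips the dilogarithm
  factors off the given identity until only substitutions are left on one side, and then
  compares both sides on a nonnegative function. The factors are removed by two limits and a
  symmetry. Throughout, \<open>p\<close> and \<open>-q\<close> denote \<open>\<epsilon>\<^sub>i\<^sub>j\<close> and \<open>\<epsilon>\<^sub>j\<^sub>i\<close>, where \<open>p, q > 0\<close> and \<open>pq = 2\<close>;
  the opposite sign is the same situation with \<open>i\<close> and \<open>j\<close> exchanged and \<open>c\<close> replaced by its
  inverse.

  First limit. Conjugation by the multiplication operator \<open>exp(i \<eta>\<cdot>a)\<close> translates \<open>x\<close> and
  \<open>x~\<close> in direction \<open>k\<close> by a negative multiple of \<open>\<eta>\<^sub>k\<close>, and \<open>\<Phi>(z) \<rightarrow> 1\<close> as \<open>z \<rightarrow> -\<infinity>\<close>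
  (\<open>quantum_dilog_tendsto_1\<close>). A dilogarithm factor therefore commutes with the modulation
  when \<open>\<eta>\<^sub>k = 0\<close> and disappears as \<open>\<eta>\<^sub>k \<rightarrow> \<infinity>\<close>, while \<open>K'\<close> replaces \<open>\<eta>\<close> by its pullback. Apply
  both sides of the identity to functions modulated with \<open>\<eta> = -n e\<^sub>j\<close>. On the left the three
  factors meet the frequencies \<open>0, n, 0\<close>, on the right \<open>n, qn, n\<close>. In both cases the
  accumulated modulation is the same, a piecewise linear identity in the matrix entries
  (\<open>frequencies_agree\<close>), and it can be cancelled. What remains
  (\<open>identity_after_modulation_limit\<close>) has the form \<open>P\<^sub>0 K' K' P\<^sub>2 K' = c K' K' K'\<close>: the
  substitutions \<open>K'\<close> are those of the six mutations, and \<open>P\<^sub>0\<close> and \<open>P\<^sub>2\<close> are the dilogarithm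
  factors of \<open>\<Gamma>0\<close> and \<open>\<Gamma>2\<close> in direction \<open>i\<close>.

  Symmetry. The composition of the first two substitutions on the left carries the operators
  \<open>x, x~\<close> of \<open>\<Gamma>2\<close> in direction \<open>i\<close> to the negatives of those of \<open>\<Gamma>0\<close>. Hence \<open>P\<^sub>2\<close> may be
  moved to the left, where it becomes the factor \<open>P\<^sub>0\<^sup>-\<close> of the function \<open>\<Phi>(-z)\<close>
  (\<open>reflected_dilog_factor\<close>).

  Second limit. Let \<open>y\<close> run through Gaussians that concentrate on the line spanned by \<open>e\<^sub>i\<close>.
  On them the linear forms in \<open>x\<close> and \<open>x~\<close> become negligible, so the two operators have the
  same limit and both quotients \<open>P\<^sub>0\<close> and \<open>P\<^sub>0\<^sup>-\<close> tend to the identity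
  (\<open>first_order_quotient_squeeze_tendsto\<close>). Thus \<open>c h - y \<rightarrow> 0\<close>, where \<open>y\<close> and \<open>h\<close> are
  nonnegative functions and \<open>y\<close> has a fixed nonzero norm. Pairing with \<open>y\<close> makes \<open>c\<close> a
  nonnegative real number, so \<open>c = 1\<close> (\<open>phase_eq_1_if_pos\<close>).

  These arguments use the functional calculus only through the unitary group
  \<open>V\<^sub>s = exp(i s x)\<close>, which is an explicit translation followed by multiplication with a
  phase. The link is the notion \<open>group_function\<close>: an operator whose quadratic form
  integrates \<open>\<phi>\<close> against the measures with characteristic functions \<open>s \<mapsto> \<langle>F, V\<^sub>s F\<rangle>\<close>. By
  uniqueness of characteristic functions such an operator is determined by \<open>V\<close> and \<open>\<phi>\<close>, and
  inherits every covariance of \<open>V\<close>. That \<open>\<phi>(x)\<close> has this property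
  (\<open>functional_calculus_first_order\<close>) requires that the operator on the Gaussian domain has
  exactly one self-adjoint extension, namely multiplication by a coordinate in a
  Fourier-type picture, and that a multiplication operator has exactly one spectral measure.
\<close>

section \<open>Square-integrable functions and their classes\<close>

lemma abs_rep_l2 [simp]: "abs_l2 (rep_l2 F) = F"
  by (rule Quotient3_abs_rep[OF Quotient3_l2])

lemma square_integrable_rep_l2 [simp]: "square_integrable (rep_l2 F)"
  using Quotient3_rep_reflp[OF Quotient3_l2, of F] by auto

lemma measurable_rep_l2 [measurable]: "rep_l2 F \<in> borel_measurable borel"
  using square_integrable_rep_l2[of F] by (simp add: square_integrable_def)

lemma abs_l2_eqI:
  assumes "square_integrable f" "square_integrable g" "AE a in lborel. f a = g a"
  shows "abs_l2 f = abs_l2 g"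
  using Quotient3_rel[OF Quotient3_l2, of f g] assms by auto

lemma abs_l2_eqD:
  assumes "square_integrable f" "square_integrable g" "abs_l2 f = abs_l2 g"
  shows "AE a in lborel. f a = g a"
  using Quotient3_rel[OF Quotient3_l2, of f g] assms by auto

lemma AE_rep_abs_l2:
  assumes "square_integrable f"
  shows "AE a in lborel. rep_l2 (abs_l2 f) a = f a"
  by (rule abs_l2_eqD) (use assms in auto)

lemma l2_eqI:
  assumes "AE a in lborel. rep_l2 F a = rep_l2 G a"
  shows "F = G"
  using abs_l2_eqI[OF _ _ assms] by simp

lemma cinner_rep: "cinner F G = (LINT a|lborel. cnj (rep_l2 F a) * rep_l2 G a)"
  by (rule cinner.rep_eq)

lemma cinner_abs_l2:
  assumes "square_integrable f" "square_integrable g"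
  shows "cinner (abs_l2 f) (abs_l2 g) = (LINT a|lborel. cnj (f a) * g a)"
  by (rule cinner.abs_eq) (use assms in auto)

lemma cscale_abs_l2: "square_integrable f \<Longrightarrow> cscale c (abs_l2 f) = abs_l2 (\<lambda>a. c * f a)"
  by (rule cscale.abs_eq) auto

lemma plus_abs_l2: "square_integrable f \<Longrightarrow> square_integrable g \<Longrightarrow>
    abs_l2 f + abs_l2 g = abs_l2 (\<lambda>a. f a + g a)"
  by (rule plus_l2.abs_eq) auto

lemma minus_abs_l2: "square_integrable f \<Longrightarrow> square_integrable g \<Longrightarrow>
    abs_l2 f - abs_l2 g = abs_l2 (\<lambda>a. f a - g a)"
  by (rule minus_l2.abs_eq) auto

lemma zero_abs_l2: "0 = abs_l2 (\<lambda>_. 0)"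
  by (simp add: zero_l2_def)

lemma AE_rep_plus: "AE a in lborel. rep_l2 (F + G) a = rep_l2 F a + rep_l2 G a"
  using plus_abs_l2[of "rep_l2 F" "rep_l2 G"]
    AE_rep_abs_l2[OF square_integrable_add[of "rep_l2 F" "rep_l2 G"]] by simp

lemma AE_rep_minus: "AE a in lborel. rep_l2 (F - G) a = rep_l2 F a - rep_l2 G a"
  using minus_abs_l2[of "rep_l2 F" "rep_l2 G"]
    AE_rep_abs_l2[OF square_integrable_diff[of "rep_l2 F" "rep_l2 G"]] by simp

lemma AE_rep_cscale: "AE a in lborel. rep_l2 (cscale c F) a = c * rep_l2 F a"
  using cscale_abs_l2[of "rep_l2 F"]
    AE_rep_abs_l2[OF square_integrable_cmult[of "rep_l2 F" c]] by simp

lemma AE_rep_zero: "AE a in lborel. rep_l2 0 a = 0"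
  using AE_rep_abs_l2[OF square_integrable_0] by (simp add: zero_abs_l2)

section \<open>The complex inner product\<close>

lemma cinner_add_left: "cinner (F + G) H = cinner F H + cinner G H"
  by (rule cinner_add_left_l2)

lemma cinner_cscale_left: "cinner (cscale c F) H = cnj c * cinner F H"
  by (rule cinner_cscale_left_l2)

lemma cinner_commute: "cinner F G = cnj (cinner G F)"
  by (rule cinner_commute_l2)

lemma cinner_add_right: "cinner H (F + G) = cinner H F + cinner H G"
  by (metis cinner_commute cinner_add_left complex_cnj_add)

lemma cinner_cscale_right: "cinner H (cscale c F) = c * cinner H F"
  by (metis cinner_commute cinner_cscale_left complex_cnj_mult complex_cnj_cnj)

lemma cscale_scaleR: "r *\<^sub>R F = cscale (complex_of_real r) F"
  by (simp add: scaleR_l2_def)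

lemma cinner_scaleR_left: "cinner (r *\<^sub>R F) G = r *\<^sub>R cinner F G"
  by (simp add: cscale_scaleR cinner_cscale_left scaleR_conv_of_real)

lemma cinner_scaleR_right: "cinner F (r *\<^sub>R G) = r *\<^sub>R cinner F G"
  by (simp add: cscale_scaleR cinner_cscale_right scaleR_conv_of_real)

lemma Re_cinner: "Re (cinner F G) = inner F G"
  by (simp add: inner_l2_def)

lemma cinner_self: "cinner F F = complex_of_real ((norm F)\<^sup>2)"
  using cinner_self_l2[of F] by (simp add: power2_norm_eq_inner Re_cinner)

lemma norm_cscale: "norm (cscale c F) = cmod c * norm F"
proof -
  have "complex_of_real ((norm (cscale c F))\<^sup>2) = complex_of_real ((cmod c * norm F)\<^sup>2)"
    unfolding cinner_self[symmetric] cinner_cscale_left cinner_cscale_right power_mult_distrib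
    by (simp only: cinner_self of_real_mult complex_norm_square) (simp add: mult_ac)
  then have "(norm (cscale c F))\<^sup>2 = (cmod c * norm F)\<^sup>2" by (simp only: of_real_eq_iff)
  then show ?thesis by (simp add: power2_eq_iff_nonneg)
qed

lemma cmod_cinner_le: "cmod (cinner F G) \<le> norm F * norm G"
proof (cases "cinner F G = 0")
  case False
  define c where "c = sgn (cinner F G)"
  have c: "cmod c = 1" using False by (simp add: c_def norm_sgn)
  have "cnj c * cinner F G = (cinner F G * cnj (cinner F G)) / of_real (cmod (cinner F G))"
    by (simp add: c_def sgn_eq)
  also have "\<dots> = of_real (cmod (cinner F G))"
    using False by (simp only: complex_norm_square[symmetric]) (simp add: power2_eq_square)
  finally have "cnj c * cinner F G = of_real (cmod (cinner F G))" .
  then have "cmod (cinner F G) = Re (cinner (cscale c F) G)"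
    by (simp add: cinner_cscale_left)
  also have "\<dots> \<le> norm (cscale c F) * norm G"
    by (simp add: Re_cinner norm_cauchy_schwarz)
  finally show ?thesis by (simp add: norm_cscale c)
qed simp

lemma bounded_bilinear_cinner: "bounded_bilinear cinner"
proof
  show "\<exists>K. \<forall>a b. norm (cinner a b) \<le> norm a * norm b * K"
    by (intro exI[of _ 1]) (simp add: cmod_cinner_le)
qed (simp_all add: cinner_add_left cinner_add_right cinner_scaleR_left cinner_scaleR_right)

interpretation cinner: bounded_bilinear cinner
  by (rule bounded_bilinear_cinner)

lemma l2_eq_cinnerI:
  assumes "\<And>H. cinner H F = cinner H G"
  shows "F = G"
proof -
  have "cinner (F - G) (F - G) = 0"
    unfolding cinner.diff_right using assms by simp
  then show ?thesis unfolding cinner_self by simp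
qed

lemma cscale_1 [simp]: "cscale 1 F = F"
  by (rule l2_eq_cinnerI) (simp add: cinner_cscale_right)
lemma cscale_0 [simp]: "cscale 0 F = 0"
  by (rule l2_eq_cinnerI) (simp add: cinner_cscale_right cinner.zero_right)
lemma cscale_cscale [simp]: "cscale a (cscale b F) = cscale (a * b) F"
  by (rule l2_eq_cinnerI) (simp add: cinner_cscale_right)
lemma cscale_add_right: "cscale c (F + G) = cscale c F + cscale c G"
  by (rule l2_eq_cinnerI) (simp add: cinner_cscale_right cinner_add_right distrib_left)
lemma cscale_diff_right: "cscale c (F - G) = cscale c F - cscale c G"
  by (rule l2_eq_cinnerI) (simp add: cinner_cscale_right cinner.diff_right right_diff_distrib)
lemma cscale_zero [simp]: "cscale c 0 = 0"
  by (rule l2_eq_cinnerI) (simp add: cinner_cscale_right cinner.zero_right)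
lemma minus_cscale: "- F = cscale (-1) F"
  by (rule l2_eq_cinnerI) (simp add: cinner_cscale_right cinner.minus_right)

lemma bounded_linear_cscale: "bounded_linear (cscale c)"
  by (rule bounded_linear_intro[where K = "cmod c"])
     (simp_all add: cscale_add_right cscale_scaleR norm_cscale mult.commute)

subsection \<open>Linear and unitary operators\<close>

lemma clinear_add: "clinear T \<Longrightarrow> T (F + G) = T F + T G"
  by (simp add: clinear_def)
lemma clinear_cscale: "clinear T \<Longrightarrow> T (cscale c F) = cscale c (T F)"
  by (simp add: clinear_def)
lemma clinear_zero: "clinear T \<Longrightarrow> T 0 = 0"
  using clinear_cscale[of T 0 0] by simp
lemma clinear_minus: "clinear T \<Longrightarrow> T (- F) = - T F"
  using clinear_cscale[of T "-1" F] by (simp add: minus_cscale)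
lemma clinear_diff: "clinear T \<Longrightarrow> T (F - G) = T F - T G"
  using clinear_add[of T F "- G"] clinear_minus[of T G] by simp
lemma clinear_comp: "clinear T \<Longrightarrow> clinear S \<Longrightarrow> clinear (T \<circ> S)"
  by (simp add: clinear_def)

text \<open>
  Polarization over the complex numbers: the values at \<open>F + G\<close> and \<open>F + \<i> G\<close> determine the
  sesquilinear form.
\<close>

lemma clinear_eqI_quadratic_form:
  assumes T: "clinear T" and S: "clinear S" and eq: "\<And>F. cinner F (T F) = cinner F (S F)"
  shows "T = S"
proof
  fix G
  define B where "B = (\<lambda>F G. cinner F (T G) - cinner F (S G))"
  have add: "B (F + G) (F + G) = B F F + B F G + B G F + B G G" for F G
    by (simp add: B_def clinear_add[OF T] clinear_add[OF S] cinner_add_left cinner_add_right)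
  have scr: "B F (cscale c G) = c * B F G" and scl: "B (cscale c F) G = cnj c * B F G" for c F G
    by (simp_all add: B_def clinear_cscale[OF T] clinear_cscale[OF S] cinner_cscale_left
        cinner_cscale_right right_diff_distrib)
  have zero: "B F F = 0" for F using eq by (simp add: B_def)
  show "T G = S G"
  proof (rule l2_eq_cinnerI)
    fix F
    have 1: "B F G + B G F = 0" using add[of F G] by (simp add: zero)
    have "B F (cscale \<i> G) + B (cscale \<i> G) F = 0" using add[of F "cscale \<i> G"] by (simp add: zero)
    then have "\<i> * (B F G - B G F) = 0" by (simp add: scr scl right_diff_distrib)
    then have "B F G = 0" using 1 by simp
    then show "cinner F (T G) = cinner F (S G)" by (simp add: B_def)
  qed
qed

definition unitary :: "(('n::finite) l2 \<Rightarrow> 'n l2) \<Rightarrow> bool" where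
  "unitary T \<longleftrightarrow> clinear T \<and> (\<forall>F. norm (T F) = norm F) \<and> surj T"

lemma isometry_cinner:
  assumes T: "clinear T" and n: "\<And>F. norm (T F) = norm F"
  shows "cinner (T F) (T G) = cinner F G"
proof -
  have Re: "Re (cinner (T F) (T G)) = Re (cinner F G)" for F G
  proof -
    have "(norm (T (F + G)))\<^sup>2 = (norm (F + G))\<^sup>2" by (simp add: n)
    then have "inner (T F + T G) (T F + T G) = inner (F + G) (F + G)"
      by (simp add: power2_norm_eq_inner clinear_add[OF T])
    moreover have "inner (T F) (T F) = inner F F" for F
      using n[of F] by (metis power2_norm_eq_inner)
    ultimately show ?thesis
      by (simp add: Re_cinner inner_add_left inner_add_right inner_commute)
  qed
  have "Im (cinner (T F) (T G)) = Im (cinner F G)"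
    using Re[of "cscale \<i> F" G] by (simp add: clinear_cscale[OF T] cinner_cscale_left)
  with Re[of F G] show ?thesis by (simp add: complex_eq_iff)
qed

lemma unitary_clinear: "unitary T \<Longrightarrow> clinear T"
  and unitary_norm: "unitary T \<Longrightarrow> norm (T F) = norm F"
  by (auto simp: unitary_def)

lemma unitary_cinner: "unitary T \<Longrightarrow> cinner (T F) (T G) = cinner F G"
  by (simp add: unitary_def isometry_cinner)

lemma unitary_bij:
  assumes "unitary T" shows "bij T"
proof (rule bijI)
  show "inj T"
  proof (rule injI)
    fix F G assume "T F = T G"
    then have "T (F - G) = 0" using assms by (simp add: unitary_def clinear_diff)
    moreover have "norm (T (F - G)) = norm (F - G)" using assms by (simp add: unitary_def)
    ultimately have "norm (F - G) = 0" by simp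
    then show "F = G" by simp
  qed
qed (use assms in \<open>simp add: unitary_def\<close>)

lemma unitary_inv_f [simp]: "unitary T \<Longrightarrow> T (inv T F) = F"
  and unitary_f_inv [simp]: "unitary T \<Longrightarrow> inv T (T F) = F"
  using unitary_bij[of T] by (simp_all add: bij_is_surj surj_f_inv_f bij_is_inj inv_f_f)

lemma unitary_inv:
  assumes "unitary T" shows "unitary (inv T)"
proof -
  have *: "inv T F = G \<longleftrightarrow> F = T G" for F G using assms by (metis unitary_inv_f unitary_f_inv)
  have "clinear (inv T)"
    unfolding clinear_def * using assms
    by (simp add: clinear_add clinear_cscale unitary_clinear)
  moreover have "norm (inv T F) = norm F" for F
    using unitary_norm[OF assms, of "inv T F"] assms by simp
  moreover have "surj (inv T)" using assms by (metis surjI unitary_f_inv)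
  ultimately show ?thesis by (simp add: unitary_def)
qed

lemma unitary_comp: "unitary T \<Longrightarrow> unitary S \<Longrightarrow> unitary (T \<circ> S)"
  using comp_surj[of S T] unfolding unitary_def by (simp add: clinear_comp)

lemma cinner_inv_left: "unitary T \<Longrightarrow> cinner (inv T F) G = cinner F (T G)"
  by (metis unitary_cinner unitary_inv_f)

lemma cinner_inv_right: "unitary T \<Longrightarrow> cinner F (inv T G) = cinner (T F) G"
  by (metis unitary_cinner unitary_inv_f)

lemma unitary_bounded_linear:
  assumes "unitary T" shows "bounded_linear T"
  by (rule bounded_linear_intro[where K = 1])
     (use assms in \<open>simp_all add: unitary_norm clinear_add clinear_cscale unitary_clinear cscale_scaleR\<close>)

text \<open>
  A right inverse of an isometry makes it surjective.
\<close>

lemma unitary_I_inverse: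
  assumes "clinear T" "\<And>F. norm (T F) = norm F" "\<And>F. T (S F) = F"
  shows "unitary T"
  using assms surjI[of T S] by (simp add: unitary_def)

section \<open>Completeness and dense subspaces\<close>

lemma norm_l2_square: "(norm F)\<^sup>2 = (LINT a|lborel. (cmod (rep_l2 F a))\<^sup>2)"
proof -
  have "(norm F)\<^sup>2 = Re (cinner F F)" by (simp add: cinner_self)
  also have "\<dots> = (LINT a|lborel. (cmod (rep_l2 F a))\<^sup>2)"
    unfolding cinner_rep by (rule Re_cinner_self_l2) simp
  finally show ?thesis .
qed

lemma nn_norm_l2:
  "ennreal ((norm F)\<^sup>2) = (\<integral>\<^sup>+a. ennreal ((cmod (rep_l2 F a))\<^sup>2) \<partial>lborel)"
  unfolding norm_l2_square
  using square_integrable_rep_l2[of F]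
  by (intro nn_integral_eq_integral[symmetric]) (auto simp: square_integrable_def)

lemma norm_abs_l2_square:
  assumes "square_integrable f"
  shows "(norm (abs_l2 f))\<^sup>2 = (LINT a|lborel. (cmod (f a))\<^sup>2)"
proof -
  have "complex_of_real ((norm (abs_l2 f))\<^sup>2) = (LINT a|lborel. cnj (f a) * f a)"
    unfolding cinner_self[symmetric] using assms by (simp add: cinner_abs_l2)
  then show ?thesis using Re_cinner_self_l2[OF assms] by (metis Re_complex_of_real)
qed

lemma square_integrable_nnI:
  assumes [measurable]: "f \<in> borel_measurable borel"
    and "(\<integral>\<^sup>+a. ennreal ((cmod (f a))\<^sup>2) \<partial>lborel) < \<infinity>"
  shows "square_integrable f"
  unfolding square_integrable_def
  using assms(2) by (auto intro!: integrableI_bounded)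

lemma nn_norm_abs_l2:
  assumes "square_integrable f"
  shows "ennreal ((norm (abs_l2 f))\<^sup>2) = (\<integral>\<^sup>+a. ennreal ((cmod (f a))\<^sup>2) \<partial>lborel)"
  unfolding nn_norm_l2 using AE_rep_abs_l2[OF assms]
  by (intro nn_integral_cong_AE) auto

text \<open>
  The representatives of a rapidly converging Cauchy sequence converge almost everywhere,
  because the sum of the squared differences, weighted by powers of 4, has finite integral.
  Fatou's lemma then bounds the distance to the pointwise limit.
\<close>

lemma l2_Cauchy_fast_converges:
  fixes X :: "nat \<Rightarrow> ('n::finite) l2"
  assumes fast: "\<And>j k. j \<le> k \<Longrightarrow> norm (X k - X j) \<le> (1/4)^j"
  shows "\<exists>L. X \<longlonglongrightarrow> L"
proof -
  define f where "f k = rep_l2 (X k)" for k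
  have [measurable]: "f k \<in> borel_measurable borel" for k by (simp add: f_def)
  have nn: "(\<integral>\<^sup>+a. ennreal ((cmod (f k a - f j a))\<^sup>2) \<partial>lborel) \<le> ennreal ((1/16)^j)" if "j \<le> k" for j k
  proof -
    have "(\<integral>\<^sup>+a. ennreal ((cmod (f k a - f j a))\<^sup>2) \<partial>lborel)
        = (\<integral>\<^sup>+a. ennreal ((cmod (rep_l2 (X k - X j) a))\<^sup>2) \<partial>lborel)"
      using AE_rep_minus[of "X k" "X j"] by (intro nn_integral_cong_AE) (auto simp: f_def)
    also have "\<dots> = ennreal ((norm (X k - X j))\<^sup>2)" by (rule nn_norm_l2[symmetric])
    also have "\<dots> \<le> ennreal (((1/4)^j)\<^sup>2)"
      using fast[OF that] by (intro ennreal_leI power_mono) auto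
    also have "((1/4)^j)\<^sup>2 = ((1/16)^j :: real)"
      by (simp add: power2_eq_square flip: power_mult_distrib)
    finally show ?thesis .
  qed
  have "(\<integral>\<^sup>+a. (\<Sum>k. ennreal (4^k * (cmod (f (Suc k) a - f k a))\<^sup>2)) \<partial>lborel)
      = (\<Sum>k. \<integral>\<^sup>+a. ennreal (4^k * (cmod (f (Suc k) a - f k a))\<^sup>2) \<partial>lborel)"
    by (rule nn_integral_suminf) measurable
  also have "\<dots> \<le> (\<Sum>k. ennreal ((1/4)^k))"
  proof (intro suminf_le)
    fix k :: nat
    have "(\<integral>\<^sup>+a. ennreal (4^k * (cmod (f (Suc k) a - f k a))\<^sup>2) \<partial>lborel)
        = ennreal (4^k) * (\<integral>\<^sup>+a. ennreal ((cmod (f (Suc k) a - f k a))\<^sup>2) \<partial>lborel)"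
      by (subst nn_integral_cmult[symmetric]) (auto simp: ennreal_mult)
    also have "\<dots> \<le> ennreal (4^k) * ennreal ((1/16)^k)"
      by (intro mult_left_mono nn) auto
    also have "\<dots> = ennreal ((1/4)^k)"
      by (simp flip: ennreal_mult' power_mult_distrib)
    finally show "(\<integral>\<^sup>+a. ennreal (4^k * (cmod (f (Suc k) a - f k a))\<^sup>2) \<partial>lborel) \<le> ennreal ((1/4)^k)" .
  qed auto
  also have "\<dots> < \<infinity>"
    by (subst suminf_ennreal2) (auto intro: summable_geometric)
  finally have "AE a in lborel. (\<Sum>k. ennreal (4^k * (cmod (f (Suc k) a - f k a))\<^sup>2)) \<noteq> \<infinity>"
    by (intro nn_integral_PInf_AE) auto
  \<comment> \<open>Finiteness of the weighted sum at \<open>a\<close> bounds the increments by a geometric series.\<close>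
  then have conv: "AE a in lborel. convergent (\<lambda>k. f k a)"
  proof eventually_elim
    case (elim a)
    define u where "u k = 4^k * (cmod (f (Suc k) a - f k a))\<^sup>2" for k
    have u0: "u k \<ge> 0" for k by (simp add: u_def)
    have "summable u"
      using elim unfolding u_def[symmetric] by (intro summable_suminf_not_top u0) simp
    then have "u \<longlonglongrightarrow> 0" by (rule summable_LIMSEQ_zero)
    then obtain C where C: "\<And>k. norm (u k) \<le> C"
      using convergent_imp_Bseq[of u] unfolding convergent_def Bseq_def by blast
    have "cmod (f (Suc k) a - f k a) \<le> sqrt C * (1/2)^k" for k
    proof (rule power2_le_imp_le)
      have "4^k * (cmod (f (Suc k) a - f k a))\<^sup>2 \<le> C" using C[of k] u0[of k] by (simp add: u_def)
      then have "(cmod (f (Suc k) a - f k a))\<^sup>2 \<le> C * (1/4)^k"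
        by (simp add: field_simps power_one_over)
      also have "\<dots> = (sqrt C * (1/2)^k)\<^sup>2"
      proof -
        have "((1/2)^k)\<^sup>2 = ((1/4)^k :: real)" by (simp add: power2_eq_square flip: power_mult_distrib)
        then show ?thesis
          using order_trans[OF norm_ge_zero C[of 0]] by (simp add: power_mult_distrib)
      qed
      finally show "(cmod (f (Suc k) a - f k a))\<^sup>2 \<le> (sqrt C * (1/2)^k)\<^sup>2" .
      show "0 \<le> sqrt C * (1/2)^k" using order_trans[OF norm_ge_zero C[of 0]] by simp
    qed
    moreover have "summable (\<lambda>k. sqrt C * (1/2)^k)"
      by (rule summable_mult) (simp add: summable_geometric)
    ultimately have "summable (\<lambda>k. f (Suc k) a - f k a)"
      by (rule summable_comparison_test'[where N = 0, rotated])
    then have "(\<lambda>n. \<Sum>k<n. f (Suc k) a - f k a) \<longlonglongrightarrow> (\<Sum>k. f (Suc k) a - f k a)"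
      by (rule summable_LIMSEQ)
    then have "(\<lambda>n. f n a - f 0 a) \<longlonglongrightarrow> (\<Sum>k. f (Suc k) a - f k a)"
      by (simp only: sum_lessThan_telescope[of "\<lambda>k. f k a"])
    then have "(\<lambda>n. (f n a - f 0 a) + f 0 a) \<longlonglongrightarrow> (\<Sum>k. f (Suc k) a - f k a) + f 0 a"
      by (intro tendsto_add tendsto_const)
    then show ?case by (auto simp: convergent_def)
  qed
  define g where "g a = lim (\<lambda>k. f k a)" for a
  have [measurable]: "g \<in> borel_measurable borel"
    unfolding g_def by measurable
  have lim: "AE a in lborel. (\<lambda>k. f k a) \<longlonglongrightarrow> g a"
    using conv by eventually_elim (simp add: g_def convergent_LIMSEQ_iff)
  have fatou: "(\<integral>\<^sup>+a. ennreal ((cmod (g a - f j a))\<^sup>2) \<partial>lborel) \<le> ennreal ((1/16)^j)" for j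
  proof -
    have "(\<integral>\<^sup>+a. ennreal ((cmod (g a - f j a))\<^sup>2) \<partial>lborel)
        = (\<integral>\<^sup>+a. liminf (\<lambda>k. ennreal ((cmod (f k a - f j a))\<^sup>2)) \<partial>lborel)"
    proof (rule nn_integral_cong_AE, use lim in eventually_elim)
      case (elim a)
      have "(\<lambda>k. ennreal ((cmod (f k a - f j a))\<^sup>2)) \<longlonglongrightarrow> ennreal ((cmod (g a - f j a))\<^sup>2)"
        by (intro tendsto_ennrealI tendsto_intros elim)
      then show ?case by (intro lim_imp_Liminf[symmetric]) auto
    qed
    also have "\<dots> \<le> liminf (\<lambda>k. \<integral>\<^sup>+a. ennreal ((cmod (f k a - f j a))\<^sup>2) \<partial>lborel)"
      by (rule nn_integral_liminf) measurable
    also have "\<dots> \<le> liminf (\<lambda>k. ennreal ((1/16)^j))"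
      by (intro Liminf_mono eventually_sequentiallyI[of j]) (rule nn)
    also have "\<dots> = ennreal ((1/16)^j)" by (simp add: Liminf_const)
    finally show ?thesis .
  qed
  have sqd: "square_integrable (\<lambda>a. g a - f j a)" for j
    using fatou[of j] by (intro square_integrable_nnI) (auto intro: le_less_trans)
  have sqg: "square_integrable g"
    using square_integrable_add[OF sqd[of 0], of "f 0"] by (simp add: f_def)
  have bound: "norm (abs_l2 g - X j) \<le> (1/4)^j" for j
  proof -
    have "abs_l2 g - abs_l2 (f j) = abs_l2 (\<lambda>a. g a - f j a)"
      using sqg by (intro minus_abs_l2) (simp_all add: f_def)
    then have "abs_l2 g - X j = abs_l2 (\<lambda>a. g a - f j a)" by (simp add: f_def)
    then have "ennreal ((norm (abs_l2 g - X j))\<^sup>2) \<le> ennreal ((1/16)^j)"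
      using fatou[of j] nn_norm_abs_l2[OF sqd[of j]] by simp
    then have "(norm (abs_l2 g - X j))\<^sup>2 \<le> (1/16)^j" by (simp add: ennreal_le_iff)
    also have "(1/16)^j = (((1/4)^j)\<^sup>2 :: real)"
      by (simp add: power2_eq_square flip: power_mult_distrib)
    finally show ?thesis by (rule power2_le_imp_le) simp
  qed
  have "(\<lambda>j. (1/4)^j :: real) \<longlonglongrightarrow> 0" by (rule LIMSEQ_power_zero) simp
  moreover have "\<forall>\<^sub>F j in sequentially. norm (X j - abs_l2 g) \<le> (1/4)^j"
    by (subst norm_minus_commute) (simp add: bound)
  ultimately have "(\<lambda>j. X j - abs_l2 g) \<longlonglongrightarrow> 0"
    by (rule Lim_null_comparison[rotated])
  then have "X \<longlonglongrightarrow> abs_l2 g" by (simp add: LIM_zero_iff)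
  then show ?thesis by blast
qed

text \<open>
  The Riesz--Fischer theorem: a rapidly converging subsequence suffices.
\<close>

instance l2 :: (finite) complete_space
proof
  fix X :: "nat \<Rightarrow> 'a l2"
  assume C: "Cauchy X"
  have "\<exists>r::nat\<Rightarrow>nat. strict_mono r \<and> (\<forall>j. \<forall>m\<ge>r j. \<forall>n\<ge>r j. norm (X m - X n) \<le> (1/4)^j)"
  proof -
    have "\<exists>N. \<forall>m\<ge>N. \<forall>n\<ge>N. norm (X m - X n) \<le> (1/4)^j" for j
      using CauchyD[OF C, of "(1/4)^j"] by (auto intro: less_imp_le)
    then obtain N where N: "\<And>j. \<forall>m\<ge>N j. \<forall>n\<ge>N j. norm (X m - X n) \<le> (1/4)^j" by metis
    define r where "r j = (\<Sum>i\<le>j. N i + 1)" for j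
    have "strict_mono r" by (rule strict_mono_Suc_iff[THEN iffD2]) (simp add: r_def)
    moreover have "N j \<le> r j" for j
      unfolding r_def by (rule order_trans[OF _ member_le_sum[of j]]) auto
    ultimately show ?thesis using N by (intro exI[of _ r]) (meson order_trans)
  qed
  then obtain r :: "nat \<Rightarrow> nat" where r: "strict_mono r"
    and close: "\<And>j m n. m \<ge> r j \<Longrightarrow> n \<ge> r j \<Longrightarrow> norm (X m - X n) \<le> (1/4)^j" by blast
  have "\<exists>L. (X \<circ> r) \<longlonglongrightarrow> L"
    by (rule l2_Cauchy_fast_converges)
       (auto intro!: close simp: r strict_mono_less_eq)
  then obtain L where "(X \<circ> r) \<longlonglongrightarrow> L" by blast
  then have "X \<longlonglongrightarrow> L" using Cauchy_converges_subseq[OF C r] by simp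
  then show "convergent X" by (auto simp: convergent_def)
qed

definition csubspace :: "(('n::finite) l2) set \<Rightarrow> bool" where
  "csubspace S \<longleftrightarrow> 0 \<in> S \<and> (\<forall>F\<in>S. \<forall>G\<in>S. F + G \<in> S) \<and> (\<forall>c. \<forall>F\<in>S. cscale c F \<in> S)"

text \<open>
  A minimizing sequence for the distance from \<open>x\<close> to the subspace is Cauchy by the
  parallelogram law. The difference between \<open>x\<close> and its limit is orthogonal to the subspace,
  hence zero.
\<close>

lemma csubspace_dense:
  fixes S :: "(('n::finite) l2) set"
  assumes S: "csubspace S" and triv: "\<And>F. (\<And>G. G \<in> S \<Longrightarrow> cinner G F = 0) \<Longrightarrow> F = 0"
  shows "closure S = UNIV"
proof -
  have "x \<in> closure S" for x
  proof -
    have S0: "0 \<in> S" and Sadd: "\<And>F G. F \<in> S \<Longrightarrow> G \<in> S \<Longrightarrow> F + G \<in> S"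
      and Ssc: "\<And>c F. F \<in> S \<Longrightarrow> cscale c F \<in> S" using S by (auto simp: csubspace_def)
    define d where "d = infdist x S"
    have d0: "d \<ge> 0" by (simp add: d_def infdist_nonneg)
    have dle: "d \<le> norm (x - s)" if "s \<in> S" for s
      using infdist_le[OF that, of x] by (simp add: d_def dist_norm)
    have "\<exists>s\<in>S. norm (x - s) < d + 1 / Suc n" for n
    proof -
      have "Inf ((\<lambda>s. dist x s) ` S) < d + 1 / Suc n"
        using S0 by (auto simp: d_def infdist_def)
      moreover have "bdd_below ((\<lambda>s. dist x s) ` S)" by (rule bdd_belowI[of _ 0]) auto
      ultimately show ?thesis
        using S0 by (subst (asm) cInf_less_iff) (auto simp: dist_norm)
    qed
    then obtain y where yS: "\<And>n. y n \<in> S" and y: "\<And>n. norm (x - y n) < d + 1 / Suc n" by metis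
    have lim: "(\<lambda>n. norm (x - y n)) \<longlonglongrightarrow> d"
    proof (rule tendsto_sandwich[of "\<lambda>_. d" _ _ "\<lambda>n. d + 1 / Suc n"])
      show "(\<lambda>n. d + 1 / Suc n) \<longlonglongrightarrow> d"
        using LIMSEQ_inverse_real_of_nat_add[of d] by (simp add: inverse_eq_divide)
    qed (use dle yS y in \<open>auto intro!: always_eventually less_imp_le\<close>)
    have par: "(norm (y m - y n))\<^sup>2 \<le> 2 * ((norm (x - y m))\<^sup>2 - d\<^sup>2) + 2 * ((norm (x - y n))\<^sup>2 - d\<^sup>2)" for m n
    proof -
      have "cscale (1/2) (y m + y n) \<in> S" by (intro Ssc Sadd yS)
      then have "d\<^sup>2 \<le> (norm (x - cscale (1/2) (y m + y n)))\<^sup>2"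
        using d0 dle by (intro power_mono) auto
      also have "cscale (1/2) (y m + y n) = (1/2) *\<^sub>R (y m + y n)" by (simp add: cscale_scaleR)
      finally show ?thesis
        unfolding power2_norm_eq_inner
        by (simp add: inner_add_left inner_add_right inner_diff_left inner_diff_right
            inner_commute field_simps)
    qed
    have "Cauchy y"
    proof (rule CauchyI)
      fix e :: real assume e: "e > 0"
      have "(\<lambda>n. (norm (x - y n))\<^sup>2 - d\<^sup>2) \<longlonglongrightarrow> d\<^sup>2 - d\<^sup>2"
        by (intro tendsto_intros lim)
      then have "\<forall>\<^sub>F n in sequentially. (norm (x - y n))\<^sup>2 - d\<^sup>2 < e\<^sup>2 / 4"
        using e by (intro order_tendstoD(2)) auto
      then obtain N where N: "\<And>n. n \<ge> N \<Longrightarrow> (norm (x - y n))\<^sup>2 - d\<^sup>2 < e\<^sup>2 / 4"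
        by (auto simp: eventually_sequentially)
      have "norm (y m - y n) < e" if "m \<ge> N" "n \<ge> N" for m n
      proof (rule power2_less_imp_less)
        show "(norm (y m - y n))\<^sup>2 < e\<^sup>2" using par[of m n] N[OF that(1)] N[OF that(2)] by simp
      qed (use e in simp)
      then show "\<exists>M. \<forall>m\<ge>M. \<forall>n\<ge>M. norm (y m - y n) < e" by blast
    qed
    then obtain z where z: "y \<longlonglongrightarrow> z" using Cauchy_convergent convergent_def by blast
    define w where "w = x - z"
    have nw: "norm w = d"
      using LIMSEQ_unique[OF lim tendsto_norm[OF tendsto_diff[OF tendsto_const[of x] z]]] by (simp add: w_def)
    have wle: "norm w \<le> norm (w - s)" if "s \<in> S" for s
    proof -
      have "d \<le> norm (x - (y n + s))" for n using yS that by (intro dle Sadd)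
      moreover have "(\<lambda>n. norm (x - (y n + s))) \<longlonglongrightarrow> norm (x - (z + s))"
        by (intro tendsto_intros z)
      ultimately have "d \<le> norm (x - (z + s))" by (intro LIMSEQ_le_const) auto
      moreover have "w - s = x - (z + s)" by (simp add: w_def)
      ultimately show ?thesis by (simp only: nw)
    qed
    have "cinner s w = 0" if s: "s \<in> S" for s
    proof (rule ccontr)
      assume nz: "cinner s w \<noteq> 0"
      define q where "q = (cmod (cinner s w))\<^sup>2"
      have q: "q > 0" using nz by (simp add: q_def)
      have "2 * t * q \<le> t\<^sup>2 * q * (norm s)\<^sup>2" for t :: real
      proof -
        define c where "c = of_real t * cinner s w"
        have "(norm w)\<^sup>2 \<le> (norm (w - cscale c s))\<^sup>2" using s by (intro power_mono wle Ssc) auto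
        also have "\<dots> = (norm w)\<^sup>2 - 2 * Re (cinner (cscale c s) w) + (norm (cscale c s))\<^sup>2"
          unfolding Re_cinner power2_norm_eq_inner
          by (simp add: inner_diff_left inner_diff_right inner_commute)
        also have "cinner (cscale c s) w = of_real (t * q)"
          unfolding cinner_cscale_left c_def q_def
          by (simp add: complex_norm_square mult.commute mult.left_commute del: of_real_power)
        also have "(norm (cscale c s))\<^sup>2 = t\<^sup>2 * q * (norm s)\<^sup>2"
          by (simp add: norm_cscale c_def norm_mult power_mult_distrib q_def)
        finally show ?thesis by simp
      qed
      note le = this
      \<comment> \<open>The inequality \<open>le\<close> is violated for small positive \<open>t\<close>.\<close>
      define t where "t = 1 / ((norm s)\<^sup>2 + 1)"
      have t: "t > 0" "t * (norm s)\<^sup>2 < 1"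
        by (auto simp: t_def add_nonneg_pos)
      have "2 * (t * q) \<le> (t * q) * (t * (norm s)\<^sup>2)" using le[of t] by (simp add: power2_eq_square algebra_simps)
      also have "\<dots> \<le> (t * q) * 1" using t q by (intro mult_left_mono) auto
      finally show False using t q by simp
    qed
    then have "w = 0" by (rule triv)
    then show "x \<in> closure S" using z yS by (auto simp: w_def closure_sequential)
  qed
  then show ?thesis by auto
qed

lemma isometry_extension:
  fixes T0 :: "('n::finite) l2 \<Rightarrow> 'n l2"
  assumes S: "csubspace S" and dense: "closure S = UNIV"
    and add: "\<And>F G. F \<in> S \<Longrightarrow> G \<in> S \<Longrightarrow> T0 (F + G) = T0 F + T0 G"
    and sc: "\<And>c F. F \<in> S \<Longrightarrow> T0 (cscale c F) = cscale c (T0 F)"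
    and iso: "\<And>F. F \<in> S \<Longrightarrow> norm (T0 F) = norm F"
  shows "\<exists>T. clinear T \<and> (\<forall>F. norm (T F) = norm F) \<and> (\<forall>F\<in>S. T F = T0 F)"
proof -
  have Sadd: "\<And>F G. F \<in> S \<Longrightarrow> G \<in> S \<Longrightarrow> F + G \<in> S"
    and Ssc: "\<And>c F. F \<in> S \<Longrightarrow> cscale c F \<in> S" using S by (auto simp: csubspace_def)
  have dist: "dist (T0 F) (T0 G) = dist F G" if "F \<in> S" "G \<in> S" for F G
  proof -
    have "T0 (F + cscale (-1) G) = T0 F + cscale (-1) (T0 G)" using that by (simp add: add sc Ssc)
    then have "T0 F - T0 G = T0 (F - G)" by (simp flip: minus_cscale)
    moreover have "F - G \<in> S" using Sadd[OF that(1) Ssc[OF that(2), of "-1"]] by (simp flip: minus_cscale)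
    ultimately show ?thesis using iso by (simp add: dist_norm)
  qed
  have "uniformly_continuous_on S T0"
    unfolding uniformly_continuous_on_def using dist by auto
  then obtain T where ucT: "uniformly_continuous_on (closure S) T" and TS: "\<And>F. F \<in> S \<Longrightarrow> T0 F = T F"
    using uniformly_continuous_on_extension_on_closure by metis
  have contT: "continuous_on UNIV T" using ucT by (simp add: dense uniformly_continuous_imp_continuous)
  have seq: "\<exists>f. (\<forall>n::nat. f n \<in> S) \<and> f \<longlonglongrightarrow> F" for F
    using dense closure_sequential[of F S] by auto
  have Tlim: "(\<lambda>n. T (f n)) \<longlonglongrightarrow> T F" if "f \<longlonglongrightarrow> F" for f :: "nat \<Rightarrow> 'n l2" and F
    using contT that by (simp add: continuous_on_eq_continuous_at isCont_tendsto_compose)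
  have "T (F + G) = T F + T G" for F G
  proof -
    obtain f g where fg: "\<And>n. f n \<in> S" "f \<longlonglongrightarrow> F" "\<And>n. g n \<in> S" "g \<longlonglongrightarrow> G" using seq by metis
    have "(\<lambda>n. T (f n + g n)) \<longlonglongrightarrow> T (F + G)" by (intro Tlim tendsto_add fg)
    moreover have "T (f n + g n) = T (f n) + T (g n)" for n
      using fg add Sadd by (simp flip: TS)
    ultimately have "(\<lambda>n. T (f n) + T (g n)) \<longlonglongrightarrow> T (F + G)" by simp
    moreover have "(\<lambda>n. T (f n) + T (g n)) \<longlonglongrightarrow> T F + T G" by (intro tendsto_add Tlim fg)
    ultimately show ?thesis by (rule LIMSEQ_unique)
  qed
  moreover have "T (cscale c F) = cscale c (T F)" for c F
  proof -
    obtain f where f: "\<And>n. f n \<in> S" "f \<longlonglongrightarrow> F" using seq by metis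
    have "(\<lambda>n. T (cscale c (f n))) \<longlonglongrightarrow> T (cscale c F)"
      by (intro Tlim bounded_linear.tendsto[OF bounded_linear_cscale] f)
    moreover have "T (cscale c (f n)) = cscale c (T (f n))" for n
      using f sc Ssc by (simp flip: TS)
    ultimately have "(\<lambda>n. cscale c (T (f n))) \<longlonglongrightarrow> T (cscale c F)" by simp
    moreover have "(\<lambda>n. cscale c (T (f n))) \<longlonglongrightarrow> cscale c (T F)"
      by (intro bounded_linear.tendsto[OF bounded_linear_cscale] Tlim f)
    ultimately show ?thesis by (rule LIMSEQ_unique)
  qed
  moreover have "norm (T F) = norm F" for F
  proof -
    obtain f where f: "\<And>n. f n \<in> S" "f \<longlonglongrightarrow> F" using seq by metis
    have "(\<lambda>n. norm (T (f n))) \<longlonglongrightarrow> norm (T F)" by (intro tendsto_norm Tlim f)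
    moreover have "norm (T (f n)) = norm (f n)" for n using f iso by (simp flip: TS)
    ultimately have "(\<lambda>n. norm (f n)) \<longlonglongrightarrow> norm (T F)" by simp
    then show ?thesis using LIMSEQ_unique tendsto_norm[OF f(2)] by blast
  qed
  ultimately show ?thesis using TS by (intro exI[of _ T]) (auto simp: clinear_def)
qed

lemma clinear_eq_on_dense:
  assumes "closure S = UNIV" "bounded_linear T" "bounded_linear T'" "\<And>F. F \<in> S \<Longrightarrow> T F = T' F"
  shows "T = T'"
proof
  fix F
  obtain f where f: "\<And>n::nat. f n \<in> S" "f \<longlonglongrightarrow> F"
    using assms(1) closure_sequential[of F S] by auto
  show "T F = T' F"
    using LIMSEQ_unique[OF bounded_linear.tendsto[OF assms(2) f(2)]]
      bounded_linear.tendsto[OF assms(3) f(2)] f(1) assms(4) by simp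
qed

section \<open>Uniqueness of characteristic functions\<close>

text \<open>
  The uniqueness theorem of Levy for probability distributions, transferred to finite
  measures by normalizing the total mass, which is the value of the characteristic function
  at \<open>0\<close>.
\<close>

lemma finite_measure_eqI_char:
  fixes M N :: "real measure"
  assumes M: "finite_measure M" "sets M = sets borel" and N: "finite_measure N" "sets N = sets borel"
    and eq: "\<And>t. (LINT x|M. exp (\<i> * of_real (t * x))) = (LINT x|N. exp (\<i> * of_real (t * x)))"
  shows "M = N"
proof -
  interpret M: finite_measure M by fact
  interpret N: finite_measure N by fact
  have sp: "space M = UNIV" "space N = UNIV"
    using M(2) N(2) by (auto dest: sets_eq_imp_space_eq)
  have [measurable_cong]: "sets M = sets borel" "sets N = sets borel" by fact+
  define c where "c = measure M UNIV"
  have cN: "c = measure N UNIV"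
    using eq[of 0] by (simp add: sp c_def)
  show ?thesis
  proof (cases "c = 0")
    case True
    have "emeasure M A = 0" for A
    proof -
      have "emeasure M A \<le> emeasure M (space M)" by (rule emeasure_space)
      then show ?thesis using True by (simp add: sp M.emeasure_eq_measure c_def measure_le_0_iff)
    qed
    moreover have "emeasure N A = 0" for A
    proof -
      have "emeasure N A \<le> emeasure N (space N)" by (rule emeasure_space)
      then show ?thesis using True cN by (simp add: sp N.emeasure_eq_measure measure_le_0_iff)
    qed
    ultimately show ?thesis using M(2) N(2) by (intro measure_eqI) auto
  next
    case False
    then have c: "c > 0" by (simp add: c_def zero_less_measure_iff less_le)
    have em: "emeasure M UNIV = ennreal c" "emeasure N UNIV = ennreal c"
      by (simp_all add: M.emeasure_eq_measure N.emeasure_eq_measure c_def cN[unfolded c_def])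
    define M' where "M' = density M (\<lambda>_. ennreal (1 / c))"
    define N' where "N' = density N (\<lambda>_. ennreal (1 / c))"
    have dist: "real_distribution M'" "real_distribution N'"
      unfolding M'_def N'_def real_distribution_def real_distribution_axioms_def
      using c M(2) N(2)
      by (auto intro!: prob_spaceI simp: sp emeasure_density nn_integral_cmult em
          simp flip: ennreal_mult)
    have "char M' = char N'"
    proof
      fix t
      have "char M' t = (1 / c) *\<^sub>R (LINT x|M. exp (\<i> * of_real (t * x)))"
        unfolding char_def M'_def using c by (subst integral_density) auto
      moreover have "char N' t = (1 / c) *\<^sub>R (LINT x|N. exp (\<i> * of_real (t * x)))"
        unfolding char_def N'_def using c by (subst integral_density) auto
      ultimately show "char M' t = char N' t" by (simp only: eq)
    qed
    then have MN': "M' = N'" by (rule Levy_uniqueness[OF dist])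
    show ?thesis
    proof (rule measure_eqI)
      show "sets M = sets N" using M(2) N(2) by simp
      fix A assume A: "A \<in> sets M"
      then have A': "A \<in> sets N" using M(2) N(2) by simp
      have "ennreal (1 / c) * emeasure M A = emeasure M' A"
        unfolding M'_def using A c by (simp add: emeasure_density nn_integral_cmult)
      also have "\<dots> = ennreal (1 / c) * emeasure N A"
        unfolding MN' N'_def using A' c by (simp add: emeasure_density nn_integral_cmult)
      finally show "emeasure M A = emeasure N A"
        using c by (simp add: ennreal_mult_cancel_left)
    qed
  qed
qed

text \<open>
  The images under \<open>m\<close> of the densities given by the positive and the negative part of \<open>r\<close>
  are finite measures with the same characteristic function.
\<close>

lemma integral_indicator_eq_0_if_real:
  fixes r m :: "'a \<Rightarrow> real"
  assumes r: "integrable M r" and [measurable]: "m \<in> borel_measurable M"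
    and zero: "\<And>t. (LINT x|M. of_real (r x) * exp (\<i> * of_real (t * m x))) = 0"
    and [measurable]: "S \<in> sets borel"
  shows "(LINT x|M. r x * indicator S (m x)) = 0"
proof -
  have [measurable]: "r \<in> borel_measurable M" using r by auto
  define p where "p s x = max (s * r x) 0" for s x
  have p0: "p s x \<ge> 0" for s x by (simp add: p_def)
  have pint: "integrable M (p s)" for s unfolding p_def using r by (intro integrable_max) auto
  have [measurable]: "p s \<in> borel_measurable M" for s using pint by auto
  define D where "D s = distr (density M (\<lambda>x. ennreal (p s x))) borel m" for s
  have Dint: "(LINT y|D s. f y) = (LINT x|M. p s x *\<^sub>R f (m x))"
    if [measurable]: "f \<in> borel_measurable borel" for f :: "real \<Rightarrow> 'b :: {banach, second_countable_topology}" and s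
    unfolding D_def by (subst integral_distr, simp, simp, subst integral_density) (auto simp: p0)
  have fin: "finite_measure (D s)" for s
  proof
    have "emeasure (D s) UNIV = (\<integral>\<^sup>+x. ennreal (p s x) \<partial>M)"
      unfolding D_def by (subst emeasure_distr) (auto simp: emeasure_density cong: nn_integral_cong)
    then show "emeasure (D s) (space (D s)) \<noteq> \<infinity>"
      using nn_integral_eq_integral[OF pint[of s]] p0[of s] by (simp add: D_def)
  qed
  have int: "integrable M (\<lambda>x. p s x *\<^sub>R exp (\<i> * of_real (t * m x)))" for s t
    by (rule Bochner_Integration.integrable_bound[OF pint[of s]]) (auto simp: norm_mult)
  have diff: "r x = p 1 x - p (-1) x" for x by (simp add: p_def max_def)
  have "D 1 = D (-1)"
  proof (rule finite_measure_eqI_char)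
    fix t
    have "0 = (LINT x|M. p 1 x *\<^sub>R exp (\<i> * of_real (t * m x)) - p (-1) x *\<^sub>R exp (\<i> * of_real (t * m x)))"
      unfolding zero[symmetric, of t] diff by (simp add: scaleR_conv_of_real left_diff_distrib)
    also have "\<dots> = (LINT x|M. p 1 x *\<^sub>R exp (\<i> * of_real (t * m x)))
        - (LINT x|M. p (-1) x *\<^sub>R exp (\<i> * of_real (t * m x)))"
      by (intro Bochner_Integration.integral_diff int)
    finally show "(LINT x|D 1. exp (\<i> * of_real (t * x))) = (LINT x|D (-1). exp (\<i> * of_real (t * x)))"
      by (simp add: Dint del: of_real_mult)
  qed (auto simp: fin, simp_all add: D_def)
  moreover have "(LINT y|D s. indicator S y :: real) = (LINT x|M. p s x * indicator S (m x))" for s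
    by (subst Dint) simp_all
  ultimately have "(LINT x|M. p 1 x * indicator S (m x)) = (LINT x|M. p (-1) x * indicator S (m x))"
    by metis
  moreover have "integrable M (\<lambda>x. p s x * indicator S (m x))" for s
    by (rule Bochner_Integration.integrable_bound[OF pint[of s]]) (auto simp: indicator_def)
  ultimately show ?thesis by (simp add: diff left_diff_distrib)
qed

lemma integral_indicator_eq_0_if_char:
  fixes \<psi> :: "'a \<Rightarrow> complex" and m :: "'a \<Rightarrow> real"
  assumes \<psi>: "integrable M \<psi>" and [measurable]: "m \<in> borel_measurable M"
    and zero: "\<And>t. (LINT x|M. \<psi> x * exp (\<i> * of_real (t * m x))) = 0"
    and [measurable]: "S \<in> sets borel"
  shows "(LINT x|M. \<psi> x * indicator S (m x)) = 0"
proof -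
  have [measurable]: "\<psi> \<in> borel_measurable M" using \<psi> by auto
  have int: "integrable M (\<lambda>x. \<psi> x * exp (\<i> * of_real (t * m x)))" for t
    by (rule Bochner_Integration.integrable_bound[OF integrable_norm[OF \<psi>]]) (auto simp: norm_mult)
  have inti: "integrable M (\<lambda>x. \<psi> x * indicator S (m x))"
    by (rule Bochner_Integration.integrable_bound[OF integrable_norm[OF \<psi>]])
       (auto simp: norm_mult indicator_def)
  have cz: "(LINT x|M. cnj (\<psi> x) * exp (\<i> * of_real (t * m x))) = 0" for t
  proof -
    have "(LINT x|M. cnj (\<psi> x) * exp (\<i> * of_real (t * m x)))
        = (LINT x|M. cnj (\<psi> x * exp (\<i> * of_real ((-t) * m x))))"
      by (simp add: exp_cnj)
    also have "\<dots> = 0" unfolding Bochner_Integration.integral_cnj zero by simp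
    finally show ?thesis .
  qed
  have cint: "integrable M (\<lambda>x. cnj (\<psi> x) * exp (\<i> * of_real (t * m x)))" for t
    using Bochner_Integration.integrable_cnj[OF int[of "-t"]] by (simp add: exp_cnj)
  have Re: "(LINT x|M. Re (\<psi> x) * indicator S (m x)) = 0"
  proof (rule integral_indicator_eq_0_if_real)
    fix t
    have "(LINT x|M. of_real (Re (\<psi> x)) * exp (\<i> * of_real (t * m x)))
        = (LINT x|M. (\<psi> x * exp (\<i> * of_real (t * m x)) + cnj (\<psi> x) * exp (\<i> * of_real (t * m x))) / 2)"
      by (intro Bochner_Integration.integral_cong) (simp_all add: complex_eq_iff field_simps)
    also have "\<dots> = 0" using int[of t] cint[of t] by (simp only: integral_divide_zero Bochner_Integration.integral_add zero cz add_0_left div_0)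
    finally show "(LINT x|M. of_real (Re (\<psi> x)) * exp (\<i> * of_real (t * m x))) = 0" .
  qed (use \<psi> in auto)
  have Im: "(LINT x|M. Im (\<psi> x) * indicator S (m x)) = 0"
  proof (rule integral_indicator_eq_0_if_real)
    fix t
    have "(LINT x|M. of_real (Im (\<psi> x)) * exp (\<i> * of_real (t * m x)))
        = (LINT x|M. (\<psi> x * exp (\<i> * of_real (t * m x)) - cnj (\<psi> x) * exp (\<i> * of_real (t * m x))) / (2 * \<i>))"
      by (intro Bochner_Integration.integral_cong) (simp_all add: complex_eq_iff field_simps Re_divide Im_divide power2_eq_square)
    also have "\<dots> = 0" using int[of t] cint[of t] by (simp only: integral_divide_zero Bochner_Integration.integral_diff zero cz diff_self div_0)
    finally show "(LINT x|M. of_real (Im (\<psi> x)) * exp (\<i> * of_real (t * m x))) = 0" .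
  qed (use \<psi> in auto)
  have "Re (LINT x|M. \<psi> x * indicator S (m x)) = (LINT x|M. Re (\<psi> x * indicator S (m x)))"
    by (rule integral_Re[OF inti, symmetric])
  also have "\<dots> = 0" unfolding Re[symmetric]
    by (intro Bochner_Integration.integral_cong) (auto simp: indicator_def)
  finally have "Re (LINT x|M. \<psi> x * indicator S (m x)) = 0" .
  moreover have "Im (LINT x|M. \<psi> x * indicator S (m x)) = (LINT x|M. Im (\<psi> x * indicator S (m x)))"
    by (rule integral_Im[OF inti, symmetric])
  moreover have "\<dots> = 0" unfolding Im[symmetric]
    by (intro Bochner_Integration.integral_cong) (auto simp: indicator_def)
  ultimately show ?thesis by (simp add: complex_eq_iff)
qed

lemma measurable_vec_nth [measurable]: "(\<lambda>a :: real ^ 'n. a $ i) \<in> borel_measurable borel"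
  by (intro borel_measurable_continuous_onI continuous_intros)

text \<open>
  The exponentials are replaced by indicator functions one coordinate at a time; each
  replacement is an instance of the one-dimensional statement.
\<close>

lemma integral_box_eq_0_if_fourier:
  fixes \<psi> :: "real ^ 'n::finite \<Rightarrow> complex"
  assumes \<psi>: "integrable lborel \<psi>"
    and zero: "\<And>v :: 'n \<Rightarrow> real. (LINT a|lborel. \<psi> a * (\<Prod>i\<in>UNIV. exp (\<i> * of_real (v i * a $ i)))) = 0"
    and S: "\<And>i. S i \<in> sets borel"
  shows "(LINT a|lborel. \<psi> a * (\<Prod>i\<in>UNIV. indicator (S i) (a $ i))) = 0"
proof -
  note [measurable] = S
  have [measurable]: "\<psi> \<in> borel_measurable lborel" using \<psi> by auto
  have "\<forall>v :: 'n \<Rightarrow> real. (LINT a|lborel. \<psi> a * (\<Prod>i\<in>I. indicator (S i) (a $ i))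
      * (\<Prod>i\<in>-I. exp (\<i> * of_real (v i * a $ i)))) = 0" if "finite I" for I :: "'n set"
    using that
  proof induction
    case empty
    show ?case using zero by simp
  next
    case (insert k I)
    show ?case
    proof
      fix v :: "'n \<Rightarrow> real"
      define w where "w a = \<psi> a * (\<Prod>i\<in>I. indicator (S i) (a $ i))
          * (\<Prod>i\<in>-insert k I. exp (\<i> * of_real (v i * a $ i)))" for a
      have [measurable]: "w \<in> borel_measurable lborel" unfolding w_def by measurable
      have compl: "- I = insert k (- insert k I)" using insert.hyps by auto
      have "(LINT a|lborel. w a * indicator (S k) (a $ k)) = 0"
      proof (rule integral_indicator_eq_0_if_char)
        show "integrable lborel w"
        proof (rule Bochner_Integration.integrable_bound[OF integrable_norm[OF \<psi>]])
          have "cmod (\<Prod>i\<in>I. indicator (S i) (a $ i)) \<le> 1" for a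
            unfolding prod_norm[symmetric] by (intro prod_le_1) (auto simp: indicator_def)
          then show "AE a in lborel. norm (w a) \<le> norm (norm (\<psi> a))"
            by (auto simp: w_def norm_mult prod_norm[symmetric] intro!: mult_left_le)
        qed simp
        fix t
        have "(LINT a|lborel. \<psi> a * (\<Prod>i\<in>I. indicator (S i) (a $ i))
            * (\<Prod>i\<in>-I. exp (\<i> * of_real ((v(k := t)) i * a $ i)))) = 0"
          using insert.IH by blast
        also have "(\<lambda>a. \<psi> a * (\<Prod>i\<in>I. indicator (S i) (a $ i))
            * (\<Prod>i\<in>-I. exp (\<i> * of_real ((v(k := t)) i * a $ i))))
          = (\<lambda>a. w a * exp (\<i> * of_real (t * a $ k)))"
          unfolding compl w_def by (subst prod.insert) (auto simp: fun_eq_iff intro!: prod.cong)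
        finally show "(LINT a|lborel. w a * exp (\<i> * of_real (t * a $ k))) = 0" .
      qed auto
      also have "(\<lambda>a. w a * indicator (S k) (a $ k)) = (\<lambda>a. \<psi> a * (\<Prod>i\<in>insert k I. indicator (S i) (a $ i))
          * (\<Prod>i\<in>-insert k I. exp (\<i> * of_real (v i * a $ i))))"
        using insert.hyps by (auto simp: w_def fun_eq_iff)
      finally show "(LINT a|lborel. \<psi> a * (\<Prod>i\<in>insert k I. indicator (S i) (a $ i))
          * (\<Prod>i\<in>-insert k I. exp (\<i> * of_real (v i * a $ i)))) = 0" .
    qed
  qed
  from this[of UNIV] show ?thesis by simp
qed

text \<open>
  Boxes form an intersection-stable generator of the Borel sets, so the positive and the
  negative part of \<open>r\<close> are densities of the same measure.
\<close>

lemma real_eq_0_if_box_integrals: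
  fixes r :: "real ^ 'n::finite \<Rightarrow> real"
  assumes r: "integrable lborel r"
    and zero: "\<And>u v. (LINT a|lborel. r a * indicator (box u v) a) = 0"
  shows "AE a in lborel. r a = 0"
proof -
  have [measurable]: "r \<in> borel_measurable borel" using r by auto
  define p where "p s x = max (s * r x) 0" for s x
  have p0: "p s x \<ge> 0" for s x by (simp add: p_def)
  have pint: "integrable lborel (p s)" for s unfolding p_def using r by (intro integrable_max) auto
  have [measurable]: "p s \<in> borel_measurable borel" for s unfolding p_def by measurable
  have diff: "r x = p 1 x - p (-1) x" for x by (simp add: p_def max_def)
  define D where "D s = density lborel (\<lambda>x. ennreal (p s x))" for s
  have fin: "emeasure (D s) A \<noteq> top" for s A
  proof -
    have "emeasure (D s) A \<le> emeasure (D s) (space (D s))" by (rule emeasure_space)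
    also have "emeasure (D s) (space (D s)) = (\<integral>\<^sup>+x. ennreal (p s x) \<partial>lborel)"
      by (auto simp: D_def emeasure_density)
    also have "\<dots> < \<infinity>" using nn_integral_eq_integral[OF pint[of s]] p0[of s] by simp
    finally show ?thesis by simp
  qed
  have pi: "integrable lborel (\<lambda>x. p s x * indicator (box u v) x)" for s u v
    by (rule Bochner_Integration.integrable_bound[OF pint[of s]]) (auto simp: indicator_def)
  have box: "emeasure (D s) (box u v) = ennreal (LINT x|lborel. p s x * indicator (box u v) x)" for s u v
    unfolding D_def
    by (subst nn_integral_eq_integral[symmetric, OF pi])
       (auto simp: p0 emeasure_density indicator_def intro!: nn_integral_cong)
  have "D 1 = D (-1)"
  proof (rule measure_eqI_generator_eq[where E = "range (\<lambda>(a, b). box a b)" and \<Omega> = UNIV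
        and A = "\<lambda>n::nat. box (- (real n *\<^sub>R One)) (real n *\<^sub>R One)"])
    show "Int_stable (range (\<lambda>(a, b). box a b :: (real^'n) set))"
      by (auto simp: Int_stable_def box_Int_box)
    show "emeasure (D 1) X = emeasure (D (-1)) X" if "X \<in> range (\<lambda>(a, b). box a b)" for X
      using that zero pi[of 1] pi[of "-1"] by (auto simp: box diff left_diff_distrib)
    show "sets (D 1) = sigma_sets UNIV (range (\<lambda>(a, b). box a b))"
      "sets (D (-1)) = sigma_sets UNIV (range (\<lambda>(a, b). box a b))"
      by (simp_all add: D_def borel_eq_box sets_measure_of)
    show "(\<Union>n::nat. box (- (real n *\<^sub>R One)) (real n *\<^sub>R One)) = (UNIV :: (real^'n) set)"
      using UN_box_eq_UNIV by auto
  qed (auto simp: fin)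
  moreover have "sigma_finite_measure (lborel :: (real^'n) measure)" by (rule sigma_finite_lborel)
  ultimately have "AE x in lborel. ennreal (p 1 x) = ennreal (p (-1) x)"
    unfolding D_def by (subst (asm) sigma_finite_measure.density_unique_iff) auto
  then show ?thesis by eventually_elim (simp add: diff p0)
qed

text \<open>
  Injectivity of the Fourier transform on integrable functions.
\<close>

lemma eq_0_if_fourier_eq_0:
  fixes \<psi> :: "real ^ 'n::finite \<Rightarrow> complex"
  assumes \<psi>: "integrable lborel \<psi>"
    and zero: "\<And>v :: 'n \<Rightarrow> real. (LINT a|lborel. \<psi> a * (\<Prod>i\<in>UNIV. exp (\<i> * of_real (v i * a $ i)))) = 0"
  shows "AE a in lborel. \<psi> a = 0"
proof -
  have [measurable]: "\<psi> \<in> borel_measurable borel" using \<psi> by auto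
  have ind: "(\<Prod>i\<in>UNIV. indicator {u $ i<..<v $ i} (a $ i)) = (indicator (box u v) a :: complex)"
    for u v a :: "real ^ 'n"
    by (auto simp: indicator_def mem_box_cart)
  have int: "integrable lborel (\<lambda>a. \<psi> a * indicator (box u v) a)" for u v :: "real ^ 'n"
    by (rule Bochner_Integration.integrable_bound[OF integrable_norm[OF \<psi>]])
       (auto simp: norm_mult indicator_def)
  have z: "(LINT a|lborel. \<psi> a * indicator (box u v) a) = 0" for u v :: "real ^ 'n"
    using integral_box_eq_0_if_fourier[OF \<psi> zero, of "\<lambda>i. {u $ i<..<v $ i}"] by (simp add: ind)
  have "(LINT a|lborel. Re (\<psi> a) * indicator (box u v) a) = 0" for u v :: "real ^ 'n"
  proof -
    have "(LINT a|lborel. Re (\<psi> a) * indicator (box u v) a) = (LINT a|lborel. Re (\<psi> a * indicator (box u v) a))"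
      by (intro Bochner_Integration.integral_cong) (auto simp: indicator_def)
    also have "\<dots> = 0" using z[of u v] by (simp only: int integral_Re integral_Im zero_complex.simps)
    finally show ?thesis .
  qed
  then have "AE a in lborel. Re (\<psi> a) = 0" by (intro real_eq_0_if_box_integrals) (use \<psi> in auto)
  moreover have "(LINT a|lborel. Im (\<psi> a) * indicator (box u v) a) = 0" for u v :: "real ^ 'n"
  proof -
    have "(LINT a|lborel. Im (\<psi> a) * indicator (box u v) a) = (LINT a|lborel. Im (\<psi> a * indicator (box u v) a))"
      by (intro Bochner_Integration.integral_cong) (auto simp: indicator_def)
    also have "\<dots> = 0" using z[of u v] by (simp only: int integral_Re integral_Im zero_complex.simps)
    finally show ?thesis .
  qed
  then have "AE a in lborel. Im (\<psi> a) = 0" by (intro real_eq_0_if_box_integrals) (use \<psi> in auto)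
  ultimately show ?thesis by eventually_elim (simp add: complex_eq_iff)
qed

section \<open>Gaussians\<close>

text \<open>
  This is the characteristic function of the standard normal distribution.
\<close>

lemma has_bochner_integral_gaussian_imaginary:
  "has_bochner_integral lborel (\<lambda>x. exp (\<i> * of_real (t * x) - of_real (x\<^sup>2) / 2))
     (of_real (sqrt (2 * pi)) * exp (- (of_real t)\<^sup>2 / 2))"
proof -
  let ?f = "\<lambda>x. std_normal_density x *\<^sub>R exp (\<i> * of_real (t * x))"
  have f: "?f x = of_real (1 / sqrt (2 * pi)) * exp (\<i> * of_real (t * x) - of_real (x\<^sup>2) / 2)" for x
  proof -
    have "of_real (exp (- x\<^sup>2 / 2)) * exp (\<i> * of_real (t * x)) = exp (\<i> * of_real (t * x) - of_real (x\<^sup>2) / 2)"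
      unfolding exp_of_real[symmetric] exp_add[symmetric] by (rule arg_cong[of _ _ exp]) simp
    then show ?thesis
      unfolding std_normal_density_def scaleR_conv_of_real of_real_mult mult.assoc by (simp only:)
  qed
  have int: "integrable lborel ?f"
    by (rule Bochner_Integration.integrable_bound[OF integrable_std_normal_moment[of 0]])
       (auto simp: norm_mult)
  have "(LINT x|lborel. ?f x) = char std_normal_distribution t"
    unfolding char_def by (subst integral_density) auto
  also have "\<dots> = exp (- (of_real t)\<^sup>2 / 2)"
    unfolding char_std_normal_distribution by (simp add: exp_of_real[symmetric])
  finally have "has_bochner_integral lborel ?f (exp (- (of_real t)\<^sup>2 / 2))"
    using int by (simp add: has_bochner_integral_iff)
  then have "has_bochner_integral lborel (\<lambda>x. of_real (sqrt (2 * pi)) * ?f x)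
      (of_real (sqrt (2 * pi)) * exp (- (of_real t)\<^sup>2 / 2))"
    by (rule has_bochner_integral_mult_right)
  moreover have "of_real (sqrt (2 * pi)) * ?f x = exp (\<i> * of_real (t * x) - of_real (x\<^sup>2) / 2)" for x
    unfolding f by (simp add: field_simps)
  ultimately show ?thesis by (simp only:)
qed

text \<open>
  The affine substitution \<open>x \<mapsto> s\<^sup>2 u + s x\<close>, with \<open>u\<close> the real part of \<open>\<beta>\<close>, leaves only the
  imaginary part of \<open>\<beta>\<close> in the exponent. This reduces the integral to the preceding one.
\<close>

lemma has_bochner_integral_gaussian:
  fixes \<beta> :: complex
  assumes "\<alpha> > 0"
  shows "has_bochner_integral lborel (\<lambda>x. exp (\<beta> * of_real x - of_real (\<alpha> * x\<^sup>2) / 2))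
     (of_real (sqrt (2 * pi / \<alpha>)) * exp (\<beta>\<^sup>2 / of_real (2 * \<alpha>)))"
proof -
  define s where "s = 1 / sqrt \<alpha>"
  have s: "s > 0" "\<alpha> * s\<^sup>2 = 1" using assms by (auto simp: s_def power_divide)
  define u v where "u = Re \<beta>" and "v = Im \<beta>"
  have \<beta>: "\<beta> = of_real u + \<i> * of_real v" by (simp add: u_def v_def complex_eq)
  define C where "C = exp (of_real (s\<^sup>2 * u\<^sup>2) / 2 + \<i> * of_real (s\<^sup>2 * u * v))"
  let ?f = "\<lambda>x. exp (\<beta> * of_real x - of_real (\<alpha> * x\<^sup>2) / 2)"
  have \<alpha>: "\<alpha> = 1 / s\<^sup>2" using s by (simp add: field_simps)
  have eq: "?f (s\<^sup>2 * u + s * x) = C * exp (\<i> * of_real ((s * v) * x) - of_real (x\<^sup>2) / 2)" for x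
  proof -
    have "\<beta> * of_real (s\<^sup>2 * u + s * x) - of_real (\<alpha> * (s\<^sup>2 * u + s * x)\<^sup>2) / 2
      = of_real (u * (s\<^sup>2 * u + s * x) - \<alpha> * (s\<^sup>2 * u + s * x)\<^sup>2 / 2) + \<i> * of_real (v * (s\<^sup>2 * u + s * x))"
      by (simp add: \<beta> algebra_simps)
    also have "u * (s\<^sup>2 * u + s * x) - \<alpha> * (s\<^sup>2 * u + s * x)\<^sup>2 / 2 = s\<^sup>2 * u\<^sup>2 / 2 - x\<^sup>2 / 2"
      using s(1) by (simp add: \<alpha> field_simps power2_eq_square)
    finally have E: "\<beta> * of_real (s\<^sup>2 * u + s * x) - of_real (\<alpha> * (s\<^sup>2 * u + s * x)\<^sup>2) / 2
      = of_real (s\<^sup>2 * u\<^sup>2 / 2 - x\<^sup>2 / 2) + \<i> * of_real (v * (s\<^sup>2 * u + s * x))" .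
    show ?thesis
      unfolding E C_def exp_add[symmetric] by (rule arg_cong[of _ _ exp]) (simp add: algebra_simps)
  qed
  have "has_bochner_integral lborel (\<lambda>x. C * exp (\<i> * of_real ((s * v) * x) - of_real (x\<^sup>2) / 2))
      (C * (of_real (sqrt (2 * pi)) * exp (- (of_real (s * v))\<^sup>2 / 2)))"
    by (intro has_bochner_integral_mult_right has_bochner_integral_gaussian_imaginary)
  then have "has_bochner_integral lborel (\<lambda>x. ?f (s\<^sup>2 * u + s * x))
      (C * (of_real (sqrt (2 * pi)) * exp (- (of_real (s * v))\<^sup>2 / 2)))"
    by (simp only: eq)
  moreover have "C * (of_real (sqrt (2 * pi)) * exp (- (of_real (s * v))\<^sup>2 / 2))
      = (of_real (sqrt (2 * pi / \<alpha>)) * exp (\<beta>\<^sup>2 / of_real (2 * \<alpha>))) /\<^sub>R \<bar>s\<bar>"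
  proof -
    have "\<beta>\<^sup>2 / of_real (2 * \<alpha>) = of_real (s\<^sup>2 * u\<^sup>2) / 2 + \<i> * of_real (s\<^sup>2 * u * v) + - (of_real (s * v))\<^sup>2 / 2"
      using s(1) by (simp add: \<alpha> \<beta> field_simps power2_eq_square)
    moreover have "sqrt (2 * pi / \<alpha>) = s * sqrt (2 * pi)" using assms by (simp add: s_def real_sqrt_divide)
    ultimately show ?thesis using s(1) by (simp only: C_def exp_add) (simp add: scaleR_conv_of_real)
  qed
  ultimately show ?thesis
    using lborel_has_bochner_integral_real_affine_iff[of s ?f "of_real (sqrt (2 * pi / \<alpha>)) * exp (\<beta>\<^sup>2 / of_real (2 * \<alpha>))" "s\<^sup>2 * u"] s(1)
    by simp
qed

lemma has_bochner_integral_vec_prod: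
  fixes f :: "'n::finite \<Rightarrow> real \<Rightarrow> complex"
  assumes f: "\<And>i. has_bochner_integral lborel (f i) (I i)"
  shows "has_bochner_integral lborel (\<lambda>a :: real ^ 'n. \<Prod>i\<in>UNIV. f i (a $ i)) (\<Prod>i\<in>UNIV. I i)"
proof -
  interpret P: product_sigma_finite "\<lambda>_ :: real ^ 'n. lborel :: real measure"
    by standard
  have [measurable]: "f i \<in> borel_measurable borel" for i using f[of i] by (auto simp: has_bochner_integral_iff)
  define ix :: "real ^ 'n \<Rightarrow> 'n" where "ix = inv (\<lambda>i. axis i 1)"
  have inj: "inj (\<lambda>i :: 'n. axis i (1::real))" by (auto simp: inj_on_def axis_eq_axis)
  have ix: "ix (axis i 1) = i" for i unfolding ix_def by (rule inv_f_f[OF inj])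
  have Basis: "(Basis :: (real ^ 'n) set) = range (\<lambda>i. axis i 1)" by (auto simp: Basis_vec_def)
  have prod: "(\<Prod>b\<in>Basis. g b) = (\<Prod>i\<in>UNIV. g (axis i 1))" for g :: "real ^ 'n \<Rightarrow> complex"
    unfolding Basis using inj by (simp add: prod.reindex)
  have nth: "(\<Sum>b\<in>Basis. x b *\<^sub>R b) $ i = x (axis i 1)" for x :: "real ^ 'n \<Rightarrow> real" and i
  proof -
    have "(\<Sum>b\<in>Basis. x b *\<^sub>R b) \<bullet> axis i 1 = x (axis i 1)"
      by (rule inner_sum_left_Basis) (simp add: Basis)
    then show ?thesis by (simp add: inner_axis)
  qed
  have "integrable (\<Pi>\<^sub>M b\<in>Basis. lborel) (\<lambda>x. \<Prod>b\<in>Basis. f (ix b) (x b))"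
    using f by (intro P.product_integrable_prod) (auto simp: has_bochner_integral_iff)
  moreover have "integral\<^sup>L (\<Pi>\<^sub>M b\<in>Basis. lborel) (\<lambda>x. \<Prod>b\<in>Basis. f (ix b) (x b)) = (\<Prod>b\<in>Basis. (LINT x|lborel. f (ix b) x))"
    using f by (intro P.product_integral_prod) (auto simp: has_bochner_integral_iff)
  ultimately have "has_bochner_integral (\<Pi>\<^sub>M b\<in>Basis. lborel) (\<lambda>x. \<Prod>b\<in>Basis. f (ix b) (x b)) (\<Prod>i\<in>UNIV. I i)"
    using f by (simp add: has_bochner_integral_iff prod ix)
  then have "has_bochner_integral (\<Pi>\<^sub>M b\<in>Basis. lborel)
      (\<lambda>x. \<Prod>i\<in>UNIV. f i ((\<Sum>b\<in>Basis. x b *\<^sub>R b :: real ^ 'n) $ i)) (\<Prod>i\<in>UNIV. I i)"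
    by (simp only: prod ix nth)
  then show ?thesis
    by (subst lborel_eq) (simp add: has_bochner_integral_iff integrable_distr_eq integral_distr)
qed

text \<open>
  These Gaussians with complex centres are a total family, are permuted up to scalars by
  translations and by the Fourier transform, and have Gram matrices in closed form. They
  replace the Schwartz space in the construction of the Fourier transform.
\<close>

definition gauss :: "('n::finite \<Rightarrow> complex) \<Rightarrow> real ^ 'n \<Rightarrow> complex" where
  "gauss b a = (\<Prod>i\<in>UNIV. exp (b i * of_real (a $ i) - of_real ((a $ i)\<^sup>2) / 2))"

lemma measurable_gauss [measurable]: "gauss b \<in> borel_measurable borel"
  unfolding gauss_def by measurable

lemma has_bochner_integral_cnj_gauss_mult:
  "has_bochner_integral lborel (\<lambda>a. cnj (gauss b a) * gauss c a)
     (\<Prod>i\<in>UNIV. of_real (sqrt pi) * exp ((cnj (b i) + c i)\<^sup>2 / 4))"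
proof -
  have eq: "cnj (gauss b a) * gauss c a
      = (\<Prod>i\<in>UNIV. exp ((cnj (b i) + c i) * of_real (a $ i) - of_real (2 * (a $ i)\<^sup>2) / 2))" for a
    unfolding gauss_def by (simp add: exp_cnj exp_add[symmetric] algebra_simps flip: prod.distrib)
  show ?thesis unfolding eq
    using has_bochner_integral_gaussian[of 2] by (intro has_bochner_integral_vec_prod) simp
qed

lemma square_integrable_gauss: "square_integrable (gauss b)"
proof (rule square_integrable_nnI)
  have "integrable lborel (\<lambda>a. cnj (gauss b a) * gauss b a)"
    using has_bochner_integral_cnj_gauss_mult[of b b] by (simp add: has_bochner_integral_iff)
  then have "(\<integral>\<^sup>+a. ennreal (norm (cnj (gauss b a) * gauss b a)) \<partial>lborel) < \<infinity>"
    by (simp add: integrable_iff_bounded)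
  then show "(\<integral>\<^sup>+a. ennreal ((cmod (gauss b a))\<^sup>2) \<partial>lborel) < \<infinity>"
    by (simp add: norm_mult power2_eq_square)
qed simp

lemma cinner_gauss:
  "cinner (abs_l2 (gauss b)) (abs_l2 (gauss c)) = (\<Prod>i\<in>UNIV. of_real (sqrt pi) * exp ((cnj (b i) + c i)\<^sup>2 / 4))"
  using has_bochner_integral_cnj_gauss_mult[of b c]
  by (simp add: cinner_abs_l2 square_integrable_gauss has_bochner_integral_iff)

text \<open>
  For purely imaginary \<open>b\<close> the inner products are the Fourier transform of \<open>F\<close> times a fixed
  Gaussian without zeros.
\<close>

lemma eq_0_if_orthogonal_gauss:
  assumes "\<And>b. cinner (abs_l2 (gauss b)) F = 0"
  shows "F = 0"
proof -
  have zero: "(LINT a|lborel. cnj (gauss b a) * rep_l2 F a) = 0" for b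
    using assms[of b] cinner_abs_l2[OF square_integrable_gauss square_integrable_rep_l2, of b F] by simp
  have gexp: "cnj (gauss (\<lambda>i. - \<i> * of_real (v i)) a) = gauss (\<lambda>_. 0) a * (\<Prod>i\<in>UNIV. exp (\<i> * of_real (v i * a $ i)))"
    for v :: "'a \<Rightarrow> real" and a
    unfolding gauss_def by (simp add: exp_cnj exp_add[symmetric] algebra_simps flip: prod.distrib)
  have "AE a in lborel. gauss (\<lambda>_. 0) a * rep_l2 F a = 0"
  proof (rule eq_0_if_fourier_eq_0)
    have "cnj (gauss (\<lambda>_. 0) a) = gauss (\<lambda>_. 0) a" for a :: "real^'a"
      unfolding gauss_def by (simp add: exp_cnj)
    then show "integrable lborel (\<lambda>a. gauss (\<lambda>_. 0) a * rep_l2 F a)"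
      using square_integrable_mult[OF square_integrable_gauss[of "\<lambda>_. 0"] square_integrable_rep_l2[of F]] by simp
    show "(LINT a|lborel. gauss (\<lambda>_. 0) a * rep_l2 F a * (\<Prod>i\<in>UNIV. exp (\<i> * of_real (v i * a $ i)))) = 0" for v
      using zero[of "\<lambda>i. - \<i> * of_real (v i)"] unfolding gexp by (simp only: mult_ac)
  qed
  moreover have "gauss (\<lambda>_. 0) a \<noteq> 0" for a :: "real^'a" by (simp add: gauss_def)
  ultimately have "AE a in lborel. rep_l2 F a = 0" by simp
  then show ?thesis using AE_rep_zero by (intro l2_eqI) auto
qed

section \<open>Isometries from Gram matrices\<close>

text \<open>
  The relation pairs a linear combination of the \<open>u b\<close> with the combination of the \<open>v b\<close>
  that has the same coefficients. As a relation it needs no linear independence of the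
  \<open>u b\<close>; that it is a function follows from the equality of the Gram matrices.
\<close>

inductive gram_rel :: "('b \<Rightarrow> ('n::finite) l2) \<Rightarrow> ('b \<Rightarrow> 'n l2) \<Rightarrow> 'n l2 \<Rightarrow> 'n l2 \<Rightarrow> bool" for u v where
  zero: "gram_rel u v 0 0"
| step: "gram_rel u v F G \<Longrightarrow> gram_rel u v (F + cscale c (u b)) (G + cscale c (v b))"

lemma gram_rel_add: "gram_rel u v F' G' \<Longrightarrow> gram_rel u v F G \<Longrightarrow> gram_rel u v (F + F') (G + G')"
proof (induction rule: gram_rel.induct)
  case (step F' G' c b)
  show ?case using gram_rel.step[OF step.IH[OF step.prems], of c b] by (simp add: add.assoc)
qed simp

lemma gram_rel_cscale: "gram_rel u v F G \<Longrightarrow> gram_rel u v (cscale d F) (cscale d G)"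
proof (induction rule: gram_rel.induct)
  case zero show ?case using gram_rel.zero by simp
next
  case (step F G c b)
  show ?case using gram_rel.step[OF step.IH, of "d * c" b] by (simp add: cscale_add_right)
qed

lemma gram_rel_gen: "gram_rel u v (u b) (v b)"
  using gram_rel.step[OF gram_rel.zero, of u v 1 b] by simp

lemma gram_rel_cinner:
  assumes gram: "\<And>b c. cinner (u b) (u c) = cinner (v b) (v c)"
    and "gram_rel u v F G" and "gram_rel u v F' G'"
  shows "cinner F F' = cinner G G'"
proof -
  have 1: "cinner (u b) F = cinner (v b) G" for b
    using assms(2) by induction (simp_all add: cinner_add_right cinner_cscale_right gram cinner.zero_right)
  have "cinner F (u b) = cinner G (v b)" for b
    using 1[of b] cinner_commute[of F] cinner_commute[of G] by simp
  with assms(3) show ?thesis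
    by induction (simp_all add: cinner_add_right cinner_cscale_right cinner.zero_right)
qed

lemma csubspace_gram: "csubspace {F. \<exists>G. gram_rel u v F G}"
  unfolding csubspace_def using gram_rel.zero gram_rel_add gram_rel_cscale by blast

text \<open>
  Equal Gram matrices make \<open>u b \<mapsto> v b\<close> well defined and isometric on the span of the total
  family \<open>u\<close>, from where it extends by continuity.
\<close>

lemma isometry_from_gram:
  fixes u v :: "'b \<Rightarrow> ('n::finite) l2"
  assumes gram: "\<And>b c. cinner (u b) (u c) = cinner (v b) (v c)"
    and total: "\<And>F. (\<And>b. cinner (u b) F = 0) \<Longrightarrow> F = 0"
  shows "\<exists>T. clinear T \<and> (\<forall>F. norm (T F) = norm F) \<and> (\<forall>b. T (u b) = v b)"
proof -
  define S where "S = {F. \<exists>G. gram_rel u v F G}"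
  define T0 where "T0 F = (SOME G. gram_rel u v F G)" for F
  have norm: "norm F = norm G" if "gram_rel u v F G" for F G
  proof -
    have "complex_of_real ((norm F)\<^sup>2) = complex_of_real ((norm G)\<^sup>2)"
      using gram_rel_cinner[OF gram that that] by (simp only: cinner_self)
    then show ?thesis by (simp only: of_real_eq_iff power2_eq_iff_nonneg norm_ge_zero)
  qed
  have uniq: "G = G'" if "gram_rel u v F G" "gram_rel u v F G'" for F G G'
  proof -
    have "gram_rel u v (F + cscale (-1) F) (G + cscale (-1) G')"
      using that gram_rel_add gram_rel_cscale by blast
    then show ?thesis using norm by (fastforce simp flip: minus_cscale)
  qed
  have T0: "gram_rel u v F (T0 F)" if "F \<in> S" for F
    using that unfolding S_def T0_def by (auto intro: someI)
  have T0eq: "T0 F = G" if "gram_rel u v F G" for F G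
    using T0[of F] uniq that by (auto simp: S_def)
  have dense: "closure S = UNIV"
  proof (rule csubspace_dense)
    show "csubspace S" unfolding S_def by (rule csubspace_gram)
    fix F assume "\<And>G. G \<in> S \<Longrightarrow> cinner G F = 0"
    then have "cinner (u b) F = 0" for b using gram_rel_gen[of u v b] unfolding S_def by blast
    then show "F = 0" by (rule total)
  qed
  have "\<exists>T. clinear T \<and> (\<forall>F. norm (T F) = norm F) \<and> (\<forall>F\<in>S. T F = T0 F)"
  proof (rule isometry_extension[OF _ dense])
    show "csubspace S" unfolding S_def by (rule csubspace_gram)
    show "T0 (F + G) = T0 F + T0 G" if "F \<in> S" "G \<in> S" for F G
      using that by (intro T0eq gram_rel_add T0)
    show "T0 (cscale c F) = cscale c (T0 F)" if "F \<in> S" for c F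
      using that by (intro T0eq gram_rel_cscale T0)
    show "norm (T0 F) = norm F" if "F \<in> S" for F using norm[OF T0[OF that]] by simp
  qed
  moreover have "u b \<in> S" "T0 (u b) = v b" for b
    using gram_rel_gen[of u v b] T0eq by (auto simp: S_def)
  ultimately show ?thesis by metis
qed

lemma clinear_eq_on_total:
  fixes u :: "'b \<Rightarrow> ('n::finite) l2"
  assumes total: "\<And>F. (\<And>b. cinner (u b) F = 0) \<Longrightarrow> F = 0"
    and T: "clinear T" "bounded_linear T" and T': "clinear T'" "bounded_linear T'"
    and eq: "\<And>b. T (u b) = T' (u b)"
  shows "T = T'"
proof (rule clinear_eq_on_dense)
  let ?S = "{F. \<exists>G. gram_rel u u F G}"
  show "closure ?S = UNIV"
  proof (rule csubspace_dense)
    show "csubspace ?S" by (rule csubspace_gram)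
    fix F assume "\<And>G. G \<in> ?S \<Longrightarrow> cinner G F = 0"
    then have "cinner (u b) F = 0" for b using gram_rel_gen[of u u b] by blast
    then show "F = 0" by (rule total)
  qed
  fix F assume "F \<in> ?S"
  then obtain G where "gram_rel u u F G" by auto
  then show "T F = T' F"
    by induction (auto simp: clinear_zero clinear_add clinear_cscale T T' eq)
qed (fact T T')+

section \<open>Multiplication and substitution operators\<close>

definition bounded_borel :: "('a::topological_space \<Rightarrow> complex) \<Rightarrow> bool" where
  "bounded_borel \<phi> \<longleftrightarrow> \<phi> \<in> borel_measurable borel \<and> (\<exists>C. \<forall>a. cmod (\<phi> a) \<le> C)"

lemma measurable_cnj [measurable]: "cnj \<in> borel_measurable borel"
  by (intro borel_measurable_continuous_onI continuous_intros)

definition mulop :: "(real ^ 'n \<Rightarrow> complex) \<Rightarrow> ('n::finite) l2 \<Rightarrow> 'n l2" where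
  "mulop \<phi> F = abs_l2 (\<lambda>a. \<phi> a * rep_l2 F a)"

lemma bounded_borelI: "\<phi> \<in> borel_measurable borel \<Longrightarrow> (\<And>a. cmod (\<phi> a) \<le> C) \<Longrightarrow> bounded_borel \<phi>"
  by (auto simp: bounded_borel_def)

lemma bounded_borel_mult:
  assumes "bounded_borel \<phi>" "bounded_borel \<psi>"
  shows "bounded_borel (\<lambda>a. \<phi> a * \<psi> a)"
proof -
  obtain C D where C: "\<And>a. cmod (\<phi> a) \<le> C" and D: "\<And>a. cmod (\<psi> a) \<le> D"
    using assms by (auto simp: bounded_borel_def)
  have [measurable]: "\<phi> \<in> borel_measurable borel" "\<psi> \<in> borel_measurable borel"
    using assms by (auto simp: bounded_borel_def)
  have "cmod (\<phi> a * \<psi> a) \<le> C * D" for a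
    using C[of a] D[of a] order_trans[OF norm_ge_zero C] unfolding norm_mult by (intro mult_mono) auto
  then show ?thesis by (intro bounded_borelI[of _ "C * D"]) auto
qed

lemma bounded_borel_comp:
  assumes "bounded_borel \<phi>" "m \<in> borel_measurable borel"
  shows "bounded_borel (\<lambda>a. \<phi> (m a))"
  using assms unfolding bounded_borel_def by (auto intro: measurable_compose)

lemma square_integrable_bounded_mult:
  assumes "bounded_borel \<phi>" "square_integrable f"
  shows "square_integrable (\<lambda>a. \<phi> a * f a)"
proof -
  obtain C where C: "\<And>a. cmod (\<phi> a) \<le> C" using assms by (auto simp: bounded_borel_def)
  have [measurable]: "\<phi> \<in> borel_measurable borel" "f \<in> borel_measurable borel"
    using assms by (auto simp: bounded_borel_def square_integrable_def)
  have int: "integrable lborel (\<lambda>a. C\<^sup>2 * (cmod (f a))\<^sup>2)"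
    using assms(2) by (simp add: square_integrable_def)
  have "integrable lborel (\<lambda>a. (cmod (\<phi> a * f a))\<^sup>2)"
    using power_mono[OF C norm_ge_zero, of _ 2]
    by (intro Bochner_Integration.integrable_bound[OF int])
       (auto simp: norm_mult power_mult_distrib intro!: mult_right_mono)
  then show ?thesis by (simp add: square_integrable_def)
qed

lemma AE_rep_mulop: "bounded_borel \<phi> \<Longrightarrow> AE a in lborel. rep_l2 (mulop \<phi> F) a = \<phi> a * rep_l2 F a"
  unfolding mulop_def by (intro AE_rep_abs_l2 square_integrable_bounded_mult) auto

lemma mulop_abs_l2:
  assumes "bounded_borel \<phi>" "square_integrable f"
  shows "mulop \<phi> (abs_l2 f) = abs_l2 (\<lambda>a. \<phi> a * f a)"
  unfolding mulop_def using AE_rep_abs_l2[OF assms(2)]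
  by (intro abs_l2_eqI square_integrable_bounded_mult assms) auto

lemma clinear_mulop:
  assumes "bounded_borel \<phi>" shows "clinear (mulop \<phi>)"
  unfolding clinear_def
proof (intro conjI allI)
  fix F G c
  note A = AE_rep_mulop[OF assms]
  show "mulop \<phi> (F + G) = mulop \<phi> F + mulop \<phi> G"
    using A[of F] A[of G] A[of "F + G"] AE_rep_plus[of F G] AE_rep_plus[of "mulop \<phi> F" "mulop \<phi> G"]
    by (intro l2_eqI) (auto simp: algebra_simps)
  show "mulop \<phi> (cscale c F) = cscale c (mulop \<phi> F)"
    using A[of F] A[of "cscale c F"] AE_rep_cscale[of c F] AE_rep_cscale[of c "mulop \<phi> F"]
    by (intro l2_eqI) (auto simp: algebra_simps)
qed

lemma mulop_mulop:
  assumes "bounded_borel \<phi>" "bounded_borel \<psi>"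
  shows "mulop \<phi> (mulop \<psi> F) = mulop (\<lambda>a. \<phi> a * \<psi> a) F"
  using AE_rep_mulop[OF assms(1), of "mulop \<psi> F"] AE_rep_mulop[OF assms(2), of F]
    AE_rep_mulop[OF bounded_borel_mult[OF assms], of F]
  by (intro l2_eqI) auto

lemma mulop_one [simp]: "mulop (\<lambda>_. 1) F = F"
  by (simp add: mulop_def)

lemma cinner_mulop:
  assumes "bounded_borel \<phi>"
  shows "cinner F (mulop \<phi> G) = (LINT a|lborel. cnj (rep_l2 F a) * (\<phi> a * rep_l2 G a))"
  using cinner_abs_l2[OF square_integrable_rep_l2[of F] square_integrable_bounded_mult[OF assms square_integrable_rep_l2[of G]]]
  by (simp add: mulop_def)

lemma integrable_cmod_rep: "integrable lborel (\<lambda>a. (cmod (rep_l2 F a))\<^sup>2)"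
  using square_integrable_rep_l2[of F] by (simp add: square_integrable_def)

lemma norm_mulop_le:
  assumes "bounded_borel \<phi>" "\<And>a. cmod (\<phi> a) \<le> C"
  shows "norm (mulop \<phi> F) \<le> C * norm F"
proof (rule power2_le_imp_le)
  have C0: "C \<ge> 0" using order_trans[OF norm_ge_zero assms(2)] .
  have "(norm (mulop \<phi> F))\<^sup>2 = (LINT a|lborel. (cmod (\<phi> a * rep_l2 F a))\<^sup>2)"
    unfolding mulop_def by (intro norm_abs_l2_square square_integrable_bounded_mult assms) auto
  also have "\<dots> \<le> (LINT a|lborel. C\<^sup>2 * (cmod (rep_l2 F a))\<^sup>2)"
  proof (rule integral_mono)
    show "integrable lborel (\<lambda>a. (cmod (\<phi> a * rep_l2 F a))\<^sup>2)"
      using square_integrable_bounded_mult[OF assms(1) square_integrable_rep_l2[of F]]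
      by (simp add: square_integrable_def)
    show "integrable lborel (\<lambda>a. C\<^sup>2 * (cmod (rep_l2 F a))\<^sup>2)" by (simp add: integrable_cmod_rep)
    show "(cmod (\<phi> a * rep_l2 F a))\<^sup>2 \<le> C\<^sup>2 * (cmod (rep_l2 F a))\<^sup>2" for a
      using assms(2)[of a] by (auto simp: norm_mult power_mult_distrib intro!: mult_right_mono power_mono)
  qed
  also have "\<dots> = (C * norm F)\<^sup>2" by (simp add: norm_l2_square power_mult_distrib)
  finally show "(norm (mulop \<phi> F))\<^sup>2 \<le> (C * norm F)\<^sup>2" .
  show "0 \<le> C * norm F" using C0 by simp
qed

lemma bounded_linear_mulop:
  assumes "bounded_borel \<phi>" shows "bounded_linear (mulop \<phi>)"
proof -
  obtain C where C: "\<And>a. cmod (\<phi> a) \<le> C" using assms by (auto simp: bounded_borel_def)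
  show ?thesis
    using norm_mulop_le[OF assms C] clinear_mulop[OF assms]
    by (intro bounded_linear_intro[where K = C]) (auto simp: clinear_def cscale_scaleR mult.commute)
qed

lemma bounded_borel_unimodular:
  "\<phi> \<in> borel_measurable borel \<Longrightarrow> (\<And>a. cmod (\<phi> a) = 1) \<Longrightarrow> bounded_borel \<phi>"
  by (rule bounded_borelI[of _ 1]) auto

lemma unitary_mulop:
  assumes [measurable]: "\<phi> \<in> borel_measurable borel" and u: "\<And>a. cmod (\<phi> a) = 1"
  shows "unitary (mulop \<phi>)" "inv (mulop \<phi>) = mulop (\<lambda>a. cnj (\<phi> a))"
proof -
  have m: "bounded_borel \<phi>" by (rule bounded_borel_unimodular) (auto simp: u)
  have mc: "bounded_borel (\<lambda>a. cnj (\<phi> a))" by (rule bounded_borel_unimodular) (auto simp: u)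
  have one: "\<phi> a * cnj (\<phi> a) = 1" "cnj (\<phi> a) * \<phi> a = 1" for a
    using u[of a] complex_norm_square[of "\<phi> a"] by (simp_all add: mult.commute)
  have r: "mulop \<phi> (mulop (\<lambda>a. cnj (\<phi> a)) F) = F" "mulop (\<lambda>a. cnj (\<phi> a)) (mulop \<phi> F) = F" for F
    by (simp_all add: mulop_mulop m mc one)
  have "norm (mulop \<phi> F) = norm F" for F
  proof (rule antisym)
    show "norm (mulop \<phi> F) \<le> norm F" using norm_mulop_le[OF m, of 1 F] u by simp
    show "norm F \<le> norm (mulop \<phi> F)"
      using norm_mulop_le[OF mc, of 1 "mulop \<phi> F"] u by (simp add: r)
  qed
  then show 1: "unitary (mulop \<phi>)"
    by (intro unitary_I_inverse[where S = "mulop (\<lambda>a. cnj (\<phi> a))"] clinear_mulop m r)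
  show "inv (mulop \<phi>) = mulop (\<lambda>a. cnj (\<phi> a))"
    using 1 r by (intro ext) (metis unitary_f_inv)
qed

lemma mulop_tendsto:
  fixes \<phi> :: "nat \<Rightarrow> real ^ 'n::finite \<Rightarrow> complex"
  assumes [measurable]: "\<And>n. \<phi> n \<in> borel_measurable borel" "\<psi> \<in> borel_measurable borel"
    and C: "\<And>n a. cmod (\<phi> n a) \<le> C" and lim: "\<And>a. (\<lambda>n. \<phi> n a) \<longlonglongrightarrow> \<psi> a"
  shows "(\<lambda>n. mulop (\<phi> n) F) \<longlonglongrightarrow> mulop \<psi> F"
proof -
  have C\<psi>: "cmod (\<psi> a) \<le> C" for a
    by (rule LIMSEQ_le_const2[OF tendsto_norm[OF lim]]) (use C in auto)
  have C0: "C \<ge> 0" using order_trans[OF norm_ge_zero C] .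
  have b\<phi>: "bounded_borel (\<phi> n)" for n by (rule bounded_borelI[of _ C]) (auto simp: C)
  have b\<psi>: "bounded_borel \<psi>" by (rule bounded_borelI[of _ C]) (auto simp: C\<psi>)
  have eq: "(norm (mulop (\<phi> n) F - mulop \<psi> F))\<^sup>2 = (LINT a|lborel. (cmod ((\<phi> n a - \<psi> a) * rep_l2 F a))\<^sup>2)" for n
  proof -
    have "mulop (\<phi> n) F - mulop \<psi> F = abs_l2 (\<lambda>a. \<phi> n a * rep_l2 F a - \<psi> a * rep_l2 F a)"
      unfolding mulop_def by (intro minus_abs_l2 square_integrable_bounded_mult b\<phi> b\<psi>) auto
    then show ?thesis
      by (simp only:, subst norm_abs_l2_square)
         (auto intro!: square_integrable_diff square_integrable_bounded_mult b\<phi> b\<psi> simp: left_diff_distrib)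
  qed
  have "(\<lambda>n. LINT a|lborel. (cmod ((\<phi> n a - \<psi> a) * rep_l2 F a))\<^sup>2) \<longlonglongrightarrow> (LINT a|(lborel :: (real ^ 'n) measure). (0 :: real))"
  proof (rule integral_dominated_convergence)
    show "integrable lborel (\<lambda>a. (2 * C)\<^sup>2 * (cmod (rep_l2 F a))\<^sup>2)" by (simp add: integrable_cmod_rep)
    show "AE a in lborel. (\<lambda>n. (cmod ((\<phi> n a - \<psi> a) * rep_l2 F a))\<^sup>2) \<longlonglongrightarrow> 0"
    proof (rule AE_I2)
      fix a
      have "(\<lambda>n. (cmod ((\<phi> n a - \<psi> a) * rep_l2 F a))\<^sup>2) \<longlonglongrightarrow> (cmod ((\<psi> a - \<psi> a) * rep_l2 F a))\<^sup>2"
        by (intro tendsto_intros lim)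
      then show "(\<lambda>n. (cmod ((\<phi> n a - \<psi> a) * rep_l2 F a))\<^sup>2) \<longlonglongrightarrow> 0" by simp
    qed
    have "cmod (\<phi> n a - \<psi> a) \<le> 2 * C" for n a
      using norm_triangle_ineq4[of "\<phi> n a" "\<psi> a"] C[of n a] C\<psi>[of a] by simp
    then have "(cmod (\<phi> n a - \<psi> a))\<^sup>2 * (cmod (rep_l2 F a))\<^sup>2 \<le> (2 * C)\<^sup>2 * (cmod (rep_l2 F a))\<^sup>2" for n a
      by (intro mult_right_mono power_mono) auto
    then show "AE a in lborel. norm ((cmod ((\<phi> n a - \<psi> a) * rep_l2 F a))\<^sup>2) \<le> (2 * C)\<^sup>2 * (cmod (rep_l2 F a))\<^sup>2" for n
      unfolding norm_mult power_mult_distrib[of "cmod (\<phi> n _ - \<psi> _)"] by simp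
  qed measurable
  then have "(\<lambda>n. (norm (mulop (\<phi> n) F - mulop \<psi> F))\<^sup>2) \<longlonglongrightarrow> 0" by (simp add: eq)
  then have "(\<lambda>n. sqrt ((norm (mulop (\<phi> n) F - mulop \<psi> F))\<^sup>2)) \<longlonglongrightarrow> sqrt 0" by (rule tendsto_real_sqrt)
  then have "(\<lambda>n. norm (mulop (\<phi> n) F - mulop \<psi> F)) \<longlonglongrightarrow> 0" by simp
  then show ?thesis by (simp add: tendsto_norm_zero_iff LIM_zero_iff)
qed

text \<open>
  The image of Lebesgue measure under \<open>A\<close> is \<open>r\<close> times Lebesgue measure. For a linear
  bijection \<open>r\<close> is the inverse of the modulus of its determinant.
\<close>

definition scaling :: "real \<Rightarrow> (real ^ 'n::finite \<Rightarrow> real ^ 'n) \<Rightarrow> bool" where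
  "scaling r A \<longleftrightarrow> r > 0 \<and> A \<in> borel_measurable borel \<and>
     distr lborel borel A = density lborel (\<lambda>_. ennreal r)"

text \<open>
  The factor \<open>1 / sqrt r\<close> compensates the change of Lebesgue measure and makes the
  substitution an isometry.
\<close>

definition subst_op :: "real \<Rightarrow> (real ^ 'n \<Rightarrow> real ^ 'n) \<Rightarrow> ('n::finite) l2 \<Rightarrow> 'n l2" where
  "subst_op r A F = abs_l2 (\<lambda>a. of_real (1 / sqrt r) * rep_l2 F (A a))"

lemma scaling_measurable: "scaling r A \<Longrightarrow> A \<in> borel_measurable borel"
  by (simp add: scaling_def)

text \<open>
  Needed in order that substitution is compatible with equality almost everywhere: \<open>A\<close> pulls
  back null sets to null sets.
\<close>

lemma scaling_AE:
  assumes "scaling r A" "AE a in lborel. P a"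
  shows "AE a in lborel. P (A a)"
proof -
  have "AE a in distr lborel borel A. P a"
  proof -
    have "distr lborel borel A = density lborel (\<lambda>_. ennreal r)" using assms(1) by (simp add: scaling_def)
    then show ?thesis using assms(2) by (simp only:) (subst AE_density, auto)
  qed
  then show ?thesis
    using assms(1) by (intro AE_distrD[of A lborel borel]) (auto simp: scaling_def)
qed

lemma square_integrable_subst:
  assumes "scaling r A" "square_integrable f"
  shows "square_integrable (\<lambda>a. of_real (1 / sqrt r) * f (A a))"
    and "(LINT a|lborel. (cmod (of_real (1 / sqrt r) * f (A a)))\<^sup>2) = (LINT a|lborel. (cmod (f a))\<^sup>2)"
proof -
  have [measurable]: "A \<in> borel_measurable borel" "f \<in> borel_measurable borel" and r: "r > 0"
    and D: "distr lborel borel A = density lborel (\<lambda>_. ennreal r)"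
    using assms by (auto simp: scaling_def square_integrable_def)
  have f: "integrable lborel (\<lambda>a. (cmod (f a))\<^sup>2)" using assms(2) by (simp add: square_integrable_def)
  have "integrable (distr lborel borel A) (\<lambda>a. (cmod (f a))\<^sup>2)"
    unfolding D using r f by (subst integrable_density) auto
  then have "integrable lborel (\<lambda>a. (cmod (f (A a)))\<^sup>2)" by (subst (asm) integrable_distr_eq) auto
  then have "integrable lborel (\<lambda>a. (cmod (of_real (1 / sqrt r) * f (A a)))\<^sup>2)"
    unfolding norm_mult power_mult_distrib by (rule integrable_mult_right)
  then show "square_integrable (\<lambda>a. of_real (1 / sqrt r) * f (A a))"
    by (simp add: square_integrable_def)
  have "(LINT a|lborel. (cmod (f (A a)))\<^sup>2) = (LINT a|distr lborel borel A. (cmod (f a))\<^sup>2)"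
    by (subst integral_distr) auto
  also have "\<dots> = r * (LINT a|lborel. (cmod (f a))\<^sup>2)"
    unfolding D using r by (subst integral_density) auto
  finally show "(LINT a|lborel. (cmod (of_real (1 / sqrt r) * f (A a)))\<^sup>2) = (LINT a|lborel. (cmod (f a))\<^sup>2)"
    using r by (simp add: norm_mult norm_divide power_divide power_mult_distrib)
qed

lemma AE_rep_subst_op:
  "scaling r A \<Longrightarrow> AE a in lborel. rep_l2 (subst_op r A F) a = of_real (1 / sqrt r) * rep_l2 F (A a)"
  unfolding subst_op_def by (intro AE_rep_abs_l2 square_integrable_subst) auto

lemma norm_subst_op: "scaling r A \<Longrightarrow> norm (subst_op r A F) = norm F"
proof -
  assume A: "scaling r A"
  have "(norm (subst_op r A F))\<^sup>2 = (norm F)\<^sup>2"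
    unfolding subst_op_def
    by (subst norm_abs_l2_square) (simp_all only: square_integrable_subst[OF A square_integrable_rep_l2] norm_l2_square)
  then show ?thesis by (simp add: power2_eq_iff_nonneg)
qed

lemma clinear_subst_op:
  assumes A: "scaling r A" shows "clinear (subst_op r A)"
  unfolding clinear_def
proof (intro conjI allI)
  fix F G c
  note S = AE_rep_subst_op[OF A]
  show "subst_op r A (F + G) = subst_op r A F + subst_op r A G"
    using S[of F] S[of G] S[of "F + G"] scaling_AE[OF A AE_rep_plus[of F G]]
      AE_rep_plus[of "subst_op r A F" "subst_op r A G"]
    by (intro l2_eqI) (auto simp: algebra_simps add_divide_distrib)
  show "subst_op r A (cscale c F) = cscale c (subst_op r A F)"
    using S[of F] S[of "cscale c F"] scaling_AE[OF A AE_rep_cscale[of c F]]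
      AE_rep_cscale[of c "subst_op r A F"]
    by (intro l2_eqI) (auto simp: algebra_simps)
qed

lemma subst_op_subst_op:
  assumes "scaling r A" "scaling s B"
  shows "subst_op r A (subst_op s B F) = subst_op (r * s) (\<lambda>a. B (A a)) F"
proof -
  have r: "r > 0" and [measurable]: "A \<in> borel_measurable borel" "B \<in> borel_measurable borel"
    and s: "s > 0" using assms by (auto simp: scaling_def)
  have AB: "scaling (r * s) (\<lambda>a. B (A a))"
    unfolding scaling_def
  proof (intro conjI)
    have "distr lborel borel (\<lambda>a. B (A a)) = distr (distr lborel borel A) borel B"
      by (subst distr_distr) (auto simp: comp_def)
    also have "\<dots> = distr (density lborel (\<lambda>_. ennreal r)) borel B" using assms(1) by (simp add: scaling_def)
    also have "\<dots> = density (distr lborel borel B) (\<lambda>_. ennreal r)"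
      by (subst density_distr) auto
    also have "\<dots> = density lborel (\<lambda>_. ennreal (r * s))"
      using assms(2) r s by (simp add: scaling_def density_density_eq ennreal_mult mult.commute)
    finally show "distr lborel borel (\<lambda>a. B (A a)) = density lborel (\<lambda>_. ennreal (r * s))" .
  qed (use r s in auto)
  show ?thesis
    using AE_rep_subst_op[OF assms(1), of "subst_op s B F"] scaling_AE[OF assms(1) AE_rep_subst_op[OF assms(2), of F]]
      AE_rep_subst_op[OF AB, of F]
    by (intro l2_eqI) (auto simp: real_sqrt_mult)
qed

lemma subst_op_id [simp]: "subst_op 1 (\<lambda>a. a) F = F"
  by (simp add: subst_op_def)

lemma unitary_subst_op:
  assumes "scaling r A" "scaling (1 / r) B" "\<And>a. A (B a) = a"
  shows "unitary (subst_op r A)"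
proof (rule unitary_I_inverse[where S = "subst_op (1 / r) B"])
  have AB: "r \<noteq> 0" using assms by (auto simp: scaling_def)
  fix F
  have "subst_op (1 / r) B (subst_op r A F') = F'" for F'
    using subst_op_subst_op[OF assms(2,1), of F'] AB by (simp add: assms(3))
  then have S: "surj (subst_op (1 / r) B)" by (metis surjI)
  have u: "unitary (subst_op (1 / r) B)"
    using assms(2) S by (simp add: unitary_def clinear_subst_op norm_subst_op)
  have "inv (subst_op (1 / r) B) = subst_op r A"
    using u \<open>\<And>F'. subst_op (1 / r) B (subst_op r A F') = F'\<close> by (intro ext) (metis unitary_f_inv)
  then show "subst_op r A (subst_op (1 / r) B F) = F" using u by (metis unitary_f_inv)
qed (use assms in \<open>auto simp: clinear_subst_op norm_subst_op\<close>)

lemma subst_op_abs_l2: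
  assumes "scaling r A" "square_integrable f"
  shows "subst_op r A (abs_l2 f) = abs_l2 (\<lambda>a. of_real (1 / sqrt r) * f (A a))"
  unfolding subst_op_def using scaling_AE[OF assms(1) AE_rep_abs_l2[OF assms(2)]]
  by (intro abs_l2_eqI square_integrable_subst assms) auto

lemma subst_op_mulop:
  assumes "scaling r A" "bounded_borel \<phi>"
  shows "subst_op r A (mulop \<phi> F) = mulop (\<lambda>a. \<phi> (A a)) (subst_op r A F)"
  using AE_rep_subst_op[OF assms(1), of F] AE_rep_subst_op[OF assms(1), of "mulop \<phi> F"]
    scaling_AE[OF assms(1) AE_rep_mulop[OF assms(2), of F]]
    AE_rep_mulop[OF bounded_borel_comp[OF assms(2) scaling_measurable[OF assms(1)]], of "subst_op r A F"]
  by (intro l2_eqI) auto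

lemma scaling_translation: "scaling 1 (\<lambda>a. a - w)"
proof -
  have "(\<lambda>a. a - w) = (+) (- w)" by auto
  then show ?thesis
    by (auto simp: scaling_def lborel_distr_plus density_1 simp flip: one_ennreal_def
        intro!: borel_measurable_continuous_onI continuous_intros)
qed

section \<open>A unitary that diagonalizes translations\<close>

definition translate :: "real ^ 'n \<Rightarrow> ('n::finite) l2 \<Rightarrow> 'n l2" where
  "translate w = subst_op 1 (\<lambda>a. a - w)"

lemma unitary_translate: "unitary (translate w)"
  unfolding translate_def
  using scaling_translation[of w] scaling_translation[of "- w"]
  by (intro unitary_subst_op[where B = "\<lambda>a. a - (- w)"]) auto

lemma translate_gauss:
  "translate w (abs_l2 (gauss b)) = cscale (\<Prod>i\<in>UNIV. exp (- b i * of_real (w $ i) - of_real ((w $ i)\<^sup>2) / 2))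
     (abs_l2 (gauss (\<lambda>i. b i + of_real (w $ i))))"
proof -
  have "gauss b (a - w) = (\<Prod>i\<in>UNIV. exp (- b i * of_real (w $ i) - of_real ((w $ i)\<^sup>2) / 2))
     * gauss (\<lambda>i. b i + of_real (w $ i)) a" for a
    unfolding gauss_def prod.distrib[symmetric] exp_add[symmetric]
    by (intro prod.cong refl arg_cong[of _ _ exp]) (simp add: power2_eq_square field_simps)
  then show ?thesis
    unfolding translate_def
    by (simp add: subst_op_abs_l2 scaling_translation square_integrable_gauss cscale_abs_l2)
qed

lemma prod_exp_axis:
  "(\<Prod>i\<in>UNIV. exp (- \<i> * of_real (axis k r $ i * a $ i))) = exp (- \<i> * of_real (r * a $ k))"
  for a :: "real ^ 'n::finite"
proof -
  have "(\<Prod>i\<in>UNIV. exp (- \<i> * of_real (axis k r $ i * a $ i)))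
      = (\<Prod>i\<in>UNIV. if i = k then exp (- \<i> * of_real (r * a $ k)) else 1)"
    by (intro prod.cong) (auto simp: axis_def)
  then show ?thesis by simp
qed

text \<open>
  The map \<open>gauss b \<mapsto> (\<Prod>i. exp (b\<^sub>i\<^sup>2 / 2)) gauss (-\<i> b)\<close> is the unitary Fourier transform on
  Gaussians. It preserves the Gram matrix of the family, and its fourth power is the
  identity, which makes it onto. All that is needed of it is that it turns translations into
  multiplications.
\<close>

theorem fourier_unitary_exists:
  "\<exists>U :: ('n::finite) l2 \<Rightarrow> 'n l2. unitary U \<and>
     (\<forall>k r F. U (translate (axis k r) F) = mulop (\<lambda>a. exp (- \<i> * of_real (r * a $ k))) (U F))"
proof -
  define u where "u b = abs_l2 (gauss b :: real ^ 'n \<Rightarrow> complex)" for b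
  define v where "v b = cscale (\<Prod>i\<in>UNIV. exp ((b i)\<^sup>2 / 2)) (u (\<lambda>i. - \<i> * b i))" for b :: "'n \<Rightarrow> complex"
  have total: "F = 0" if "\<And>b. cinner (u b) F = 0" for F
    using that unfolding u_def by (rule eq_0_if_orthogonal_gauss)
  have gram: "cinner (u b) (u c) = cinner (v b) (v c)" for b c
  proof -
    have "cinner (v b) (v c) = (\<Prod>i\<in>UNIV. cnj (exp ((b i)\<^sup>2 / 2)) * (exp ((c i)\<^sup>2 / 2) *
        (of_real (sqrt pi) * exp ((cnj (- \<i> * b i) + - \<i> * c i)\<^sup>2 / 4))))"
      unfolding v_def cinner_cscale_left cinner_cscale_right u_def cinner_gauss cnj_prod prod.distrib
      by (simp only: mult_ac)
    also have "\<dots> = (\<Prod>i\<in>UNIV. of_real (sqrt pi) * exp ((cnj (b i) + c i)\<^sup>2 / 4))"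
    proof (intro prod.cong refl)
      fix i
      have "exp ((cnj (b i) + c i)\<^sup>2 / 4) = exp ((cnj (b i))\<^sup>2 / 2) * (exp ((c i)\<^sup>2 / 2) * exp ((cnj (- \<i> * b i) + - \<i> * c i)\<^sup>2 / 4))"
        unfolding exp_add[symmetric] by (rule arg_cong[of _ _ exp]) (simp add: power2_eq_square field_simps)
      then show "cnj (exp ((b i)\<^sup>2 / 2)) * (exp ((c i)\<^sup>2 / 2) *
        (of_real (sqrt pi) * exp ((cnj (- \<i> * b i) + - \<i> * c i)\<^sup>2 / 4))) = of_real (sqrt pi) * exp ((cnj (b i) + c i)\<^sup>2 / 4)"
        by (simp add: exp_cnj)
    qed
    also have "\<dots> = cinner (u b) (u c)" by (simp add: u_def cinner_gauss)
    finally show ?thesis ..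
  qed
  obtain U where U: "clinear U" "\<And>F. norm (U F) = norm F" and Uu: "\<And>b. U (u b) = v b"
    using isometry_from_gram[of u v, OF gram total] by blast
  have bU: "bounded_linear U"
    using U by (intro bounded_linear_intro[where K = 1]) (auto simp: clinear_def cscale_scaleR)
  \<comment> \<open>The square of the Fourier transform is the reflection \<open>a \<mapsto> -a\<close>.\<close>
  have UU: "U (U (u b)) = u (\<lambda>i. - b i)" for b
  proof -
    have "(\<Prod>i\<in>UNIV. exp ((b i)\<^sup>2 / 2)) * (\<Prod>i\<in>UNIV. exp ((- \<i> * b i)\<^sup>2 / 2)) = 1"
      unfolding prod.distrib[symmetric] exp_add[symmetric] by (simp add: power_mult_distrib)
    then show ?thesis by (simp add: Uu v_def clinear_cscale[OF U(1)])
  qed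
  have "(U \<circ> (U \<circ> (U \<circ> U))) = id"
  proof (rule clinear_eq_on_total[of u, OF total])
    show "bounded_linear (U \<circ> (U \<circ> (U \<circ> U)))"
      using bounded_linear_compose[OF bU bounded_linear_compose[OF bU bounded_linear_compose[OF bU bU]]]
      by (simp add: comp_def)
    show "bounded_linear (id :: 'n l2 \<Rightarrow> 'n l2)" by (simp add: id_def bounded_linear_ident)
    show "clinear (U \<circ> (U \<circ> (U \<circ> U)))" by (intro clinear_comp U)
    show "clinear (id :: 'n l2 \<Rightarrow> 'n l2)" by (simp add: clinear_def)
    show "(U \<circ> (U \<circ> (U \<circ> U))) (u b) = id (u b)" for b by (simp add: UU)
  qed
  then have inv: "U (U (U (U F))) = F" for F by (metis comp_apply id_apply)
  have unU: "unitary U" using U inv by (intro unitary_I_inverse[where S = "U \<circ> U \<circ> U"]) auto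
  have "U (translate (axis k r) F) = mulop (\<lambda>a. exp (- \<i> * of_real (r * a $ k))) (U F)" for k r F
  proof -
    let ?e = "\<lambda>a :: real ^ 'n. exp (- \<i> * of_real (r * a $ k))"
    have be: "bounded_borel ?e" by (rule bounded_borel_unimodular) auto
    have "U \<circ> translate (axis k r) = mulop ?e \<circ> U"
    proof (rule clinear_eq_on_total[of u, OF total])
      show "bounded_linear (U \<circ> translate (axis k r))" unfolding comp_def
        by (intro bounded_linear_compose[OF bU] unitary_bounded_linear unitary_translate)
      show "clinear (U \<circ> translate (axis k r))"
        by (intro clinear_comp U unitary_clinear unitary_translate)
      show "bounded_linear (mulop ?e \<circ> U)" unfolding comp_def
        by (intro bounded_linear_compose[OF bounded_linear_mulop] bU be)
      show "clinear (mulop ?e \<circ> U)" by (intro clinear_comp U clinear_mulop be)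
      fix b :: "'n \<Rightarrow> complex"
      define w :: "real ^ 'n" where "w = axis k r"
      define b' where "b' i = b i + of_real (w $ i)" for i
      have "U (translate w (u b)) = cscale ((\<Prod>i\<in>UNIV. exp (- b i * of_real (w $ i) - of_real ((w $ i)\<^sup>2) / 2))
          * (\<Prod>i\<in>UNIV. exp ((b' i)\<^sup>2 / 2))) (u (\<lambda>i. - \<i> * b' i))"
        using translate_gauss[of w b] Uu[of b'] by (simp add: u_def[symmetric] clinear_cscale[OF U(1)] v_def b'_def[symmetric])
      also have "\<dots> = abs_l2 (\<lambda>a. ((\<Prod>i\<in>UNIV. exp (- b i * of_real (w $ i) - of_real ((w $ i)\<^sup>2) / 2))
          * (\<Prod>i\<in>UNIV. exp ((b' i)\<^sup>2 / 2))) * gauss (\<lambda>i. - \<i> * b' i) a)"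
        unfolding u_def by (rule cscale_abs_l2[OF square_integrable_gauss])
      also have "\<dots> = abs_l2 (\<lambda>a. (\<Prod>i\<in>UNIV. exp (- \<i> * of_real (w $ i * a $ i))) *
          ((\<Prod>i\<in>UNIV. exp ((b i)\<^sup>2 / 2)) * gauss (\<lambda>i. - \<i> * b i) a))"
        unfolding gauss_def prod.distrib[symmetric] exp_add[symmetric] b'_def
        by (intro arg_cong[of _ _ abs_l2] ext prod.cong refl arg_cong[of _ _ exp]) (simp add: power2_eq_square field_simps)
      also have "\<dots> = mulop ?e (U (u b))"
      proof -
        have Ub: "U (u b) = abs_l2 (\<lambda>a. (\<Prod>i\<in>UNIV. exp ((b i)\<^sup>2 / 2)) * gauss (\<lambda>i. - \<i> * b i) a)"
          by (simp only: Uu v_def) (simp only: u_def cscale_abs_l2[OF square_integrable_gauss])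
        show ?thesis unfolding w_def prod_exp_axis Ub
          by (rule mulop_abs_l2[symmetric, OF be square_integrable_cmult[OF square_integrable_gauss]])
      qed
      finally show "(U \<circ> translate (axis k r)) (u b) = (mulop ?e \<circ> U) (u b)" by (simp add: w_def)
    qed
    then show ?thesis by (metis comp_apply)
  qed
  then show ?thesis using unU by blast
qed

section \<open>Functions of a one-parameter group\<close>

text \<open>
  The distribution of the generator of \<open>V\<close> in the state \<open>F\<close>, characterized without reference
  to the generator by its characteristic function.
\<close>

definition law :: "(real \<Rightarrow> ('n::finite) l2 \<Rightarrow> 'n l2) \<Rightarrow> 'n l2 \<Rightarrow> real measure \<Rightarrow> bool" where
  "law V F \<mu> \<longleftrightarrow> finite_measure \<mu> \<and> sets \<mu> = sets borel \<and>
     (\<forall>s. cinner F (V s F) = (LINT t|\<mu>. exp (\<i> * of_real (s * t))))"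

text \<open>
  \<open>T\<close> is \<open>\<phi>\<close> of the generator of \<open>V\<close>. Since \<open>law\<close> depends on \<open>V\<close> alone, \<open>T\<close> is determined by
  \<open>V\<close> and \<open>\<phi>\<close>, and covariance of \<open>V\<close> under a unitary passes to \<open>T\<close> with no further mention
  of spectral measures.
\<close>

definition group_function ::
    "(real \<Rightarrow> ('n::finite) l2 \<Rightarrow> 'n l2) \<Rightarrow> (real \<Rightarrow> complex) \<Rightarrow> ('n l2 \<Rightarrow> 'n l2) \<Rightarrow> bool" where
  "group_function V \<phi> T \<longleftrightarrow> clinear T \<and> (\<forall>F. \<exists>\<mu>. law V F \<mu> \<and> cinner F (T F) = (LINT t|\<mu>. \<phi> t))"

lemma law_unique: "law V F \<mu> \<Longrightarrow> law V F \<nu> \<Longrightarrow> \<mu> = \<nu>"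
  unfolding law_def by (intro finite_measure_eqI_char) auto

lemma group_function_law:
  "group_function V \<phi> T \<Longrightarrow> law V F \<mu> \<Longrightarrow> cinner F (T F) = (LINT t|\<mu>. \<phi> t)"
  unfolding group_function_def by (metis law_unique)

lemma group_function_unique:
  assumes "group_function V \<phi> T" "group_function V \<phi> T'"
  shows "T = T'"
proof (rule clinear_eqI_quadratic_form)
  show "cinner F (T F) = cinner F (T' F)" for F
    using assms unfolding group_function_def by (metis law_unique)
qed (use assms in \<open>auto simp: group_function_def\<close>)

text \<open>
  Transporting \<open>T'\<close> back along \<open>W\<close> gives an operator with the defining property of \<open>T\<close>.
\<close>

lemma group_function_conjugate:
  assumes W: "unitary W" and V: "\<And>s F. V' s (W F) = W (V s F)"
    and T: "group_function V \<phi> T" and T': "group_function V' \<phi> T'"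
  shows "T' (W F) = W (T F)"
proof -
  have "group_function V \<phi> (inv W \<circ> T' \<circ> W)"
    unfolding group_function_def
  proof (intro conjI allI)
    show "clinear (inv W \<circ> T' \<circ> W)"
      using clinear_comp[OF clinear_comp[OF unitary_clinear[OF unitary_inv[OF W]]] unitary_clinear[OF W], of T'] T'
      by (simp add: group_function_def)
    fix F
    obtain \<mu> where \<mu>: "law V' (W F) \<mu>" "cinner (W F) (T' (W F)) = (LINT t|\<mu>. \<phi> t)"
      using T' by (auto simp: group_function_def)
    have "law V F \<mu>" using \<mu>(1) W by (simp add: law_def V unitary_cinner)
    then show "\<exists>\<mu>. law V F \<mu> \<and> cinner F ((inv W \<circ> T' \<circ> W) F) = (LINT t|\<mu>. \<phi> t)"
      using \<mu>(2) W by (auto simp: cinner_inv_right)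
  qed
  then have "inv W \<circ> T' \<circ> W = T" using T by (rule group_function_unique)
  then show ?thesis using W by (metis comp_apply unitary_inv_f)
qed

text \<open>
  The group on the left is generated by \<open>c x + v\<close> if \<open>V\<close> is generated by \<open>x\<close>.
\<close>

lemma group_function_affine:
  fixes \<phi> :: "real \<Rightarrow> complex"
  assumes T: "group_function V (\<lambda>t. \<phi> (c * t + v)) T" and [measurable]: "\<phi> \<in> borel_measurable borel"
  shows "group_function (\<lambda>s F. cscale (exp (\<i> * of_real (s * v))) (V (c * s) F)) \<phi> T"
  unfolding group_function_def
proof (intro conjI allI)
  fix F
  obtain \<mu> where \<mu>: "law V F \<mu>" "cinner F (T F) = (LINT t|\<mu>. \<phi> (c * t + v))"
    using T by (auto simp: group_function_def)
  then have sets[measurable_cong]: "sets \<mu> = sets borel" by (simp add: law_def)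
  interpret finite_measure \<mu> using \<mu>(1) by (simp add: law_def)
  define \<nu> where "\<nu> = distr \<mu> borel (\<lambda>t. c * t + v)"
  have "finite_measure \<nu>" unfolding \<nu>_def by (rule finite_measure_distr) measurable
  moreover have "cinner F (cscale (exp (\<i> * of_real (s * v))) (V (c * s) F)) = (LINT t|\<nu>. exp (\<i> * of_real (s * t)))" for s
  proof -
    have "(LINT t|\<nu>. exp (\<i> * of_real (s * t))) = (LINT t|\<mu>. exp (\<i> * of_real (s * v)) * exp (\<i> * of_real (c * s * t)))"
      unfolding \<nu>_def exp_add[symmetric] by (subst integral_distr) (auto simp: algebra_simps)
    also have "\<dots> = exp (\<i> * of_real (s * v)) * (LINT t|\<mu>. exp (\<i> * of_real (c * s * t)))" by simp
    also have "(LINT t|\<mu>. exp (\<i> * of_real (c * s * t))) = cinner F (V (c * s) F)"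
      using \<mu>(1) unfolding law_def by metis
    finally show ?thesis by (simp add: cinner_cscale_right)
  qed
  ultimately have "law (\<lambda>s F. cscale (exp (\<i> * of_real (s * v))) (V (c * s) F)) F \<nu>"
    by (simp add: law_def \<nu>_def)
  moreover have "cinner F (T F) = (LINT t|\<nu>. \<phi> t)"
    unfolding \<mu>(2) \<nu>_def by (subst integral_distr) auto
  ultimately show "\<exists>\<nu>. law (\<lambda>s F. cscale (exp (\<i> * of_real (s * v))) (V (c * s) F)) F \<nu> \<and> cinner F (T F) = (LINT t|\<nu>. \<phi> t)"
    by blast
qed (use T in \<open>simp add: group_function_def\<close>)

text \<open>
  Dominated convergence gives \<open>\<langle>F, T\<^sub>n F\<rangle> \<rightarrow> \<parallel>F\<parallel>\<^sup>2\<close>; as the \<open>T\<^sub>n\<close> are unitary, this weak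
  statement already implies convergence in norm.
\<close>

lemma group_function_tendsto_id:
  fixes \<phi> :: "nat \<Rightarrow> real \<Rightarrow> complex"
  assumes T: "\<And>n. group_function V (\<phi> n) (T n)" and u: "\<And>n. unitary (T n)"
    and V0: "\<And>F. V 0 F = F"
    and [measurable]: "\<And>n. \<phi> n \<in> borel_measurable borel"
    and b: "\<And>n t. cmod (\<phi> n t) = 1" and lim: "\<And>t. (\<lambda>n. \<phi> n t) \<longlonglongrightarrow> 1"
  shows "(\<lambda>n. T n F) \<longlonglongrightarrow> F"
proof -
  obtain \<mu> where \<mu>: "law V F \<mu>" using T[of 0] by (auto simp: group_function_def)
  then have sets[measurable_cong]: "sets \<mu> = sets borel" by (simp add: law_def)
  interpret finite_measure \<mu> using \<mu>(1) by (simp add: law_def)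
  have "(\<lambda>n. LINT t|\<mu>. \<phi> n t) \<longlonglongrightarrow> (LINT t|\<mu>. 1)"
    by (rule integral_dominated_convergence[where w = "\<lambda>_. 1"]) (auto simp: b lim)
  moreover have "(LINT t|\<mu>. 1) = complex_of_real ((norm F)\<^sup>2)"
  proof -
    have "cinner F (V 0 F) = (LINT t|\<mu>. exp (\<i> * of_real (0 * t)))" using \<mu> unfolding law_def by metis
    then show ?thesis by (simp add: V0 cinner_self)
  qed
  ultimately have "(\<lambda>n. cinner F (T n F)) \<longlonglongrightarrow> complex_of_real ((norm F)\<^sup>2)"
    using group_function_law[OF T \<mu>] by simp
  then have "(\<lambda>n. Re (cinner F (T n F))) \<longlonglongrightarrow> (norm F)\<^sup>2" using tendsto_Re by fastforce
  then have "(\<lambda>n. 2 * (norm F)\<^sup>2 - 2 * Re (cinner F (T n F))) \<longlonglongrightarrow> 2 * (norm F)\<^sup>2 - 2 * (norm F)\<^sup>2"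
    by (intro tendsto_intros)
  moreover have "2 * (norm F)\<^sup>2 - 2 * Re (cinner F (T n F)) = (norm (T n F - F))\<^sup>2" for n
  proof -
    have "inner (T n F) (T n F) = inner F F" using unitary_norm[OF u, of n F] by (metis power2_norm_eq_inner)
    then show ?thesis
      unfolding Re_cinner power2_norm_eq_inner by (simp add: inner_diff_left inner_diff_right inner_commute)
  qed
  ultimately have "(\<lambda>n. (norm (T n F - F))\<^sup>2) \<longlonglongrightarrow> 0" by simp
  then have "(\<lambda>n. sqrt ((norm (T n F - F))\<^sup>2)) \<longlonglongrightarrow> sqrt 0" by (rule tendsto_real_sqrt)
  then show ?thesis by (simp add: tendsto_norm_zero_iff LIM_zero_iff)
qed

section \<open>Multiplication operators as self-adjoint operators\<close>

text \<open>
  The distribution in the state \<open>F\<close> of the operator that \<open>U\<close> turns into multiplication by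
  \<open>m\<close>.
\<close>

definition density_law :: "(('n::finite) l2 \<Rightarrow> 'n l2) \<Rightarrow> (real ^ 'n \<Rightarrow> real) \<Rightarrow> 'n l2 \<Rightarrow> real measure" where
  "density_law U m F = distr (density lborel (\<lambda>a. ennreal ((cmod (rep_l2 (U F) a))\<^sup>2))) borel m"

text \<open>
  The operator \<open>\<phi>(U\<^sup>-\<^sup>1 m U)\<close>, in the picture in which it is a multiplication.
\<close>

definition mult_calculus ::
    "(('n::finite) l2 \<Rightarrow> 'n l2) \<Rightarrow> (real ^ 'n \<Rightarrow> real) \<Rightarrow> (real \<Rightarrow> complex) \<Rightarrow> 'n l2 \<Rightarrow> 'n l2" where
  "mult_calculus U m \<phi> F = inv U (mulop (\<lambda>a. \<phi> (m a)) (U F))"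

text \<open>
  The graph of \<open>U\<^sup>-\<^sup>1 m U\<close> on its maximal domain.
\<close>

definition mult_graph ::
    "(('n::finite) l2 \<Rightarrow> 'n l2) \<Rightarrow> (real ^ 'n \<Rightarrow> real) \<Rightarrow> ('n l2 \<times> 'n l2) set" where
  "mult_graph U m = {(F, G). AE a in lborel. rep_l2 (U G) a = of_real (m a) * rep_l2 (U F) a}"

lemma sets_density_law [simp]: "sets (density_law U m F) = sets borel"
  by (simp add: density_law_def)

lemma space_density_law [simp]: "space (density_law U m F) = UNIV"
  by (simp add: density_law_def)

lemma bounded_borel_m:
  fixes m :: "real ^ 'n::finite \<Rightarrow> real"
  shows "m \<in> borel_measurable borel \<Longrightarrow> bounded_borel \<phi> \<Longrightarrow> bounded_borel (\<lambda>a. \<phi> (m a))"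
  by (rule bounded_borel_comp) auto

lemma bounded_borel_exp: "bounded_borel (\<lambda>t :: real. exp (\<i> * of_real (s * t)))"
  by (rule bounded_borel_unimodular) auto

lemma indicator_bounded_borel:
  "S \<in> sets borel \<Longrightarrow> bounded_borel (indicator S :: real \<Rightarrow> complex)"
  by (rule bounded_borelI[of _ 1]) (auto simp: indicator_def)

context
  fixes U :: "('n::finite) l2 \<Rightarrow> 'n l2" and m :: "real ^ 'n \<Rightarrow> real"
  assumes U: "unitary U" and m [measurable]: "m \<in> borel_measurable borel"
begin

lemma integral_density_law:
  fixes \<phi> :: "real \<Rightarrow> 'b :: {banach, second_countable_topology}"
  assumes [measurable]: "\<phi> \<in> borel_measurable borel"
  shows "(LINT t|density_law U m F. \<phi> t) = (LINT a|lborel. (cmod (rep_l2 (U F) a))\<^sup>2 *\<^sub>R \<phi> (m a))"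
  unfolding density_law_def by (subst integral_distr, simp, simp, subst integral_density) auto

lemma integrable_density_law:
  fixes \<phi> :: "real \<Rightarrow> 'b :: {banach, second_countable_topology}"
  assumes [measurable]: "\<phi> \<in> borel_measurable borel"
  shows "integrable (density_law U m F) \<phi> \<longleftrightarrow>
    integrable lborel (\<lambda>a. (cmod (rep_l2 (U F) a))\<^sup>2 *\<^sub>R \<phi> (m a))"
  unfolding density_law_def by (subst integrable_distr_eq, simp, simp, subst integrable_density) auto

lemma finite_measure_density_law: "finite_measure (density_law U m F)"
proof
  have "emeasure (density_law U m F) (space (density_law U m F)) = (\<integral>\<^sup>+a. ennreal ((cmod (rep_l2 (U F) a))\<^sup>2) \<partial>lborel)"
    by (simp add: density_law_def emeasure_distr emeasure_density)
  also have "\<dots> = ennreal ((norm (U F))\<^sup>2)" by (rule nn_norm_l2[symmetric])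
  finally show "emeasure (density_law U m F) (space (density_law U m F)) \<noteq> \<infinity>" by simp
qed

lemma clinear_mult_calculus: "bounded_borel \<phi> \<Longrightarrow> clinear (mult_calculus U m \<phi>)"
  using clinear_comp[OF unitary_clinear[OF unitary_inv[OF U]] clinear_comp[OF clinear_mulop unitary_clinear[OF U]]]
    bounded_borel_m[OF m] by (simp add: comp_def mult_calculus_def[abs_def])

lemma bounded_linear_mult_calculus: "bounded_borel \<phi> \<Longrightarrow> bounded_linear (mult_calculus U m \<phi>)"
  using bounded_linear_compose[OF unitary_bounded_linear[OF unitary_inv[OF U]]
      bounded_linear_compose[OF bounded_linear_mulop unitary_bounded_linear[OF U]]] bounded_borel_m[OF m]
  by (simp add: mult_calculus_def[abs_def])

lemma cinner_mult_calculus: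
  assumes "bounded_borel \<phi>"
  shows "cinner F (mult_calculus U m \<phi> F) = (LINT t|density_law U m F. \<phi> t)"
proof -
  have [measurable]: "\<phi> \<in> borel_measurable borel" using assms by (simp add: bounded_borel_def)
  have "cinner F (mult_calculus U m \<phi> F) = (LINT a|lborel. cnj (rep_l2 (U F) a) * (\<phi> (m a) * rep_l2 (U F) a))"
    unfolding mult_calculus_def cinner_inv_right[OF U] by (rule cinner_mulop[OF bounded_borel_m[OF m assms]])
  also have "\<dots> = (LINT a|lborel. (cmod (rep_l2 (U F) a))\<^sup>2 *\<^sub>R \<phi> (m a))"
  proof (rule Bochner_Integration.integral_cong[OF refl])
    fix a
    have "complex_of_real ((cmod (rep_l2 (U F) a))\<^sup>2) = rep_l2 (U F) a * cnj (rep_l2 (U F) a)"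
      by (rule complex_norm_square)
    then show "cnj (rep_l2 (U F) a) * (\<phi> (m a) * rep_l2 (U F) a) = (cmod (rep_l2 (U F) a))\<^sup>2 *\<^sub>R \<phi> (m a)"
      by (simp only: scaleR_conv_of_real mult_ac)
  qed
  finally show ?thesis by (simp add: integral_density_law)
qed

lemma group_function_mult_calculus:
  assumes "bounded_borel \<phi>" "\<And>s. V s = mult_calculus U m (\<lambda>t. exp (\<i> * of_real (s * t)))"
  shows "group_function V \<phi> (mult_calculus U m \<phi>)"
  unfolding group_function_def law_def assms(2)
  using clinear_mult_calculus[OF assms(1)] cinner_mult_calculus[OF assms(1)]
    cinner_mult_calculus[OF bounded_borel_exp] finite_measure_density_law sets_density_law
  by blast

lemma unitary_mult_calculus:
  assumes "\<phi> \<in> borel_measurable borel" "\<And>t. cmod (\<phi> t) = 1"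
  shows "unitary (mult_calculus U m \<phi>)"
proof -
  have [measurable]: "\<phi> \<in> borel_measurable borel" by fact
  have "unitary (inv U \<circ> (mulop (\<lambda>a. \<phi> (m a)) \<circ> U))"
    by (intro unitary_comp unitary_inv U unitary_mulop) (auto simp: assms)
  then show ?thesis by (simp add: comp_def mult_calculus_def[abs_def])
qed

text \<open>
  For the nontrivial inclusion the multiplication is truncated to the set where \<open>\<bar>m\<bar> \<le> N\<close>.
  The discrepancy \<open>D\<close> between the two sides of the desired equation on this set lies in the
  domain of the operator, and testing the adjoint relation against \<open>D\<close> itself shows that \<open>D\<close>
  is zero.
\<close>

lemma self_adjoint_mult_graph: "self_adjoint (mult_graph U m)"
  unfolding self_adjoint_def
proof (intro set_eqI iffI)
  fix p assume "p \<in> mult_graph U m"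
  then obtain F G where p: "p = (F, G)" and FG: "AE a in lborel. rep_l2 (U G) a = of_real (m a) * rep_l2 (U F) a"
    by (auto simp: mult_graph_def)
  have "cinner v F = cinner u G" if "(u, v) \<in> mult_graph U m" for u v
  proof -
    have uv: "AE a in lborel. rep_l2 (U v) a = of_real (m a) * rep_l2 (U u) a"
      using that by (simp add: mult_graph_def)
    have "cinner (U v) (U F) = cinner (U u) (U G)"
      unfolding cinner_rep using FG uv by (intro integral_cong_AE) auto
    then show ?thesis by (simp add: unitary_cinner[OF U])
  qed
  then show "p \<in> adjoint_graph (mult_graph U m)" by (auto simp: p adjoint_graph_def)
next
  fix p assume "p \<in> adjoint_graph (mult_graph U m)"
  moreover obtain F G where p: "p = (F, G)" by (cases p)
  ultimately have adj: "cinner v F = cinner u G" if "(u, v) \<in> mult_graph U m" for u v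
    using that by (auto simp: adjoint_graph_def)
  have "AE a in lborel. \<bar>m a\<bar> \<le> real N \<longrightarrow> rep_l2 (U G) a = of_real (m a) * rep_l2 (U F) a" for N :: nat
  proof -
    define \<chi>' where "\<chi>' = (\<lambda>t :: real. indicator {- real N..real N} t :: complex)"
    define \<eta> where "\<eta> = (\<lambda>t :: real. of_real t * \<chi>' t :: complex)"
    have b\<chi>: "bounded_borel \<chi>'" unfolding \<chi>'_def by (rule indicator_bounded_borel) simp
    have b\<eta>: "bounded_borel \<eta>" unfolding \<eta>_def \<chi>'_def
      by (rule bounded_borelI[of _ "real N"]) (auto simp: indicator_def)
    define D where "D = mulop (\<lambda>a. \<eta> (m a)) (U F) - mulop (\<lambda>a. \<chi>' (m a)) (U G)"
    define u where "u = inv U D"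
    define v where "v = inv U (mulop (\<lambda>a. \<eta> (m a)) D)"
    note bm = bounded_borel_m[OF m b\<chi>] bounded_borel_m[OF m b\<eta>]
    have AED: "AE a in lborel. rep_l2 D a = \<eta> (m a) * rep_l2 (U F) a - \<chi>' (m a) * rep_l2 (U G) a"
      unfolding D_def
      using AE_rep_minus[of "mulop (\<lambda>a. \<eta> (m a)) (U F)" "mulop (\<lambda>a. \<chi>' (m a)) (U G)"]
        AE_rep_mulop[OF bm(1), of "U G"] AE_rep_mulop[OF bm(2), of "U F"] by auto
    have \<eta>\<chi>: "of_real t * \<chi>' t = \<eta> t" "\<chi>' t * \<chi>' t = \<chi>' t" "\<eta> t * \<chi>' t = \<eta> t" for t
      by (auto simp: \<eta>_def \<chi>'_def indicator_def)
    have "(u, v) \<in> mult_graph U m"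
    proof -
      have "AE a in lborel. rep_l2 (mulop (\<lambda>a. \<eta> (m a)) D) a = of_real (m a) * rep_l2 D a"
        using AE_rep_mulop[OF bm(2), of D] AED
      proof eventually_elim
        case (elim a)
        show ?case unfolding elim by (auto simp: \<eta>_def \<chi>'_def indicator_def)
      qed
      then show ?thesis by (simp add: mult_graph_def u_def v_def U)
    qed
    from adj[OF this] have "cinner (mulop (\<lambda>a. \<eta> (m a)) D) (U F) = cinner D (U G)"
      by (simp add: u_def v_def cinner_inv_left[OF U])
    moreover have "cinner (mulop (\<lambda>a. \<eta> (m a)) D) (U F) = cinner D (mulop (\<lambda>a. \<eta> (m a)) (U F))"
      unfolding cinner_rep
      using AE_rep_mulop[OF bm(2), of D] AE_rep_mulop[OF bm(2), of "U F"]
      by (intro integral_cong_AE) (auto simp: \<eta>_def \<chi>'_def indicator_def)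
    moreover have "cinner D (U G) = cinner D (mulop (\<lambda>a. \<chi>' (m a)) (U G))"
      unfolding cinner_rep
      using AE_rep_mulop[OF bm(1), of "U G"] AED
      by (intro integral_cong_AE) (auto simp: \<eta>_def \<chi>'_def indicator_def)
    ultimately have "cinner D D = 0" by (simp add: D_def cinner.diff_right)
    then have "D = 0" by (simp add: cinner_self)
    then have "AE a in lborel. rep_l2 D a = 0" using AE_rep_zero by simp
    with AED show ?thesis by eventually_elim (auto simp: \<eta>_def \<chi>'_def indicator_def)
  qed
  then have "AE a in lborel. \<forall>N::nat. \<bar>m a\<bar> \<le> real N \<longrightarrow> rep_l2 (U G) a = of_real (m a) * rep_l2 (U F) a"
    unfolding AE_all_countable by blast
  then have "AE a in lborel. rep_l2 (U G) a = of_real (m a) * rep_l2 (U F) a"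
    by eventually_elim (use real_arch_simple in blast)
  then show "p \<in> mult_graph U m" by (simp add: p mult_graph_def)
qed

lemma mult_graph_symmetric:
  assumes "(F, G) \<in> mult_graph U m" "(F', G') \<in> mult_graph U m"
  shows "cinner G F' = cinner F G'"
  using self_adjoint_mult_graph assms unfolding self_adjoint_def adjoint_graph_def by blast

lemma mult_graph_unique:
  assumes "(F, G) \<in> mult_graph U m" "(F, G') \<in> mult_graph U m"
  shows "G = G'"
proof -
  have "AE a in lborel. rep_l2 (U G) a = rep_l2 (U G') a"
    using assms by (auto simp: mult_graph_def)
  then have "U G = U G'" by (rule l2_eqI)
  then show ?thesis using U by (metis unitary_f_inv)
qed

lemma mult_graph_add:
  assumes "(F, G) \<in> mult_graph U m" "(F', G') \<in> mult_graph U m"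
  shows "(F + cscale c F', G + cscale c G') \<in> mult_graph U m"
  using assms AE_rep_plus[of "U F" "cscale c (U F')"] AE_rep_plus[of "U G" "cscale c (U G')"]
    AE_rep_cscale[of c "U F'"] AE_rep_cscale[of c "U G'"]
  unfolding mult_graph_def clinear_add[OF unitary_clinear[OF U]] mem_Collect_eq prod.case
    clinear_cscale[OF unitary_clinear[OF U]]
  by eventually_elim (auto simp: algebra_simps)

lemma Domain_mult_graph: "Domain (mult_graph U m) = {F. integrable (density_law U m F) (\<lambda>t. t\<^sup>2)}"
proof -
  have "F \<in> Domain (mult_graph U m) \<longleftrightarrow> square_integrable (\<lambda>a. of_real (m a) * rep_l2 (U F) a)" for F
  proof
    assume "F \<in> Domain (mult_graph U m)"
    then obtain G where G: "AE a in lborel. rep_l2 (U G) a = of_real (m a) * rep_l2 (U F) a"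
      by (auto simp: mult_graph_def)
    have "integrable lborel (\<lambda>a. (cmod (of_real (m a) * rep_l2 (U F) a))\<^sup>2)"
      using G by (intro integrable_cong_AE_imp[OF integrable_cmod_rep[of "U G"]]) auto
    then show "square_integrable (\<lambda>a. of_real (m a) * rep_l2 (U F) a)" by (simp add: square_integrable_def)
  next
    assume sq: "square_integrable (\<lambda>a. of_real (m a) * rep_l2 (U F) a)"
    then have "(F, inv U (abs_l2 (\<lambda>a. of_real (m a) * rep_l2 (U F) a))) \<in> mult_graph U m"
      using AE_rep_abs_l2[OF sq] by (simp add: mult_graph_def U)
    then show "F \<in> Domain (mult_graph U m)" by blast
  qed
  moreover have "square_integrable (\<lambda>a. of_real (m a) * rep_l2 (U F) a) \<longleftrightarrow> integrable (density_law U m F) (\<lambda>t. t\<^sup>2)" for F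
    by (subst integrable_density_law) (simp_all add: square_integrable_def norm_mult power_mult_distrib mult.commute)
  ultimately show ?thesis by auto
qed

lemma quadratic_form_mult_graph:
  assumes "(F, G) \<in> mult_graph U m"
  shows "cinner F G = of_real (LINT t|density_law U m F. t)"
proof -
  have "cinner F G = cinner (U F) (U G)" by (simp add: unitary_cinner[OF U])
  also have "\<dots> = (LINT a|lborel. complex_of_real ((cmod (rep_l2 (U F) a))\<^sup>2 *\<^sub>R m a))"
    unfolding cinner_rep
  proof (rule integral_cong_AE)
    show "AE a in lborel. cnj (rep_l2 (U F) a) * rep_l2 (U G) a = complex_of_real ((cmod (rep_l2 (U F) a))\<^sup>2 *\<^sub>R m a)"
      using assms unfolding mult_graph_def mem_Collect_eq prod.case
    proof eventually_elim
      case (elim a)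
      then show ?case
        by (simp only: real_scaleR_def of_real_mult complex_norm_square) (simp only: mult_ac)
    qed
  qed measurable
  also have "\<dots> = of_real (LINT t|density_law U m F. t)"
    unfolding integral_complex_of_real by (subst integral_density_law) simp_all
  finally show ?thesis .
qed

lemma emeasure_density_law:
  assumes [measurable]: "S \<in> sets borel"
  shows "emeasure (density_law U m F) S = ennreal (Re (cinner F (mult_calculus U m (indicator S) F)))"
proof -
  interpret finite_measure "density_law U m F" by (rule finite_measure_density_law)
  have "cinner F (mult_calculus U m (indicator S) F) = (LINT t|density_law U m F. indicator S t)"
    by (rule cinner_mult_calculus) (rule indicator_bounded_borel, fact)
  also have "\<dots> = of_real (measure (density_law U m F) S)"
  proof -
    have "(LINT t|density_law U m F. indicator S t) = (LINT t|density_law U m F. complex_of_real (indicator S t))"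
      by (intro Bochner_Integration.integral_cong) (auto simp: indicator_def)
    then show ?thesis unfolding integral_complex_of_real by simp
  qed
  finally show ?thesis by (simp add: emeasure_eq_measure)
qed

end

lemma diagonal_measure_eqI:
  fixes M :: "real measure"
  assumes "sets M = sets borel" "\<And>S. S \<in> sets borel \<Longrightarrow> emeasure M S = ennreal (Re (cinner F (E S F)))"
  shows "diagonal_measure E F = M"
proof -
  have "space M = UNIV" using assms(1) by (auto dest: sets_eq_imp_space_eq)
  then have "M = measure_of UNIV (sets borel) (emeasure M)"
    using measure_of_of_measure[of M] assms(1) by simp
  also have "\<dots> = diagonal_measure E F"
    unfolding diagonal_measure_def
    by (rule measure_of_eq) (use assms(2) sets.sigma_sets_eq[of "borel :: real measure"] in auto)
  finally show ?thesis by simp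
qed

section \<open>Projection-valued measures\<close>

context
  fixes E :: "real set \<Rightarrow> ('n::finite) l2 \<Rightarrow> 'n l2"
  assumes E: "projection_valued_measure E"
begin

lemma pvm_sums:
  "range S \<subseteq> sets borel \<Longrightarrow> disjoint_family S \<Longrightarrow> (\<lambda>k. E (S k) F) sums E (\<Union>k. S k) F"
  for S :: "nat \<Rightarrow> real set"
  using E by (simp add: projection_valued_measure_def)

lemma pvm_UNIV: "E UNIV F = F"
  using E by (simp add: projection_valued_measure_def)

lemma pvm_proj: "S \<in> sets borel \<Longrightarrow> orthogonal_projection (E S)"
  using E by (simp add: projection_valued_measure_def)

lemma pvm_clinear: "S \<in> sets borel \<Longrightarrow> clinear (E S)"
  and pvm_idem: "S \<in> sets borel \<Longrightarrow> E S (E S F) = E S F"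
  and pvm_cinner: "S \<in> sets borel \<Longrightarrow> cinner (E S F) G = cinner F (E S G)"
  using pvm_proj by (auto simp: orthogonal_projection_def)

lemma pvm_empty: "E {} F = 0"
proof -
  have "(\<lambda>k::nat. E {} F) sums E (\<Union>k::nat. {}) F"
    by (rule pvm_sums[of "\<lambda>_. {}"]) (auto simp: disjoint_family_on_def)
  then have "(\<lambda>k::nat. E {} F) \<longlonglongrightarrow> 0" by (intro summable_LIMSEQ_zero) (auto simp: sums_iff)
  then show ?thesis by (simp add: LIMSEQ_const_iff)
qed

lemma pvm_Un:
  assumes "A \<in> sets borel" "B \<in> sets borel" "A \<inter> B = {}"
  shows "E (A \<union> B) F = E A F + E B F"
proof -
  have "(\<lambda>k. E (binaryset A B k) F) sums E (\<Union>k. binaryset A B k) F"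
    using assms by (intro pvm_sums) (auto simp: range_binaryset_eq disjoint_family_on_def binaryset_def)
  moreover have "(\<lambda>k. E (binaryset A B k) F) sums (\<Sum>k\<in>{0, 1::nat}. E (binaryset A B k) F)"
    by (rule sums_finite) (auto simp: binaryset_def pvm_empty)
  ultimately show ?thesis
    using sums_unique2 by (fastforce simp: UN_binaryset_eq binaryset_def)
qed

text \<open>
  Additivity of \<open>E\<close> on the disjoint union of \<open>A\<close> and \<open>B\<close> makes the two projections
  anticommute. Multiplying by one of them shows that they also commute.
\<close>

lemma pvm_disjoint:
  assumes "A \<in> sets borel" "B \<in> sets borel" "A \<inter> B = {}"
  shows "E A (E B F) = 0"
proof -
  have AB: "A \<union> B \<in> sets borel" using assms by simp
  have 1: "E A (E B G) + E B (E A G) = 0" for G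
    using pvm_idem[OF AB, of G] assms
    by (simp add: pvm_Un clinear_add[OF pvm_clinear] pvm_idem add.commute)
  have "E A (E B F) + E A (E B (E A F)) = 0"
    using arg_cong[OF 1[of F], of "E A"] assms(1)
    by (simp add: clinear_add[OF pvm_clinear] clinear_zero[OF pvm_clinear] pvm_idem)
  moreover have "E A (E B (E A F)) + E B (E A F) = 0" using 1[of "E A F"] assms(1) by (simp add: pvm_idem)
  ultimately have "E A (E B F) = E B (E A F)" by (metis add_eq_0_iff add.commute)
  then have "2 *\<^sub>R E A (E B F) = 0" using 1[of F] by (simp add: scaleR_2)
  then show ?thesis by simp
qed

lemma pvm_Int:
  assumes A: "A \<in> sets borel" and B: "B \<in> sets borel"
  shows "E A (E B F) = E (A \<inter> B) F"
proof -
  have "E B F = E (A \<inter> B) F + E (B - A) F" for F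
  proof -
    have "(A \<inter> B) \<union> (B - A) = B" "(A \<inter> B) \<inter> (B - A) = {}" by auto
    then show ?thesis using pvm_Un[of "A \<inter> B" "B - A" F] A B by simp
  qed
  moreover have "E A (E (A \<inter> B) F) = E (A \<inter> B) (E (A \<inter> B) F) + E (A - B) (E (A \<inter> B) F)"
  proof -
    have "(A \<inter> B) \<union> (A - B) = A" "(A \<inter> B) \<inter> (A - B) = {}" by auto
    then show ?thesis using pvm_Un[of "A \<inter> B" "A - B" "E (A \<inter> B) F"] A B by simp
  qed
  moreover have "E A (E (B - A) F) = 0" "E (A - B) (E (A \<inter> B) F) = 0"
    using A B by (auto intro!: pvm_disjoint)
  ultimately show ?thesis
    using A B by (simp add: clinear_add[OF pvm_clinear] pvm_idem)
qed

lemma pvm_Compl: "S \<in> sets borel \<Longrightarrow> E S F + E (- S) F = F"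
  using pvm_Un[of S "- S" F] by (simp add: pvm_UNIV Compl_partition)

lemma pvm_norm: "S \<in> sets borel \<Longrightarrow> cinner F (E S F) = of_real ((norm (E S F))\<^sup>2)"
  using pvm_cinner[of S F "E S F"] cinner_self[of "E S F"] by (simp add: pvm_idem)

lemma emeasure_diagonal_measure:
  assumes "S \<in> sets borel"
  shows "emeasure (diagonal_measure E F) S = ennreal (Re (cinner F (E S F)))"
  unfolding diagonal_measure_def
proof (rule emeasure_measure_of_sigma)
  show "sigma_algebra UNIV (sets borel :: real set set)"
    using sets.sigma_algebra_axioms[of "borel :: real measure"] by simp
  show "positive (sets borel) (\<lambda>S. ennreal (Re (cinner F (E S F))))"
    by (simp add: positive_def pvm_empty cinner.zero_right)
  show "countably_additive (sets borel) (\<lambda>S. ennreal (Re (cinner F (E S F))))"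
    unfolding countably_additive_def
  proof (intro allI impI)
    fix S :: "nat \<Rightarrow> real set"
    assume S: "range S \<subseteq> sets borel" "disjoint_family S" "(\<Union>k. S k) \<in> sets borel"
    have "(\<lambda>k. cinner F (E (S k) F)) sums cinner F (E (\<Union>k. S k) F)"
      by (rule bounded_linear.sums[OF cinner.bounded_linear_right pvm_sums[OF S(1,2)]])
    then have "(\<lambda>k. Re (cinner F (E (S k) F))) sums Re (cinner F (E (\<Union>k. S k) F))" by (rule sums_Re)
    then have "(\<lambda>k. ennreal (Re (cinner F (E (S k) F)))) sums ennreal (Re (cinner F (E (\<Union>k. S k) F)))"
      using S(1) by (subst sums_ennreal) (auto simp: pvm_norm image_subset_iff)
    then show "(\<Sum>k. ennreal (Re (cinner F (E (S k) F)))) = ennreal (Re (cinner F (E (\<Union>k. S k) F)))"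
      by (simp add: sums_iff)
  qed
qed (fact assms)

lemma sets_diagonal_measure [simp]: "sets (diagonal_measure E F) = sets borel"
  unfolding diagonal_measure_def
  using sets.sigma_sets_eq[of "borel :: real measure"] by (subst sets_measure_of) auto

lemma space_diagonal_measure [simp]: "space (diagonal_measure E F) = UNIV"
  unfolding diagonal_measure_def by (rule space_measure_of) auto

lemma finite_measure_diagonal_measure: "finite_measure (diagonal_measure E F)"
  by standard (simp add: emeasure_diagonal_measure)

end

lemma diagonal_measure_cong:
  assumes "\<And>S. S \<in> sets borel \<Longrightarrow> Re (cinner F (E S F)) = Re (cinner G (E' S G))"
  shows "diagonal_measure E F = diagonal_measure E' G"
  unfolding diagonal_measure_def
  by (rule measure_of_eq) (use assms sets.sigma_sets_eq[of "borel :: real measure"] in auto)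

section \<open>Uniqueness of the spectral measure\<close>

context
  fixes U :: "('n::finite) l2 \<Rightarrow> 'n l2" and m :: "real ^ 'n \<Rightarrow> real"
    and E :: "real set \<Rightarrow> 'n l2 \<Rightarrow> 'n l2"
  assumes U: "unitary U" and m [measurable]: "m \<in> borel_measurable borel"
    and spec: "spectral_measure (mult_graph U m) E"
begin

private lemma E: "projection_valued_measure E"
  using spec by (simp add: spectral_measure_def)

private lemma quad: "(F, G) \<in> mult_graph U m \<Longrightarrow> cinner F G = of_real (LINT t|diagonal_measure E F. t)"
  using spec by (auto simp: spectral_measure_def)

text \<open>
  The private lemmas up to \<open>diagonal_measure_unique\<close> compare an arbitrary spectral measure
  \<open>E\<close> of \<open>mult_graph U m\<close> with the multiplication picture. The only data on \<open>E\<close> are the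
  domain and the quadratic form, so it is not given in advance that \<open>E\<close> commutes with the
  operator.
\<close>

private lemma AE_band:
  assumes S: "S \<in> sets borel" and F: "E S F = F"
  shows "AE t in diagonal_measure E F. t \<in> S"
proof (rule AE_I'[of "- S"])
  have "E (- S) F = 0" using pvm_disjoint[OF E, of "- S" S F] S F by auto
  then show "- S \<in> null_sets (diagonal_measure E F)"
    using S by (auto simp: null_sets_def emeasure_diagonal_measure[OF E] cinner.zero_right sets_diagonal_measure[OF E])
qed auto

private lemma band_domain:
  assumes S: "S \<in> sets borel" "S \<subseteq> {c - \<delta>..c + \<delta>}" and F: "E S F = F"
  shows "\<exists>G. (F, G) \<in> mult_graph U m"
proof -
  interpret finite_measure "diagonal_measure E F" by (rule finite_measure_diagonal_measure[OF E])
  have [measurable_cong]: "sets (diagonal_measure E F) = sets borel" by (rule sets_diagonal_measure[OF E])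
  have "integrable (diagonal_measure E F) (\<lambda>t. t\<^sup>2)"
  proof (rule integrable_const_bound[of _ "(\<bar>c\<bar> + \<bar>\<delta>\<bar>)\<^sup>2"])
    show "AE t in diagonal_measure E F. norm (t\<^sup>2) \<le> (\<bar>c\<bar> + \<bar>\<delta>\<bar>)\<^sup>2"
      using AE_band[OF S(1) F]
    proof eventually_elim
      case (elim t)
      then have "\<bar>t\<bar> \<le> \<bar>c\<bar> + \<bar>\<delta>\<bar>" using S(2) by fastforce
      then show ?case using power_mono[of "\<bar>t\<bar>" "\<bar>c\<bar> + \<bar>\<delta>\<bar>" 2] by simp
    qed
  qed measurable
  then have "F \<in> Domain (mult_graph U m)" using spec by (simp add: spectral_measure_def)
  then show ?thesis by auto
qed

text \<open>
  The diagonal measure of \<open>F + \<omega> K\<close> does not depend on the phase \<open>\<omega>\<close> when \<open>F\<close> and \<open>K\<close> lie in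
  complementary spectral subspaces; so the cross terms of the quadratic form vanish.
\<close>

private lemma band_orthogonal:
  assumes S: "S \<in> sets borel" and F: "E S F = F" "(F, G) \<in> mult_graph U m"
    and K: "E (- S) K = K" "(K, L) \<in> mult_graph U m"
  shows "cinner K G = 0"
proof -
  have cross: "cinner F (E T K) = 0" "cinner K (E T F) = 0" if T: "T \<in> sets borel" for T
  proof -
    have "E T K = E (T \<inter> - S) K" using pvm_Int[OF E T, of "- S" K] S K(1) by simp
    then have "E S (E T K) = 0" using pvm_disjoint[OF E S, of "T \<inter> - S" K] S T by auto
    then show 1: "cinner F (E T K) = 0"
      using pvm_cinner[OF E S, of F "E T K"] F(1) by (simp add: cinner.zero_right)
    show "cinner K (E T F) = 0"
      using 1 pvm_cinner[OF E T, of K F] cinner_commute[of "E T K" F] by simp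
  qed
  have diag: "diagonal_measure E (F + cscale \<omega> K) = diagonal_measure E (F + K)" if "cmod \<omega> = 1" for \<omega>
  proof (rule diagonal_measure_cong)
    fix T :: "real set" assume T: "T \<in> sets borel"
    have unim: "cnj \<omega> * \<omega> = 1" using that complex_norm_square[of \<omega>] by (simp add: mult.commute)
    have quadr: "cinner (F + cscale z K) (E T (F + cscale z K)) = cinner F (E T F) + (cnj z * z) * cinner K (E T K)" for z
      using cross[OF T] T
      by (simp add: clinear_add[OF pvm_clinear[OF E]] clinear_cscale[OF pvm_clinear[OF E]]
          cinner_add_left cinner_add_right cinner_cscale_left cinner_cscale_right)
    show "Re (cinner (F + cscale \<omega> K) (E T (F + cscale \<omega> K))) = Re (cinner (F + K) (E T (F + K)))"
      using quadr[of 1] unfolding quadr[of \<omega>] unim by simp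
  qed
  have "cinner (F + cscale \<omega> K) (G + cscale \<omega> L) = cinner (F + cscale 1 K) (G + cscale 1 L)" if "cmod \<omega> = 1" for \<omega>
    using quad[OF mult_graph_add[OF U m F(2) K(2), of \<omega>]] quad[OF mult_graph_add[OF U m F(2) K(2), of 1]]
      diag[OF that] by simp
  \<comment> \<open>The phase \<open>-1\<close> isolates the sum of the two cross terms, the phase \<open>\<i>\<close> their difference.\<close>
  note eqs = this[of "-1"] this[of \<i>]
  have "2 * (cinner F L + cinner K G) = 0"
    using eqs(1) by (simp add: cinner_add_left cinner_add_right cinner_cscale_left cinner_cscale_right algebra_simps)
  then have FL: "cinner F L = - cinner K G" by (simp add: add_eq_0_iff)
  have "2 * \<i> * cinner K G = 0"
    using eqs(2) by (simp add: cinner_add_left cinner_add_right cinner_cscale_left cinner_cscale_right algebra_simps FL)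
  then show ?thesis by simp
qed

text \<open>
  The component of \<open>G\<close> outside the spectral subspace of \<open>S\<close> is cut into pieces with bounded
  spectral support. Each piece lies in the domain and so is orthogonal to \<open>G\<close> by the
  preceding lemma.
\<close>

private lemma band_invariant:
  assumes S: "S \<in> sets borel" and F: "E S F = F" "(F, G) \<in> mult_graph U m"
  shows "E S G = G"
proof -
  have cS: "- S \<in> sets borel" using S by auto
  define K where "K = E (- S) G"
  \<comment> \<open>A partition of the line into bounded pieces.\<close>
  define B where "B n = {t :: real. nat \<lfloor>\<bar>t\<bar>\<rfloor> = n}" for n
  have B: "range B \<subseteq> sets borel" "disjoint_family B" "(\<Union>n. B n) = UNIV"
    by (auto simp: B_def disjoint_family_on_def)
  have Bn: "B n \<in> sets borel" for n using B(1) by auto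
  have "(\<lambda>n. E (B n) K) sums E (\<Union>n. B n) K" by (rule pvm_sums[OF E B(1,2)])
  then have sums: "(\<lambda>n. E (B n) K) sums K" by (simp add: B(3) pvm_UNIV[OF E])
  have "cinner (E (B n) K) G = 0" for n
  proof -
    have KB: "E (B n) K = E (B n \<inter> - S) G" unfolding K_def by (rule pvm_Int[OF E Bn cS])
    have BS: "B n \<inter> - S \<in> sets borel" using Bn cS by auto
    have "E (B n \<inter> - S) (E (B n) K) = E (B n) K" unfolding KB by (rule pvm_idem[OF E BS])
    moreover have "B n \<inter> - S \<subseteq> {0 - (real n + 1)..0 + (real n + 1)}"
    proof
      fix t assume "t \<in> B n \<inter> - S"
      then have "nat \<lfloor>\<bar>t\<bar>\<rfloor> = n" by (simp add: B_def)
      then have "\<bar>t\<bar> \<le> real n + 1" by linarith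
      then show "t \<in> {0 - (real n + 1)..0 + (real n + 1)}" by auto
    qed
    ultimately obtain L where L: "(E (B n) K, L) \<in> mult_graph U m" using band_domain[OF BS] by blast
    have "E (- S) (E (B n) K) = E (B n) K"
      unfolding KB using pvm_Int[OF E cS BS] by (simp add: Int_commute Int_left_commute)
    from band_orthogonal[OF S F this L] show ?thesis .
  qed
  moreover have "(\<lambda>n. cinner (E (B n) K) G) sums cinner K G"
    by (rule bounded_linear.sums[OF cinner.bounded_linear_left sums])
  ultimately have "cinner K G = 0" by (simp add: sums_iff)
  moreover have "cinner K G = cinner K K"
    unfolding K_def using pvm_cinner[OF E cS, of G G] pvm_cinner[OF E cS, of G "E (- S) G"]
    by (simp add: pvm_idem[OF E cS])
  ultimately have "K = 0" by (simp add: cinner_self)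
  then show ?thesis using pvm_Compl[OF E S, of G] by (simp add: K_def)
qed

text \<open>
  On vectors with spectral support in an interval of radius \<open>\<delta>\<close> about \<open>c\<close>, the numerical
  range of the operator minus \<open>c\<close> is contained in \<open>[-\<delta>, \<delta>]\<close>. As for bounded self-adjoint
  operators, this bounds the norm: polarize with \<open>W\<close> the multiple of \<open>H\<close> that has the norm
  of \<open>F\<close>.
\<close>

private lemma band_norm:
  assumes S: "S \<in> sets borel" "S \<subseteq> {c - \<delta>..c + \<delta>}" and F: "E S F = F" "(F, G) \<in> mult_graph U m"
  shows "norm (G - cscale (of_real c) F) \<le> \<delta> * norm F"
proof -
  define B where "B = (\<lambda>(F :: 'n l2) G. G - cscale (of_real c) F)"
  have num: "\<bar>Re (cinner F (B F G))\<bar> \<le> \<delta> * (norm F)\<^sup>2" if F: "E S F = F" "(F, G) \<in> mult_graph U m" for F G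
  proof -
    interpret finite_measure "diagonal_measure E F" by (rule finite_measure_diagonal_measure[OF E])
    have [measurable_cong]: "sets (diagonal_measure E F) = sets borel" by (rule sets_diagonal_measure[OF E])
    have one: "measure (diagonal_measure E F) UNIV = (norm F)\<^sup>2"
      by (simp add: measure_def emeasure_diagonal_measure[OF E] pvm_UNIV[OF E] cinner_self)
    have int: "integrable (diagonal_measure E F) (\<lambda>t. t)"
    proof (rule integrable_const_bound[of _ "\<bar>c\<bar> + \<bar>\<delta>\<bar>"])
      show "AE t in diagonal_measure E F. norm t \<le> \<bar>c\<bar> + \<bar>\<delta>\<bar>"
        using AE_band[OF S(1) F(1)] by eventually_elim (use S(2) in fastforce)
    qed measurable
    have "Re (cinner F (B F G)) = (LINT t|diagonal_measure E F. t - c)"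
      using int by (simp add: B_def cinner.diff_right quad[OF F(2)] cinner_cscale_right cinner_self one[symmetric]
          space_diagonal_measure[OF E])
    also have "\<bar>\<dots>\<bar> \<le> (LINT t|diagonal_measure E F. \<bar>t - c\<bar>)" by (rule integral_abs_bound)
    also have "\<dots> \<le> (LINT t|diagonal_measure E F. \<delta>)"
    proof (rule integral_mono_AE)
      show "AE t in diagonal_measure E F. \<bar>t - c\<bar> \<le> \<delta>"
        using AE_band[OF S(1) F(1)] by eventually_elim (use S(2) in fastforce)
    qed (use int in auto)
    also have "\<dots> = \<delta> * (norm F)\<^sup>2" by (simp add: one space_diagonal_measure[OF E])
    finally show ?thesis .
  qed
  define H where "H = B F G"
  show ?thesis
  proof (cases "H = 0 \<or> F = 0")
    case disj: True
    show ?thesis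
    proof (cases "F = 0")
      case True
      have "(0, 0) \<in> mult_graph U m"
        using mult_graph_add[OF U m F(2) F(2), of "-1"] by (simp flip: minus_cscale)
      then have "G = 0" using F(2) mult_graph_unique[OF U m, of 0 G 0] True by simp
      then show ?thesis using True by simp
    next
      case False
      then have "H = 0" using disj by simp
      moreover have "0 \<le> \<delta>"
      proof -
        have "0 \<le> \<delta> * (norm F)\<^sup>2" using order_trans[OF abs_ge_zero num[OF F]] .
        then show ?thesis using False by (simp add: zero_le_mult_iff)
      qed
      ultimately show ?thesis by (simp add: H_def B_def)
    qed
  next
    case False
    then have nz: "norm H > 0" "norm F > 0" by auto
    \<comment> \<open>With this normalization both parallelogram terms equal \<open>\<parallel>F\<parallel>\<^sup>2\<close>, and \<open>\<langle>W, H\<rangle>\<close> is the product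
      of the norms of \<open>F\<close> and \<open>H\<close>.\<close>
    define s where "s = norm F / norm H"
    define W where "W = cscale (of_real s) H"
    have s: "s > 0" using nz by (simp add: s_def)
    have "E S G = G" by (rule band_invariant[OF S(1) F])
    then have "E S H = H" using F(1)
      by (simp add: H_def B_def clinear_diff[OF pvm_clinear[OF E S(1)]] clinear_cscale[OF pvm_clinear[OF E S(1)]])
    then have EW: "E S W = W" by (simp add: W_def clinear_cscale[OF pvm_clinear[OF E S(1)]])
    obtain W' where W': "(W, W') \<in> mult_graph U m" using band_domain[OF S EW] by blast
    have EFW: "E S (F + cscale \<omega> W) = F + cscale \<omega> W" for \<omega>
      by (simp add: clinear_add[OF pvm_clinear[OF E S(1)]] clinear_cscale[OF pvm_clinear[OF E S(1)]] EW F(1))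
    have nW: "norm W = norm F" using s nz by (simp add: W_def norm_cscale s_def norm_divide)
    define P where "P \<omega> = F + cscale \<omega> W" for \<omega>
    define Q where "Q \<omega> = G + cscale \<omega> W'" for \<omega>
    have "Re (cinner (P 1) (B (P 1) (Q 1))) - Re (cinner (P (-1)) (B (P (-1)) (Q (-1))))
        \<le> \<delta> * (norm (P 1))\<^sup>2 + \<delta> * (norm (P (-1)))\<^sup>2"
      using num[OF EFW mult_graph_add[OF U m F(2) W'], of 1] num[OF EFW mult_graph_add[OF U m F(2) W'], of "-1"]
      by (simp add: P_def Q_def)
    also have "\<dots> = \<delta> * (2 * (norm F)\<^sup>2 + 2 * (norm W)\<^sup>2)"
      unfolding power2_norm_eq_inner P_def
      by (simp add: inner_add_left inner_add_right inner_commute flip: minus_cscale) (simp add: algebra_simps inner_commute)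
    also have "\<dots> = 4 * \<delta> * (norm F)\<^sup>2" by (simp add: nW)
    also have "Re (cinner (P 1) (B (P 1) (Q 1))) - Re (cinner (P (-1)) (B (P (-1)) (Q (-1))))
        = 2 * Re (cinner F (B W W')) + 2 * Re (cinner W H)"
      by (simp add: P_def Q_def B_def H_def cinner_add_left cinner_add_right cinner.diff_right
          cinner_cscale_left cinner_cscale_right algebra_simps)
    also have "Re (cinner F (B W W')) = Re (cinner W H)"
    proof -
      have "cinner G W = cinner F W'" by (rule mult_graph_symmetric[OF U m F(2) W'])
      then have "cinner F (B W W') = cinner H W"
        by (simp add: B_def H_def cinner.diff_right cinner.diff_left cinner_cscale_left cinner_cscale_right)
      then show ?thesis by (subst cinner_commute) simp
    qed
    also have "Re (cinner W H) = norm F * norm H"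
      using nz by (simp add: W_def cinner_cscale_left cinner_self s_def power2_eq_square)
    finally have "norm F * norm H \<le> norm F * (\<delta> * norm F)" by (simp add: power2_eq_square mult.left_commute)
    then show ?thesis using nz by (simp add: H_def B_def)
  qed
qed

text \<open>
  Iterating the norm bound, \<open>(m - c)\<^sup>n U F\<close> has norm at most \<open>\<delta>\<^sup>n \<parallel>F\<parallel>\<close> for every \<open>n\<close>. Where
  \<open>\<bar>m - c\<bar> > \<delta>\<close>, this is possible only if \<open>U F\<close> vanishes.
\<close>

private lemma band_support:
  assumes S: "S \<in> sets borel" "S \<subseteq> {c - \<delta>..c + \<delta>}" and \<delta>: "\<delta> > 0" and F: "E S F = F"
  shows "AE a in lborel. m a \<notin> {c - \<delta>..c + \<delta>} \<longrightarrow> rep_l2 (U F) a = 0"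
proof -
  have pow: "\<exists>H. E S H = H \<and> norm H \<le> \<delta> ^ n * norm F \<and>
      (AE a in lborel. rep_l2 (U H) a = of_real ((m a - c) ^ n) * rep_l2 (U F) a)" for n
  proof (induction n)
    case 0
    show ?case by (rule exI[of _ F]) (simp add: F)
  next
    case (Suc n)
    then obtain H where H: "E S H = H" "norm H \<le> \<delta> ^ n * norm F"
      "AE a in lborel. rep_l2 (U H) a = of_real ((m a - c) ^ n) * rep_l2 (U F) a" by blast
    obtain G where G: "(H, G) \<in> mult_graph U m" using band_domain[OF S H(1)] by blast
    define H' where "H' = G - cscale (of_real c) H"
    have "E S H' = H'"
      using band_invariant[OF S(1) H(1) G] H(1)
      by (simp add: H'_def clinear_diff[OF pvm_clinear[OF E S(1)]] clinear_cscale[OF pvm_clinear[OF E S(1)]])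
    moreover have "norm H' \<le> \<delta> ^ Suc n * norm F"
      using order_trans[OF band_norm[OF S H(1) G] mult_left_mono[OF H(2), of \<delta>]] \<delta> by (simp add: H'_def mult.assoc)
    moreover have "AE a in lborel. rep_l2 (U H') a = of_real ((m a - c) ^ Suc n) * rep_l2 (U F) a"
    proof -
      have UH': "U H' = U G - cscale (of_real c) (U H)"
        by (simp add: H'_def clinear_diff[OF unitary_clinear[OF U]] clinear_cscale[OF unitary_clinear[OF U]])
      show ?thesis unfolding UH'
        using AE_rep_minus[of "U G" "cscale (of_real c) (U H)"] AE_rep_cscale[of "of_real c" "U H"] H(3) G
        unfolding mult_graph_def mem_Collect_eq prod.case
        by eventually_elim (simp add: algebra_simps)
    qed
    ultimately show ?case by blast
  qed
  \<comment> \<open>The mass \<open>I\<close> of \<open>U F\<close> at distance at least \<open>\<delta> + \<eta>\<close> from \<open>c\<close> is bounded by a geometric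
    sequence.\<close>
  have far: "AE a in lborel. \<bar>m a - c\<bar> \<ge> \<delta> + \<eta> \<longrightarrow> rep_l2 (U F) a = 0" if \<eta>: "\<eta> > 0" for \<eta>
  proof -
    define I where "I = (\<integral>\<^sup>+a. ennreal (indicator {a. \<bar>m a - c\<bar> \<ge> \<delta> + \<eta>} a * (cmod (rep_l2 (U F) a))\<^sup>2) \<partial>lborel)"
    have "I \<le> ennreal ((norm F)\<^sup>2 * (\<delta>\<^sup>2 / (\<delta> + \<eta>)\<^sup>2) ^ n)" for n
    proof -
      obtain H where H: "norm H \<le> \<delta> ^ n * norm F"
        "AE a in lborel. rep_l2 (U H) a = of_real ((m a - c) ^ n) * rep_l2 (U F) a" using pow by blast
      have "ennreal (((\<delta> + \<eta>)\<^sup>2) ^ n) * I = (\<integral>\<^sup>+a. ennreal (((\<delta> + \<eta>)\<^sup>2) ^ n) *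
          ennreal (indicator {a. \<bar>m a - c\<bar> \<ge> \<delta> + \<eta>} a * (cmod (rep_l2 (U F) a))\<^sup>2) \<partial>lborel)"
        unfolding I_def by (rule nn_integral_cmult[symmetric]) measurable
      also have "\<dots> \<le> (\<integral>\<^sup>+a. ennreal ((cmod (rep_l2 (U H) a))\<^sup>2) \<partial>lborel)"
      proof (rule nn_integral_mono_AE)
        show "AE a in lborel. ennreal (((\<delta> + \<eta>)\<^sup>2) ^ n) *
          ennreal (indicator {a. \<bar>m a - c\<bar> \<ge> \<delta> + \<eta>} a * (cmod (rep_l2 (U F) a))\<^sup>2) \<le> ennreal ((cmod (rep_l2 (U H) a))\<^sup>2)"
          using H(2)
        proof eventually_elim
          case (elim a)
          show ?case
          proof (cases "\<bar>m a - c\<bar> \<ge> \<delta> + \<eta>")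
            case True
            then have "((\<delta> + \<eta>)\<^sup>2) ^ n \<le> ((m a - c)\<^sup>2) ^ n"
              using power_mono[of "\<delta> + \<eta>" "\<bar>m a - c\<bar>" 2] \<delta> \<eta> by (intro power_mono[of "(\<delta> + \<eta>)\<^sup>2"]) simp_all
            then have "((\<delta> + \<eta>)\<^sup>2) ^ n * (cmod (rep_l2 (U F) a))\<^sup>2 \<le> ((m a - c)\<^sup>2) ^ n * (cmod (rep_l2 (U F) a))\<^sup>2"
              by (rule mult_right_mono) simp
            also have "\<dots> = (cmod (rep_l2 (U H) a))\<^sup>2"
              unfolding elim norm_mult norm_of_real power_mult_distrib power2_abs
              by (simp add: mult.commute flip: power_mult)
            finally show ?thesis using True by (simp flip: ennreal_mult)
          qed simp
        qed
      qed
      also have "\<dots> = ennreal ((norm (U H))\<^sup>2)" by (rule nn_norm_l2[symmetric])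
      also have "\<dots> \<le> ennreal ((\<delta> ^ n * norm F)\<^sup>2)"
        using H(1) by (intro ennreal_leI power_mono) (auto simp: unitary_norm[OF U])
      also have "(\<delta> ^ n * norm F)\<^sup>2 = ((\<delta> + \<eta>)\<^sup>2) ^ n * ((norm F)\<^sup>2 * (\<delta>\<^sup>2 / (\<delta> + \<eta>)\<^sup>2) ^ n)"
        using \<delta> \<eta> by (simp add: power_mult_distrib power_divide power_mult[symmetric] mult.commute)
      finally have "ennreal (((\<delta> + \<eta>)\<^sup>2) ^ n) * I \<le> ennreal (((\<delta> + \<eta>)\<^sup>2) ^ n) * ennreal ((norm F)\<^sup>2 * (\<delta>\<^sup>2 / (\<delta> + \<eta>)\<^sup>2) ^ n)"
        by (simp add: ennreal_mult)
      then show ?thesis using \<delta> \<eta> by (subst (asm) ennreal_mult_le_mult_iff) auto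
    qed
    moreover have "(\<lambda>n. ennreal ((norm F)\<^sup>2 * (\<delta>\<^sup>2 / (\<delta> + \<eta>)\<^sup>2) ^ n)) \<longlonglongrightarrow> ennreal ((norm F)\<^sup>2 * 0)"
    proof (intro tendsto_ennrealI tendsto_mult_left LIMSEQ_realpow_zero)
      show "\<delta>\<^sup>2 / (\<delta> + \<eta>)\<^sup>2 < 1" using \<delta> \<eta> by (simp add: power_strict_mono)
    qed simp
    ultimately have "I \<le> ennreal ((norm F)\<^sup>2 * 0)" by (intro LIMSEQ_le_const) auto
    then have "I = 0" by simp
    then have "AE a in lborel. ennreal (indicator {a. \<bar>m a - c\<bar> \<ge> \<delta> + \<eta>} a * (cmod (rep_l2 (U F) a))\<^sup>2) = 0"
      unfolding I_def by (subst (asm) nn_integral_0_iff_AE) auto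
    then show ?thesis by eventually_elim (auto simp: indicator_def split: if_splits)
  qed
  have "AE a in lborel. \<forall>k. \<bar>m a - c\<bar> \<ge> \<delta> + inverse (real (Suc k)) \<longrightarrow> rep_l2 (U F) a = 0"
    unfolding AE_all_countable using far by simp
  then show ?thesis
  proof eventually_elim
    case (elim a)
    show ?case
    proof
      assume "m a \<notin> {c - \<delta>..c + \<delta>}"
      then have "\<bar>m a - c\<bar> - \<delta> > 0" by auto
      then obtain k where "inverse (real (Suc k)) < \<bar>m a - c\<bar> - \<delta>" using reals_Archimedean by blast
      then show "rep_l2 (U F) a = 0" using elim by (smt (verit))
    qed
  qed
qed

text \<open>
  Each piece \<open>E (S k) F\<close> is supported where \<open>m\<close> takes values in \<open>I\<close>. Hence the range of
  \<open>E I\<close> is contained in the range of the projection \<open>indicator I (m)\<close>. The intervals around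
  the pieces are closed, which is why the two cases in which the lemma is used are closed
  half lines.
\<close>

private lemma half_line_le:
  fixes S :: "nat \<Rightarrow> real set"
  assumes I: "(\<Union>k. S k) = I" "disjoint_family S" and S: "\<And>k. S k \<in> sets borel"
    "\<And>k. S k \<subseteq> {c k - 1..c k + 1}" "\<And>k. {c k - 1..c k + 1} \<subseteq> I" and IB: "I \<in> sets borel"
  shows "emeasure (diagonal_measure E F) I \<le> emeasure (density_law U m F) I"
proof -
  let ?Q = "mult_calculus U m (indicator I)"
  have bI: "bounded_borel (indicator I :: real \<Rightarrow> complex)" by (rule indicator_bounded_borel[OF IB])
  have Q: "?Q (E (S k) F) = E (S k) F" for k
  proof -
    have "AE a in lborel. m a \<notin> {c k - 1..c k + 1} \<longrightarrow> rep_l2 (U (E (S k) F)) a = 0"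
      using pvm_idem[OF E S(1)] by (intro band_support[OF S(1,2)]) auto
    then have "AE a in lborel. rep_l2 (mulop (\<lambda>a. indicator I (m a)) (U (E (S k) F))) a = rep_l2 (U (E (S k) F)) a"
      using AE_rep_mulop[OF bounded_borel_m[OF m bI], of "U (E (S k) F)"]
      by eventually_elim (use S(3)[of k] in \<open>auto simp: indicator_def\<close>)
    then have "mulop (\<lambda>a. indicator I (m a)) (U (E (S k) F)) = U (E (S k) F)" by (rule l2_eqI)
    then show ?thesis by (simp add: mult_calculus_def U)
  qed
  have sums: "(\<lambda>k. E (S k) F) sums E I F"
    using pvm_sums[OF E, of S F] S(1) I by auto
  have "(\<lambda>k. ?Q (E (S k) F)) sums ?Q (E I F)"
    by (rule bounded_linear.sums[OF bounded_linear_mult_calculus[OF U m bI] sums])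
  \<comment> \<open>The range of \<open>E I\<close> is contained in the range of the orthogonal projection \<open>?Q\<close>; hence \<open>E I F\<close>
    is not longer than \<open>?Q F\<close>.\<close>
  then have QE: "?Q (E I F) = E I F" using sums sums_unique2 by (auto simp: Q)
  have Qsa: "cinner (?Q G) H = cinner G (?Q H)" for G H
  proof -
    note A = AE_rep_mulop[OF bounded_borel_m[OF m bI]]
    have "cinner (mulop (\<lambda>a. indicator I (m a)) (U G)) (U H) = cinner (U G) (mulop (\<lambda>a. indicator I (m a)) (U H))"
      unfolding cinner_rep using A[of "U G"] A[of "U H"]
      by (intro integral_cong_AE) (auto simp: indicator_def)
    then show ?thesis by (simp add: mult_calculus_def cinner_inv_left[OF U] cinner_inv_right[OF U])
  qed
  have QQ: "?Q (?Q G) = ?Q G" for G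
  proof -
    have "(\<lambda>a. indicator I (m a) * indicator I (m a)) = (\<lambda>a. indicator I (m a) :: complex)"
      by (auto simp: indicator_def)
    then show ?thesis
      by (simp add: mult_calculus_def U mulop_mulop[OF bounded_borel_m[OF m bI] bounded_borel_m[OF m bI]])
  qed
  have n1: "cinner F (E I F) = of_real ((norm (E I F))\<^sup>2)" by (rule pvm_norm[OF E IB])
  have n2: "cinner F (?Q F) = of_real ((norm (?Q F))\<^sup>2)"
    using Qsa[of F "?Q F"] cinner_self[of "?Q F"] by (simp add: QQ)
  have "(norm (E I F))\<^sup>2 = cmod (cinner (?Q F) (E I F))"
    using n1 Qsa[of F "E I F"] by (simp add: QE norm_power)
  also have "\<dots> \<le> norm (?Q F) * norm (E I F)" by (rule cmod_cinner_le)
  finally have "norm (E I F) \<le> norm (?Q F)"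
    by (cases "norm (E I F) = 0") (auto simp: power2_eq_square)
  then have "(norm (E I F))\<^sup>2 \<le> (norm (?Q F))\<^sup>2" by (intro power_mono) auto
  then show ?thesis
    by (simp add: emeasure_diagonal_measure[OF E IB] emeasure_density_law[OF U m IB] n1 n2 ennreal_leI)
qed

private lemma le_ray: "emeasure (diagonal_measure E F) {b..} \<le> emeasure (density_law U m F) {b..}"
proof (rule half_line_le[of "\<lambda>k. {b + real k..<b + real k + 1}" _ "\<lambda>k. b + real k + 1"])
  show "(\<Union>k. {b + real k..<b + real k + 1}) = {b..}"
  proof (intro set_eqI iffI)
    fix t assume "t \<in> {b..}"
    then have "t \<in> {b + real (nat \<lfloor>t - b\<rfloor>)..<b + real (nat \<lfloor>t - b\<rfloor>) + 1}" by (auto; linarith)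
    then show "t \<in> (\<Union>k. {b + real k..<b + real k + 1})" by blast
  qed auto
  show "disjoint_family (\<lambda>k. {b + real k..<b + real k + 1})"
    unfolding disjoint_family_on_def
  proof (intro ballI impI)
    fix j k :: nat assume "j \<noteq> k"
    then have "real j + 1 \<le> real k \<or> real k + 1 \<le> real j" by linarith
    then show "{b + real j..<b + real j + 1} \<inter> {b + real k..<b + real k + 1} = {}" by auto
  qed
qed auto

private lemma le_ray': "emeasure (diagonal_measure E F) {..b} \<le> emeasure (density_law U m F) {..b}"
proof (rule half_line_le[of "\<lambda>k. {b - real k - 1<..b - real k}" _ "\<lambda>k. b - real k - 1"])
  show "(\<Union>k. {b - real k - 1<..b - real k}) = {..b}"
  proof (intro set_eqI iffI)
    fix t assume "t \<in> {..b}"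
    then have "t \<in> {b - real (nat \<lfloor>b - t\<rfloor>) - 1<..b - real (nat \<lfloor>b - t\<rfloor>)}" by (auto; linarith)
    then show "t \<in> (\<Union>k. {b - real k - 1<..b - real k})" by blast
  qed auto
  show "disjoint_family (\<lambda>k. {b - real k - 1<..b - real k})"
    unfolding disjoint_family_on_def
  proof (intro ballI impI)
    fix j k :: nat assume "j \<noteq> k"
    then have "real j + 1 \<le> real k \<or> real k + 1 \<le> real j" by linarith
    then show "{b - real j - 1<..b - real j} \<inter> {b - real k - 1<..b - real k} = {}" by auto
  qed
qed auto

text \<open>
  Two inequalities, on upper and on lower half lines, and equality of the total masses force
  the two measures to agree on every half line.
\<close>

lemma diagonal_measure_unique: "diagonal_measure E F = density_law U m F"
proof (rule measure_eqI_lessThan)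
  interpret M: finite_measure "diagonal_measure E F" by (rule finite_measure_diagonal_measure[OF E])
  interpret N: finite_measure "density_law U m F" by (rule finite_measure_density_law[OF U m])
  show sM: "sets (diagonal_measure E F) = sets borel" by (rule sets_diagonal_measure[OF E])
  show sN: "sets (density_law U m F) = sets borel" by (rule sets_density_law)
  fix b :: real
  show "emeasure (diagonal_measure E F) {b<..} < \<infinity>" by (simp add: M.emeasure_eq_measure)
  have inc: "incseq (\<lambda>k. {b + inverse (real (Suc k))..})"
    by (intro incseq_SucI) (auto intro: order_trans[rotated])
  have un: "(\<Union>k. {b + inverse (real (Suc k))..}) = {b<..}"
  proof (intro set_eqI iffI)
    fix t assume "t \<in> {b<..}"
    then have "0 < t - b" by simp
    then obtain k where "inverse (real (Suc k)) < t - b" using reals_Archimedean by blast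
    then have "t \<in> {b + inverse (real (Suc k))..}" by simp
    then show "t \<in> (\<Union>k. {b + inverse (real (Suc k))..})" by blast
  next
    fix t assume "t \<in> (\<Union>k. {b + inverse (real (Suc k))..})"
    then obtain k where "b + inverse (real (Suc k)) \<le> t" by auto
    moreover have "inverse (real (Suc k)) > 0" by simp
    ultimately have "b < t" by linarith
    then show "t \<in> {b<..}" by simp
  qed
  have "(\<lambda>k. emeasure (diagonal_measure E F) {b + inverse (real (Suc k))..}) \<longlonglongrightarrow> emeasure (diagonal_measure E F) {b<..}"
    using Lim_emeasure_incseq[OF _ inc, of "diagonal_measure E F"] unfolding un by (simp add: sM image_subset_iff)
  moreover have "emeasure (diagonal_measure E F) {b + inverse (real (Suc k))..} \<le> emeasure (density_law U m F) {b<..}" for k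
  proof -
    have "{b + inverse (real (Suc k))..} \<subseteq> {b<..}" using un by blast
    then have "emeasure (density_law U m F) {b + inverse (real (Suc k))..} \<le> emeasure (density_law U m F) {b<..}"
      by (intro emeasure_mono) (auto simp: sN)
    then show ?thesis using le_ray order_trans by blast
  qed
  ultimately have 1: "emeasure (diagonal_measure E F) {b<..} \<le> emeasure (density_law U m F) {b<..}"
    by (intro LIMSEQ_le_const2) auto
  have split: "UNIV = {..b} \<union> {b<..}" "{..b} \<inter> {b<..} = {}" by auto
  have tot: "emeasure (diagonal_measure E F) UNIV = emeasure (density_law U m F) UNIV"
  proof -
    have "mult_calculus U m (indicator UNIV) F = F" by (simp add: mult_calculus_def U)
    then show ?thesis
      using emeasure_density_law[OF U m, of UNIV F] by (simp add: emeasure_diagonal_measure[OF E] pvm_UNIV[OF E])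
  qed
  have "measure (diagonal_measure E F) UNIV = measure (diagonal_measure E F) {..b} + measure (diagonal_measure E F) {b<..}"
    unfolding split(1) by (rule M.finite_measure_Union) (auto simp: sM)
  moreover have "measure (density_law U m F) UNIV = measure (density_law U m F) {..b} + measure (density_law U m F) {b<..}"
    unfolding split(1) by (rule N.finite_measure_Union) (auto simp: sN)
  ultimately have "measure (diagonal_measure E F) {b<..} = measure (density_law U m F) {b<..}"
    using arg_cong[OF tot, of enn2real] 1 le_ray'[of F b]
    unfolding measure_def[symmetric] by (simp add: M.emeasure_eq_measure N.emeasure_eq_measure)
  then show "emeasure (diagonal_measure E F) {b<..} = emeasure (density_law U m F) {b<..}"
    by (simp add: M.emeasure_eq_measure N.emeasure_eq_measure)
qed

end

section \<open>The functional calculus of a multiplication operator\<close>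

lemma projection_valued_measure_mult_calculus:
  fixes U :: "('n::finite) l2 \<Rightarrow> 'n l2"
  assumes U: "unitary U" and m [measurable]: "m \<in> borel_measurable borel"
  shows "projection_valued_measure (\<lambda>S. mult_calculus U m (indicator S))"
  unfolding projection_valued_measure_def
proof (intro conjI allI ballI impI)
  fix S :: "real set" assume S: "S \<in> sets borel"
  have bI: "bounded_borel (indicator S :: real \<Rightarrow> complex)" by (rule indicator_bounded_borel[OF S])
  note bm = bounded_borel_m[OF m bI]
  show "orthogonal_projection (mult_calculus U m (indicator S))"
    unfolding orthogonal_projection_def
  proof (intro conjI allI)
    show "clinear (mult_calculus U m (indicator S))" by (rule clinear_mult_calculus[OF U m bI])
    have "(\<lambda>a. indicator S (m a) * indicator S (m a)) = (\<lambda>a. indicator S (m a) :: complex)"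
      by (auto simp: indicator_def)
    then show "mult_calculus U m (indicator S) (mult_calculus U m (indicator S) F) = mult_calculus U m (indicator S) F" for F
      by (simp add: mult_calculus_def U mulop_mulop[OF bm bm])
    fix F G
    have "cinner (mulop (\<lambda>a. indicator S (m a)) (U F)) (U G) = cinner (U F) (mulop (\<lambda>a. indicator S (m a)) (U G))"
      unfolding cinner_rep using AE_rep_mulop[OF bm, of "U G"] AE_rep_mulop[OF bm, of "U F"]
      by (intro integral_cong_AE) (auto simp: indicator_def)
    then show "cinner (mult_calculus U m (indicator S) F) G = cinner F (mult_calculus U m (indicator S) G)"
      by (simp add: mult_calculus_def cinner_inv_left[OF U] cinner_inv_right[OF U])
  qed
next
  show "mult_calculus U m (indicator UNIV) F = F" for F by (simp add: mult_calculus_def U)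
next
  fix S :: "nat \<Rightarrow> real set" and F :: "'n l2"
  assume "range S \<subseteq> sets borel \<and> disjoint_family S"
  then have S[measurable]: "\<And>k. S k \<in> sets borel" and disj: "disjoint_family S" by auto
  define \<phi> where "\<phi> n t = (\<Sum>k<n. indicator (S k) t :: complex)" for n t
  have \<phi>: "\<phi> n t = indicator (\<Union>k<n. S k) t" for n t
    unfolding \<phi>_def using disj
    by (subst indicator_UN_disjoint) (auto intro: disjoint_family_on_mono)
  have bI: "bounded_borel (indicator (S k) :: real \<Rightarrow> complex)" for k by (rule indicator_bounded_borel) simp
  have "(\<lambda>n. mulop (\<lambda>a. \<phi> n (m a)) (U F)) \<longlonglongrightarrow> mulop (\<lambda>a. indicator (\<Union>k. S k) (m a)) (U F)"
  proof (rule mulop_tendsto[where C = 1])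
    show "(\<lambda>a. \<phi> n (m a)) \<in> borel_measurable borel" for n unfolding \<phi>_def by measurable
    show "cmod (\<phi> n (m a)) \<le> 1" for n a unfolding \<phi> by (auto simp: indicator_def)
    show "(\<lambda>n. \<phi> n (m a)) \<longlonglongrightarrow> indicator (\<Union>k. S k) (m a)" for a
      unfolding \<phi> by (rule LIMSEQ_indicator_UN)
    have "(\<Union>k. S k) \<in> sets borel" by auto
    from bounded_borel_m[OF m indicator_bounded_borel[OF this]]
    show "(\<lambda>a. indicator (\<Union>k. S k) (m a) :: complex) \<in> borel_measurable borel" by (simp add: bounded_borel_def)
  qed
  moreover have "mulop (\<lambda>a. \<phi> n (m a)) G = (\<Sum>k<n. mulop (\<lambda>a. indicator (S k) (m a)) G)" for n G
  proof (induction n)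
    case 0
    have "mulop (\<lambda>a. 0) G = 0" by (simp add: mulop_def flip: zero_abs_l2)
    then show ?case by (simp add: \<phi>_def)
  next
    case (Suc n)
    have b: "bounded_borel (\<lambda>a. \<phi> n (m a))" "bounded_borel (\<lambda>a. \<phi> (Suc n) (m a))"
      by (rule bounded_borelI[of _ 1]; simp add: \<phi>; simp add: indicator_def)+
    have "mulop (\<lambda>a. \<phi> (Suc n) (m a)) G = mulop (\<lambda>a. \<phi> n (m a)) G + mulop (\<lambda>a. indicator (S n) (m a)) G"
      using AE_rep_mulop[OF b(1), of G] AE_rep_mulop[OF b(2), of G] AE_rep_mulop[OF bounded_borel_m[OF m bI[of n]], of G]
        AE_rep_plus[of "mulop (\<lambda>a. \<phi> n (m a)) G" "mulop (\<lambda>a. indicator (S n) (m a)) G"]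
      by (intro l2_eqI) (auto simp: \<phi>_def algebra_simps)
    then show ?case by (simp add: Suc)
  qed
  ultimately have "(\<lambda>n. \<Sum>k<n. mulop (\<lambda>a. indicator (S k) (m a)) (U F)) \<longlonglongrightarrow> mulop (\<lambda>a. indicator (\<Union>k. S k) (m a)) (U F)"
    by simp
  then have "(\<lambda>k. mulop (\<lambda>a. indicator (S k) (m a)) (U F)) sums mulop (\<lambda>a. indicator (\<Union>k. S k) (m a)) (U F)"
    by (simp add: sums_def)
  then show "(\<lambda>k. mult_calculus U m (indicator (S k)) F) sums mult_calculus U m (indicator (\<Union>k. S k)) F"
    unfolding mult_calculus_def
    by (rule bounded_linear.sums[OF unitary_bounded_linear[OF unitary_inv[OF U]]])
qed

text \<open>
  The indicator functions of \<open>m\<close> give one spectral measure; uniqueness of the diagonal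
  measures makes the definite description well defined.
\<close>

theorem functional_calculus_mult_graph:
  fixes U :: "('n::finite) l2 \<Rightarrow> 'n l2"
  assumes U: "unitary U" and m: "m \<in> borel_measurable borel" and \<phi>: "bounded_borel \<phi>"
  shows "functional_calculus \<phi> (mult_graph U m) = mult_calculus U m \<phi>"
proof -
  let ?E = "\<lambda>S. mult_calculus U m (indicator S)"
  have pvm: "projection_valued_measure ?E" by (rule projection_valued_measure_mult_calculus[OF U m])
  have diag: "diagonal_measure ?E F = density_law U m F" for F
    by (rule diagonal_measure_eqI) (simp_all add: emeasure_density_law[OF U m])
  have spec: "spectral_measure (mult_graph U m) ?E"
    unfolding spectral_measure_def diag
    using pvm Domain_mult_graph[OF U m] quadratic_form_mult_graph[OF U m] by auto
  show ?thesis
    unfolding functional_calculus_def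
  proof (rule the_equality)
    show "\<exists>E. spectral_measure (mult_graph U m) E \<and> clinear (mult_calculus U m \<phi>) \<and> bounded_linear (mult_calculus U m \<phi>) \<and>
        (\<forall>f. cinner f (mult_calculus U m \<phi> f) = (LINT t|diagonal_measure E f. \<phi> t))"
      using spec clinear_mult_calculus[OF U m \<phi>] bounded_linear_mult_calculus[OF U m \<phi>] cinner_mult_calculus[OF U m \<phi>]
      by (intro exI[of _ ?E]) (simp add: diag)
    fix T
    assume "\<exists>E. spectral_measure (mult_graph U m) E \<and> clinear T \<and> bounded_linear T \<and>
        (\<forall>f. cinner f (T f) = (LINT t|diagonal_measure E f. \<phi> t))"
    then obtain E where "spectral_measure (mult_graph U m) E" and T: "clinear T"
      "\<And>f. cinner f (T f) = (LINT t|diagonal_measure E f. \<phi> t)" by blast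
    then show "T = mult_calculus U m \<phi>"
      by (intro clinear_eqI_quadratic_form clinear_mult_calculus U m \<phi>)
         (simp_all add: diagonal_measure_unique[OF U m] cinner_mult_calculus[OF U m \<phi>])
  qed
qed

section \<open>Gaussian decay\<close>

definition gauss_decay :: "(real ^ 'n::finite \<Rightarrow> complex) \<Rightarrow> bool" where
  "gauss_decay w \<longleftrightarrow> continuous_on UNIV w \<and> (\<exists>C \<delta>. \<delta> > 0 \<and> (\<forall>a. cmod (w a) \<le> C * exp (- \<delta> * (norm a)\<^sup>2)))"

lemma norm_vec_square: "(norm a)\<^sup>2 = (\<Sum>i\<in>UNIV. (a $ i)\<^sup>2)" for a :: "real ^ 'n::finite"
  unfolding power2_norm_eq_inner by (simp add: inner_vec_def power2_eq_square)

lemma integrable_exp_norm_square: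
  assumes "\<delta> > 0"
  shows "integrable lborel (\<lambda>a :: real ^ 'n::finite. exp (- \<delta> * (norm a)\<^sup>2))"
proof -
  have "has_bochner_integral lborel (\<lambda>a :: real ^ 'n. \<Prod>i\<in>UNIV. exp ((0 :: complex) * of_real (a $ i) - of_real (2 * \<delta> * (a $ i)\<^sup>2) / 2))
      (\<Prod>i\<in>(UNIV :: 'n set). of_real (sqrt (2 * pi / (2 * \<delta>))) * exp (0\<^sup>2 / of_real (2 * (2 * \<delta>))))"
    using assms by (intro has_bochner_integral_vec_prod has_bochner_integral_gaussian) simp
  then have "integrable lborel (\<lambda>a :: real ^ 'n. cmod (\<Prod>i\<in>UNIV. exp ((0 :: complex) * of_real (a $ i) - of_real (2 * \<delta> * (a $ i)\<^sup>2) / 2)))"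
    by (intro integrable_norm) (simp add: has_bochner_integral_iff)
  also have "(\<lambda>a :: real ^ 'n. cmod (\<Prod>i\<in>UNIV. exp ((0 :: complex) * of_real (a $ i) - of_real (2 * \<delta> * (a $ i)\<^sup>2) / 2)))
      = (\<lambda>a. exp (- \<delta> * (norm a)\<^sup>2))"
    by (auto simp: prod_norm[symmetric] norm_vec_square sum_distrib_left exp_sum[symmetric] fun_eq_iff sum_negf[symmetric])
  finally show ?thesis .
qed

lemma gauss_decay_continuous: "gauss_decay w \<Longrightarrow> continuous_on UNIV w"
  by (simp add: gauss_decay_def)

lemma gauss_decay_square_integrable:
  assumes "gauss_decay w" shows "square_integrable w"
proof -
  obtain C \<delta> where \<delta>: "\<delta> > 0" and w: "\<And>a. cmod (w a) \<le> C * exp (- \<delta> * (norm a)\<^sup>2)"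
    using assms by (auto simp: gauss_decay_def)
  have [measurable]: "w \<in> borel_measurable borel"
    using assms by (intro borel_measurable_continuous_onI gauss_decay_continuous)
  have int: "integrable lborel (\<lambda>a :: real ^ 'a. C\<^sup>2 * exp (- (2 * \<delta>) * (norm a)\<^sup>2))"
    using \<delta> by (intro integrable_mult_right integrable_exp_norm_square) simp
  have "integrable lborel (\<lambda>a. (cmod (w a))\<^sup>2)"
  proof (rule Bochner_Integration.integrable_bound[OF int])
    have "(cmod (w a))\<^sup>2 \<le> C\<^sup>2 * exp (- (2 * \<delta>) * (norm a)\<^sup>2)" for a
    proof -
      have "(cmod (w a))\<^sup>2 \<le> (C * exp (- \<delta> * (norm a)\<^sup>2))\<^sup>2" by (intro power_mono w) simp
      also have "\<dots> = C\<^sup>2 * exp (- (2 * \<delta>) * (norm a)\<^sup>2)"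
        by (simp add: power_mult_distrib exp_double[symmetric] flip: exp_of_nat_mult)
      finally show ?thesis .
    qed
    then show "AE a in lborel. norm ((cmod (w a))\<^sup>2) \<le> norm (C\<^sup>2 * exp (- (2 * \<delta>) * (norm a)\<^sup>2))" by simp
  qed simp
  then show ?thesis by (simp add: square_integrable_def)
qed

lemma gauss_decay_0: "gauss_decay (\<lambda>_. 0)"
  unfolding gauss_decay_def by (auto intro!: exI[of _ 0] exI[of _ 1])

lemma gauss_decay_add:
  assumes "gauss_decay v" "gauss_decay w" shows "gauss_decay (\<lambda>a. v a + w a)"
proof -
  obtain C \<delta> where \<delta>: "\<delta> > 0" and v: "\<And>a. cmod (v a) \<le> C * exp (- \<delta> * (norm a)\<^sup>2)"
    using assms by (auto simp: gauss_decay_def)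
  obtain C' \<delta>' where \<delta>': "\<delta>' > 0" and w: "\<And>a. cmod (w a) \<le> C' * exp (- \<delta>' * (norm a)\<^sup>2)"
    using assms by (auto simp: gauss_decay_def)
  have "cmod (v a + w a) \<le> (\<bar>C\<bar> + \<bar>C'\<bar>) * exp (- min \<delta> \<delta>' * (norm a)\<^sup>2)" for a
  proof -
    have "exp (- \<delta> * (norm a)\<^sup>2) \<le> exp (- min \<delta> \<delta>' * (norm a)\<^sup>2)"
      "exp (- \<delta>' * (norm a)\<^sup>2) \<le> exp (- min \<delta> \<delta>' * (norm a)\<^sup>2)"
      by (auto intro!: mult_right_mono)
    then have "C * exp (- \<delta> * (norm a)\<^sup>2) \<le> \<bar>C\<bar> * exp (- min \<delta> \<delta>' * (norm a)\<^sup>2)"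
      "C' * exp (- \<delta>' * (norm a)\<^sup>2) \<le> \<bar>C'\<bar> * exp (- min \<delta> \<delta>' * (norm a)\<^sup>2)"
      by (intro mult_mono; simp)+
    then show ?thesis
      using norm_triangle_ineq[of "v a" "w a"] v[of a] w[of a] by (simp add: distrib_right)
  qed
  then show ?thesis
    using assms \<delta> \<delta>' unfolding gauss_decay_def
    by (intro conjI continuous_intros exI[of _ "\<bar>C\<bar> + \<bar>C'\<bar>"] exI[of _ "min \<delta> \<delta>'"]) auto
qed

lemma gauss_decay_sum: "(\<And>m. m \<in> A \<Longrightarrow> gauss_decay (f m)) \<Longrightarrow> gauss_decay (\<lambda>a. \<Sum>m\<in>A. f m a)"
  by (induction A rule: infinite_finite_induct) (auto simp: gauss_decay_0 intro: gauss_decay_add)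

lemma real_polynomial_exp_bound:
  fixes p :: "real ^ 'n::finite \<Rightarrow> real"
  assumes "real_polynomial_function p" "\<eta> > 0"
  shows "\<exists>C. \<forall>a. \<bar>p a\<bar> \<le> C * exp (\<eta> * norm a)"
  using assms
proof (induction arbitrary: \<eta>)
  case (linear f)
  obtain K where K: "K > 0" "\<And>a. norm (f a) \<le> norm a * K" using bounded_linear.pos_bounded[OF linear(1)] by blast
  have "\<bar>f a\<bar> \<le> K / \<eta> * exp (\<eta> * norm a)" for a
  proof -
    have "\<bar>f a\<bar> \<le> K / \<eta> * (\<eta> * norm a)" using K(2)[of a] linear(2) by (simp add: mult.commute)
    also have "\<dots> \<le> K / \<eta> * exp (\<eta> * norm a)"
    proof (rule mult_left_mono)
      show "\<eta> * norm a \<le> exp (\<eta> * norm a)" using exp_ge_add_one_self[of "\<eta> * norm a"] by linarith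
    qed (use K(1) linear(2) in simp)
    finally show ?thesis .
  qed
  then show ?case by blast
next
  case (const c)
  have "\<bar>c\<bar> \<le> \<bar>c\<bar> * exp (\<eta> * norm a)" for a :: "real ^ 'n"
    using mult_left_mono[of 1 "exp (\<eta> * norm a)" "\<bar>c\<bar>"] const by simp
  then show ?case by blast
next
  case (add f g)
  obtain C C' where C: "\<And>a. \<bar>f a\<bar> \<le> C * exp (\<eta> * norm a)" "\<And>a. \<bar>g a\<bar> \<le> C' * exp (\<eta> * norm a)"
    using add by blast
  have "\<bar>f a + g a\<bar> \<le> (C + C') * exp (\<eta> * norm a)" for a
    using C[of a] by (simp add: distrib_right)
  then show ?case by blast
next
  case (mult f g)
  obtain C C' where C: "\<And>a. \<bar>f a\<bar> \<le> C * exp (\<eta> / 2 * norm a)" "\<And>a. \<bar>g a\<bar> \<le> C' * exp (\<eta> / 2 * norm a)"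
    using mult.IH[of "\<eta> / 2"] mult.prems by auto
  have "\<bar>f a * g a\<bar> \<le> (C * C') * exp (\<eta> * norm a)" for a
  proof -
    have "\<bar>f a\<bar> * \<bar>g a\<bar> \<le> (C * exp (\<eta> / 2 * norm a)) * (C' * exp (\<eta> / 2 * norm a))"
      using C[of a] by (intro mult_mono order_trans[OF abs_ge_zero C(1)]) auto
    also have "\<dots> = (C * C') * exp (\<eta> * norm a)" by (simp flip: exp_add)
    finally show ?thesis by (simp add: abs_mult)
  qed
  then show ?case by blast
qed

lemma polynomial_function_complex_iff:
  fixes P :: "real ^ 'n::finite \<Rightarrow> complex"
  shows "polynomial_function P \<longleftrightarrow> real_polynomial_function (\<lambda>a. Re (P a)) \<and> real_polynomial_function (\<lambda>a. Im (P a))"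
  by (auto simp: polynomial_function_iff_Basis_inner Basis_complex_def)

text \<open>
  Half of the quadratic decay absorbs the linear exponent and the exponential bound on the
  polynomial, by completing the square.
\<close>

lemma gauss_decay_term:
  fixes P :: "real ^ 'n::finite \<Rightarrow> complex"
  assumes \<alpha>: "\<And>i. Re (\<alpha> i) > 0" and P: "polynomial_function P"
  shows "gauss_decay (\<lambda>a. exp (- (\<Sum>i\<in>UNIV. \<alpha> i * of_real ((a $ i)\<^sup>2) + \<beta> i * of_real (a $ i))) * P a)"
proof -
  define \<delta> where "\<delta> = Min (range (\<lambda>i. Re (\<alpha> i)))"
  have \<delta>: "\<delta> > 0" "\<And>i. \<delta> \<le> Re (\<alpha> i)" using \<alpha> by (auto simp: \<delta>_def)
  define B where "B = (\<Sum>i\<in>UNIV. \<bar>Re (\<beta> i)\<bar>)"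
  obtain C C' where C: "\<And>a. \<bar>Re (P a)\<bar> \<le> C * exp (1 * norm a)" "\<And>a. \<bar>Im (P a)\<bar> \<le> C' * exp (1 * norm a)"
    using P real_polynomial_exp_bound[of "\<lambda>a. Re (P a)" 1] real_polynomial_exp_bound[of "\<lambda>a. Im (P a)" 1]
    unfolding polynomial_function_complex_iff by auto
  have P': "cmod (P a) \<le> (C + C') * exp (norm a)" for a
    using cmod_le[of "P a"] C[of a] by (simp add: distrib_right)
  have CC: "C + C' \<ge> 0" using order_trans[OF norm_ge_zero P'[of 0]] by simp
  let ?t = "\<lambda>a. exp (- (\<Sum>i\<in>UNIV. \<alpha> i * of_real ((a $ i)\<^sup>2) + \<beta> i * of_real (a $ i))) * P a"
  define K where "K = (C + C') * exp ((B + 1)\<^sup>2 / (2 * \<delta>))"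
  have "cmod (?t a) \<le> K * exp (- (\<delta> / 2) * (norm a)\<^sup>2)" for a
  proof -
    have 1: "\<delta> * (norm a)\<^sup>2 \<le> (\<Sum>i\<in>UNIV. Re (\<alpha> i) * (a $ i)\<^sup>2)"
      unfolding norm_vec_square sum_distrib_left by (intro sum_mono mult_right_mono \<delta>) auto
    have 2: "- (B * norm a) \<le> (\<Sum>i\<in>UNIV. Re (\<beta> i) * a $ i)"
    proof -
      have "\<bar>\<Sum>i\<in>UNIV. Re (\<beta> i) * a $ i\<bar> \<le> (\<Sum>i\<in>UNIV. \<bar>Re (\<beta> i)\<bar> * norm a)"
        by (rule order_trans[OF sum_abs]) (auto simp: abs_mult intro!: sum_mono mult_left_mono component_le_norm_cart)
      then show ?thesis by (simp add: B_def sum_distrib_right)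
    qed
    have 3: "(B + 1) * norm a \<le> \<delta> / 2 * (norm a)\<^sup>2 + (B + 1)\<^sup>2 / (2 * \<delta>)"
    proof -
      have "0 \<le> (\<delta> * norm a - (B + 1))\<^sup>2 / (2 * \<delta>)" using \<delta> by simp
      also have "\<dots> = \<delta> / 2 * (norm a)\<^sup>2 + (B + 1)\<^sup>2 / (2 * \<delta>) - (B + 1) * norm a"
        using \<delta>(1) by (simp add: field_simps power2_eq_square)
      finally show ?thesis by simp
    qed
    have "cmod (?t a) = exp (- (\<Sum>i\<in>UNIV. Re (\<alpha> i) * (a $ i)\<^sup>2) - (\<Sum>i\<in>UNIV. Re (\<beta> i) * a $ i)) * cmod (P a)"
      by (simp add: norm_mult Re_sum sum.distrib power2_eq_square)
    also have "\<dots> \<le> exp (- (\<delta> * (norm a)\<^sup>2) + B * norm a) * ((C + C') * exp (norm a))"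
      using 1 2 P'[of a] by (intro mult_mono) auto
    also have "\<dots> = (C + C') * exp (- (\<delta> * (norm a)\<^sup>2) + (B + 1) * norm a)"
    proof -
      have e: "- (\<delta> * (norm a)\<^sup>2) + (B + 1) * norm a = (- (\<delta> * (norm a)\<^sup>2) + B * norm a) + norm a"
        by (simp add: algebra_simps)
      show ?thesis unfolding e exp_add by (simp only: mult_ac)
    qed
    also have "\<dots> \<le> (C + C') * exp ((B + 1)\<^sup>2 / (2 * \<delta>) + - (\<delta> / 2) * (norm a)\<^sup>2)"
      using 3 CC by (intro mult_left_mono) (auto simp: algebra_simps)
    also have "\<dots> = K * exp (- (\<delta> / 2) * (norm a)\<^sup>2)" unfolding K_def exp_add by simp
    finally show ?thesis .
  qed
  moreover have "continuous_on UNIV ?t"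
    using P by (intro continuous_intros continuous_on_polymonial_function)
  ultimately show ?thesis
    unfolding gauss_decay_def using \<delta> by (intro conjI exI[of _ K] exI[of _ "\<delta> / 2"]) auto
qed

lemma gaussian_domainD:
  fixes u :: "real ^ 'n::finite \<Rightarrow> complex"
  assumes "u \<in> gaussian_domain"
  shows "\<exists>(N::nat) \<alpha> \<beta> P. (\<forall>m<N. \<forall>i. Re (\<alpha> m i) > 0) \<and> (\<forall>m<N. polynomial_function (P m)) \<and>
    u = (\<lambda>a. \<Sum>m<N. exp (- (\<Sum>i\<in>UNIV. \<alpha> m i * of_real ((a $ i)\<^sup>2) + \<beta> m i * of_real (a $ i))) * P m a)"
  using assms unfolding gaussian_domain_def by blast

lemma gauss_decay_gaussian_domain:
  fixes u :: "real ^ 'n::finite \<Rightarrow> complex"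
  assumes "u \<in> gaussian_domain"
  shows "gauss_decay u"
proof -
  obtain N \<alpha> \<beta> P where "\<forall>m<N. \<forall>i. Re (\<alpha> m i) > 0" "\<forall>m<N. polynomial_function (P m)"
    and u: "u = (\<lambda>a. \<Sum>m<(N::nat). exp (- (\<Sum>i\<in>UNIV. \<alpha> m i * of_real ((a $ i)\<^sup>2) + \<beta> m i * of_real (a $ i))) * P m a)"
    using gaussian_domainD[OF assms] by (elim exE conjE) (rule that)
  then show ?thesis unfolding u by (intro gauss_decay_sum gauss_decay_term) auto
qed

lemma gaussian_domain_square_integrable: "u \<in> gaussian_domain \<Longrightarrow> square_integrable u"
  by (intro gauss_decay_square_integrable gauss_decay_gaussian_domain)

lemma gauss_in_gaussian_domain: "gauss b \<in> gaussian_domain"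
proof -
  have "gauss b = (\<lambda>a. \<Sum>m<1::nat. exp (- (\<Sum>i\<in>UNIV. (1/2) * of_real ((a $ i)\<^sup>2) + (- b i) * of_real (a $ i))) * 1)"
    unfolding gauss_def by (auto simp: fun_eq_iff sum_negf[symmetric] exp_sum intro!: prod.cong)
  then show ?thesis
    unfolding gaussian_domain_def mem_Collect_eq
    by (intro exI[of _ "1::nat"] exI[of _ "\<lambda>_ _. 1/2"] exI[of _ "\<lambda>_ i. - b i"] exI[of _ "\<lambda>_ _. 1"]) auto
qed

section \<open>First-order operators on the Gaussian domain\<close>

definition linform :: "('n \<Rightarrow> real) \<Rightarrow> real ^ 'n::finite \<Rightarrow> real" where
  "linform e a = (\<Sum>j\<in>UNIV. e j * a $ j)"

text \<open>
  For \<open>\<kappa> = \<pi> \<hbar> / d\<^sub>k\<close> and \<open>e\<close> the \<open>k\<close>-th row of the exchange matrix, up to sign, these are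
  the operators \<open>x\<close> and \<open>x~\<close> of a seed.
\<close>

definition first_order ::
    "real \<Rightarrow> ('n \<Rightarrow> real) \<Rightarrow> 'n \<Rightarrow> (real ^ 'n::finite \<Rightarrow> complex) \<Rightarrow> real ^ 'n \<Rightarrow> complex" where
  "first_order \<kappa> e k f a = \<i> * of_real \<kappa> * vector_derivative (\<lambda>t. f (a + t *\<^sub>R axis k 1)) (at 0)
     - of_real (linform e a) * f a"

text \<open>
  The unitary group generated by \<open>first_order \<kappa> e k\<close>. When \<open>e k = 0\<close> the linear form is
  constant along the translation, so the translation and the phase commute and this is
  indeed a group.
\<close>

definition first_order_group ::
    "real \<Rightarrow> ('n \<Rightarrow> real) \<Rightarrow> 'n \<Rightarrow> real \<Rightarrow> ('n::finite) l2 \<Rightarrow> 'n l2" where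
  "first_order_group \<kappa> e k s F = mulop (\<lambda>a. exp (- \<i> * of_real (s * linform e a))) (translate (axis k (\<kappa> * s)) F)"

lemma linform_translate: "e k = 0 \<Longrightarrow> linform e (a + r *\<^sub>R axis k 1) = linform e a"
  unfolding linform_def by (intro sum.cong) (auto simp: axis_def)

lemma axis_scaleR: "axis k r = r *\<^sub>R axis k (1::real)"
  by (auto simp: axis_def vec_eq_iff)

lemma measurable_linform [measurable]: "linform e \<in> borel_measurable borel"
  unfolding linform_def by measurable

lemma real_polynomial_partial:
  fixes p :: "real ^ 'n::finite \<Rightarrow> real"
  assumes "real_polynomial_function p"
  shows "\<exists>q. real_polynomial_function q \<and> (\<forall>a. ((\<lambda>t. p (a + t *\<^sub>R axis k 1)) has_real_derivative q a) (at 0))"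
  using assms
proof induction
  case (linear f)
  interpret bounded_linear f by fact
  have "((\<lambda>t. f (a + t *\<^sub>R axis k 1)) has_real_derivative f (axis k 1)) (at 0)" for a
    by (simp add: add scaleR) (auto intro!: derivative_eq_intros)
  then show ?case by (intro exI[of _ "\<lambda>_. f (axis k 1)"]) (auto intro: real_polynomial_function.intros(2))
next
  case (const c)
  show ?case by (intro exI[of _ "\<lambda>_. 0"]) (auto intro: real_polynomial_function.intros(2))
next
  case (add f g)
  then obtain f' g' where "real_polynomial_function f'" "\<forall>a. ((\<lambda>t. f (a + t *\<^sub>R axis k 1)) has_real_derivative f' a) (at 0)"
    "real_polynomial_function g'" "\<forall>a. ((\<lambda>t. g (a + t *\<^sub>R axis k 1)) has_real_derivative g' a) (at 0)" by blast
  then show ?case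
    by (intro exI[of _ "\<lambda>a. f' a + g' a"]) (auto intro: real_polynomial_function.intros(3) DERIV_add)
next
  case (mult f g)
  then obtain f' g' where fg: "real_polynomial_function f'" "\<forall>a. ((\<lambda>t. f (a + t *\<^sub>R axis k 1)) has_real_derivative f' a) (at 0)"
    "real_polynomial_function g'" "\<forall>a. ((\<lambda>t. g (a + t *\<^sub>R axis k 1)) has_real_derivative g' a) (at 0)" by blast
  have "((\<lambda>t. f (a + t *\<^sub>R axis k 1) * g (a + t *\<^sub>R axis k 1)) has_real_derivative f' a * g a + g' a * f a) (at 0)" for a
    using DERIV_mult[OF fg(2)[rule_format, of a] fg(4)[rule_format, of a]] by simp
  then show ?case
    using fg mult.hyps
    by (intro exI[of _ "\<lambda>a. f' a * g a + g' a * f a"]) (auto intro!: real_polynomial_function.intros(3) real_polynomial_function.intros(4))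
qed

lemma polynomial_partial:
  fixes P :: "real ^ 'n::finite \<Rightarrow> complex"
  assumes "polynomial_function P"
  shows "\<exists>Q. polynomial_function Q \<and> (\<forall>a. ((\<lambda>t. P (a + t *\<^sub>R axis k 1)) has_vector_derivative Q a) (at 0))"
proof -
  obtain q1 q2 where q: "real_polynomial_function q1" "\<And>a. ((\<lambda>t. Re (P (a + t *\<^sub>R axis k 1))) has_real_derivative q1 a) (at 0)"
    "real_polynomial_function q2" "\<And>a. ((\<lambda>t. Im (P (a + t *\<^sub>R axis k 1))) has_real_derivative q2 a) (at 0)"
    using assms real_polynomial_partial[of "\<lambda>a. Re (P a)" k] real_polynomial_partial[of "\<lambda>a. Im (P a)" k]
    unfolding polynomial_function_complex_iff by blast
  have "((\<lambda>t. P (a + t *\<^sub>R axis k 1)) has_vector_derivative Complex (q1 a) (q2 a)) (at 0)" for a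
    using q(2)[of a] q(4)[of a]
    by (simp add: has_vector_derivative_complex_iff has_real_derivative_iff_has_vector_derivative)
  then show ?thesis
    using q by (intro exI[of _ "\<lambda>a. Complex (q1 a) (q2 a)"]) (auto simp: polynomial_function_complex_iff)
qed

lemma polynomial_function_mult_coord:
  fixes P :: "real ^ 'n::finite \<Rightarrow> complex"
  assumes "polynomial_function P"
  shows "polynomial_function (\<lambda>a. c * of_real (a $ i) * P a)"
proof -
  have "real_polynomial_function (\<lambda>a :: real ^ 'n. a $ i)"
    by (rule real_polynomial_function.intros(1)) (rule bounded_linear_vec_nth)
  then have "polynomial_function (\<lambda>a. (a $ i) *\<^sub>R (c * P a))"
    using polynomial_function_compose[OF assms polynomial_function_bounded_linear[OF bounded_linear_mult_right[of c]]]
    by (intro polynomial_function_mult) (auto simp: real_polynomial_function_eq[symmetric] comp_def)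
  then show ?thesis by (simp add: scaleR_conv_of_real mult_ac)
qed

lemma polynomial_function_cmult:
  fixes P :: "real ^ 'n::finite \<Rightarrow> complex"
  assumes "polynomial_function P"
  shows "polynomial_function (\<lambda>a. c * P a)"
  using polynomial_function_compose[OF assms polynomial_function_bounded_linear[OF bounded_linear_mult_right[of c]]] by (simp add: comp_def)

lemma gaussian_term_partial:
  fixes P :: "real ^ 'n::finite \<Rightarrow> complex"
  assumes "polynomial_function P"
  shows "\<exists>Q. polynomial_function Q \<and> (\<forall>a.
    ((\<lambda>t. exp (- (\<Sum>i\<in>UNIV. \<alpha> i * of_real (((a + t *\<^sub>R axis k 1) $ i)\<^sup>2) + \<beta> i * of_real ((a + t *\<^sub>R axis k 1) $ i))) * P (a + t *\<^sub>R axis k 1))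
      has_vector_derivative exp (- (\<Sum>i\<in>UNIV. \<alpha> i * of_real ((a $ i)\<^sup>2) + \<beta> i * of_real (a $ i))) * Q a) (at 0))"
proof -
  obtain P' where P': "polynomial_function P'" "\<And>a. ((\<lambda>t. P (a + t *\<^sub>R axis k 1)) has_vector_derivative P' a) (at 0)"
    using polynomial_partial[OF assms] by blast
  define Q where "Q a = P' a + ((- 2 * \<alpha> k) * of_real (a $ k) * P a + (- \<beta> k) * P a)" for a
  have "polynomial_function Q"
    unfolding Q_def by (intro polynomial_function_add P' polynomial_function_mult_coord polynomial_function_cmult assms)
  moreover have "((\<lambda>t. exp (- (\<Sum>i\<in>UNIV. \<alpha> i * of_real (((a + t *\<^sub>R axis k 1) $ i)\<^sup>2) + \<beta> i * of_real ((a + t *\<^sub>R axis k 1) $ i))) * P (a + t *\<^sub>R axis k 1))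
      has_vector_derivative exp (- (\<Sum>i\<in>UNIV. \<alpha> i * of_real ((a $ i)\<^sup>2) + \<beta> i * of_real (a $ i))) * Q a) (at 0)" for a
  proof -
    define R where "R = (\<Sum>i\<in>UNIV-{k}. \<alpha> i * of_real ((a $ i)\<^sup>2) + \<beta> i * of_real (a $ i))"
    have split: "(\<Sum>i\<in>UNIV. \<alpha> i * of_real (((a + t *\<^sub>R axis k 1) $ i)\<^sup>2) + \<beta> i * of_real ((a + t *\<^sub>R axis k 1) $ i))
      = \<alpha> k * (of_real (a $ k) + of_real t)\<^sup>2 + \<beta> k * (of_real (a $ k) + of_real t) + R" for t
    proof -
      have "(\<Sum>i\<in>UNIV-{k}. \<alpha> i * of_real (((a + t *\<^sub>R axis k 1) $ i)\<^sup>2) + \<beta> i * of_real ((a + t *\<^sub>R axis k 1) $ i)) = R"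
        unfolding R_def by (intro sum.cong) (auto simp: axis_def)
      then show ?thesis by (subst sum.remove[of _ k]) (auto simp: axis_def)
    qed
    let ?g = "\<lambda>z. exp (- (\<alpha> k * (of_real (a $ k) + z)\<^sup>2 + \<beta> k * (of_real (a $ k) + z) + R))"
    have "(?g has_field_derivative (- 2 * \<alpha> k * of_real (a $ k) - \<beta> k) * ?g 0) (at (of_real 0))"
      by (auto intro!: derivative_eq_intros simp: algebra_simps)
    then have "((\<lambda>t. ?g (of_real t)) has_vector_derivative (- 2 * \<alpha> k * of_real (a $ k) - \<beta> k) * ?g 0) (at 0)"
      by (rule has_vector_derivative_real_field)
    from has_vector_derivative_mult[OF this P'(2)[of a]]
    have "((\<lambda>t. ?g (of_real t) * P (a + t *\<^sub>R axis k 1)) has_vector_derivative ?g 0 * Q a) (at 0)"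
      by (simp add: Q_def algebra_simps)
    then show ?thesis unfolding split using split[of 0] by simp
  qed
  ultimately show ?thesis by blast
qed

text \<open>
  Partial derivatives and multiplication by coordinates change only the polynomials, so the
  operator preserves its domain.
\<close>

lemma gaussian_domain_first_order:
  assumes u: "u \<in> gaussian_domain"
  shows "first_order \<kappa> e k u \<in> gaussian_domain"
    and "\<exists>D. \<forall>a. ((\<lambda>t. u (a + t *\<^sub>R axis k 1)) has_vector_derivative D a) (at 0)"
proof -
  obtain N \<alpha> \<beta> P where \<alpha>': "\<forall>m<N. \<forall>i. Re (\<alpha> m i) > 0" and P': "\<forall>m<N. polynomial_function (P m)"
    and u: "u = (\<lambda>a. \<Sum>m<(N::nat). exp (- (\<Sum>i\<in>UNIV. \<alpha> m i * of_real ((a $ i)\<^sup>2) + \<beta> m i * of_real (a $ i))) * P m a)"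
    using gaussian_domainD[OF u] by (elim exE conjE) (rule that)
  have \<alpha>: "Re (\<alpha> m i) > 0" and P: "polynomial_function (P m)" if "m < N" for m i
    using \<alpha>' P' that by auto
  let ?g = "\<lambda>m a. exp (- (\<Sum>i\<in>UNIV. \<alpha> m i * of_real ((a $ i)\<^sup>2) + \<beta> m i * of_real (a $ i)))"
  have "\<exists>Q. \<forall>m<N. polynomial_function (Q m) \<and> (\<forall>a.
    ((\<lambda>t. ?g m (a + t *\<^sub>R axis k 1) * P m (a + t *\<^sub>R axis k 1)) has_vector_derivative ?g m a * Q m a) (at 0))"
    using gaussian_term_partial[OF P] by (intro choice) blast
  then obtain Q where Q: "\<And>m. m < N \<Longrightarrow> polynomial_function (Q m)" and
    D: "\<And>m a. m < N \<Longrightarrow> ((\<lambda>t. ?g m (a + t *\<^sub>R axis k 1) * P m (a + t *\<^sub>R axis k 1)) has_vector_derivative ?g m a * Q m a) (at 0)"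
    by blast
  have du: "((\<lambda>t. u (a + t *\<^sub>R axis k 1)) has_vector_derivative (\<Sum>m<N. ?g m a * Q m a)) (at 0)" for a
    unfolding u by (intro has_vector_derivative_sum D) auto
  then show "\<exists>D. \<forall>a. ((\<lambda>t. u (a + t *\<^sub>R axis k 1)) has_vector_derivative D a) (at 0)"
    by (intro exI allI)
  define R where "R m a = (\<i> * of_real \<kappa>) * Q m a + (\<Sum>j\<in>UNIV. of_real (- e j) * of_real (a $ j) * P m a)" for m a
  have "first_order \<kappa> e k u a = (\<Sum>m<N. ?g m a * R m a)" for a
  proof -
    have "first_order \<kappa> e k u a = \<i> * of_real \<kappa> * (\<Sum>m<N. ?g m a * Q m a) - of_real (linform e a) * (\<Sum>m<N. ?g m a * P m a)"
      unfolding first_order_def vector_derivative_at[OF du] by (simp add: u)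
    also have "\<dots> = (\<Sum>m<N. ?g m a * ((\<i> * of_real \<kappa>) * Q m a + (- of_real (linform e a)) * P m a))"
      unfolding sum_distrib_left sum_subtractf[symmetric] by (intro sum.cong) (auto simp: algebra_simps)
    also have "\<dots> = (\<Sum>m<N. ?g m a * R m a)"
    proof -
      have "(- of_real (linform e a)) * P m a = (\<Sum>j\<in>UNIV. of_real (- e j) * of_real (a $ j) * P m a)" for m
        by (simp add: linform_def sum_distrib_right sum_negf)
      then show ?thesis unfolding R_def by simp
    qed
    finally show ?thesis .
  qed
  moreover have "polynomial_function (R m)" if "m < N" for m
    unfolding R_def using Q[OF that] P[OF that]
    by (intro polynomial_function_add polynomial_function_sum polynomial_function_mult_coord polynomial_function_cmult) auto
  ultimately show "first_order \<kappa> e k u \<in> gaussian_domain"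
    unfolding gaussian_domain_def mem_Collect_eq using \<alpha>
    by (intro exI[of _ N] exI[of _ \<alpha>] exI[of _ \<beta>] exI[of _ R]) (auto simp: fun_eq_iff)
qed

text \<open>
  A translation and a phase change only \<open>\<beta>\<close> and the polynomial. The invariance of the domain
  under the group is the reason why the operator has just one self-adjoint extension.
\<close>

lemma gaussian_domain_group:
  assumes u: "u \<in> gaussian_domain"
  shows "(\<lambda>a. exp (- \<i> * of_real (s * linform e a)) * u (a - axis k r)) \<in> gaussian_domain"
proof -
  obtain N \<alpha> \<beta> P where \<alpha>': "\<forall>m<N. \<forall>i. Re (\<alpha> m i) > 0" and P': "\<forall>m<N. polynomial_function (P m)"
    and u: "u = (\<lambda>a. \<Sum>m<(N::nat). exp (- (\<Sum>i\<in>UNIV. \<alpha> m i * of_real ((a $ i)\<^sup>2) + \<beta> m i * of_real (a $ i))) * P m a)"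
    using gaussian_domainD[OF u] by (elim exE conjE) (rule that)
  have \<alpha>: "Re (\<alpha> m i) > 0" and P: "polynomial_function (P m)" if "m < N" for m i
    using \<alpha>' P' that by auto
  define w :: "real ^ 'a" where "w = axis k r"
  define \<beta>' where "\<beta>' m i = \<beta> m i - 2 * \<alpha> m i * of_real (w $ i) + \<i> * of_real (s * e i)" for m i
  define P' where "P' m a = exp (- (\<Sum>i\<in>UNIV. \<alpha> m i * of_real ((w $ i)\<^sup>2) - \<beta> m i * of_real (w $ i))) * P m (a - w)" for m a
  have pw: "polynomial_function (\<lambda>a :: real ^ 'a. a - w)"
    by (intro polynomial_function_diff polynomial_function_id polynomial_function_const)
  have "polynomial_function (P' m)" if "m < N" for m
    unfolding P'_def using polynomial_function_compose[OF pw P[OF that]]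
    by (intro polynomial_function_cmult) (simp add: comp_def)
  moreover have "(\<lambda>a. exp (- \<i> * of_real (s * linform e a)) * u (a - w))
    = (\<lambda>a. \<Sum>m<N. exp (- (\<Sum>i\<in>UNIV. \<alpha> m i * of_real ((a $ i)\<^sup>2) + \<beta>' m i * of_real (a $ i))) * P' m a)"
  proof (rule ext)
    fix a
    have "exp (- \<i> * of_real (s * linform e a)) *
        exp (- (\<Sum>i\<in>UNIV. \<alpha> m i * of_real (((a - w) $ i)\<^sup>2) + \<beta> m i * of_real ((a - w) $ i)))
      = exp (- (\<Sum>i\<in>UNIV. \<alpha> m i * of_real ((a $ i)\<^sup>2) + \<beta>' m i * of_real (a $ i))) *
        exp (- (\<Sum>i\<in>UNIV. \<alpha> m i * of_real ((w $ i)\<^sup>2) - \<beta> m i * of_real (w $ i)))" for m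
      unfolding exp_add[symmetric] \<beta>'_def linform_def
      by (rule arg_cong[of _ _ exp])
         (simp add: sum_distrib_left sum_negf[symmetric] sum.distrib[symmetric] sum_subtractf[symmetric] algebra_simps power2_eq_square)
    then show "exp (- \<i> * of_real (s * linform e a)) * u (a - w)
      = (\<Sum>m<N. exp (- (\<Sum>i\<in>UNIV. \<alpha> m i * of_real ((a $ i)\<^sup>2) + \<beta>' m i * of_real (a $ i))) * P' m a)"
      unfolding u P'_def sum_distrib_left mult.assoc[symmetric] by simp
  qed
  ultimately show ?thesis
    unfolding gaussian_domain_def mem_Collect_eq w_def[symmetric] using \<alpha>
    by (intro exI[of _ N] exI[of _ \<alpha>] exI[of _ \<beta>'] exI[of _ P']) auto
qed

section \<open>Essential self-adjointness of first-order operators\<close>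

text \<open>
  Norm limits and almost everywhere limits agree when both exist, by Fatou's lemma.
\<close>

lemma l2_tendsto_AE_limit:
  assumes lim: "G \<longlonglongrightarrow> H" and AE: "AE a in lborel. (\<lambda>n. rep_l2 (G n) a) \<longlonglongrightarrow> g a"
  shows "AE a in lborel. rep_l2 H a = g a"
proof -
  let ?D = "\<lambda>n a. ennreal ((cmod (rep_l2 (G n - H) a))\<^sup>2)"
  have "(\<integral>\<^sup>+a. liminf (\<lambda>n. ?D n a) \<partial>lborel) \<le> liminf (\<lambda>n. \<integral>\<^sup>+a. ?D n a \<partial>lborel)"
    by (rule nn_integral_liminf) measurable
  also have "\<dots> = liminf (\<lambda>n. ennreal ((norm (G n - H))\<^sup>2))" by (simp only: nn_norm_l2)
  also have "\<dots> = 0"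
  proof (intro lim_imp_Liminf)
    have "(\<lambda>n. ennreal ((norm (G n - H))\<^sup>2)) \<longlonglongrightarrow> ennreal ((norm (H - H))\<^sup>2)"
      by (intro tendsto_ennrealI tendsto_intros lim)
    then show "(\<lambda>n. ennreal ((norm (G n - H))\<^sup>2)) \<longlonglongrightarrow> 0" by simp
  qed simp
  finally have "(\<integral>\<^sup>+a. liminf (\<lambda>n. ?D n a) \<partial>lborel) = 0" by simp
  then have "AE a in lborel. liminf (\<lambda>n. ?D n a) = 0"
    by (subst (asm) nn_integral_0_iff_AE) auto
  moreover have "AE a in lborel. \<forall>n. rep_l2 (G n - H) a = rep_l2 (G n) a - rep_l2 H a"
    unfolding AE_all_countable by (intro allI AE_rep_minus)
  ultimately show ?thesis using AE
  proof eventually_elim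
    case (elim a)
    have "(\<lambda>n. ennreal ((cmod (rep_l2 (G n) a - rep_l2 H a))\<^sup>2)) \<longlonglongrightarrow> ennreal ((cmod (g a - rep_l2 H a))\<^sup>2)"
      by (intro tendsto_ennrealI tendsto_intros elim(3))
    then have "liminf (\<lambda>n. ?D n a) = ennreal ((cmod (g a - rep_l2 H a))\<^sup>2)"
      using elim(2) by (intro lim_imp_Liminf) auto
    then show ?case using elim(1) by simp
  qed
qed

lemma l2_tendsto_dominated:
  fixes f :: "nat \<Rightarrow> real ^ 'n::finite \<Rightarrow> complex"
  assumes f: "\<And>n. f n \<in> borel_measurable borel" and g: "g \<in> borel_measurable borel"
    and w: "integrable lborel (\<lambda>a. (w a)\<^sup>2)" and le: "\<And>n a. cmod (f n a) \<le> w a"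
    and lim: "\<And>a. (\<lambda>n. f n a) \<longlonglongrightarrow> g a"
  shows "(\<lambda>n. abs_l2 (f n)) \<longlonglongrightarrow> abs_l2 g" "\<And>n. square_integrable (f n)" "square_integrable g"
proof -
  note [measurable] = f g
  have leg: "cmod (g a) \<le> w a" for a
    by (rule LIMSEQ_le_const2[OF tendsto_norm[OF lim]]) (use le in auto)
  have sq: "square_integrable h" if "h \<in> borel_measurable borel" "\<And>a. cmod (h a) \<le> w a" for h
  proof -
    have [measurable]: "h \<in> borel_measurable borel" by fact
    have "integrable lborel (\<lambda>a. (cmod (h a))\<^sup>2)"
      by (rule Bochner_Integration.integrable_bound[OF w]) (auto intro!: power_mono that)
    then show ?thesis by (simp add: square_integrable_def)
  qed
  show sqf: "square_integrable (f n)" for n by (rule sq) (auto simp: le)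
  show sqg: "square_integrable g" by (rule sq) (auto simp: leg)
  have "(\<lambda>n. LINT a|lborel. (cmod (f n a - g a))\<^sup>2) \<longlonglongrightarrow> (LINT a|(lborel :: (real ^ 'n) measure). (0 :: real))"
  proof (rule integral_dominated_convergence)
    show "integrable lborel (\<lambda>a. 4 * (w a)\<^sup>2)" using w by simp
    show "AE a in lborel. (\<lambda>n. (cmod (f n a - g a))\<^sup>2) \<longlonglongrightarrow> 0"
    proof (rule AE_I2)
      fix a
      have "(\<lambda>n. (cmod (f n a - g a))\<^sup>2) \<longlonglongrightarrow> (cmod (g a - g a))\<^sup>2" by (intro tendsto_intros lim)
      then show "(\<lambda>n. (cmod (f n a - g a))\<^sup>2) \<longlonglongrightarrow> 0" by simp
    qed
    have "(cmod (f n a - g a))\<^sup>2 \<le> 4 * (w a)\<^sup>2" for n a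
    proof -
      have "cmod (f n a - g a) \<le> 2 * w a" using norm_triangle_ineq4[of "f n a" "g a"] le[of n a] leg[of a] by simp
      then have "(cmod (f n a - g a))\<^sup>2 \<le> (2 * w a)\<^sup>2" by (intro power_mono) auto
      then show ?thesis by simp
    qed
    then show "AE a in lborel. norm ((cmod (f n a - g a))\<^sup>2) \<le> 4 * (w a)\<^sup>2" for n by simp
  qed measurable
  moreover have "(norm (abs_l2 (f n) - abs_l2 g))\<^sup>2 = (LINT a|lborel. (cmod (f n a - g a))\<^sup>2)" for n
    unfolding minus_abs_l2[OF sqf sqg] by (intro norm_abs_l2_square square_integrable_diff sqf sqg)
  ultimately have "(\<lambda>n. (norm (abs_l2 (f n) - abs_l2 g))\<^sup>2) \<longlonglongrightarrow> 0" by simp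
  then have "(\<lambda>n. sqrt ((norm (abs_l2 (f n) - abs_l2 g))\<^sup>2)) \<longlonglongrightarrow> sqrt 0" by (rule tendsto_real_sqrt)
  then show "(\<lambda>n. abs_l2 (f n)) \<longlonglongrightarrow> abs_l2 g" by (simp add: tendsto_norm_zero_iff LIM_zero_iff)
qed

lemma LIMSEQ_difference_quotient:
  fixes f :: "real \<Rightarrow> complex"
  assumes "(f has_vector_derivative D) (at x)"
  shows "(\<lambda>n. of_nat (Suc n) * (f (x + 1 / real (Suc n)) - f x)) \<longlonglongrightarrow> D"
proof -
  have "((\<lambda>h. norm (f (x + h) - f x - h *\<^sub>R D) / norm h) \<longlongrightarrow> 0) (at 0)"
    using assms by (simp add: has_vector_derivative_def has_derivative_at)
  moreover have "filterlim (\<lambda>n. 1 / real (Suc n)) (at 0) sequentially"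
    using LIMSEQ_inverse_real_of_nat by (auto simp: filterlim_at inverse_eq_divide)
  ultimately have "(\<lambda>n. norm (f (x + 1 / real (Suc n)) - f x - (1 / real (Suc n)) *\<^sub>R D) / norm (1 / real (Suc n))) \<longlonglongrightarrow> 0"
    by (rule filterlim_compose)
  moreover have "norm (f (x + 1 / real (Suc n)) - f x - (1 / real (Suc n)) *\<^sub>R D) / norm (1 / real (Suc n))
     = norm (of_nat (Suc n) * (f (x + 1 / real (Suc n)) - f x) - D)" for n
  proof -
    have "of_nat (Suc n) * (f (x + 1 / real (Suc n)) - f x) - D
        = of_nat (Suc n) * (f (x + 1 / real (Suc n)) - f x - (1 / real (Suc n)) *\<^sub>R D)"
      by (simp add: scaleR_conv_of_real right_diff_distrib del: of_nat_Suc)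
    then show ?thesis by (simp only: norm_mult) (simp add: norm_divide del: of_nat_Suc)
  qed
  ultimately have "(\<lambda>n. norm (of_nat (Suc n) * (f (x + 1 / real (Suc n)) - f x) - D)) \<longlonglongrightarrow> 0" by simp
  then show ?thesis by (simp add: tendsto_norm_zero_iff LIM_zero_iff)
qed

lemma first_order_group_abs_l2:
  assumes "square_integrable u"
  shows "first_order_group \<kappa> e k s (abs_l2 u) = abs_l2 (\<lambda>a. exp (- \<i> * of_real (s * linform e a)) * u (a - axis k (\<kappa> * s)))"
proof -
  have b: "bounded_borel (\<lambda>a. exp (- \<i> * of_real (s * linform e a)))"
    by (rule bounded_borel_unimodular) auto
  show ?thesis
    unfolding first_order_group_def translate_def subst_op_abs_l2[OF scaling_translation assms]
    using square_integrable_subst(1)[OF scaling_translation assms, of "axis k (\<kappa> * s)"]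
    by (subst mulop_abs_l2[OF b]) auto
qed

text \<open>
  The difference quotients are dominated, uniformly in the step, by a fixed Gaussian \<open>w\<close>:
  the derivative along the group is the operator applied to a translate of \<open>u\<close>, and bounded
  translations of a function of Gaussian decay have a common Gaussian bound.
\<close>

lemma first_order_group_derivative:
  fixes u :: "real ^ 'n::finite \<Rightarrow> complex"
  assumes u: "u \<in> gaussian_domain" and e: "e k = 0"
  shows "(\<lambda>n. cscale (of_nat (Suc n)) (first_order_group \<kappa> e k (1 / real (Suc n)) (abs_l2 u) - abs_l2 u))
     \<longlonglongrightarrow> cscale \<i> (abs_l2 (first_order \<kappa> e k u))"
proof -
  define y where "y = first_order \<kappa> e k u"
  have y: "y \<in> gaussian_domain" unfolding y_def by (rule gaussian_domain_first_order(1)[OF u])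
  obtain D where D: "\<And>a. ((\<lambda>t. u (a + t *\<^sub>R axis k 1)) has_vector_derivative D a) (at 0)"
    using gaussian_domain_first_order(2)[OF u] by blast
  have yD: "y a = \<i> * of_real \<kappa> * D a - of_real (linform e a) * u a" for a
    unfolding y_def first_order_def by (simp add: vector_derivative_at[OF D])
  obtain C \<delta> where \<delta>: "\<delta> > 0" and C: "\<And>a. cmod (y a) \<le> C * exp (- \<delta> * (norm a)\<^sup>2)"
    using gauss_decay_gaussian_domain[OF y] by (auto simp: gauss_decay_def)
  have C0: "C \<ge> 0" using order_trans[OF norm_ge_zero C[of 0]] by simp
  define w where "w a = C * exp (\<delta> * \<kappa>\<^sup>2) * exp (- (\<delta> / 2) * (norm a)\<^sup>2)" for a :: "real ^ 'n"
  have yw: "cmod (y (a - axis k (\<kappa> * s))) \<le> w a" if "0 \<le> s" "s \<le> 1" for a s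
  proof -
    let ?b = "axis k (\<kappa> * s) :: real ^ 'n"
    have nb: "(norm ?b)\<^sup>2 \<le> \<kappa>\<^sup>2"
    proof -
      have "(norm ?b)\<^sup>2 = \<kappa>\<^sup>2 * s\<^sup>2" by (simp add: axis_scaleR[of k "\<kappa> * s"] power_mult_distrib)
      also have "\<dots> \<le> \<kappa>\<^sup>2 * 1" using that by (intro mult_left_mono) (auto simp: power_le_one)
      finally show ?thesis by simp
    qed
    have "norm a \<le> norm (a - ?b) + norm ?b" using norm_triangle_ineq[of "a - ?b" ?b] by simp
    then have "(norm a)\<^sup>2 \<le> (norm (a - ?b) + norm ?b)\<^sup>2" by (intro power_mono) auto
    also have "\<dots> \<le> 2 * (norm (a - ?b))\<^sup>2 + 2 * (norm ?b)\<^sup>2"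
      using sum_squares_bound[of "norm (a - ?b)" "norm ?b"] by (simp add: power2_sum)
    finally have "(norm a)\<^sup>2 / 2 - \<kappa>\<^sup>2 \<le> (norm (a - ?b))\<^sup>2" using nb by simp
    then have "- \<delta> * (norm (a - ?b))\<^sup>2 \<le> \<delta> * \<kappa>\<^sup>2 + - (\<delta> / 2) * (norm a)\<^sup>2"
      using mult_left_mono[of "(norm a)\<^sup>2 / 2 - \<kappa>\<^sup>2" "(norm (a - ?b))\<^sup>2" \<delta>] \<delta> by (simp add: algebra_simps)
    then have "C * exp (- \<delta> * (norm (a - ?b))\<^sup>2) \<le> C * exp (\<delta> * \<kappa>\<^sup>2 + - (\<delta> / 2) * (norm a)\<^sup>2)"
      using C0 by (intro mult_left_mono) auto
    then show ?thesis using C[of "a - ?b"] unfolding w_def exp_add by simp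
  qed
  define \<psi> where "\<psi> a s = exp (- \<i> * of_real (s * linform e a)) * u (a - axis k (\<kappa> * s))" for a s
  have lin: "linform e (a - axis k r) = linform e a" for a r
    using linform_translate[where e = e and k = k, OF e, of a "- r"] by (simp add: axis_scaleR[of k r])
  have d\<psi>: "(\<psi> a has_vector_derivative \<i> * exp (- \<i> * of_real (s * linform e a)) * y (a - axis k (\<kappa> * s))) (at s)" for a s
  proof -
    define b where "b = a - axis k (\<kappa> * s)"
    have ax: "b + (- (\<kappa> * (s' - s))) *\<^sub>R axis k 1 = a - axis k (\<kappa> * s')" for s'
      unfolding b_def axis_scaleR[of k "\<kappa> * s"] axis_scaleR[of k "\<kappa> * s'"] by (simp add: algebra_simps)
    have "((\<lambda>t. - (\<kappa> * (t - s))) has_vector_derivative - \<kappa>) (at s)"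
      by (auto intro!: derivative_eq_intros simp: has_real_derivative_iff_has_vector_derivative[symmetric])
    from vector_diff_chain_at[OF this, of "\<lambda>t. u (b + t *\<^sub>R axis k 1)" "D b"]
    have "((\<lambda>t. u (a - axis k (\<kappa> * t))) has_vector_derivative (- \<kappa>) *\<^sub>R D b) (at s)"
      using D[of b] by (simp add: comp_def ax del: scaleR_minus_left)
    moreover have "((\<lambda>t. exp (- \<i> * of_real (t * linform e a))) has_vector_derivative
        (- \<i> * of_real (linform e a)) * exp (- \<i> * of_real (s * linform e a))) (at s)"
    proof -
      have "((\<lambda>z. exp (- \<i> * (z * of_real (linform e a)))) has_field_derivative
         (- \<i> * of_real (linform e a)) * exp (- \<i> * (of_real s * of_real (linform e a)))) (at (of_real s))"
        by (auto intro!: derivative_eq_intros)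
      from has_vector_derivative_real_field[OF this] show ?thesis by simp
    qed
    ultimately have "(\<psi> a has_vector_derivative exp (- \<i> * of_real (s * linform e a)) * ((- \<kappa>) *\<^sub>R D b)
       + (- \<i> * of_real (linform e a)) * exp (- \<i> * of_real (s * linform e a)) * u b) (at s)"
      unfolding \<psi>_def b_def by (rule has_vector_derivative_mult[rotated])
    moreover have "exp (- \<i> * of_real (s * linform e a)) * ((- \<kappa>) *\<^sub>R D b)
       + (- \<i> * of_real (linform e a)) * exp (- \<i> * of_real (s * linform e a)) * u b
       = \<i> * exp (- \<i> * of_real (s * linform e a)) * y b"
      unfolding yD using lin[of a "\<kappa> * s"] by (simp add: b_def[symmetric] scaleR_conv_of_real algebra_simps)
    ultimately show ?thesis by (simp add: b_def)
  qed
  have bound: "cmod (\<psi> a s - \<psi> a 0) \<le> w a * s" if "0 < s" "s \<le> 1" for a s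
  proof -
    have "norm (\<psi> a s - \<psi> a 0) \<le> (\<lambda>s. w a * s) s - (\<lambda>s. w a * s) 0"
    proof (rule differentiable_bound_general[OF that(1)])
      show "continuous_on {0..s} (\<psi> a)"
        using d\<psi> by (intro continuous_at_imp_continuous_on ballI has_vector_derivative_continuous) blast
      show "continuous_on {0..s} (\<lambda>s. w a * s)" by (intro continuous_intros)
      show "(\<psi> a has_vector_derivative \<i> * exp (- \<i> * of_real (x * linform e a)) * y (a - axis k (\<kappa> * x))) (at x)" for x
        by (rule d\<psi>)
      show "((\<lambda>s. w a * s) has_vector_derivative w a) (at x)" for x
        by (auto intro!: derivative_eq_intros simp: has_real_derivative_iff_has_vector_derivative[symmetric])
      show "norm (\<i> * exp (- \<i> * of_real (x * linform e a)) * y (a - axis k (\<kappa> * x))) \<le> w a" if "0 < x" "x < s" for x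
        using yw[of x a] that \<open>s \<le> 1\<close> by (simp add: norm_mult)
    qed
    then show ?thesis by simp
  qed
  have su: "square_integrable u" by (rule gaussian_domain_square_integrable[OF u])
  have V: "first_order_group \<kappa> e k s (abs_l2 u) = abs_l2 (\<lambda>a. \<psi> a s)" for s
    unfolding \<psi>_def by (rule first_order_group_abs_l2[OF su])
  have sV: "square_integrable (\<lambda>a. \<psi> a s)" for s
    unfolding \<psi>_def by (rule gaussian_domain_square_integrable[OF gaussian_domain_group[OF u]])
  have axis0: "axis k 0 = (0 :: real ^ 'n)" using axis_scaleR[of k 0] by simp
  have \<psi>0: "\<psi> a 0 = u a" for a by (simp add: \<psi>_def axis0)
  define f where "f n a = of_nat (Suc n) * (\<psi> a (1 / real (Suc n)) - \<psi> a 0)" for n a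
  have eq: "cscale (of_nat (Suc n)) (first_order_group \<kappa> e k (1 / real (Suc n)) (abs_l2 u) - abs_l2 u) = abs_l2 (f n)" for n
    unfolding V f_def \<psi>0 minus_abs_l2[OF sV su] by (rule cscale_abs_l2[OF square_integrable_diff[OF sV su]])
  have sy: "square_integrable y" by (rule gaussian_domain_square_integrable[OF y])
  have meas: "(\<lambda>a. \<psi> a s) \<in> borel_measurable borel" for s using sV[of s] by (simp add: square_integrable_def)
  have "(\<lambda>n. abs_l2 (f n)) \<longlonglongrightarrow> abs_l2 (\<lambda>a. \<i> * y a)"
  proof (rule l2_tendsto_dominated(1)[where w = w])
    show "f n \<in> borel_measurable borel" for n unfolding f_def
      by (intro borel_measurable_times borel_measurable_diff meas borel_measurable_const)
    show "(\<lambda>a. \<i> * y a) \<in> borel_measurable borel"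
      using square_integrable_cmult[OF sy, of \<i>] by (simp add: square_integrable_def)
    have "(\<lambda>a :: real ^ 'n. (w a)\<^sup>2) = (\<lambda>a. (C * exp (\<delta> * \<kappa>\<^sup>2))\<^sup>2 * exp (- \<delta> * (norm a)\<^sup>2))"
      by (simp add: w_def fun_eq_iff power_mult_distrib flip: exp_of_nat_mult)
    then show "integrable lborel (\<lambda>a :: real ^ 'n. (w a)\<^sup>2)"
      using \<delta> by (simp only:) (intro integrable_mult_right integrable_exp_norm_square)
    show "cmod (f n a) \<le> w a" for n a
    proof -
      have "real (Suc n) * cmod (\<psi> a (1 / real (Suc n)) - \<psi> a 0) \<le> real (Suc n) * (w a * (1 / real (Suc n)))"
        by (intro mult_left_mono bound) auto
      also have "\<dots> = w a" by (simp del: of_nat_Suc)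
      finally show ?thesis unfolding f_def norm_mult norm_of_nat .
    qed
    show "(\<lambda>n. f n a) \<longlonglongrightarrow> \<i> * y a" for a
      using LIMSEQ_difference_quotient[OF d\<psi>[of a 0]] unfolding f_def by (simp add: axis0 del: of_nat_Suc)
  qed
  then show ?thesis unfolding eq y_def[symmetric] cscale_abs_l2[OF sy] .
qed

text \<open>
  Multiplication by \<open>exp(\<i> a\<^sub>k (e\<cdot>a) / \<kappa>)\<close> conjugates the group to pure translations along
  \<open>a\<^sub>k\<close>, since \<open>e\<cdot>a\<close> does not contain \<open>a\<^sub>k\<close>. The Fourier transform turns these into
  multiplications.
\<close>

theorem first_order_diagonalization:
  fixes e :: "'n::finite \<Rightarrow> real"
  assumes \<kappa>: "\<kappa> \<noteq> 0" and e: "e k = 0"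
  shows "\<exists>U :: 'n l2 \<Rightarrow> 'n l2. unitary U \<and>
     (\<forall>s F. U (first_order_group \<kappa> e k s F) = mulop (\<lambda>a. exp (\<i> * of_real (s * (- \<kappa> * a $ k)))) (U F))"
proof -
  obtain U0 :: "'n l2 \<Rightarrow> 'n l2" where U0: "unitary U0"
    "\<And>r F. U0 (translate (axis k r) F) = mulop (\<lambda>a. exp (- \<i> * of_real (r * a $ k))) (U0 F)"
    using fourier_unitary_exists by blast
  define p where "p a = exp (\<i> * of_real (a $ k * linform e a / \<kappa>))" for a :: "real ^ 'n"
  have pm [measurable]: "p \<in> borel_measurable borel" unfolding p_def by measurable
  have p1: "cmod (p a) = 1" for a by (simp add: p_def)
  have bp: "bounded_borel p" by (rule bounded_borel_unimodular) (auto simp: p1)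
  have U: "unitary (U0 \<circ> mulop p)" by (intro unitary_comp U0 unitary_mulop(1)) (auto simp: p1)
  moreover have "U0 (mulop p (first_order_group \<kappa> e k s F)) = mulop (\<lambda>a. exp (\<i> * of_real (s * (- \<kappa> * a $ k)))) (U0 (mulop p F))" for s F
  proof -
    have be: "bounded_borel (\<lambda>a. exp (- \<i> * of_real (s * linform e a)))"
      by (rule bounded_borel_unimodular) auto
    have shift: "p a * exp (- \<i> * of_real (s * linform e a)) = p (a - axis k (\<kappa> * s))" for a
    proof -
      have "linform e (a - axis k (\<kappa> * s)) = linform e a"
        using linform_translate[where e = e and k = k, OF e, of a "- (\<kappa> * s)"] by (simp add: axis_scaleR[of k "\<kappa> * s"])
      moreover have "(a - axis k (\<kappa> * s)) $ k = a $ k - \<kappa> * s" by (simp add: axis_def)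
      ultimately show ?thesis
        unfolding p_def exp_add[symmetric] using \<kappa> by (intro arg_cong[of _ _ exp]) (simp add: field_simps)
    qed
    have "mulop p (first_order_group \<kappa> e k s F) = translate (axis k (\<kappa> * s)) (mulop p F)"
      unfolding first_order_group_def mulop_mulop[OF bp be] shift translate_def
      by (rule subst_op_mulop[OF scaling_translation bp, symmetric])
    then show ?thesis by (simp add: U0(2) mult.assoc mult.left_commute)
  qed
  ultimately show ?thesis by (intro exI[of _ "U0 \<circ> mulop p"]) simp
qed

text \<open>
  Differentiating the group at \<open>0\<close> shows that the operator is contained in the
  multiplication operator. For uniqueness of the extension it suffices that the adjoint is
  also contained in it. If \<open>(F, G)\<close> is in the adjoint, testing with the whole orbit of \<open>u\<close>
  under the group, which stays in the domain, gives the vanishing of a characteristic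
  function in \<open>t\<close>; so the defect is zero on every set \<open>\<bar>m\<bar> \<le> N\<close>.
\<close>

theorem sa_operator_first_order:
  fixes e :: "'n::finite \<Rightarrow> real" and U :: "'n l2 \<Rightarrow> 'n l2"
  assumes e: "e k = 0" and U: "unitary U" and m [measurable]: "m \<in> borel_measurable borel"
    and diag: "\<And>s F. U (first_order_group \<kappa> e k s F) = mulop (\<lambda>a. exp (\<i> * of_real (s * m a))) (U F)"
  shows "sa_operator (first_order \<kappa> e k) = mult_graph U m"
proof -
  let ?L = "first_order \<kappa> e k"
  define A where "A = {(abs_l2 f, abs_l2 (?L f)) | f. f \<in> gaussian_domain}"
  have be: "bounded_borel (\<lambda>a. exp (\<i> * of_real (s * m a)))" for s :: real
    by (rule bounded_borel_unimodular) auto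
  have sub: "(abs_l2 u, abs_l2 (?L u)) \<in> mult_graph U m" if u: "u \<in> gaussian_domain" for u
  proof -
    define G where "G n = U (cscale (of_nat (Suc n)) (first_order_group \<kappa> e k (1 / real (Suc n)) (abs_l2 u) - abs_l2 u))" for n
    have lim: "G \<longlonglongrightarrow> U (cscale \<i> (abs_l2 (?L u)))"
      unfolding G_def by (rule bounded_linear.tendsto[OF unitary_bounded_linear[OF U] first_order_group_derivative[where e = e and k = k, OF u e]])
    have G: "AE a in lborel. rep_l2 (G n) a = of_nat (Suc n) * (exp (\<i> * of_real (1 / real (Suc n) * m a)) - 1) * rep_l2 (U (abs_l2 u)) a" for n
    proof -
      have G': "G n = cscale (of_nat (Suc n)) (mulop (\<lambda>a. exp (\<i> * of_real (1 / real (Suc n) * m a))) (U (abs_l2 u)) - U (abs_l2 u))"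
        unfolding G_def by (simp only: clinear_cscale[OF unitary_clinear[OF U]] clinear_diff[OF unitary_clinear[OF U]] diag)
      let ?X = "mulop (\<lambda>a. exp (\<i> * of_real (1 / real (Suc n) * m a))) (U (abs_l2 u))"
      show ?thesis unfolding G'
        using AE_rep_cscale[of "of_nat (Suc n)" "?X - U (abs_l2 u)"] AE_rep_minus[of ?X "U (abs_l2 u)"]
          AE_rep_mulop[OF be, of "1 / real (Suc n)" "U (abs_l2 u)"]
        by eventually_elim (simp only: mult.assoc left_diff_distrib mult_1_left)
    qed
    then have "AE a in lborel. \<forall>n. rep_l2 (G n) a = of_nat (Suc n) * (exp (\<i> * of_real (1 / real (Suc n) * m a)) - 1) * rep_l2 (U (abs_l2 u)) a"
      unfolding AE_all_countable by blast
    then have "AE a in lborel. (\<lambda>n. rep_l2 (G n) a) \<longlonglongrightarrow> \<i> * of_real (m a) * rep_l2 (U (abs_l2 u)) a"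
    proof eventually_elim
      case (elim a)
      have "((\<lambda>z. exp (\<i> * (z * of_real (m a)))) has_field_derivative \<i> * of_real (m a)) (at (of_real 0))"
        by (auto intro!: derivative_eq_intros)
      from LIMSEQ_difference_quotient[OF has_vector_derivative_real_field[OF this]]
      have "(\<lambda>n. of_nat (Suc n) * (exp (\<i> * of_real (1 / real (Suc n) * m a)) - 1)) \<longlonglongrightarrow> \<i> * of_real (m a)"
        by (simp del: of_nat_Suc)
      then show ?case unfolding elim[rule_format] by (rule tendsto_mult[OF _ tendsto_const])
    qed
    then have "AE a in lborel. rep_l2 (U (cscale \<i> (abs_l2 (?L u)))) a = \<i> * of_real (m a) * rep_l2 (U (abs_l2 u)) a"
      by (rule l2_tendsto_AE_limit[OF lim])
    then have "AE a in lborel. rep_l2 (U (abs_l2 (?L u))) a = of_real (m a) * rep_l2 (U (abs_l2 u)) a"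
      unfolding clinear_cscale[OF unitary_clinear[OF U]] using AE_rep_cscale[of \<i> "U (abs_l2 (?L u))"]
      by eventually_elim simp
    then show ?thesis by (simp add: mult_graph_def)
  qed
  have adj: "adjoint_graph A \<subseteq> mult_graph U m"
  proof
    fix q assume q: "q \<in> adjoint_graph A"
    obtain F G where FG: "q = (F, G)" by (cases q)
    have pair: "cinner (abs_l2 (?L u)) F = cinner (abs_l2 u) G" if "u \<in> gaussian_domain" for u
      using q that unfolding FG adjoint_graph_def A_def by auto
    have "AE a in lborel. \<bar>m a\<bar> \<le> real N \<longrightarrow> rep_l2 (U G) a = of_real (m a) * rep_l2 (U F) a" for N :: nat
    proof -
      define h where "h = (\<lambda>t :: real. indicator {- real N..real N} t :: complex)"
      define \<eta> where "\<eta> = (\<lambda>t :: real. of_real t * h t :: complex)"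
      have bh: "bounded_borel h" unfolding h_def by (rule indicator_bounded_borel) simp
      have b\<eta>: "bounded_borel \<eta>" unfolding \<eta>_def h_def
        by (rule bounded_borelI[of _ "real N"]) (auto simp: indicator_def)
      note bm = bounded_borel_m[OF m bh] bounded_borel_m[OF m b\<eta>]
      define D where "D = mulop (\<lambda>a. \<eta> (m a)) (U F) - mulop (\<lambda>a. h (m a)) (U G)"
      have AED: "AE a in lborel. rep_l2 D a = \<eta> (m a) * rep_l2 (U F) a - h (m a) * rep_l2 (U G) a"
        unfolding D_def
        using AE_rep_minus[of "mulop (\<lambda>a. \<eta> (m a)) (U F)" "mulop (\<lambda>a. h (m a)) (U G)"]
          AE_rep_mulop[OF bm(1), of "U G"] AE_rep_mulop[OF bm(2), of "U F"] by auto
      have orth: "cinner (U (abs_l2 u)) D = 0" if u: "u \<in> gaussian_domain" for u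
      proof -
        define v where "v = rep_l2 (U (abs_l2 u))"
        define \<Psi> where "\<Psi> a = cnj (of_real (m a) * v a) * rep_l2 (U F) a - cnj (v a) * rep_l2 (U G) a" for a
        have [measurable]: "v \<in> borel_measurable borel" by (simp add: v_def)
        have Lu: "AE a in lborel. rep_l2 (U (abs_l2 (?L u))) a = of_real (m a) * v a"
          using sub[OF u] by (simp add: mult_graph_def v_def)
        have int1: "integrable lborel (\<lambda>a. cnj (of_real (m a) * v a) * rep_l2 (U F) a)"
          by (rule integrable_cong_AE_imp[OF square_integrable_mult[OF square_integrable_rep_l2[of "U (abs_l2 (?L u))"]
                square_integrable_rep_l2[of "U F"]]]) (use Lu in auto)
        have int2: "integrable lborel (\<lambda>a. cnj (v a) * rep_l2 (U G) a)"
          unfolding v_def by (rule square_integrable_mult) auto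
        have int: "integrable lborel \<Psi>" unfolding \<Psi>_def by (rule Bochner_Integration.integrable_diff[OF int1 int2])
        have zero: "(LINT a|lborel. \<Psi> a * exp (\<i> * of_real (t * m a))) = 0" for t
        proof -
          \<comment> \<open>The function \<open>us\<close> represents \<open>V\<^sub>-\<^sub>t u\<close>; after diagonalization it carries the extra
            factor \<open>exp(-\<i> t m)\<close>.\<close>
          define us where "us a = exp (- \<i> * of_real ((- t) * linform e a)) * u (a - axis k (\<kappa> * (- t)))" for a
          have us: "us \<in> gaussian_domain" unfolding us_def by (rule gaussian_domain_group[OF u])
          have Uus: "AE a in lborel. rep_l2 (U (abs_l2 us)) a = exp (\<i> * of_real ((- t) * m a)) * v a"
            using AE_rep_mulop[OF be, of "- t" "U (abs_l2 u)"] diag[of "- t" "abs_l2 u"]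
            unfolding us_def first_order_group_abs_l2[OF gaussian_domain_square_integrable[OF u]] v_def by simp
          have ULus: "AE a in lborel. rep_l2 (U (abs_l2 (?L us))) a = of_real (m a) * (exp (\<i> * of_real ((- t) * m a)) * v a)"
            using sub[OF us] Uus unfolding mult_graph_def mem_Collect_eq prod.case by eventually_elim simp
          have c: "cnj (exp (\<i> * of_real ((- t) * x))) = exp (\<i> * of_real (t * x))" for x by (simp add: exp_cnj)
          have "0 = cinner (U (abs_l2 (?L us))) (U F) - cinner (U (abs_l2 us)) (U G)"
            using pair[OF us] by (simp add: unitary_cinner[OF U])
          also have "cinner (U (abs_l2 (?L us))) (U F) = (LINT a|lborel. cnj (of_real (m a) * v a) * rep_l2 (U F) a * exp (\<i> * of_real (t * m a)))"
            unfolding cinner_rep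
          proof (rule integral_cong_AE)
            show "AE a in lborel. cnj (rep_l2 (U (abs_l2 (?L us))) a) * rep_l2 (U F) a
                = cnj (of_real (m a) * v a) * rep_l2 (U F) a * exp (\<i> * of_real (t * m a))"
              using ULus by eventually_elim (simp only: complex_cnj_mult c mult_ac)
          qed measurable
          also have "cinner (U (abs_l2 us)) (U G) = (LINT a|lborel. cnj (v a) * rep_l2 (U G) a * exp (\<i> * of_real (t * m a)))"
            unfolding cinner_rep
          proof (rule integral_cong_AE)
            show "AE a in lborel. cnj (rep_l2 (U (abs_l2 us)) a) * rep_l2 (U G) a
                = cnj (v a) * rep_l2 (U G) a * exp (\<i> * of_real (t * m a))"
              using Uus by eventually_elim (simp only: complex_cnj_mult c mult_ac)
          qed measurable
          also have "(LINT a|lborel. cnj (of_real (m a) * v a) * rep_l2 (U F) a * exp (\<i> * of_real (t * m a)))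
             - (LINT a|lborel. cnj (v a) * rep_l2 (U G) a * exp (\<i> * of_real (t * m a)))
             = (LINT a|lborel. \<Psi> a * exp (\<i> * of_real (t * m a)))"
            unfolding \<Psi>_def left_diff_distrib
          proof (rule Bochner_Integration.integral_diff[symmetric])
            show "integrable lborel (\<lambda>a. cnj (of_real (m a) * v a) * rep_l2 (U F) a * exp (\<i> * of_real (t * m a)))"
              by (rule Bochner_Integration.integrable_bound[OF integrable_norm[OF int1]]) (auto simp: norm_mult)
            show "integrable lborel (\<lambda>a. cnj (v a) * rep_l2 (U G) a * exp (\<i> * of_real (t * m a)))"
              by (rule Bochner_Integration.integrable_bound[OF integrable_norm[OF int2]]) (auto simp: norm_mult)
          qed
          finally show ?thesis by simp
        qed
        have "(LINT a|lborel. \<Psi> a * indicator {- real N..real N} (m a)) = 0"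
          by (rule integral_indicator_eq_0_if_char[OF int _ zero]) auto
        moreover have "cinner (U (abs_l2 u)) D = (LINT a|lborel. \<Psi> a * indicator {- real N..real N} (m a))"
          unfolding cinner_rep
        proof (rule integral_cong_AE)
          show "AE a in lborel. cnj (rep_l2 (U (abs_l2 u)) a) * rep_l2 D a = \<Psi> a * indicator {- real N..real N} (m a)"
            using AED
          proof eventually_elim
            case (elim a)
            show ?case unfolding elim by (auto simp: \<Psi>_def \<eta>_def h_def v_def indicator_def algebra_simps)
          qed
        qed (auto simp: \<Psi>_def)
        ultimately show ?thesis by simp
      qed
      have "inv U D = 0"
      proof (rule eq_0_if_orthogonal_gauss)
        show "cinner (abs_l2 (gauss b)) (inv U D) = 0" for b
          using orth[OF gauss_in_gaussian_domain] by (simp add: cinner_inv_right[OF U])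
      qed
      then have "D = 0" using U clinear_zero[OF unitary_clinear[OF U]] by (metis unitary_inv_f)
      then have "AE a in lborel. rep_l2 D a = 0" using AE_rep_zero by simp
      with AED show ?thesis by eventually_elim (auto simp: \<eta>_def h_def indicator_def)
    qed
    then have "AE a in lborel. \<forall>N::nat. \<bar>m a\<bar> \<le> real N \<longrightarrow> rep_l2 (U G) a = of_real (m a) * rep_l2 (U F) a"
      unfolding AE_all_countable by blast
    then have "AE a in lborel. rep_l2 (U G) a = of_real (m a) * rep_l2 (U F) a"
      by eventually_elim (use real_arch_simple in blast)
    then show "q \<in> mult_graph U m" by (simp add: FG mult_graph_def)
  qed
  have AB: "A \<subseteq> mult_graph U m" using sub by (auto simp: A_def)
  have anti: "adjoint_graph Y \<subseteq> adjoint_graph X" if "X \<subseteq> Y" for X Y :: "('n l2 \<times> 'n l2) set"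
    using that unfolding adjoint_graph_def by blast
  note sa = self_adjoint_mult_graph[OF U m]
  have "sa_extension A = mult_graph U m"
    unfolding sa_extension_def
  proof (rule the_equality)
    show "A \<subseteq> mult_graph U m \<and> self_adjoint (mult_graph U m)" using AB sa by blast
    fix B assume B: "A \<subseteq> B \<and> self_adjoint B"
    \<comment> \<open>A self-adjoint extension \<open>B\<close> is its own adjoint, so it lies in the adjoint of \<open>A\<close>; and
      self-adjoint graphs cannot be properly contained in each other.\<close>
    then have "B \<subseteq> mult_graph U m" using anti[of A B] adj unfolding self_adjoint_def by blast
    moreover from this have "mult_graph U m \<subseteq> B" using anti[of B "mult_graph U m"] B sa unfolding self_adjoint_def by blast
    ultimately show "B = mult_graph U m" by blast
  qed
  then show ?thesis by (simp add: sa_operator_def A_def)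
qed

text \<open>
  From here on functions of first-order operators are accessible through the explicit groups
  alone.
\<close>

theorem functional_calculus_first_order:
  fixes e :: "'n::finite \<Rightarrow> real"
  assumes \<kappa>: "\<kappa> \<noteq> 0" and e: "e k = 0"
    and \<phi>: "\<phi> \<in> borel_measurable borel" "\<And>t. cmod (\<phi> t) = 1"
  shows "unitary (functional_calculus \<phi> (sa_operator (first_order \<kappa> e k)))"
    and "group_function (first_order_group \<kappa> e k) \<phi> (functional_calculus \<phi> (sa_operator (first_order \<kappa> e k)))"
proof -
  let ?m = "\<lambda>a :: real ^ 'n. - \<kappa> * a $ k"
  obtain U :: "'n l2 \<Rightarrow> 'n l2" where U: "unitary U"
    "\<And>s F. U (first_order_group \<kappa> e k s F) = mulop (\<lambda>a. exp (\<i> * of_real (s * ?m a))) (U F)"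
    using first_order_diagonalization[where e = e and k = k, OF assms(1,2)] by blast
  have m: "?m \<in> borel_measurable borel" by measurable
  have b: "bounded_borel \<phi>" by (rule bounded_borel_unimodular[OF \<phi>])
  have fc: "functional_calculus \<phi> (sa_operator (first_order \<kappa> e k)) = mult_calculus U ?m \<phi>"
    unfolding sa_operator_first_order[where e = e and k = k, OF e U(1) m U(2)] by (rule functional_calculus_mult_graph[OF U(1) m b])
  show "unitary (functional_calculus \<phi> (sa_operator (first_order \<kappa> e k)))"
    unfolding fc by (rule unitary_mult_calculus[OF U(1) m \<phi>])
  have "first_order_group \<kappa> e k s = mult_calculus U ?m (\<lambda>t. exp (\<i> * of_real (s * t)))" for s
  proof
    fix F
    have "mult_calculus U ?m (\<lambda>t. exp (\<i> * of_real (s * t))) F = inv U (U (first_order_group \<kappa> e k s F))"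
      unfolding mult_calculus_def U(2) ..
    then show "first_order_group \<kappa> e k s F = mult_calculus U ?m (\<lambda>t. exp (\<i> * of_real (s * t))) F"
      by (simp add: U(1))
  qed
  then show "group_function (first_order_group \<kappa> e k) \<phi> (functional_calculus \<phi> (sa_operator (first_order \<kappa> e k)))"
    unfolding fc by (rule group_function_mult_calculus[OF U(1) m b])
qed

section \<open>The quantum dilogarithm on the real line\<close>

lemma integrable_inverse_one_plus_square: "integrable lborel (\<lambda>x::real. inverse (1 + x\<^sup>2))"
  using integrable_inverse_1_plus_square by (simp add: set_integrable_def einterval_def)

text \<open>
  Translating the variable by \<open>\<pi> / v\<close> changes the sign of the exponential. Hence twice the
  integral is the integral of \<open>F\<close> minus a translate of \<open>F\<close> by a small amount, which tends to
  zero by dominated convergence.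
\<close>

lemma riemann_lebesgue_at_bot:
  fixes F :: "real \<Rightarrow> complex"
  assumes [measurable]: "F \<in> borel_measurable borel"
    and F: "\<And>p. cmod (F p) \<le> C * inverse (1 + p\<^sup>2)" and cont: "\<And>p. p \<noteq> r \<Longrightarrow> isCont F p"
    and v: "filterlim v at_bot sequentially"
  shows "(\<lambda>n. LINT p|lborel. exp (- \<i> * of_real p * of_real (v n)) * F p) \<longlonglongrightarrow> 0"
proof -
  \<comment> \<open>Half a period of the exponential.\<close>
  define \<epsilon> where "\<epsilon> n = pi / v n" for n
  define I where "I n = (LINT p|lborel. exp (- \<i> * of_real p * of_real (v n)) * F p)" for n
  have C0: "C \<ge> 0" using order_trans[OF norm_ge_zero F[of 0]] by simp
  have \<epsilon>: "\<epsilon> \<longlonglongrightarrow> 0"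
    unfolding \<epsilon>_def by (intro tendsto_divide_0[OF tendsto_const] filterlim_at_bot_imp_at_infinity v)
  have "\<forall>\<^sub>F n in sequentially. v n < 0" using v by (simp add: filterlim_at_bot_dense)
  moreover have "\<forall>\<^sub>F n in sequentially. \<bar>\<epsilon> n\<bar> < 1" using tendstoD[OF \<epsilon>, of 1] by (simp add: dist_real_def)
  ultimately have ev: "\<forall>\<^sub>F n in sequentially. v n < 0 \<and> \<bar>\<epsilon> n\<bar> < 1" by eventually_elim simp
  then obtain N where N: "\<And>n. n \<ge> N \<Longrightarrow> v n < 0 \<and> \<bar>\<epsilon> n\<bar> < 1" by (auto simp: eventually_sequentially)
  have dom: "integrable lborel (\<lambda>p :: real. 4 * C * inverse (1 + p\<^sup>2))"
    by (intro integrable_mult_right integrable_inverse_one_plus_square)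
  have intF: "integrable lborel F"
    by (rule Bochner_Integration.integrable_bound[OF dom])
       (use F C0 in \<open>auto intro!: AE_I2 order_trans[OF F] mult_right_mono simp: abs_mult\<close>)
  have int: "integrable lborel (\<lambda>p. exp (- \<i> * of_real p * of_real z) * F p)" for z
    by (rule Bochner_Integration.integrable_bound[OF integrable_norm[OF intF]]) (auto simp: norm_mult)
  have shift: "(LINT p|lborel. exp (- \<i> * of_real p * of_real (v n)) * F (p + \<epsilon> n)) = - I n" if "v n < 0" for n
  proof -
    have "I n = (LINT p|lborel. exp (- \<i> * of_real (\<epsilon> n + 1 * p) * of_real (v n)) * F (\<epsilon> n + 1 * p))"
      unfolding I_def by (subst lborel_integral_real_affine[of 1 _ "\<epsilon> n"]) auto
    also have "\<dots> = (LINT p|lborel. - (exp (- \<i> * of_real p * of_real (v n)) * F (p + \<epsilon> n)))"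
    proof (intro Bochner_Integration.integral_cong refl)
      fix p
      have "\<epsilon> n * v n = pi" using that by (simp add: \<epsilon>_def)
      then have "- \<i> * of_real (\<epsilon> n + 1 * p) * of_real (v n) = - \<i> * of_real p * of_real (v n) + - (\<i> * of_real pi)"
        by (simp add: algebra_simps flip: of_real_mult)
      then have "exp (- \<i> * of_real (\<epsilon> n + 1 * p) * of_real (v n)) = - exp (- \<i> * of_real p * of_real (v n))"
        by (simp only: exp_add) (simp add: exp_minus)
      then show "exp (- \<i> * of_real (\<epsilon> n + 1 * p) * of_real (v n)) * F (\<epsilon> n + 1 * p) = - (exp (- \<i> * of_real p * of_real (v n)) * F (p + \<epsilon> n))"
        by (simp add: add.commute)
    qed
    finally show ?thesis by simp
  qed
  have "(\<lambda>n. LINT p|lborel. exp (- \<i> * of_real p * of_real (v (n + N))) * (F p - F (p + \<epsilon> (n + N)))) \<longlonglongrightarrow> (LINT p|(lborel :: real measure). (0 :: complex))"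
  proof (rule integral_dominated_convergence[where w = "\<lambda>p. 4 * C * inverse (1 + p\<^sup>2)"])
    show "integrable lborel (\<lambda>p :: real. 4 * C * inverse (1 + p\<^sup>2))" by (rule dom)
    show "AE p in lborel. (\<lambda>n. exp (- \<i> * of_real p * of_real (v (n + N))) * (F p - F (p + \<epsilon> (n + N)))) \<longlonglongrightarrow> 0"
      using AE_lborel_singleton[of r]
    proof eventually_elim
      case (elim p)
      have "(\<lambda>n. p + \<epsilon> (n + N)) \<longlonglongrightarrow> p + 0" by (intro tendsto_intros LIMSEQ_ignore_initial_segment \<epsilon>)
      then have "(\<lambda>n. F (p + \<epsilon> (n + N))) \<longlonglongrightarrow> F p"
        using isCont_tendsto_compose[OF cont[OF elim]] by simp
      then have "(\<lambda>n. F p - F (p + \<epsilon> (n + N))) \<longlonglongrightarrow> F p - F p" by (intro tendsto_intros)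
      then have "(\<lambda>n. norm (F p - F (p + \<epsilon> (n + N)))) \<longlonglongrightarrow> 0" using tendsto_norm by fastforce
      then have "(\<lambda>n. norm (exp (- \<i> * of_real p * of_real (v (n + N))) * (F p - F (p + \<epsilon> (n + N))))) \<longlonglongrightarrow> 0"
        by (simp add: norm_mult)
      then show ?case by (rule tendsto_norm_zero_cancel)
    qed
    show "AE p in lborel. norm (exp (- \<i> * of_real p * of_real (v (n + N))) * (F p - F (p + \<epsilon> (n + N)))) \<le> 4 * C * inverse (1 + p\<^sup>2)" for n
    proof (rule AE_I2)
      fix p
      define q where "q = p + \<epsilon> (n + N)"
      have "\<bar>p - q\<bar> \<le> 1" using N[of "n + N"] by (simp add: q_def)
      have "1 + p\<^sup>2 \<le> 3 * (1 + q\<^sup>2)"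
      proof -
        have "(p - q)\<^sup>2 \<le> 1" using power_mono[OF \<open>\<bar>p - q\<bar> \<le> 1\<close>, of 2] by simp
        moreover have "p\<^sup>2 \<le> 2 * (p - q)\<^sup>2 + 2 * q\<^sup>2"
          using zero_le_power2[of "p - 2 * q"] by (simp add: power2_eq_square algebra_simps)
        ultimately have "1 + p\<^sup>2 \<le> 1 + (2 * 1 + 2 * q\<^sup>2)"
          by (intro add_left_mono) (meson add_right_mono mult_left_mono order_trans zero_le_numeral)
        also have "\<dots> \<le> 3 * (1 + q\<^sup>2)" by simp
        finally show ?thesis .
      qed
      then have "inverse (1 + q\<^sup>2) \<le> 3 * inverse (1 + p\<^sup>2)"
        by (simp add: field_simps add_pos_nonneg)
      then have "cmod (F q) \<le> C * (3 * inverse (1 + p\<^sup>2))"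
        using order_trans[OF F[of q] mult_left_mono[OF _ C0]] by blast
      then have "cmod (F p - F q) \<le> 4 * C * inverse (1 + p\<^sup>2)"
        using norm_triangle_ineq4[of "F p" "F q"] F[of p] by simp
      then show "norm (exp (- \<i> * of_real p * of_real (v (n + N))) * (F p - F (p + \<epsilon> (n + N)))) \<le> 4 * C * inverse (1 + p\<^sup>2)"
        by (simp add: norm_mult q_def)
    qed
  qed measurable
  moreover have "(LINT p|lborel. exp (- \<i> * of_real p * of_real (v (n + N))) * (F p - F (p + \<epsilon> (n + N)))) = 2 * I (n + N)" for n
  proof -
    have "integrable lborel (\<lambda>p. F (p + \<epsilon> (n + N)))"
      using lborel_integrable_real_affine[OF intF, of 1 "\<epsilon> (n + N)"] by (simp add: add.commute)
    then have int2: "integrable lborel (\<lambda>p. exp (- \<i> * of_real p * of_real (v (n + N))) * F (p + \<epsilon> (n + N)))"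
      by (rule Bochner_Integration.integrable_bound[OF integrable_norm]) (auto simp: norm_mult)
    have neg: "v (n + N) < 0" using N[of "n + N"] by simp
    have "(LINT p|lborel. exp (- \<i> * of_real p * of_real (v (n + N))) * (F p - F (p + \<epsilon> (n + N)))) = I (n + N) - (- I (n + N))"
      unfolding right_diff_distrib Bochner_Integration.integral_diff[OF int int2] shift[OF neg] I_def ..
    then show ?thesis by simp
  qed
  ultimately have "(\<lambda>n. 2 * I (n + N)) \<longlonglongrightarrow> 0" by simp
  then have "(\<lambda>n. (1 / 2) * (2 * I (n + N))) \<longlonglongrightarrow> (1 / 2) * 0" by (intro tendsto_intros)
  then have "(\<lambda>n. I (n + N)) \<longlonglongrightarrow> 0" by simp
  then have "I \<longlonglongrightarrow> 0" by (rule LIMSEQ_offset)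
  then show ?thesis by (simp add: I_def[abs_def])
qed

lemma sinh_of_real_complex: "sinh (complex_of_real x) = of_real (sinh x)"
  by (simp add: sinh_field_def exp_of_real flip: of_real_minus)

context
  fixes h :: real
  assumes h: "h > 0"
begin

private definition r where "r = min 1 (1 / h) / 2"

private definition den :: "complex \<Rightarrow> complex" where
  "den p = sinh (of_real pi * p) * sinh (of_real pi * of_real h * p) * p"

private definition G :: "real \<Rightarrow> real" where
  "G p = 1 / (sinh (pi * p) * sinh (pi * h * p) * p)"

private definition \<gamma> :: "real \<Rightarrow> complex" where "\<gamma> x = of_real r * exp (\<i> * of_real (pi * (1 - x)))"

text \<open>
  The integrand on the half circle in the parameter \<open>x\<close> from \<open>0\<close> to \<open>1\<close>, including the
  derivative of the parametrization \<open>\<gamma>\<close>.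
\<close>

private definition arc_fun :: "real \<Rightarrow> real \<Rightarrow> complex" where
  "arc_fun z x = exp (- \<i> * \<gamma> x * of_real z) * (- \<i> * of_real pi * \<gamma> x / den (\<gamma> x))"

private lemma r: "r > 0" "r < 1" "h * r < 1"
proof -
  show "r > 0" "r < 1" using h by (auto simp: r_def)
  have "h * r \<le> h * (1 / h / 2)" using h by (intro mult_left_mono) (auto simp: r_def)
  then show "h * r < 1" using h by simp
qed

text \<open>
  The zeros of \<open>w \<mapsto> sinh (\<pi> w)\<close> are the points \<open>\<i> n\<close> with \<open>n\<close> an integer.
\<close>

private lemma sinh_nonzero:
  assumes "w \<noteq> 0" "cmod w < 1"
  shows "sinh (of_real pi * w) \<noteq> 0"
proof
  assume "sinh (of_real pi * w) = 0"
  then have "exp (of_real pi * w) = exp (- (of_real pi * w))" by (simp add: sinh_field_def)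
  then have "exp (2 * (of_real pi * w)) = 1"
    by (metis add.right_inverse exp_add exp_zero mult_2)
  then obtain n :: int where n: "Re w = 0" "2 * (pi * Im w) = of_int (2 * n) * pi"
    by (auto simp: exp_eq_1)
  then have "Im w = of_int n" by simp
  moreover have "\<bar>Im w\<bar> < 1" using abs_Im_le_cmod[of w] assms(2) by simp
  ultimately have "Im w = 0" by simp
  then show False using n(1) assms(1) by (simp add: complex_eq_iff)
qed

private lemma norm_\<gamma>: "cmod (\<gamma> x) = r"
  using r(1) by (simp add: \<gamma>_def norm_mult)

private lemma den_\<gamma>: "den (\<gamma> x) \<noteq> 0"
proof -
  have "\<gamma> x \<noteq> 0" using norm_\<gamma>[of x] r(1) by auto
  moreover have "sinh (of_real pi * \<gamma> x) \<noteq> 0" using calculation norm_\<gamma>[of x] r(2) by (intro sinh_nonzero) auto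
  moreover have "sinh (of_real pi * (of_real h * \<gamma> x)) \<noteq> 0"
    using calculation(1) norm_\<gamma>[of x] r(3) h by (intro sinh_nonzero) (auto simp: norm_mult)
  ultimately show ?thesis by (simp add: den_def mult.assoc)
qed

private lemma G_odd: "G (- p) = - G p" by (simp add: G_def)

private lemma measurable_G [measurable]: "G \<in> borel_measurable borel"
proof -
  have [measurable]: "(sinh :: real \<Rightarrow> real) \<in> borel_measurable borel"
    by (intro borel_measurable_continuous_onI continuous_intros)
  show ?thesis unfolding G_def by measurable
qed

private lemma sinh_ge: "sinh x \<ge> x" if "x \<ge> 0" for x :: real
proof -
  have "sinh x - x \<ge> sinh 0 - (0::real)"
  proof (rule DERIV_nonneg_imp_nondecreasing[of 0 x "\<lambda>x. sinh x - x"])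
    fix y :: real
    have "((\<lambda>x. sinh x - x) has_real_derivative cosh y - 1) (at y)" by (auto intro!: derivative_eq_intros)
    moreover have "cosh y - 1 \<ge> 0" using cosh_real_ge_1[of y] by simp
    ultimately show "\<exists>d. ((\<lambda>x. sinh x - x) has_real_derivative d) (at y) \<and> 0 \<le> d" by blast
  qed (fact that)
  then show ?thesis by simp
qed

text \<open>
  The bound \<open>sinh x \<ge> x\<close> is sufficient: away from the origin it makes the integrand decay
  quadratically.
\<close>

private lemma G_bound: "\<exists>C. \<forall>p\<ge>r. \<bar>G p\<bar> \<le> C * inverse (1 + p\<^sup>2)"
proof -
  define C where "C = (1 + 1 / r\<^sup>2) / (pi\<^sup>2 * h * r)"
  have "\<bar>G p\<bar> \<le> C * inverse (1 + p\<^sup>2)" if p: "p \<ge> r" for p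
  proof -
    have p0: "p > 0" using p r(1) by simp
    have s: "sinh (pi * p) \<ge> pi * p" "sinh (pi * h * p) \<ge> pi * h * p"
      using p0 h by (intro sinh_ge; simp)+
    have "(pi * p) * (pi * h * p) * r \<le> sinh (pi * p) * sinh (pi * h * p) * p"
      using s p p0 h r(1) by (intro mult_mono mult_nonneg_nonneg order_trans[OF _ s(1)]) auto
    moreover have pos: "(pi * p) * (pi * h * p) * r > 0" using p0 h r(1) by simp
    ultimately have "\<bar>G p\<bar> \<le> 1 / ((pi * p) * (pi * h * p) * r)"
    proof -
      assume le: "(pi * p) * (pi * h * p) * r \<le> sinh (pi * p) * sinh (pi * h * p) * p"
      then have "\<bar>G p\<bar> = 1 / (sinh (pi * p) * sinh (pi * h * p) * p)"
        unfolding G_def using pos by (intro abs_of_nonneg) simp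
      also have "\<dots> \<le> 1 / ((pi * p) * (pi * h * p) * r)" by (rule frac_le) (use le pos in simp_all)
      finally show ?thesis .
    qed
    also have "\<dots> \<le> C * inverse (1 + p\<^sup>2)"
    proof -
      have "1 \<le> p\<^sup>2 / r\<^sup>2" using p r(1) by (simp add: power_mono)
      then have "1 + p\<^sup>2 \<le> (1 + 1 / r\<^sup>2) * p\<^sup>2" by (simp add: algebra_simps)
      then have "(1 + p\<^sup>2) / p\<^sup>2 \<le> 1 + 1 / r\<^sup>2" using p0 by (simp add: divide_le_eq)
      then have "(1 + p\<^sup>2) / p\<^sup>2 / (pi\<^sup>2 * h * r) \<le> C" unfolding C_def using h r(1) by (intro divide_right_mono) auto
      then have "(1 + p\<^sup>2) / p\<^sup>2 / (pi\<^sup>2 * h * r) * inverse (1 + p\<^sup>2) \<le> C * inverse (1 + p\<^sup>2)"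
        by (rule mult_right_mono) simp
      moreover have "(1 + p\<^sup>2) / p\<^sup>2 / (pi\<^sup>2 * h * r) * inverse (1 + p\<^sup>2) = 1 / ((pi * p) * (pi * h * p) * r)"
      proof -
        have "1 + p\<^sup>2 \<noteq> 0" using zero_le_power2[of p] by linarith
        then show ?thesis by (simp add: divide_simps power2_eq_square mult_ac)
      qed
      ultimately show ?thesis by simp
    qed
    finally show ?thesis .
  qed
  then show ?thesis by blast
qed

private definition F :: "real \<Rightarrow> complex" where "F p = indicator {r..} p * of_real (G p)"

private lemma F_measurable [measurable]: "F \<in> borel_measurable borel"
  unfolding F_def by measurable

private lemma F_bound: "\<exists>C. \<forall>p. cmod (F p) \<le> C * inverse (1 + p\<^sup>2)"
proof -
  obtain C where C: "\<And>p. p \<ge> r \<Longrightarrow> \<bar>G p\<bar> \<le> C * inverse (1 + p\<^sup>2)" using G_bound by blast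
  have "C * inverse (1 + r\<^sup>2) \<ge> 0" using C[of r] by simp
  then have "C \<ge> 0" by (simp add: zero_le_mult_iff add_nonneg_pos add_pos_nonneg) (meson add_pos_nonneg inverse_nonnegative_iff_nonnegative le_less_trans not_less zero_le_power2 zero_less_one order.trans less_imp_le)
  then have "cmod (F p) \<le> C * inverse (1 + p\<^sup>2)" for p
    using C[of p] by (auto simp: F_def indicator_def norm_mult)
  then show ?thesis by blast
qed

private lemma F_cont: "p \<noteq> r \<Longrightarrow> isCont F p"
proof -
  assume "p \<noteq> r"
  then consider "p < r" | "p > r" by linarith
  then show ?thesis
  proof cases
    case 1
    have "\<forall>\<^sub>F q in nhds p. F q = 0"
      using eventually_nhds_in_open[of "{..<r}" p] 1 by (auto simp: F_def elim!: eventually_mono)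
    then show ?thesis by (subst isCont_cong[of F "\<lambda>_. 0"]) auto
  next
    case 2
    have "\<forall>\<^sub>F q in nhds p. F q = of_real (G q)"
      using eventually_nhds_in_open[of "{r<..}" p] 2 by (auto simp: F_def elim!: eventually_mono)
    moreover have "isCont (\<lambda>q. complex_of_real (G q)) p"
    proof -
      have "p > 0" using 2 r(1) by simp
      then show ?thesis unfolding G_def using h by (intro continuous_intros) auto
    qed
    ultimately show ?thesis by (subst isCont_cong[of F "\<lambda>q. of_real (G q)"]) auto
  qed
qed

private lemma dilog_integrand_real:
  "dilog_integrand h z (of_real p) = exp (- \<i> * of_real p * of_real z) * of_real (G p)"
proof -
  have "sinh (of_real pi * complex_of_real p) = of_real (sinh (pi * p))"
    "sinh (of_real pi * of_real h * complex_of_real p) = of_real (sinh (pi * h * p))"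
    using sinh_of_real_complex[of "pi * p"] sinh_of_real_complex[of "pi * h * p"] by simp_all
  then show ?thesis by (simp add: dilog_integrand_def G_def)
qed

private definition J :: "real \<Rightarrow> complex" where
  "J z = (LINT p|lborel. exp (- \<i> * of_real p * of_real z) * F p)"

private lemma right_part: "(LINT p:{r..}|lborel. dilog_integrand h z (of_real p)) = J z"
  unfolding set_lebesgue_integral_def J_def dilog_integrand_real
  by (intro Bochner_Integration.integral_cong) (auto simp: F_def indicator_def)

text \<open>
  \<open>G\<close> is odd, so reflection relates the two unbounded parts of the contour.
\<close>

private lemma left_part: "(LINT p:{..-r}|lborel. dilog_integrand h z (of_real p)) = - J (- z)"
proof -
  have "(LINT p:{..-r}|lborel. dilog_integrand h z (of_real p))
      = (LINT p|lborel. indicator {..-r} p *\<^sub>R dilog_integrand h z (of_real p))"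
    by (simp add: set_lebesgue_integral_def)
  also have "\<dots> = (LINT p|lborel. indicator {..-r} (0 + (-1) * p) *\<^sub>R dilog_integrand h z (of_real (0 + (-1) * p)))"
    by (subst lborel_integral_real_affine[of "-1" _ 0]) auto
  also have "\<dots> = (LINT p|lborel. - (exp (- \<i> * of_real p * of_real (- z)) * F p))"
    by (intro Bochner_Integration.integral_cong)
       (auto simp: F_def indicator_def dilog_integrand_real[of z "- _", simplified] G_odd)
  also have "\<dots> = - J (- z)" by (simp add: J_def)
  finally show ?thesis .
qed

private lemma arc_part: "contour_integral (part_circlepath 0 r pi 0) (dilog_integrand h z) = integral {0..1} (arc_fun z)"
  unfolding contour_integral_integral
proof (rule integral_cong)
  fix x :: real assume x: "x \<in> {0..1}"
  have p: "part_circlepath 0 r pi 0 x = \<gamma> x"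
    by (simp add: part_circlepath_def \<gamma>_def linepath_def algebra_simps)
  have "vector_derivative (part_circlepath 0 r pi 0) (at x) = - \<i> * of_real pi * \<gamma> x"
    using x by (simp add: vector_derivative_part_circlepath \<gamma>_def linepath_def algebra_simps)
  then show "dilog_integrand h z (part_circlepath 0 r pi 0 x) * vector_derivative (part_circlepath 0 r pi 0) (at x) = arc_fun z x"
    unfolding p arc_fun_def dilog_integrand_def den_def by simp
qed

private lemma dilog_integral_eq: "dilog_integral h z = - J (- z) + integral {0..1} (arc_fun z) + J z"
  unfolding dilog_integral_def Let_def r_def[symmetric] left_part right_part arc_part ..

private lemma arc_continuous: "continuous_on (UNIV \<times> {0..1}) (\<lambda>(z, x). arc_fun z x)"
proof -
  have c\<gamma>: "continuous_on (UNIV \<times> {0..1}) (\<lambda>q :: real \<times> real. \<gamma> (snd q))"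
    unfolding \<gamma>_def by (intro continuous_intros)
  have cd: "continuous_on UNIV den" unfolding den_def sinh_field_def by (intro continuous_intros) auto
  have "continuous_on (UNIV \<times> {0..1}) (\<lambda>q :: real \<times> real. den (\<gamma> (snd q)))"
    by (rule continuous_on_compose2[OF cd c\<gamma>]) auto
  then show ?thesis
    unfolding arc_fun_def split_beta using c\<gamma> den_\<gamma> by (intro continuous_intros) auto
qed

private lemma arc_continuous1: "continuous_on {0..1} (arc_fun z)"
proof -
  have "continuous_on {0..1} (\<lambda>x. (\<lambda>(z, x). arc_fun z x) (z, x))"
    by (rule continuous_on_compose2[OF arc_continuous]) (auto intro!: continuous_intros)
  then show ?thesis by simp
qed

text \<open>
  In the open upper half plane \<open>exp(-\<i> p z)\<close> decays as \<open>z \<rightarrow> -\<infinity>\<close>. This is where it matters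
  that the contour passes above the origin.
\<close>

private lemma arc_integral_tendsto:
  assumes v: "filterlim v at_bot sequentially"
  shows "(\<lambda>n. integral {0..1} (arc_fun (v n))) \<longlonglongrightarrow> 0"
proof -
  have "\<forall>\<^sub>F n in sequentially. v n < 0" using v by (simp add: filterlim_at_bot_dense)
  then obtain N where N: "\<And>n. n \<ge> N \<Longrightarrow> v n < 0" by (auto simp: eventually_sequentially)
  have "bounded (arc_fun 0 ` {0..1})"
    by (intro compact_imp_bounded compact_continuous_image arc_continuous1) auto
  then obtain B where "\<forall>y\<in>arc_fun 0 ` {0..1}. cmod y \<le> B" unfolding bounded_iff by blast
  then have B: "cmod (arc_fun 0 x) \<le> B" if "x \<in> {0..1}" for x using that by blast
  have arc_fun: "cmod (arc_fun z x) = exp (r * sin (pi * (1 - x)) * z) * cmod (arc_fun 0 x)" for z x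
  proof -
    have "Re (- \<i> * \<gamma> x * of_real z) = r * sin (pi * (1 - x)) * z"
      by (simp add: \<gamma>_def Im_exp)
    moreover have "arc_fun z x = exp (- \<i> * \<gamma> x * of_real z) * arc_fun 0 x" by (simp add: arc_fun_def)
    ultimately show ?thesis by (simp only: norm_mult norm_exp_eq_Re)
  qed
  have sin: "sin (pi * (1 - x)) > 0" if "x \<in> {0<..<1}" for x :: real
    using that by (intro sin_gt_zero) auto
  have "(\<lambda>n. integral {0<..<1} (arc_fun (v (n + N)))) \<longlonglongrightarrow> integral {0<..<1} (\<lambda>_::real. 0 :: complex)"
  proof (rule dominated_convergence(2)[where h = "\<lambda>_. B"])
    show "arc_fun (v (n + N)) integrable_on {0<..<1}" for n
      unfolding integrable_on_open_interval_real by (intro integrable_continuous_real arc_continuous1)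
    show "(\<lambda>_. B) integrable_on {0<..<1::real}"
      unfolding integrable_on_open_interval_real by (intro integrable_continuous_real continuous_intros)
    fix n :: nat and x :: real assume x: "x \<in> {0<..<1}"
    have "exp (r * sin (pi * (1 - x)) * v (n + N)) \<le> 1"
      using sin[OF x] r(1) N[of "n + N"] by (simp add: mult_nonneg_nonpos)
    then have "cmod (arc_fun (v (n + N)) x) \<le> 1 * B"
      unfolding arc_fun[of "v (n + N)" x] using B[of x] x by (intro mult_mono) auto
    then show "cmod (arc_fun (v (n + N)) x) \<le> B" by simp
  next
    fix x :: real assume x: "x \<in> {0<..<1}"
    have "filterlim (\<lambda>n. (r * sin (pi * (1 - x))) * v (n + N)) at_bot sequentially"
    proof (rule filterlim_tendsto_pos_mult_at_bot[OF tendsto_const])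
      show "filterlim (\<lambda>n. v (n + N)) at_bot sequentially"
        by (rule filterlim_compose[OF v filterlim_add_const_nat_at_top])
    qed (use sin[OF x] r(1) in simp)
    then have "(\<lambda>n. exp ((r * sin (pi * (1 - x))) * v (n + N))) \<longlonglongrightarrow> 0"
      by (rule filterlim_compose[OF exp_at_bot])
    then have "(\<lambda>n. exp (r * sin (pi * (1 - x)) * v (n + N)) * cmod (arc_fun 0 x)) \<longlonglongrightarrow> 0 * cmod (arc_fun 0 x)"
      by (intro tendsto_mult tendsto_const)
    moreover have "(\<lambda>n. cmod (arc_fun (v (n + N)) x)) = (\<lambda>n. exp (r * sin (pi * (1 - x)) * v (n + N)) * cmod (arc_fun 0 x))"
      by (intro ext arc_fun)
    ultimately have "(\<lambda>n. cmod (arc_fun (v (n + N)) x)) \<longlonglongrightarrow> 0" by (simp only: mult_zero_left)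
    then show "(\<lambda>n. arc_fun (v (n + N)) x) \<longlonglongrightarrow> 0" by (rule tendsto_norm_zero_cancel)
  qed
  then have "(\<lambda>n. integral {0..1} (arc_fun (v (n + N)))) \<longlonglongrightarrow> 0"
    by (simp add: integral_open_interval_real)
  then show ?thesis by (rule LIMSEQ_offset)
qed

text \<open>
  The contour integral consists of two rays, which tend to zero by the Riemann--Lebesgue
  lemma, and the arc.
\<close>

lemma quantum_dilog_tendsto_1:
  assumes v: "filterlim v at_bot sequentially"
  shows "(\<lambda>n. quantum_dilog h (v n)) \<longlonglongrightarrow> 1"
proof -
  obtain C where C: "\<And>p. cmod (F p) \<le> C * inverse (1 + p\<^sup>2)" using F_bound by blast
  have J: "(\<lambda>n. J (v n)) \<longlonglongrightarrow> 0"
    unfolding J_def by (rule riemann_lebesgue_at_bot[OF F_measurable C F_cont v])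
  have cnjJ: "cnj (J z) = J (- z)" for z
    unfolding J_def Bochner_Integration.integral_cnj[symmetric]
    by (intro Bochner_Integration.integral_cong) (auto simp: exp_cnj F_def indicator_def)
  have "(\<lambda>n. cnj (J (v n))) \<longlonglongrightarrow> cnj 0" by (intro tendsto_cnj J)
  then have "(\<lambda>n. J (- v n)) \<longlonglongrightarrow> 0" by (simp add: cnjJ)
  then have "(\<lambda>n. dilog_integral h (v n)) \<longlonglongrightarrow> - 0 + 0 + 0"
    unfolding dilog_integral_eq by (intro tendsto_intros J arc_integral_tendsto v)
  then have "(\<lambda>n. exp (- 1 / 4 * dilog_integral h (v n))) \<longlonglongrightarrow> exp (- 1 / 4 * 0)"
    by (intro tendsto_intros) simp
  then show ?thesis by (simp add: quantum_dilog_def)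
qed

lemma measurable_quantum_dilog [measurable]: "quantum_dilog h \<in> borel_measurable borel"
proof -
  have "J \<in> borel_measurable borel" unfolding J_def by measurable
  moreover have "(\<lambda>z. integral {0..1} (arc_fun z)) \<in> borel_measurable borel"
    using integral_continuous_on_param[of UNIV 0 1 arc_fun] arc_continuous
    by (intro borel_measurable_continuous_onI) simp
  ultimately show ?thesis unfolding quantum_dilog_def dilog_integral_eq by measurable
qed

text \<open>
  The contour is symmetric under \<open>p \<mapsto> -cnj p\<close>, and this symmetry makes the contour integral
  purely imaginary.
\<close>

lemma cmod_quantum_dilog: "cmod (quantum_dilog h z) = 1"
proof -
  have cnjJ: "cnj (J z) = J (- z)" for z
    unfolding J_def Bochner_Integration.integral_cnj[symmetric]
    by (intro Bochner_Integration.integral_cong) (auto simp: exp_cnj F_def indicator_def)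
  have "Re (J z) = Re (J (- z))" unfolding cnjJ[symmetric] by simp
  \<comment> \<open>The symmetry acts on the arc by \<open>x \<mapsto> 1 - x\<close>.\<close>
  moreover have "Re (integral {0..1} (arc_fun z)) = 0"
  proof -
    define K where "K = integral {0..1} (arc_fun z)"
    have g1: "\<gamma> (1 - x) = - cnj (\<gamma> x)" for x
    proof -
      have "exp (\<i> * of_real (pi * x)) = exp (\<i> * of_real pi + cnj (\<i> * of_real (pi * (1 - x))))"
        by (rule arg_cong[of _ _ exp]) (simp add: algebra_simps)
      also have "\<dots> = - cnj (exp (\<i> * of_real (pi * (1 - x))))" unfolding exp_add exp_cnj by simp
      finally show ?thesis by (simp add: \<gamma>_def)
    qed
    have d1: "den (- cnj w) = - cnj (den w)" for w
    proof -
      have c: "cnj (sinh u) = sinh (cnj u)" for u by (simp add: sinh_field_def exp_cnj)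
      show ?thesis unfolding den_def complex_cnj_mult c by simp
    qed
    have "arc_fun z (1 - x) = - cnj (arc_fun z x)" for x
      unfolding arc_fun_def g1 d1 by (simp add: exp_cnj)
    then have sym: "arc_fun z ((-1) *\<^sub>R x + 1) = - cnj (arc_fun z x)" for x by simp
    have "(arc_fun z has_integral K) (cbox 0 1)"
      unfolding K_def using integrable_continuous_real[OF arc_continuous1, of z] by (simp add: integrable_integral)
    from has_integral_affinity[OF this, of "-1" 1]
    have "((\<lambda>x. - cnj (arc_fun z x)) has_integral K) ((\<lambda>x. - x + 1) ` {0..1})"
      unfolding sym by simp
    moreover have "(\<lambda>x. - x + 1) ` {0..1} = {0..1::real}"
      by (auto simp: image_iff intro!: bexI[of _ "1 - _"])
    moreover have "((\<lambda>x. - cnj (arc_fun z x)) has_integral - cnj K) {0..1}"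
      using has_integral_neg[OF has_integral_cnj[THEN iffD2, OF \<open>(arc_fun z has_integral K) (cbox 0 1)\<close>]] by simp
    ultimately have "K = - cnj K" using has_integral_unique by (metis (no_types, lifting))
    then have "Re K = - Re K" by (metis cnj.sel(1) uminus_complex.sel(1))
    then show ?thesis by (simp add: K_def)
  qed
  ultimately have "Re (dilog_integral h z) = 0" by (simp add: dilog_integral_eq)
  then show ?thesis by (simp add: quantum_dilog_def)
qed

end

section \<open>Volume-preserving and diagonal substitutions\<close>

text \<open>
  Fubini's theorem for one coordinate and the remaining ones.
\<close>

lemma nn_integral_lborel_axis:
  fixes f :: "real ^ 'n::finite \<Rightarrow> ennreal" and k :: 'n
  assumes [measurable]: "f \<in> borel_measurable borel"
  shows "(\<integral>\<^sup>+a. f a \<partial>lborel) = (\<integral>\<^sup>+x. (\<integral>\<^sup>+y. f ((\<Sum>b\<in>Basis - {axis k 1}. x b *\<^sub>R b) + y *\<^sub>R axis k 1) \<partial>lborel)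
     \<partial>(\<Pi>\<^sub>M b\<in>Basis - {axis k 1 :: real ^ 'n}. lborel))"
proof -
  interpret P: product_sigma_finite "\<lambda>_ :: real ^ 'n. lborel :: real measure" by standard
  let ?b = "axis k 1 :: real ^ 'n"
  have b: "?b \<in> Basis" by (auto simp: Basis_vec_def)
  have ins: "Basis = insert ?b (Basis - {?b})" using b by auto
  have S: "(\<Sum>b\<in>Basis. (x(?b := y)) b *\<^sub>R b) = (\<Sum>b\<in>Basis - {?b}. x b *\<^sub>R b) + y *\<^sub>R ?b" for x y
  proof -
    have "(\<Sum>b\<in>Basis. (x(?b := y)) b *\<^sub>R b) = y *\<^sub>R ?b + (\<Sum>b\<in>Basis - {?b}. (x(?b := y)) b *\<^sub>R b)"
      using b by (subst sum.remove[of _ ?b]) auto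
    also have "(\<Sum>b\<in>Basis - {?b}. (x(?b := y)) b *\<^sub>R b) = (\<Sum>b\<in>Basis - {?b}. x b *\<^sub>R b)"
      by (intro sum.cong) auto
    finally show ?thesis by (simp add: add.commute)
  qed
  have "(\<integral>\<^sup>+a. f a \<partial>lborel) = (\<integral>\<^sup>+x. f (\<Sum>b\<in>Basis. x b *\<^sub>R b) \<partial>(\<Pi>\<^sub>M b\<in>Basis. lborel))"
    by (subst lborel_eq) (simp add: nn_integral_distr)
  also have "\<dots> = (\<integral>\<^sup>+x. f (\<Sum>b\<in>Basis. x b *\<^sub>R b) \<partial>(\<Pi>\<^sub>M b\<in>insert ?b (Basis - {?b}). lborel))"
    using ins by simp
  also have "\<dots> = (\<integral>\<^sup>+x. (\<integral>\<^sup>+y. f (\<Sum>b\<in>Basis. (x(?b := y)) b *\<^sub>R b) \<partial>lborel) \<partial>(\<Pi>\<^sub>M b\<in>Basis - {?b}. lborel))"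
  proof (rule P.product_nn_integral_insert)
    show "(\<lambda>x. f (\<Sum>b\<in>Basis. x b *\<^sub>R b)) \<in> borel_measurable (\<Pi>\<^sub>M b\<in>insert ?b (Basis - {?b}). lborel)"
      unfolding ins[symmetric] by measurable
  qed auto
  finally show ?thesis by (simp only: S)
qed

text \<open>
  On each line parallel to the \<open>k\<close>-th axis the map is a reflection at a point that depends
  on the line only.
\<close>

lemma scaling_reflection:
  fixes g :: "real ^ 'n::finite \<Rightarrow> real"
  assumes [measurable]: "A \<in> borel_measurable borel"
    and A: "\<And>a. A a = (\<chi> i. if i = k then - (a $ k) + g a else a $ i)" and g: "\<And>a y. g (a + y *\<^sub>R axis k 1) = g a"
  shows "scaling 1 A"
proof -
  have "distr lborel borel A = lborel"
  proof (rule measure_eqI)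
    fix B assume "B \<in> sets (distr lborel borel A)"
    then have [measurable]: "B \<in> sets borel" by simp
    let ?R = "\<lambda>x. \<Sum>b\<in>Basis - {axis k 1}. x b *\<^sub>R b :: real ^ 'n"
    have R: "?R x $ k = 0" for x
    proof -
      have bk: "b $ k = 0" if "b \<in> Basis - {axis k 1}" for b :: "real ^ 'n"
        using that by (auto simp: Basis_vec_def axis_def)
      have "?R x $ k = (\<Sum>b\<in>Basis - {axis k 1}. (x b *\<^sub>R b) $ k)" by (rule sum_component)
      also have "\<dots> = 0"
      proof (rule sum.neutral, rule ballI)
        fix b :: "real ^ 'n" assume "b \<in> Basis - {axis k 1}"
        then have "b $ k = 0" by (rule bk)
        then show "(x b *\<^sub>R b) $ k = 0" by simp
      qed
      finally show ?thesis .
    qed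
    have AR: "A (?R x + y *\<^sub>R axis k 1) = ?R x + (g (?R x) + (-1) * y) *\<^sub>R axis k 1" for x y
    proof -
      have "A (r + y *\<^sub>R axis k 1) = r + (g r + (-1) * y) *\<^sub>R axis k 1" if "r $ k = 0" for r
        unfolding A g using that by (auto simp: vec_eq_iff axis_def)
      then show ?thesis using R .
    qed
    have "emeasure (distr lborel borel A) B = (\<integral>\<^sup>+a. indicator B (A a) \<partial>lborel)"
    proof -
      have "emeasure (distr lborel borel A) B = (\<integral>\<^sup>+a. indicator B a \<partial>distr lborel borel A)"
        by (rule nn_integral_indicator[symmetric]) simp
      also have "\<dots> = (\<integral>\<^sup>+a. indicator B (A a) \<partial>lborel)"
        by (rule nn_integral_distr) measurable
      finally show ?thesis .
    qed
    also have "\<dots> = (\<integral>\<^sup>+x. (\<integral>\<^sup>+y. indicator B (?R x + (g (?R x) + (-1) * y) *\<^sub>R axis k 1) \<partial>lborel)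
        \<partial>(\<Pi>\<^sub>M b\<in>Basis - {axis k 1 :: real ^ 'n}. lborel))"
      by (subst nn_integral_lborel_axis[of _ k]) (simp_all only: AR, measurable)
    also have "\<dots> = (\<integral>\<^sup>+x. (\<integral>\<^sup>+y. indicator B (?R x + y *\<^sub>R axis k 1) \<partial>lborel)
        \<partial>(\<Pi>\<^sub>M b\<in>Basis - {axis k 1 :: real ^ 'n}. lborel))"
    proof (rule nn_integral_cong)
      fix x
      have [measurable]: "(\<lambda>y. indicator B (?R x + y *\<^sub>R axis k 1) :: ennreal) \<in> borel_measurable borel"
        by measurable
      show "(\<integral>\<^sup>+y. indicator B (?R x + (g (?R x) + (-1) * y) *\<^sub>R axis k 1) \<partial>lborel) = (\<integral>\<^sup>+y. indicator B (?R x + y *\<^sub>R axis k 1) \<partial>lborel)"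
        by (subst (2) nn_integral_real_affine[of _ "-1" "g (?R x)"]) simp_all
    qed
    also have "\<dots> = (\<integral>\<^sup>+a. indicator B a \<partial>lborel)"
      by (rule nn_integral_lborel_axis[symmetric]) measurable
    finally show "emeasure (distr lborel borel A) B = emeasure lborel B" by simp
  qed simp
  then show ?thesis by (simp add: scaling_def density_1 flip: one_ennreal_def)
qed

lemma scaling_diagonal:
  fixes c :: "'n::finite \<Rightarrow> real"
  assumes c: "\<And>i. c i \<noteq> 0"
  shows "scaling (1 / (\<Prod>i\<in>UNIV. \<bar>c i\<bar>)) (\<lambda>a. \<chi> i. c i * a $ i)"
proof -
  let ?A = "\<lambda>a :: real ^ 'n. \<chi> i. c i * a $ i"
  define k where "k = (\<Prod>i\<in>UNIV. \<bar>c i\<bar>)"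
  have k: "k > 0" unfolding k_def using c by (intro prod_pos) auto
  define ix :: "real ^ 'n \<Rightarrow> 'n" where "ix = inv (\<lambda>i. axis i 1)"
  have inj: "inj (\<lambda>i :: 'n. axis i (1::real))" by (auto simp: inj_on_def axis_eq_axis)
  have ix: "ix (axis i 1) = i" for i unfolding ix_def by (rule inv_f_f[OF inj])
  have Basis: "(Basis :: (real ^ 'n) set) = range (\<lambda>i. axis i 1)" by (auto simp: Basis_vec_def)
  have "(0 + (\<Sum>b\<in>Basis. (c (ix b) * (a \<bullet> b)) *\<^sub>R b)) = ?A a" for a :: "real ^ 'n"
  proof -
    have "(\<Sum>b\<in>Basis. (c (ix b) * (a \<bullet> b)) *\<^sub>R b) = (\<Sum>i\<in>UNIV. (c i * a $ i) *\<^sub>R axis i 1)"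
      unfolding Basis using inj by (simp add: sum.reindex ix inner_axis)
    then show ?thesis by (simp add: vec_eq_iff axis_def if_distrib cong: if_cong)
  qed
  moreover have "(\<Prod>b\<in>(Basis :: (real ^ 'n) set). \<bar>c (ix b)\<bar>) = k"
    unfolding Basis k_def using inj by (simp add: prod.reindex ix)
  ultimately have aff: "lborel = density (distr lborel borel ?A) (\<lambda>_. ennreal k)"
    using lborel_affine_euclidean[of "\<lambda>b. c (ix b)" 0] c by (simp add: Basis)
  have meas: "?A \<in> borel_measurable borel"
    by (intro borel_measurable_continuous_onI continuous_intros)
  have "density lborel (\<lambda>_. ennreal (1 / k)) = density (density (distr lborel borel ?A) (\<lambda>_. ennreal k)) (\<lambda>_. ennreal (1 / k))"
    using aff by simp
  also have "\<dots> = density (distr lborel borel ?A) (\<lambda>_. ennreal k * ennreal (1 / k))"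
    by (rule density_density_eq) auto
  also have "\<dots> = distr lborel borel ?A" using k by (simp add: density_1 flip: ennreal_mult one_ennreal_def)
  finally show ?thesis using k meas by (simp add: scaling_def k_def)
qed

section \<open>Quotients of functions of first-order operators\<close>

definition first_order_fun :: "real \<Rightarrow> ('n::finite \<Rightarrow> real) \<Rightarrow> 'n \<Rightarrow> (real \<Rightarrow> complex) \<Rightarrow> 'n l2 \<Rightarrow> 'n l2" where
  "first_order_fun \<kappa> e k \<phi> = functional_calculus \<phi> (sa_operator (first_order \<kappa> e k))"

text \<open>
  With \<open>\<phi>\<close> the quantum dilogarithm this is the dilogarithm factor of an intertwiner. The
  function \<open>\<phi>\<close> is kept general because the proof also uses the reflected function \<open>\<phi>(-t)\<close>.
\<close>

definition first_order_quotient :: "real \<Rightarrow> ('n::finite \<Rightarrow> real) \<Rightarrow> 'n \<Rightarrow> (real \<Rightarrow> complex) \<Rightarrow> 'n l2 \<Rightarrow> 'n l2" where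
  "first_order_quotient \<kappa> e k \<phi> = first_order_fun \<kappa> e k \<phi> \<circ> inv (first_order_fun \<kappa> (\<lambda>j. - e j) k \<phi>)"

definition unimodular :: "(real \<Rightarrow> complex) \<Rightarrow> bool" where
  "unimodular \<phi> \<longleftrightarrow> \<phi> \<in> borel_measurable borel \<and> (\<forall>t. cmod (\<phi> t) = 1)"

lemma unimodular_affine: "unimodular \<phi> \<Longrightarrow> unimodular (\<lambda>t. \<phi> (c * t + v))"
  unfolding unimodular_def by auto

lemma unitary_first_order_fun: "\<kappa> \<noteq> 0 \<Longrightarrow> e k = 0 \<Longrightarrow> unimodular \<phi> \<Longrightarrow> unitary (first_order_fun \<kappa> e k \<phi>)"
  unfolding first_order_fun_def unimodular_def by (intro functional_calculus_first_order(1)) auto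

lemma group_function_first_order_fun:
  "\<kappa> \<noteq> 0 \<Longrightarrow> e k = 0 \<Longrightarrow> unimodular \<phi> \<Longrightarrow> group_function (first_order_group \<kappa> e k) \<phi> (first_order_fun \<kappa> e k \<phi>)"
  unfolding first_order_fun_def unimodular_def by (intro functional_calculus_first_order(2)) auto

lemma unitary_first_order_quotient: "\<kappa> \<noteq> 0 \<Longrightarrow> e k = 0 \<Longrightarrow> unimodular \<phi> \<Longrightarrow> unitary (first_order_quotient \<kappa> e k \<phi>)"
  unfolding first_order_quotient_def by (intro unitary_comp unitary_inv unitary_first_order_fun) auto

text \<open>
  The hypothesis says that \<open>W\<close> conjugates the operator with form \<open>e'\<close> into \<open>c x + v\<close>, with
  \<open>x\<close> the operator with form \<open>e\<close>.
\<close>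

lemma first_order_fun_conjugate:
  assumes \<kappa>: "\<kappa> \<noteq> 0" and e: "e k = 0" "e' k = 0" and \<phi>: "unimodular \<phi>" and W: "unitary W"
    and H: "\<And>s F. first_order_group \<kappa> e' k s (W F) = W (cscale (exp (\<i> * of_real (s * v))) (first_order_group \<kappa> e k (c * s) F))"
  shows "first_order_fun \<kappa> e' k \<phi> (W F) = W (first_order_fun \<kappa> e k (\<lambda>t. \<phi> (c * t + v)) F)"
proof (rule group_function_conjugate[where W = W and \<phi> = \<phi> and F = F and T' = "first_order_fun \<kappa> e' k \<phi>"
      and T = "first_order_fun \<kappa> e k (\<lambda>t. \<phi> (c * t + v))" and V' = "first_order_group \<kappa> e' k"
      and V = "\<lambda>s F. cscale (exp (\<i> * of_real (s * v))) (first_order_group \<kappa> e k (c * s) F)", OF W])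
  show "group_function (first_order_group \<kappa> e' k) \<phi> (first_order_fun \<kappa> e' k \<phi>)"
    by (rule group_function_first_order_fun[where e = e' and k = k, OF \<kappa> e(2) \<phi>])
  show "group_function (\<lambda>s F. cscale (exp (\<i> * of_real (s * v))) (first_order_group \<kappa> e k (c * s) F)) \<phi> (first_order_fun \<kappa> e k (\<lambda>t. \<phi> (c * t + v)))"
    using group_function_first_order_fun[where e = e and k = k, OF \<kappa> e(1) unimodular_affine[OF \<phi>]] \<phi>
    by (intro group_function_affine) (auto simp: unimodular_def)
qed (fact H)

lemma inv_conjugate:
  assumes "unitary T'" "unitary T" "\<And>F. T' (W F) = W (T F)"
  shows "inv T' (W F) = W (inv T F)"
  using assms(3)[of "inv T F"] assms(1,2) by (metis unitary_f_inv unitary_inv_f)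

lemma first_order_quotient_conjugate:
  assumes \<kappa>: "\<kappa> \<noteq> 0" and e: "e k = 0" "e' k = 0" and \<phi>: "unimodular \<phi>" and W: "unitary W"
    and H: "\<And>\<sigma> s F. \<sigma> \<in> {1, -1} \<Longrightarrow> first_order_group \<kappa> (\<lambda>j. \<sigma> * e' j) k s (W F)
       = W (cscale (exp (\<i> * of_real (s * v))) (first_order_group \<kappa> (\<lambda>j. \<sigma> * e j) k (c * s) F))"
  shows "first_order_quotient \<kappa> e' k \<phi> (W F) = W (first_order_quotient \<kappa> e k (\<lambda>t. \<phi> (c * t + v)) F)"
proof -
  note u = unimodular_affine[OF \<phi>, of c v]
  have 1: "first_order_fun \<kappa> e' k \<phi> (W F) = W (first_order_fun \<kappa> e k (\<lambda>t. \<phi> (c * t + v)) F)" for F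
    using H[of 1] by (intro first_order_fun_conjugate \<kappa> e \<phi> W) simp
  have 2: "first_order_fun \<kappa> (\<lambda>j. - e' j) k \<phi> (W F) = W (first_order_fun \<kappa> (\<lambda>j. - e j) k (\<lambda>t. \<phi> (c * t + v)) F)" for F
    using H[of "-1"] e by (intro first_order_fun_conjugate \<kappa> \<phi> W) simp_all
  have "inv (first_order_fun \<kappa> (\<lambda>j. - e' j) k \<phi>) (W F) = W (inv (first_order_fun \<kappa> (\<lambda>j. - e j) k (\<lambda>t. \<phi> (c * t + v))) F)"
    by (intro inv_conjugate unitary_first_order_fun \<kappa> u \<phi> 2) (use e in auto)
  then show ?thesis by (simp add: first_order_quotient_def 1)
qed

definition modulation :: "('n \<Rightarrow> real) \<Rightarrow> ('n::finite) l2 \<Rightarrow> 'n l2" where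
  "modulation \<eta> = mulop (\<lambda>a. exp (\<i> * of_real (linform \<eta> a)))"

lemma bounded_borel_linform: "bounded_borel (\<lambda>a. exp (\<i> * of_real (linform \<eta> a)))"
  by (rule bounded_borel_unimodular) auto

lemma unitary_modulation: "unitary (modulation \<eta>)"
  unfolding modulation_def by (intro unitary_mulop(1)) auto

lemma mulop_cscale: "cscale c (mulop \<phi> F) = mulop (\<lambda>a. c * \<phi> a) F" if b: "bounded_borel \<phi>"
proof -
  have "bounded_borel (\<lambda>a. c * \<phi> a)" by (rule bounded_borel_mult[OF _ b]) (rule bounded_borelI[of _ "cmod c"], auto)
  then show ?thesis
    using AE_rep_cscale[of c "mulop \<phi> F"] AE_rep_mulop[OF b, of F] AE_rep_mulop[of "\<lambda>a. c * \<phi> a" F]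
    by (intro l2_eqI) auto
qed

lemma linform_diff: "linform e (a - b) = linform e a - linform e b"
  by (simp add: linform_def right_diff_distrib sum_subtractf)

lemma linform_axis: "linform e (axis k r) = e k * r"
proof -
  have "linform e (axis k r) = (\<Sum>j\<in>UNIV. if j = k then e k * r else 0)"
    unfolding linform_def by (intro sum.cong) (auto simp: axis_def)
  then show ?thesis by simp
qed

lemma linform_scale: "linform (\<lambda>j. c * e j) a = c * linform e a"
  by (simp add: linform_def sum_distrib_left mult.assoc)

text \<open>
  Modulation with frequency \<open>\<eta>\<close> translates the operator by \<open>-\<kappa> \<eta>\<^sub>k\<close>, because translation by
  \<open>\<kappa> s\<close> along \<open>a\<^sub>k\<close> multiplies \<open>exp(\<i> \<eta>\<cdot>a)\<close> by a scalar. The same shift occurs for both signs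
  of \<open>e\<close>.
\<close>

lemma first_order_group_modulation:
  "first_order_group \<kappa> e k s (modulation \<eta> F) = modulation \<eta> (cscale (exp (\<i> * of_real (s * (- \<kappa> * \<eta> k)))) (first_order_group \<kappa> e k s F))"
proof -
  let ?E = "\<lambda>a. exp (- \<i> * of_real (s * linform e a))"
  let ?w = "axis k (\<kappa> * s) :: real ^ 'a"
  have bE: "bounded_borel ?E" by (rule bounded_borel_unimodular) auto
  have bs: "bounded_borel (\<lambda>a :: real ^ 'a. exp (\<i> * of_real (linform \<eta> (a - ?w))))"
    by (rule bounded_borel_comp[OF bounded_borel_linform]) (intro borel_measurable_continuous_onI continuous_intros)
  have "first_order_group \<kappa> e k s (modulation \<eta> F) = mulop (\<lambda>a. ?E a * exp (\<i> * of_real (linform \<eta> (a - ?w)))) (translate ?w F)"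
    unfolding first_order_group_def modulation_def translate_def subst_op_mulop[OF scaling_translation bounded_borel_linform]
    by (rule mulop_mulop[OF bE bs])
  also have "(\<lambda>a. ?E a * exp (\<i> * of_real (linform \<eta> (a - ?w))))
      = (\<lambda>a. exp (\<i> * of_real (linform \<eta> a)) * (exp (\<i> * of_real (s * (- \<kappa> * \<eta> k))) * ?E a))"
    unfolding linform_diff linform_axis exp_add[symmetric] by (intro ext arg_cong[of _ _ exp]) (simp add: algebra_simps)
  also have "mulop \<dots> (translate ?w F) = modulation \<eta> (cscale (exp (\<i> * of_real (s * (- \<kappa> * \<eta> k)))) (mulop ?E (translate ?w F)))"
    unfolding modulation_def mulop_cscale[OF bE]
    by (rule mulop_mulop[OF bounded_borel_linform, symmetric])
       (rule bounded_borel_mult[OF _ bE], rule bounded_borelI[of _ 1], auto)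
  finally show ?thesis by (simp add: first_order_group_def)
qed

lemma first_order_quotient_modulation:
  assumes \<kappa>: "\<kappa> \<noteq> 0" and e: "e k = 0" and \<phi>: "unimodular \<phi>"
  shows "first_order_quotient \<kappa> e k \<phi> (modulation \<eta> F) = modulation \<eta> (first_order_quotient \<kappa> e k (\<lambda>t. \<phi> (1 * t + - \<kappa> * \<eta> k)) F)"
  by (rule first_order_quotient_conjugate[where e = e and e' = e and k = k, OF \<kappa> e e \<phi> unitary_modulation]) (simp add: first_order_group_modulation)

lemma norm_unitary_diff: "unitary T \<Longrightarrow> norm (T F - T G) = norm (F - G)"
  using unitary_norm[of T "F - G"] by (simp add: clinear_diff unitary_clinear)

lemma first_order_group_0: "first_order_group \<kappa> e k 0 F = F"
proof -
  have "axis k (0 :: real) = 0" by (simp add: axis_def vec_eq_iff)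
  note zero = this
  show ?thesis by (simp add: first_order_group_def translate_def zero)
qed

lemma null_sequence_le:
  fixes f g :: "nat \<Rightarrow> real"
  assumes "g \<longlonglongrightarrow> 0" "\<And>n. 0 \<le> f n" "\<And>n. f n \<le> g n"
  shows "f \<longlonglongrightarrow> 0"
  by (rule tendsto_sandwich[where f = "\<lambda>_. 0" and h = g]) (simp_all add: assms)

text \<open>
  After conjugation with the modulation the two functions of operators have their argument
  shifted to \<open>-\<infinity>\<close>, where \<open>\<phi>\<close> tends to \<open>1\<close>; so both tend strongly to the identity.
\<close>

lemma first_order_quotient_modulation_tendsto:
  assumes \<kappa>: "\<kappa> > 0" and e: "e k = 0" and \<phi>: "unimodular \<phi>"
    and lim: "\<And>v. filterlim v at_bot sequentially \<Longrightarrow> (\<lambda>n. \<phi> (v n)) \<longlonglongrightarrow> 1"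
    and \<eta>: "filterlim (\<lambda>n. \<eta> n k) at_top sequentially"
  shows "(\<lambda>n. norm (first_order_quotient \<kappa> e k \<phi> (modulation (\<eta> n) F) - modulation (\<eta> n) F)) \<longlonglongrightarrow> 0"
proof -
  have \<kappa>0: "\<kappa> \<noteq> 0" using \<kappa> by simp
  define \<psi> where "\<psi> n t = \<phi> (1 * t + - \<kappa> * \<eta> n k)" for n t
  have u: "unimodular (\<psi> n)" for n unfolding \<psi>_def by (rule unimodular_affine[OF \<phi>])
  have T: "(\<lambda>n. first_order_fun \<kappa> e' k (\<psi> n) F) \<longlonglongrightarrow> F" if e': "e' k = 0" for e'
  proof (rule group_function_tendsto_id)
    show "group_function (first_order_group \<kappa> e' k) (\<psi> n) (first_order_fun \<kappa> e' k (\<psi> n))" for n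
      by (rule group_function_first_order_fun[where e = e' and k = k, OF \<kappa>0 e' u])
    show "unitary (first_order_fun \<kappa> e' k (\<psi> n))" for n by (rule unitary_first_order_fun[where e = e' and k = k, OF \<kappa>0 e' u])
    show "first_order_group \<kappa> e' k 0 F = F" for F by (rule first_order_group_0)
    show "\<psi> n \<in> borel_measurable borel" "cmod (\<psi> n t) = 1" for n t using u by (auto simp: unimodular_def)
    fix t
    have "filterlim (\<lambda>n. t + - (\<kappa> * \<eta> n k)) at_bot sequentially"
      unfolding filterlim_uminus_at_bot
      using filterlim_tendsto_add_at_top[OF tendsto_const[of "- t"] filterlim_tendsto_pos_mult_at_top[OF tendsto_const \<kappa> \<eta>]]
      by simp
    then show "(\<lambda>n. \<psi> n t) \<longlonglongrightarrow> 1" unfolding \<psi>_def using lim by simp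
  qed
  \<comment> \<open>The inverse of the second unitary may be replaced by the unitary itself when measuring the
    distance to the identity.\<close>
  have lim2: "(\<lambda>n. norm (first_order_fun \<kappa> (\<lambda>j. - e j) k (\<psi> n) F - F) + norm (first_order_fun \<kappa> e k (\<psi> n) F - F)) \<longlonglongrightarrow> 0 + 0"
  proof (intro tendsto_add)
    show "(\<lambda>n. norm (first_order_fun \<kappa> (\<lambda>j. - e j) k (\<psi> n) F - F)) \<longlonglongrightarrow> 0"
      using T[of "\<lambda>j. - e j"] e by (simp add: tendsto_norm_zero_iff LIM_zero_iff)
    show "(\<lambda>n. norm (first_order_fun \<kappa> e k (\<psi> n) F - F)) \<longlonglongrightarrow> 0"
      using T[of e] e by (simp add: tendsto_norm_zero_iff LIM_zero_iff)
  qed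
  have bound: "norm (first_order_quotient \<kappa> e k \<phi> (modulation (\<eta> n) F) - modulation (\<eta> n) F)
     \<le> norm (first_order_fun \<kappa> (\<lambda>j. - e j) k (\<psi> n) F - F) + norm (first_order_fun \<kappa> e k (\<psi> n) F - F)" for n
  proof -
    let ?T = "first_order_fun \<kappa> e k (\<psi> n)" and ?S = "first_order_fun \<kappa> (\<lambda>j. - e j) k (\<psi> n)"
    have T: "unitary ?T" by (rule unitary_first_order_fun[where e = e and k = k, OF \<kappa>0 e u])
    have S: "unitary ?S" by (rule unitary_first_order_fun[OF \<kappa>0 _ u]) (simp add: e)
    have "first_order_quotient \<kappa> e k \<phi> (modulation (\<eta> n) F) = modulation (\<eta> n) (?T (inv ?S F))"
    proof -
      have \<psi>': "\<psi> n = (\<lambda>t. \<phi> (1 * t + - \<kappa> * \<eta> n k))" by (simp add: \<psi>_def fun_eq_iff)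
      have "first_order_quotient \<kappa> e k \<phi> (modulation (\<eta> n) F) = modulation (\<eta> n) (first_order_quotient \<kappa> e k (\<psi> n) F)"
        unfolding \<psi>' by (rule first_order_quotient_modulation[where e = e and k = k, OF \<kappa>0 e \<phi>])
      then show ?thesis by (simp add: first_order_quotient_def)
    qed
    then have "norm (first_order_quotient \<kappa> e k \<phi> (modulation (\<eta> n) F) - modulation (\<eta> n) F) = norm (?T (inv ?S F) - F)"
      by (simp add: norm_unitary_diff[OF unitary_modulation])
    also have "\<dots> \<le> norm (?T (inv ?S F) - ?T F) + norm (?T F - F)"
      using norm_triangle_ineq[of "?T (inv ?S F) - ?T F" "?T F - F"] by simp
    also have "norm (?T (inv ?S F) - ?T F) = norm (inv ?S F - F)" by (rule norm_unitary_diff[OF T])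
    also have "\<dots> = norm (F - ?S F)" using norm_unitary_diff[OF S, of "inv ?S F" F] S by simp
    finally show ?thesis by (simp add: norm_minus_commute)
  qed
  show ?thesis
    by (rule null_sequence_le[OF _ norm_ge_zero bound]) (use lim2 in simp)
qed

section \<open>Concentration on a hyperplane\<close>

text \<open>
  The unitary dilation that contracts functions in all directions except the \<open>k\<close>-th by the
  factor \<open>n + 1\<close>.
\<close>

definition squeeze :: "'n \<Rightarrow> nat \<Rightarrow> ('n::finite) l2 \<Rightarrow> 'n l2" where
  "squeeze k n = (let c = (\<lambda>i. if i = k then 1 else real (Suc n)) in
     subst_op (1 / (\<Prod>i\<in>UNIV. \<bar>c i\<bar>)) (\<lambda>a. \<chi> i. c i * a $ i))"

lemma unitary_squeeze: "unitary (squeeze k n)"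
proof -
  define c where "c i = (if i = k then 1 else real (Suc n))" for i :: 'a
  have c: "c i \<noteq> 0" for i by (simp add: c_def del: of_nat_Suc)
  have "unitary (subst_op (1 / (\<Prod>i\<in>UNIV. \<bar>c i\<bar>)) (\<lambda>a. \<chi> i. c i * a $ i))"
  proof (rule unitary_subst_op)
    show "scaling (1 / (\<Prod>i\<in>UNIV. \<bar>c i\<bar>)) (\<lambda>a. \<chi> i. c i * a $ i)" by (rule scaling_diagonal[OF c])
    show "scaling (1 / (1 / (\<Prod>i\<in>UNIV. \<bar>c i\<bar>))) (\<lambda>a. \<chi> i. (1 / c i) * a $ i)"
      using scaling_diagonal[of "\<lambda>i. 1 / c i"] c by (simp add: prod_dividef)
    show "(\<chi> i. c i * (\<chi> i. 1 / c i * a $ i) $ i) = a" for a :: "real ^ 'a" using c by (simp add: vec_eq_iff)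
  qed
  then show ?thesis by (simp add: squeeze_def c_def[symmetric] Let_def)
qed

text \<open>
  The dilation does not affect the derivative along \<open>a\<^sub>k\<close> and scales the linear form.
\<close>

lemma first_order_group_squeeze:
  assumes e: "e k = 0"
  shows "first_order_group \<kappa> e k s (squeeze k n F) = squeeze k n (first_order_group \<kappa> (\<lambda>j. e j / real (Suc n)) k s F)"
proof -
  define c where "c i = (if i = k then 1 else real (Suc n))" for i :: 'a
  have c: "c i \<noteq> 0" for i by (simp add: c_def del: of_nat_Suc)
  define A where "A a = (\<chi> i. c i * a $ i)" for a :: "real ^ 'a"
  define r where "r = 1 / (\<Prod>i\<in>UNIV. \<bar>c i\<bar>)"
  have A: "scaling r A" unfolding A_def r_def by (rule scaling_diagonal[OF c])
  have sq: "squeeze k n = subst_op r A" by (simp add: squeeze_def c_def[symmetric] Let_def r_def A_def[abs_def])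
  have lin: "linform (\<lambda>j. e j / real (Suc n)) (A a) = linform e a" for a
    unfolding linform_def A_def by (intro sum.cong) (auto simp: c_def e simp del: of_nat_Suc)
  let ?w = "axis k (\<kappa> * s) :: real ^ 'a"
  have Aw: "A (a - ?w) = A a - ?w" for a by (auto simp: A_def c_def vec_eq_iff axis_def)
  have b: "bounded_borel (\<lambda>a :: real ^ 'a. exp (- \<i> * of_real (s * linform (\<lambda>j. e j / real (Suc n)) a)))"
    by (rule bounded_borel_unimodular) auto
  have "subst_op r A (first_order_group \<kappa> (\<lambda>j. e j / real (Suc n)) k s F)
     = mulop (\<lambda>a. exp (- \<i> * of_real (s * linform e a))) (subst_op r A (translate ?w F))"
    unfolding first_order_group_def subst_op_mulop[OF A b] lin ..
  also have "subst_op r A (translate ?w F) = translate ?w (subst_op r A F)"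
    unfolding translate_def subst_op_subst_op[OF A scaling_translation] subst_op_subst_op[OF scaling_translation A] Aw by simp
  finally show ?thesis by (simp add: sq first_order_group_def)
qed

text \<open>
  The multiplication \<open>M n\<close> conjugates the operator without linear form into the one with
  form \<open>e / (n + 1)\<close>, and \<open>M n\<close> tends strongly to the identity.
\<close>

lemma first_order_fun_tendsto:
  fixes e :: "'n::finite \<Rightarrow> real"
  assumes \<kappa>: "\<kappa> \<noteq> 0" and e: "e k = 0" and \<phi>: "unimodular \<phi>"
  shows "(\<lambda>n. first_order_fun \<kappa> (\<lambda>j. e j / real (Suc n)) k \<phi> F) \<longlonglongrightarrow> first_order_fun \<kappa> (\<lambda>_. 0) k \<phi> F"
proof -
  define p where "p n a = exp (- \<i> * of_real (a $ k * linform (\<lambda>j. e j / real (Suc n)) a / \<kappa>))" for n and a :: "real ^ 'n"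
  define M where "M n = mulop (p n)" for n
  let ?B = "first_order_fun \<kappa> (\<lambda>_. 0) k \<phi>"
  have pm [measurable]: "p n \<in> borel_measurable borel" for n unfolding p_def by measurable
  have p1: "cmod (p n a) = 1" for n a by (simp add: p_def)
  have bp: "bounded_borel (p n)" for n by (rule bounded_borel_unimodular) (auto simp: p1)
  have M: "unitary (M n)" for n unfolding M_def by (rule unitary_mulop(1)) (auto simp: p1)
  have "(\<lambda>n. mulop (p n) G) \<longlonglongrightarrow> mulop (\<lambda>_. 1) G" for G
  proof (rule mulop_tendsto[where C = 1])
    fix a :: "real ^ 'n"
    have eq: "linform (\<lambda>j. e j / real (Suc n)) a = inverse (real (Suc n)) * linform e a" for n
      using linform_scale[of "inverse (real (Suc n))" e a] by (simp add: field_simps del: of_nat_Suc)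
    have "(\<lambda>n. exp (- \<i> * of_real (a $ k * (inverse (real (Suc n)) * linform e a) / \<kappa>))) \<longlonglongrightarrow> exp (- \<i> * of_real (a $ k * (0 * linform e a) / \<kappa>))"
      by (intro tendsto_intros LIMSEQ_inverse_real_of_nat \<kappa>)
    then show "(\<lambda>n. p n a) \<longlonglongrightarrow> 1" unfolding p_def eq by simp
  qed (auto simp: p1)
  then have Mlim: "(\<lambda>n. M n G) \<longlonglongrightarrow> G" for G by (simp add: M_def)
  have conj: "first_order_fun \<kappa> (\<lambda>j. e j / real (Suc n)) k \<phi> (M n G) = M n (?B G)" for n G
  proof -
    let ?e = "\<lambda>j. e j / real (Suc n)"
    have e': "?e k = 0" by (simp add: e)
    have "first_order_group \<kappa> ?e k s (M n F) = M n (cscale (exp (\<i> * of_real (s * 0))) (first_order_group \<kappa> (\<lambda>_. 0) k (1 * s) F))" for s F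
    proof -
      let ?w = "axis k (\<kappa> * s) :: real ^ 'n"
      have be: "bounded_borel (\<lambda>a :: real ^ 'n. exp (- \<i> * of_real (s * linform ?e a)))"
        by (rule bounded_borel_unimodular) auto
      have bs: "bounded_borel (\<lambda>a. p n (a - ?w))"
        by (rule bounded_borel_comp[OF bp]) (intro borel_measurable_continuous_onI continuous_intros)
      have shift: "exp (- \<i> * of_real (s * linform ?e a)) * p n (a - ?w) = p n a" for a
      proof -
        have l: "linform ?e (a - ?w) = linform ?e a" unfolding linform_diff linform_axis by (simp add: e)
        have k: "(a - ?w) $ k = a $ k - \<kappa> * s" by (simp add: axis_def)
        show ?thesis unfolding p_def l k exp_add[symmetric]
          using \<kappa> by (intro arg_cong[of _ _ exp]) (simp add: field_simps)
      qed
      have z: "linform (\<lambda>_. 0) a = 0" for a :: "real ^ 'n" by (simp add: linform_def)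
      have "first_order_group \<kappa> ?e k s (M n F) = M n (translate ?w F)"
        unfolding first_order_group_def M_def translate_def subst_op_mulop[OF scaling_translation bp] mulop_mulop[OF be bs] shift ..
      then show ?thesis by (simp add: first_order_group_def z)
    qed
    from first_order_fun_conjugate[OF \<kappa> _ e' \<phi> M this] show ?thesis by simp
  qed
  have T0: "unitary ?B" by (rule unitary_first_order_fun[OF \<kappa> _ \<phi>]) simp
  have Tn: "unitary (first_order_fun \<kappa> (\<lambda>j. e j / real (Suc n)) k \<phi>)" for n
    by (rule unitary_first_order_fun[OF \<kappa> _ \<phi>]) (simp add: e)
  have bound: "norm (first_order_fun \<kappa> (\<lambda>j. e j / real (Suc n)) k \<phi> F - ?B F) \<le> norm (M n F - F) + norm (M n (?B F) - ?B F)" for n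
  proof -
    let ?T = "first_order_fun \<kappa> (\<lambda>j. e j / real (Suc n)) k \<phi>"
    have "norm (?T F - ?B F) \<le> norm (?T F - ?T (M n F)) + norm (?T (M n F) - ?B F)"
      using norm_triangle_ineq[of "?T F - ?T (M n F)" "?T (M n F) - ?B F"] by simp
    also have "norm (?T F - ?T (M n F)) = norm (F - M n F)" by (rule norm_unitary_diff[OF Tn])
    finally show ?thesis unfolding conj norm_minus_commute[of F "M n F"] .
  qed
  have "(\<lambda>n. norm (M n F - F) + norm (M n (?B F) - ?B F)) \<longlonglongrightarrow> 0 + 0"
    by (intro tendsto_add) (simp_all add: tendsto_norm_zero_iff LIM_zero_iff Mlim)
  then have "(\<lambda>n. norm (first_order_fun \<kappa> (\<lambda>j. e j / real (Suc n)) k \<phi> F - ?B F)) \<longlonglongrightarrow> 0"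
    by (intro null_sequence_le[OF _ norm_ge_zero bound]) simp
  then show ?thesis by (simp add: tendsto_norm_zero_iff LIM_zero_iff)
qed

text \<open>
  In the limit the two factors are the same function of the same operator and cancel.
\<close>

lemma first_order_quotient_squeeze_tendsto:
  fixes e :: "'n::finite \<Rightarrow> real"
  assumes \<kappa>: "\<kappa> \<noteq> 0" and e: "e k = 0" and \<phi>: "unimodular \<phi>"
  shows "(\<lambda>n. norm (first_order_quotient \<kappa> e k \<phi> (squeeze k n F) - squeeze k n F)) \<longlonglongrightarrow> 0"
proof -
  define T where "T n = first_order_fun \<kappa> (\<lambda>j. e j / real (Suc n)) k \<phi>" for n
  define S where "S n = first_order_fun \<kappa> (\<lambda>j. - e j / real (Suc n)) k \<phi>" for n
  define T0 where "T0 = first_order_fun \<kappa> (\<lambda>_. 0) k \<phi>"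
  have uT: "unitary (T n)" and uS: "unitary (S n)" and uT0: "unitary T0" for n
    unfolding T_def S_def T0_def by (rule unitary_first_order_fun[OF \<kappa> _ \<phi>], simp add: e)+
  define G where "G = inv T0 F"
  have G: "T0 G = F" by (simp add: G_def uT0)
  have eq: "norm (first_order_quotient \<kappa> e k \<phi> (squeeze k n F) - squeeze k n F) \<le> norm (S n G - F) + norm (T n G - F)" for n
  proof -
    have "first_order_quotient \<kappa> e k \<phi> (squeeze k n F) = squeeze k n (first_order_quotient \<kappa> (\<lambda>j. e j / real (Suc n)) k (\<lambda>t. \<phi> (1 * t + 0)) F)"
    proof (rule first_order_quotient_conjugate[where e = "\<lambda>j. e j / real (Suc n)" and e' = e and k = k, OF \<kappa> _ e \<phi> unitary_squeeze])
      fix \<sigma> s :: real and F :: "'n l2"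
      show "first_order_group \<kappa> (\<lambda>j. \<sigma> * e j) k s (squeeze k n F) = squeeze k n (cscale (exp (\<i> * of_real (s * 0)))
          (first_order_group \<kappa> (\<lambda>j. \<sigma> * (e j / real (Suc n))) k (1 * s) F))"
      proof -
        have "(\<lambda>j. \<sigma> * (e j / real (Suc n))) = (\<lambda>j. \<sigma> * e j / real (Suc n))" by (simp add: fun_eq_iff)
        then show ?thesis
          using first_order_group_squeeze[where e = "\<lambda>j. \<sigma> * e j" and k = k and \<kappa> = \<kappa> and s = s and n = n and F = F] e
          by (simp only: mult_1_left mult_zero_right of_real_0 exp_zero cscale_1)
      qed
    qed (simp add: e)
    also have "\<dots> = squeeze k n (T n (inv (S n) F))" by (simp add: first_order_quotient_def T_def S_def)
    finally have "norm (first_order_quotient \<kappa> e k \<phi> (squeeze k n F) - squeeze k n F) = norm (T n (inv (S n) F) - F)"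
      by (simp add: norm_unitary_diff[OF unitary_squeeze])
    also have "\<dots> \<le> norm (T n (inv (S n) F) - T n G) + norm (T n G - F)"
      using norm_triangle_ineq[of "T n (inv (S n) F) - T n G" "T n G - F"] by simp
    also have "norm (T n (inv (S n) F) - T n G) = norm (inv (S n) F - G)" by (rule norm_unitary_diff[OF uT])
    also have "\<dots> = norm (F - S n G)" using norm_unitary_diff[OF uS, of n "inv (S n) F" G] uS by simp
    finally show ?thesis by (simp add: norm_minus_commute)
  qed
  have "(\<lambda>n. T n G) \<longlonglongrightarrow> F" "(\<lambda>n. S n G) \<longlonglongrightarrow> F"
    using first_order_fun_tendsto[where e = e and k = k, OF \<kappa> e \<phi>, of G] first_order_fun_tendsto[where e = "\<lambda>j. - e j" and k = k, OF \<kappa> _ \<phi>, of G] e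
    by (simp_all add: G T_def S_def T0_def[symmetric])
  then have "(\<lambda>n. norm (S n G - F) + norm (T n G - F)) \<longlonglongrightarrow> 0 + 0"
    by (intro tendsto_add) (simp_all add: tendsto_norm_zero_iff LIM_zero_iff)
  then show ?thesis
    by (intro null_sequence_le[OF _ norm_ge_zero eq]) simp
qed

section \<open>Positive functions\<close>

definition pos_l2 :: "('n::finite) l2 \<Rightarrow> bool" where
  "pos_l2 F \<longleftrightarrow> (AE a in lborel. Im (rep_l2 F a) = 0 \<and> Re (rep_l2 F a) \<ge> 0)"

lemma pos_l2_subst: "scaling r A \<Longrightarrow> pos_l2 F \<Longrightarrow> pos_l2 (subst_op r A F)"
  unfolding pos_l2_def
  using AE_rep_subst_op[of r A F] scaling_AE[of r A "\<lambda>a. Im (rep_l2 F a) = 0 \<and> Re (rep_l2 F a) \<ge> 0"]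
  by (auto simp: scaling_def elim!: eventually_elim2)

lemma cinner_pos:
  assumes "pos_l2 F" "pos_l2 G"
  shows "\<exists>q\<ge>0. cinner F G = of_real q"
proof -
  have "cinner F G = (LINT a|lborel. complex_of_real (Re (rep_l2 F a) * Re (rep_l2 G a)))"
    unfolding cinner_rep
  proof (rule integral_cong_AE)
    show "AE a in lborel. cnj (rep_l2 F a) * rep_l2 G a = complex_of_real (Re (rep_l2 F a) * Re (rep_l2 G a))"
      using assms unfolding pos_l2_def by eventually_elim (simp add: complex_eq_iff)
  qed measurable
  moreover have "0 \<le> (LINT a|lborel. Re (rep_l2 F a) * Re (rep_l2 G a))"
    using assms unfolding pos_l2_def by (intro integral_nonneg_AE) (auto elim!: eventually_elim2)
  ultimately show ?thesis by (intro exI[of _ "LINT a|lborel. Re (rep_l2 F a) * Re (rep_l2 G a)"] conjI) (simp_all only: integral_complex_of_real)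
qed

lemma pos_l2_gauss: "pos_l2 (abs_l2 (gauss (\<lambda>_. 0)))"
proof -
  have "gauss (\<lambda>_. 0) a = of_real (\<Prod>i\<in>UNIV. exp (- (a $ i)\<^sup>2 / 2))" for a :: "real ^ 'a"
    unfolding gauss_def of_real_prod by (intro prod.cong) (auto simp: exp_of_real[symmetric])
  then have pg: "Im (gauss (\<lambda>_. 0) a) = 0 \<and> Re (gauss (\<lambda>_. 0) a) \<ge> 0" for a :: "real ^ 'a"
    by (simp add: prod_nonneg del: of_real_prod)
  show ?thesis
    unfolding pos_l2_def using AE_rep_abs_l2[OF square_integrable_gauss[of "\<lambda>_. 0"]]
    by eventually_elim (simp add: pg)
qed

lemma gauss_nonzero: "norm (abs_l2 (gauss (\<lambda>_. 0))) \<noteq> 0"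
proof
  assume "norm (abs_l2 (gauss (\<lambda>_. 0) :: real ^ 'a \<Rightarrow> complex)) = 0"
  then have "cinner (abs_l2 (gauss (\<lambda>_. 0) :: real ^ 'a \<Rightarrow> complex)) (abs_l2 (gauss (\<lambda>_. 0))) = 0"
    by (simp add: cinner_self)
  then show False by (simp add: cinner_gauss)
qed

text \<open>
  The inner products of \<open>y n\<close> and \<open>h n\<close> are nonnegative numbers \<open>q n\<close>, and \<open>c q n\<close> tends to
  \<open>N\<^sup>2\<close>. Taking absolute values, \<open>q n\<close> tends to \<open>N\<^sup>2\<close> as well.
\<close>

lemma phase_eq_1_if_pos:
  fixes y h :: "nat \<Rightarrow> ('n::finite) l2"
  assumes pos: "\<And>n. pos_l2 (y n)" "\<And>n. pos_l2 (h n)" and norm: "\<And>n. norm (y n) = N" and N: "N \<noteq> 0"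
    and c: "cmod c = 1" and lim: "(\<lambda>n. norm (cscale c (h n) - y n)) \<longlonglongrightarrow> 0"
  shows "c = 1"
proof -
  have "\<exists>q\<ge>0. cinner (y n) (h n) = complex_of_real q" for n by (rule cinner_pos[OF pos])
  then obtain q where q: "\<And>n. q n \<ge> 0" "\<And>n. cinner (y n) (h n) = complex_of_real (q n)" by metis
  have "(\<lambda>n. c * of_real (q n) - of_real (N\<^sup>2)) \<longlonglongrightarrow> 0"
  proof (rule Lim_null_comparison[where g = "\<lambda>n. N * norm (cscale c (h n) - y n)"])
    have "cmod (c * of_real (q n) - of_real (N\<^sup>2)) \<le> N * norm (cscale c (h n) - y n)" for n
    proof -
      have "c * of_real (q n) - of_real (N\<^sup>2) = cinner (y n) (cscale c (h n) - y n)"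
        by (simp add: cinner.diff_right cinner_cscale_right q cinner_self norm)
      then show ?thesis using cmod_cinner_le[of "y n" "cscale c (h n) - y n"] by (simp add: norm)
    qed
    then show "\<forall>\<^sub>F n in sequentially. norm (c * of_real (q n) - of_real (N\<^sup>2)) \<le> N * norm (cscale c (h n) - y n)"
      by (intro always_eventually allI)
    show "(\<lambda>n. N * norm (cscale c (h n) - y n)) \<longlonglongrightarrow> 0"
      using tendsto_mult[OF tendsto_const[of N] lim] by simp
  qed
  then have cq: "(\<lambda>n. c * of_real (q n)) \<longlonglongrightarrow> of_real (N\<^sup>2)" by (simp add: LIM_zero_iff)
  then have "(\<lambda>n. cmod (c * of_real (q n))) \<longlonglongrightarrow> cmod (of_real (N\<^sup>2))" by (rule tendsto_norm)
  then have "(\<lambda>n. q n) \<longlonglongrightarrow> N\<^sup>2" using q(1) by (simp add: norm_mult c norm_power del: of_real_power)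
  then have "(\<lambda>n. c * of_real (q n)) \<longlonglongrightarrow> c * of_real (N\<^sup>2)" by (intro tendsto_intros)
  then have "c * of_real (N\<^sup>2) = of_real (N\<^sup>2)" using cq LIMSEQ_unique by blast
  then show ?thesis using N by simp
qed

section \<open>The intertwiners of a seed\<close>

definition exch_row :: "('n::finite) seed \<Rightarrow> 'n \<Rightarrow> 'n \<Rightarrow> real" where
  "exch_row \<Gamma> k j = real_of_int (exch \<Gamma> k j)"

text \<open>
  The coefficient \<open>\<pi> \<hbar>\<^sub>k\<close> of \<open>\<i> \<partial>/\<partial>a\<^sub>k\<close> in the operators \<open>x\<close> and \<open>x~\<close> of direction \<open>k\<close>.
\<close>

definition momentum_coeff :: "real \<Rightarrow> ('n::finite) seed \<Rightarrow> 'n \<Rightarrow> real" where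
  "momentum_coeff hbar \<Gamma> k = pi * hbar / real (skew \<Gamma> k)"

definition dilog_factor :: "real \<Rightarrow> ('n::finite) seed \<Rightarrow> 'n \<Rightarrow> 'n l2 \<Rightarrow> 'n l2" where
  "dilog_factor hbar \<Gamma> k = first_order_quotient (momentum_coeff hbar \<Gamma> k) (exch_row \<Gamma> k) k (quantum_dilog (hbar / real (skew \<Gamma> k)))"

lemma xhat_first_order: "xhat hbar \<Gamma> k = first_order (momentum_coeff hbar \<Gamma> k) (exch_row \<Gamma> k) k"
proof (intro ext)
  fix f a
  have "(\<Sum>j\<in>UNIV. of_int (exch \<Gamma> k j) * qhat j f a) = of_real (linform (exch_row \<Gamma> k) a) * f a"
    by (simp add: linform_def exch_row_def qhat_def sum_distrib_right mult.assoc)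
  then show "xhat hbar \<Gamma> k f a = first_order (momentum_coeff hbar \<Gamma> k) (exch_row \<Gamma> k) k f a"
    unfolding xhat_def first_order_def phat_def momentum_coeff_def by (simp add: field_simps)
qed

lemma xhat_tilde_first_order: "xhat_tilde hbar \<Gamma> k = first_order (momentum_coeff hbar \<Gamma> k) (\<lambda>j. - exch_row \<Gamma> k j) k"
proof (intro ext)
  fix f a
  have "(\<Sum>j\<in>UNIV. of_int (exch \<Gamma> k j) * qhat j f a) = - (of_real (linform (\<lambda>j. - exch_row \<Gamma> k j) a) * f a)"
    by (simp add: linform_def exch_row_def qhat_def sum_distrib_right mult.assoc sum_negf)
  then show "xhat_tilde hbar \<Gamma> k f a = first_order (momentum_coeff hbar \<Gamma> k) (\<lambda>j. - exch_row \<Gamma> k j) k f a"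
    unfolding xhat_tilde_def first_order_def phat_def momentum_coeff_def by (simp add: field_simps)
qed

lemma intertwiner_eq: "intertwiner hbar \<Gamma> k = dilog_factor hbar \<Gamma> k \<circ> K_prime \<Gamma> k"
  unfolding intertwiner_def Let_def dilog_factor_def first_order_quotient_def first_order_fun_def xhat_first_order xhat_tilde_first_order ..

text \<open>
  The transpose of \<open>mutation_coords \<Gamma> k\<close>, acting on the frequencies of modulations.
\<close>

definition pull_frequency :: "('n::finite) seed \<Rightarrow> 'n \<Rightarrow> ('n \<Rightarrow> real) \<Rightarrow> 'n \<Rightarrow> real" where
  "pull_frequency \<Gamma> k \<eta> m = (if m = k then - \<eta> k else \<eta> m + real_of_int (max (- exch \<Gamma> k m) 0) * \<eta> k)"

context
  fixes \<Gamma> :: "('n::finite) seed" and k :: 'n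
  assumes kk: "exch \<Gamma> k k = 0"
begin

lemma mutation_coords_alt:
  "mutation_coords \<Gamma> k a = (\<chi> i. if i = k then - (a $ k) + linform (\<lambda>j. real_of_int (max (- exch \<Gamma> k j) 0)) a else a $ i)"
  unfolding mutation_coords_def linform_def ..

lemma measurable_mutation_coords: "mutation_coords \<Gamma> k \<in> borel_measurable borel"
proof (rule borel_measurable_continuous_onI)
  have "continuous_on UNIV (\<lambda>a. mutation_coords \<Gamma> k a $ i)" for i
    by (cases "i = k") (simp_all add: mutation_coords_def continuous_intros)
  then show "continuous_on UNIV (mutation_coords \<Gamma> k)"
    unfolding continuous_on_componentwise[of UNIV "mutation_coords \<Gamma> k"]
    by (simp add: Basis_vec_def inner_axis)
qed

lemma scaling_mutation_coords: "scaling 1 (mutation_coords \<Gamma> k)"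
proof (rule scaling_reflection[OF measurable_mutation_coords mutation_coords_alt])
  show "linform (\<lambda>j. real_of_int (max (- exch \<Gamma> k j) 0)) (a + y *\<^sub>R axis k 1)
      = linform (\<lambda>j. real_of_int (max (- exch \<Gamma> k j) 0)) a" for a y
    by (rule linform_translate) (simp add: kk)
qed

lemma K_prime_subst: "K_prime \<Gamma> k = subst_op 1 (mutation_coords \<Gamma> k)"
  by (simp add: K_prime_def[abs_def] subst_op_def[abs_def])

lemma mutation_coords_involution: "mutation_coords \<Gamma> k (mutation_coords \<Gamma> k a) = a"
proof -
  let ?c = "\<lambda>j. real_of_int (max (- exch \<Gamma> k j) 0)"
  have "linform ?c (mutation_coords \<Gamma> k a) = linform ?c a"
    unfolding linform_def by (intro sum.cong) (auto simp: mutation_coords_def kk)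
  then show ?thesis
    unfolding mutation_coords_alt[of "mutation_coords \<Gamma> k a"]
    by (simp add: vec_eq_iff) (simp add: mutation_coords_alt)
qed

lemma unitary_K_prime: "unitary (K_prime \<Gamma> k)"
  unfolding K_prime_subst
  by (rule unitary_subst_op[where B = "mutation_coords \<Gamma> k"]) (simp_all add: scaling_mutation_coords mutation_coords_involution)

lemma K_prime_involution: "K_prime \<Gamma> k (K_prime \<Gamma> k F) = F"
  by (simp add: K_prime_subst subst_op_subst_op scaling_mutation_coords mutation_coords_involution)

lemma pos_K_prime: "pos_l2 F \<Longrightarrow> pos_l2 (K_prime \<Gamma> k F)"
  unfolding K_prime_subst by (rule pos_l2_subst[OF scaling_mutation_coords])

lemma linform_mutation_coords: "linform \<eta> (mutation_coords \<Gamma> k a) = linform (pull_frequency \<Gamma> k \<eta>) a"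
proof -
  let ?c = "\<lambda>j. real_of_int (max (- exch \<Gamma> k j) 0)"
  have "linform \<eta> (mutation_coords \<Gamma> k a) = \<eta> k * (- (a $ k) + linform ?c a) + (\<Sum>i\<in>UNIV - {k}. \<eta> i * a $ i)"
    unfolding linform_def mutation_coords_def by (subst sum.remove[of _ k]) simp_all
  also have "linform ?c a = (\<Sum>i\<in>UNIV - {k}. ?c i * a $ i)"
    unfolding linform_def by (subst sum.remove[of _ k]) (simp_all add: kk)
  also have "\<eta> k * (- (a $ k) + (\<Sum>i\<in>UNIV - {k}. ?c i * a $ i)) + (\<Sum>i\<in>UNIV - {k}. \<eta> i * a $ i)
     = - \<eta> k * a $ k + (\<Sum>i\<in>UNIV - {k}. (\<eta> i + ?c i * \<eta> k) * a $ i)"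
    by (simp add: algebra_simps sum.distrib sum_distrib_left)
  also have "\<dots> = linform (pull_frequency \<Gamma> k \<eta>) a"
    unfolding linform_def pull_frequency_def by (subst (2) sum.remove[of _ k]) simp_all
  finally show ?thesis .
qed

lemma K_prime_modulation: "K_prime \<Gamma> k (modulation \<eta> F) = modulation (pull_frequency \<Gamma> k \<eta>) (K_prime \<Gamma> k F)"
  unfolding K_prime_subst modulation_def subst_op_mulop[OF scaling_mutation_coords bounded_borel_linform] linform_mutation_coords ..

end

section \<open>The dilogarithm factors of a seed\<close>

context
  fixes hbar :: real and \<Gamma> :: "('n::finite) seed" and k :: 'n
  assumes hbar: "hbar > 0" and d: "skew \<Gamma> k > 0" and kk: "exch \<Gamma> k k = 0"
begin

lemma momentum_coeff_pos: "momentum_coeff hbar \<Gamma> k > 0"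
  using hbar d by (simp add: momentum_coeff_def)

lemma unimodular_dilog: "unimodular (quantum_dilog (hbar / real (skew \<Gamma> k)))"
  using hbar d measurable_quantum_dilog[of "hbar / real (skew \<Gamma> k)"] cmod_quantum_dilog[of "hbar / real (skew \<Gamma> k)"]
  by (simp add: unimodular_def)

lemma exch_row_diagonal: "exch_row \<Gamma> k k = 0" by (simp add: exch_row_def kk)

lemma unitary_dilog_factor: "unitary (dilog_factor hbar \<Gamma> k)"
  unfolding dilog_factor_def using momentum_coeff_pos
  by (intro unitary_first_order_quotient[where e = "exch_row \<Gamma> k" and k = k] exch_row_diagonal unimodular_dilog) simp

lemma dilog_factor_modulation_0:
  assumes "\<eta> k = 0"
  shows "dilog_factor hbar \<Gamma> k (modulation \<eta> F) = modulation \<eta> (dilog_factor hbar \<Gamma> k F)"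
  using first_order_quotient_modulation[where e = "exch_row \<Gamma> k" and k = k, OF _ exch_row_diagonal unimodular_dilog, of "momentum_coeff hbar \<Gamma> k" \<eta> F] momentum_coeff_pos assms
  by (simp add: dilog_factor_def)

lemma dilog_factor_modulation_tendsto:
  assumes "filterlim (\<lambda>n. \<eta> n k) at_top sequentially"
  shows "(\<lambda>n. norm (dilog_factor hbar \<Gamma> k (modulation (\<eta> n) F) - modulation (\<eta> n) F)) \<longlonglongrightarrow> 0"
  unfolding dilog_factor_def
  using quantum_dilog_tendsto_1[of "hbar / real (skew \<Gamma> k)"] hbar d
  by (intro first_order_quotient_modulation_tendsto[where e = "exch_row \<Gamma> k" and k = k] momentum_coeff_pos exch_row_diagonal unimodular_dilog assms) simp

end

section \<open>Mutations and a rank two submatrix\<close>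

lemma D_seed_diagonal: "D_seed \<Gamma> \<Longrightarrow> exch \<Gamma> k k = 0"
proof -
  assume D: "D_seed \<Gamma>"
  then have "real_of_int (exch \<Gamma> k k) / real (skew \<Gamma> k) = - (real_of_int (exch \<Gamma> k k) / real (skew \<Gamma> k))"
    and "skew \<Gamma> k > 0" unfolding D_seed_def by blast+
  then show ?thesis by (simp add: field_simps)
qed

text \<open>
  The sign convention makes \<open>p\<close> and \<open>q\<close> positive, or both negative, for a seed of type B2.
\<close>

definition rank_two :: "('n::finite) seed \<Rightarrow> 'n \<Rightarrow> 'n \<Rightarrow> int \<Rightarrow> int \<Rightarrow> bool" where
  "rank_two \<Gamma> i j p q \<longleftrightarrow> exch \<Gamma> i i = 0 \<and> exch \<Gamma> j j = 0 \<and> exch \<Gamma> i j = p \<and> exch \<Gamma> j i = - q"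

lemma rank_two_mutate:
  assumes "rank_two \<Gamma> i j p q" "i \<noteq> j" "p * q \<ge> 0"
  shows "rank_two (mutate i \<Gamma>) i j (- p) (- q)" "rank_two (mutate j \<Gamma>) i j (- p) (- q)"
proof -
  have "\<bar>q\<bar> * p = q * \<bar>p\<bar>" "\<bar>p\<bar> * q = p * \<bar>q\<bar>"
    using assms(3) by (auto simp: zero_le_mult_iff abs_if)
  then show "rank_two (mutate i \<Gamma>) i j (- p) (- q)" "rank_two (mutate j \<Gamma>) i j (- p) (- q)"
    using assms(1,2) by (auto simp: rank_two_def mutate_def)
qed

text \<open>
  The term added to an entry of the exchange matrix by mutation, as a piecewise linear
  function of \<open>y\<close> for fixed sign of \<open>x\<close>.
\<close>

lemma mutation_correction: "(\<bar>x\<bar> * y + x * \<bar>y\<bar>) div 2 = (if x \<ge> 0 then x * max y 0 else x * max (- y) 0)" for x y :: int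
proof -
  have "\<bar>x\<bar> * y + x * \<bar>y\<bar> = 2 * (if x \<ge> 0 then x * max y 0 else x * max (- y) 0)"
    by (cases "x \<ge> 0"; cases "y \<ge> 0") (simp_all add: max_def)
  then show ?thesis by (simp only: nonzero_mult_div_cancel_left)
qed

lemma mutate_entry:
  "m \<noteq> l \<Longrightarrow> i \<noteq> l \<Longrightarrow> exch (mutate l \<Gamma>) i m = exch \<Gamma> i m + (if exch \<Gamma> i l \<ge> 0 then exch \<Gamma> i l * max (exch \<Gamma> l m) 0
      else exch \<Gamma> i l * max (- exch \<Gamma> l m) 0)"
  unfolding mutate_def using mutation_correction by simp

lemma mutate_row: "exch (mutate l \<Gamma>) l m = - exch \<Gamma> l m"
  by (simp add: mutate_def)

lemma skew_mutate [simp]: "skew (mutate l \<Gamma>) = skew \<Gamma>"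
  by (simp add: mutate_def)

section \<open>Intertwiners at high modulation\<close>

lemma norm_diff_null_trans:
  fixes X Y Z :: "nat \<Rightarrow> 'a::real_normed_vector"
  assumes "(\<lambda>n. norm (X n - Y n)) \<longlonglongrightarrow> 0" "(\<lambda>n. norm (Y n - Z n)) \<longlonglongrightarrow> 0"
  shows "(\<lambda>n. norm (X n - Z n)) \<longlonglongrightarrow> 0"
proof (rule null_sequence_le)
  show "(\<lambda>n. norm (X n - Y n) + norm (Y n - Z n)) \<longlonglongrightarrow> 0"
    using tendsto_add[OF assms] by simp
  show "norm (X n - Z n) \<le> norm (X n - Y n) + norm (Y n - Z n)" for n
    using norm_triangle_ineq[of "X n - Y n" "Y n - Z n"] by simp
qed simp

lemma norm_diff_null_unitary:
  assumes "unitary T" "(\<lambda>n. norm (X n - Y n)) \<longlonglongrightarrow> 0"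
  shows "(\<lambda>n. norm (T (X n) - T (Y n))) \<longlonglongrightarrow> 0"
  using assms(2) by (simp add: norm_unitary_diff[OF assms(1)])

context
  fixes hbar :: real and \<Gamma> :: "('n::finite) seed" and k :: 'n
  assumes hbar: "hbar > 0" and d: "skew \<Gamma> k > 0" and kk: "exch \<Gamma> k k = 0"
begin

lemma unitary_intertwiner: "unitary (intertwiner hbar \<Gamma> k)"
  unfolding intertwiner_eq by (intro unitary_comp unitary_dilog_factor unitary_K_prime hbar d kk)

text \<open>
  A frequency with \<open>\<eta>\<^sub>k = 0\<close> is fixed by the pullback and invisible to the dilogarithm
  factor.
\<close>

lemma intertwiner_modulation_0:
  assumes "\<eta> k = 0"
  shows "intertwiner hbar \<Gamma> k (modulation \<eta> F) = modulation \<eta> (intertwiner hbar \<Gamma> k F)"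
proof -
  have "pull_frequency \<Gamma> k \<eta> = \<eta>" using assms by (auto simp: pull_frequency_def fun_eq_iff)
  then show ?thesis
    using dilog_factor_modulation_0[where \<Gamma> = \<Gamma> and k = k and \<eta> = \<eta>, OF hbar d kk assms]
    by (simp add: intertwiner_eq K_prime_modulation[where k = k, OF kk])
qed

text \<open>
  The minus sign in the hypothesis comes from the pullback, which changes the sign of \<open>\<eta>\<^sub>k\<close>
  before the dilogarithm factor acts.
\<close>

lemma intertwiner_modulation_tendsto:
  assumes "filterlim (\<lambda>n. - \<eta> n k) at_top sequentially"
  shows "(\<lambda>n. norm (intertwiner hbar \<Gamma> k (modulation (\<eta> n) F) - modulation (pull_frequency \<Gamma> k (\<eta> n)) (K_prime \<Gamma> k F))) \<longlonglongrightarrow> 0"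
proof -
  have "filterlim (\<lambda>n. pull_frequency \<Gamma> k (\<eta> n) k) at_top sequentially"
    using assms by (simp add: pull_frequency_def)
  from dilog_factor_modulation_tendsto[where \<Gamma> = \<Gamma> and k = k and \<eta> = "\<lambda>n. pull_frequency \<Gamma> k (\<eta> n)", OF hbar d kk this]
  show ?thesis by (simp add: intertwiner_eq K_prime_modulation[where k = k, OF kk])
qed

end

section \<open>The mutation cycle of type B2\<close>

context
  fixes \<Gamma>0 \<Gamma>1 \<Gamma>2 \<Gamma>4 \<Gamma>5 :: "('n::finite) seed" and i j :: 'n and p q :: int and hbar :: real
  assumes hbar: "hbar > 0" and skew_pos: "\<And>k. skew \<Gamma>0 k > 0"
    and ij: "i \<noteq> j" and R0: "rank_two \<Gamma>0 i j p q" and pq: "p > 0" "q > 0" "p * q = 2"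
    and \<Gamma>1: "\<Gamma>1 = mutate i \<Gamma>0" and \<Gamma>2: "\<Gamma>2 = mutate j \<Gamma>1"
    and \<Gamma>4: "\<Gamma>4 = mutate j \<Gamma>0" and \<Gamma>5: "\<Gamma>5 = mutate i \<Gamma>4"
begin

lemma rank_two_seeds:
  "rank_two \<Gamma>1 i j (- p) (- q)" "rank_two \<Gamma>2 i j p q" "rank_two \<Gamma>4 i j (- p) (- q)" "rank_two \<Gamma>5 i j p q"
proof -
  have pq0: "p * q \<ge> 0" "(- p) * (- q) \<ge> 0" using pq by simp_all
  show 1: "rank_two \<Gamma>1 i j (- p) (- q)" unfolding \<Gamma>1 by (rule rank_two_mutate(1)[OF R0 ij pq0(1)])
  show 4: "rank_two \<Gamma>4 i j (- p) (- q)" unfolding \<Gamma>4 by (rule rank_two_mutate(2)[OF R0 ij pq0(1)])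
  show "rank_two \<Gamma>2 i j p q" unfolding \<Gamma>2 using rank_two_mutate(2)[OF 1 ij pq0(2)] by simp
  show "rank_two \<Gamma>5 i j p q" unfolding \<Gamma>5 using rank_two_mutate(1)[OF 4 ij pq0(2)] by simp
qed

lemma diagonal_entries:
  "exch \<Gamma>0 i i = 0" "exch \<Gamma>0 j j = 0" "exch \<Gamma>1 j j = 0" "exch \<Gamma>2 i i = 0" "exch \<Gamma>4 i i = 0" "exch \<Gamma>5 j j = 0"
  using R0 rank_two_seeds by (simp_all add: rank_two_def)

lemma rank_two_entries:
  "exch \<Gamma>0 i j = p" "exch \<Gamma>0 j i = - q" "exch \<Gamma>1 j i = q" "exch \<Gamma>1 i j = - p" "exch \<Gamma>2 i j = p"
  "exch \<Gamma>4 j i = q" "exch \<Gamma>4 i j = - p" "exch \<Gamma>5 j i = - q"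
  using R0 rank_two_seeds by (simp_all add: rank_two_def)

lemma skew_constant: "skew \<Gamma>1 = skew \<Gamma>0" "skew \<Gamma>2 = skew \<Gamma>0" "skew \<Gamma>4 = skew \<Gamma>0" "skew \<Gamma>5 = skew \<Gamma>0"
  by (simp_all add: \<Gamma>1 \<Gamma>2 \<Gamma>4 \<Gamma>5)

lemma mutated_rows:
  assumes "m \<noteq> i" "m \<noteq> j"
  shows "exch \<Gamma>1 j m = exch \<Gamma>0 j m - q * max (- exch \<Gamma>0 i m) 0"
    and "exch \<Gamma>2 i m = - exch \<Gamma>0 i m - p * max (- exch \<Gamma>1 j m) 0"
    and "exch \<Gamma>4 i m = exch \<Gamma>0 i m + p * max (exch \<Gamma>0 j m) 0"
    and "exch \<Gamma>5 j m = - exch \<Gamma>0 j m + q * max (exch \<Gamma>4 i m) 0"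
proof -
  show "exch \<Gamma>1 j m = exch \<Gamma>0 j m - q * max (- exch \<Gamma>0 i m) 0"
    unfolding \<Gamma>1 using assms ij pq rank_two_entries by (simp add: mutate_entry)
  have "exch \<Gamma>1 i m = - exch \<Gamma>0 i m" unfolding \<Gamma>1 by (rule mutate_row)
  then show "exch \<Gamma>2 i m = - exch \<Gamma>0 i m - p * max (- exch \<Gamma>1 j m) 0"
    unfolding \<Gamma>2 using assms ij pq rank_two_entries by (simp add: mutate_entry)
  show "exch \<Gamma>4 i m = exch \<Gamma>0 i m + p * max (exch \<Gamma>0 j m) 0"
    unfolding \<Gamma>4 using assms ij pq rank_two_entries by (simp add: mutate_entry)
  have "exch \<Gamma>4 j m = - exch \<Gamma>0 j m" unfolding \<Gamma>4 by (rule mutate_row)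
  then show "exch \<Gamma>5 j m = - exch \<Gamma>0 j m + q * max (exch \<Gamma>4 i m) 0"
    unfolding \<Gamma>5 using assms ij pq rank_two_entries by (simp add: mutate_entry)
qed

text \<open>
  This is what the agreement of the frequencies amounts to in a coordinate \<open>m\<close> other than
  \<open>i\<close> and \<open>j\<close>, with \<open>u\<close> and \<open>v\<close> the entries of column \<open>m\<close> in rows \<open>i\<close> and \<open>j\<close> of the matrix
  of \<open>\<Gamma>0\<close>, and \<open>w\<close> the entry in row \<open>i\<close> for \<open>\<Gamma>4\<close>. As \<open>p q = 2\<close>, only two pairs \<open>(p, q)\<close>
  occur, and for each of them the identity is piecewise linear.
\<close>

lemma tropical_identity:
  fixes u v :: int
  assumes "w = u + p * max v 0"
  shows "max (- (v - q * max (- u) 0)) 0 = max (- (- v + q * max w 0)) 0 + q * max (- w) 0 + max (- v) 0"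
proof -
  have "p = 1 \<and> q = 2 \<or> p = 2 \<and> q = 1"
  proof -
    have "p dvd 2" using pq(3) by (metis dvd_triv_left)
    then have "p \<le> 2" by (simp add: zdvd_imp_le)
    then have "p = 1 \<or> p = 2" using pq(1) by linarith
    then show ?thesis using pq(3) by auto
  qed
  then show ?thesis using assms by (auto simp: max_def split: if_splits)
qed

text \<open>
  The direction \<open>-e\<^sub>j\<close> is chosen because on the left it reaches only the middle dilogarithm
  factor, whereas on the right it removes all three.
\<close>

definition "escape_frequency (n::nat) m = (if m = j then - real n else 0)"

text \<open>
  On the left the outer two mutations, in direction \<open>i\<close>, do not change the frequency, so
  only the pullback of the middle one appears.
\<close>

lemma frequencies_agree:
  "pull_frequency \<Gamma>1 j (escape_frequency n) = pull_frequency \<Gamma>0 j (pull_frequency \<Gamma>4 i (pull_frequency \<Gamma>5 j (escape_frequency n)))"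
    (is "?l = ?r")
proof
  fix m
  have max0: "max (- p) 0 = 0" "max (- q) 0 = 0" "max p 0 = p" "max q 0 = q" using pq by simp_all
  consider "m = i" | "m = j" | "m \<noteq> i" "m \<noteq> j" by blast
  then show "?l m = ?r m"
  proof cases
    case 1
    have "real_of_int p * real_of_int q = 2" using pq(3) by (metis of_int_mult of_int_numeral)
    then show ?thesis using 1 ij by (simp add: pull_frequency_def escape_frequency_def rank_two_entries max0 diagonal_entries algebra_simps)
  next
    case 2
    have "real_of_int p * real_of_int q = 2" using pq(3) by (metis of_int_mult of_int_numeral)
    then show ?thesis using 2 ij by (simp add: pull_frequency_def escape_frequency_def rank_two_entries max0 diagonal_entries algebra_simps)
  next
    case 3
    let ?M = "\<lambda>x. max (- x) 0"
    have T: "?M (exch \<Gamma>1 j m) = ?M (exch \<Gamma>5 j m) + q * ?M (exch \<Gamma>4 i m) + ?M (exch \<Gamma>0 j m)"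
      unfolding mutated_rows(1)[OF 3] mutated_rows(4)[OF 3] by (rule tropical_identity) (rule mutated_rows(3)[OF 3])
    have pqr: "real_of_int p * real_of_int q = 2" using pq(3) by (metis of_int_mult of_int_numeral)
    have l: "?l m = - real_of_int (?M (exch \<Gamma>1 j m)) * real n"
      using 3 ij by (simp add: pull_frequency_def escape_frequency_def)
    have z5: "pull_frequency \<Gamma>5 j (escape_frequency n) j = real n" "pull_frequency \<Gamma>5 j (escape_frequency n) i = - (real_of_int q * real n)"
      "pull_frequency \<Gamma>5 j (escape_frequency n) m = - real_of_int (?M (exch \<Gamma>5 j m)) * real n"
      using 3 ij by (simp_all add: pull_frequency_def escape_frequency_def rank_two_entries max0)
    have z4: "pull_frequency \<Gamma>4 i (pull_frequency \<Gamma>5 j (escape_frequency n)) j = - real n"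
      "pull_frequency \<Gamma>4 i (pull_frequency \<Gamma>5 j (escape_frequency n)) m
         = - real_of_int (?M (exch \<Gamma>5 j m)) * real n - real_of_int (?M (exch \<Gamma>4 i m)) * (real_of_int q * real n)"
      unfolding pull_frequency_def[of \<Gamma>4] z5 using 3 ij pqr by (simp_all add: rank_two_entries max0 algebra_simps)
    have "?r m = - real_of_int (?M (exch \<Gamma>5 j m)) * real n - real_of_int (?M (exch \<Gamma>4 i m)) * (real_of_int q * real n)
      - real_of_int (?M (exch \<Gamma>0 j m)) * real n"
      unfolding pull_frequency_def[of \<Gamma>0] z4 using 3 by simp
    also have "\<dots> = - real_of_int (?M (exch \<Gamma>5 j m) + q * ?M (exch \<Gamma>4 i m) + ?M (exch \<Gamma>0 j m)) * real n"
      by (simp add: algebra_simps del: of_int_max)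
    finally show ?thesis unfolding l T ..
  qed
qed

text \<open>
  The frequencies met by the three dilogarithm factors are \<open>0\<close>, \<open>n\<close>, \<open>0\<close>.
\<close>

lemma modulation_limit_left:
  "(\<lambda>n. norm (intertwiner hbar \<Gamma>0 i (intertwiner hbar \<Gamma>1 j (intertwiner hbar \<Gamma>2 i (modulation (escape_frequency n) F)))
     - modulation (pull_frequency \<Gamma>1 j (escape_frequency n)) (intertwiner hbar \<Gamma>0 i (K_prime \<Gamma>1 j (intertwiner hbar \<Gamma>2 i F))))) \<longlonglongrightarrow> 0"
proof -
  \<comment> \<open>The outer two intertwiners, in direction \<open>i\<close>, commute with the modulations that reach them.\<close>
  have I2: "intertwiner hbar \<Gamma>2 i (modulation (escape_frequency n) F) = modulation (escape_frequency n) (intertwiner hbar \<Gamma>2 i F)" for n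
    by (rule intertwiner_modulation_0[where k = i]) (use hbar skew_pos ij in \<open>simp_all add: skew_constant diagonal_entries escape_frequency_def\<close>)
  have f0: "pull_frequency \<Gamma>1 j (escape_frequency n) i = 0" for n
    using ij pq by (simp add: pull_frequency_def escape_frequency_def rank_two_entries)
  have I0: "intertwiner hbar \<Gamma>0 i (modulation (pull_frequency \<Gamma>1 j (escape_frequency n)) G) = modulation (pull_frequency \<Gamma>1 j (escape_frequency n)) (intertwiner hbar \<Gamma>0 i G)" for n G
    by (rule intertwiner_modulation_0[where k = i]) (use hbar skew_pos in \<open>simp_all add: diagonal_entries f0\<close>)
  have "(\<lambda>n. norm (intertwiner hbar \<Gamma>1 j (modulation (escape_frequency n) G) - modulation (pull_frequency \<Gamma>1 j (escape_frequency n)) (K_prime \<Gamma>1 j G))) \<longlonglongrightarrow> 0" for G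
    by (rule intertwiner_modulation_tendsto[where k = j])
       (use hbar skew_pos in \<open>simp_all add: skew_constant diagonal_entries escape_frequency_def filterlim_real_sequentially\<close>)
  from norm_diff_null_unitary[OF unitary_intertwiner[where \<Gamma> = \<Gamma>0 and k = i, OF hbar skew_pos diagonal_entries(1)] this]
  show ?thesis unfolding I2 I0 .
qed

text \<open>
  The frequencies met by the three dilogarithm factors are \<open>n\<close>, \<open>q n\<close>, \<open>n\<close>, in the order in
  which they act. The last one is \<open>(p q - 1) n\<close>, which equals \<open>n\<close>.
\<close>

lemma modulation_limit_right:
  "(\<lambda>n. norm (intertwiner hbar \<Gamma>0 j (intertwiner hbar \<Gamma>4 i (intertwiner hbar \<Gamma>5 j (modulation (escape_frequency n) F)))
     - modulation (pull_frequency \<Gamma>0 j (pull_frequency \<Gamma>4 i (pull_frequency \<Gamma>5 j (escape_frequency n))))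
         (K_prime \<Gamma>0 j (K_prime \<Gamma>4 i (K_prime \<Gamma>5 j F))))) \<longlonglongrightarrow> 0"
proof -
  have pqr: "real_of_int p * real_of_int q = 2" using pq(3) by (metis of_int_mult of_int_numeral)
  have "filterlim (\<lambda>n. - pull_frequency \<Gamma>5 j (escape_frequency n) i) at_top sequentially"
  proof -
    have "- pull_frequency \<Gamma>5 j (escape_frequency n) i = real_of_int q * real n" for n
      using ij pq by (simp add: pull_frequency_def escape_frequency_def rank_two_entries)
    then show ?thesis
      using filterlim_tendsto_pos_mult_at_top[OF tendsto_const[of "real_of_int q"] _ filterlim_real_sequentially] pq by simp
  qed
  moreover have "- pull_frequency \<Gamma>4 i (pull_frequency \<Gamma>5 j (escape_frequency n)) j = real n" for n
    using ij pq pqr by (simp add: pull_frequency_def escape_frequency_def rank_two_entries algebra_simps)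
  ultimately have
    A: "(\<lambda>n. norm (intertwiner hbar \<Gamma>5 j (modulation (escape_frequency n) F) - modulation (pull_frequency \<Gamma>5 j (escape_frequency n)) (K_prime \<Gamma>5 j F))) \<longlonglongrightarrow> 0"
    and B: "(\<lambda>n. norm (intertwiner hbar \<Gamma>4 i (modulation (pull_frequency \<Gamma>5 j (escape_frequency n)) G)
       - modulation (pull_frequency \<Gamma>4 i (pull_frequency \<Gamma>5 j (escape_frequency n))) (K_prime \<Gamma>4 i G))) \<longlonglongrightarrow> 0"
    and C: "(\<lambda>n. norm (intertwiner hbar \<Gamma>0 j (modulation (pull_frequency \<Gamma>4 i (pull_frequency \<Gamma>5 j (escape_frequency n))) G)
       - modulation (pull_frequency \<Gamma>0 j (pull_frequency \<Gamma>4 i (pull_frequency \<Gamma>5 j (escape_frequency n)))) (K_prime \<Gamma>0 j G))) \<longlonglongrightarrow> 0" for G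
    by - (rule intertwiner_modulation_tendsto;
       use hbar skew_pos in \<open>simp add: skew_constant diagonal_entries escape_frequency_def filterlim_real_sequentially\<close>)+
  have U4: "unitary (intertwiner hbar \<Gamma>4 i)" and U0: "unitary (intertwiner hbar \<Gamma>0 j)"
    by (rule unitary_intertwiner; use hbar skew_pos in \<open>simp add: skew_constant diagonal_entries\<close>)+
  show ?thesis
    by (rule norm_diff_null_trans[OF norm_diff_null_unitary[OF U0 norm_diff_null_trans[OF norm_diff_null_unitary[OF U4 A] B]] C])
qed

text \<open>
  By \<open>frequencies_agree\<close> both sides carry the same modulation in the limit. It is unitary,
  so the two remaining vectors, which do not depend on \<open>n\<close>, are equal and not just
  asymptotic.
\<close>

lemma identity_after_modulation_limit:
  assumes eq: "intertwiner hbar \<Gamma>0 i \<circ> intertwiner hbar \<Gamma>1 j \<circ> intertwiner hbar \<Gamma>2 i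
       = cscale c \<circ> (intertwiner hbar \<Gamma>0 j \<circ> intertwiner hbar \<Gamma>4 i \<circ> intertwiner hbar \<Gamma>5 j)"
    and c: "cmod c = 1"
  shows "intertwiner hbar \<Gamma>0 i (K_prime \<Gamma>1 j (intertwiner hbar \<Gamma>2 i F))
       = cscale c (K_prime \<Gamma>0 j (K_prime \<Gamma>4 i (K_prime \<Gamma>5 j F)))"
proof -
  let ?W = "\<lambda>n. modulation (pull_frequency \<Gamma>1 j (escape_frequency n))"
  let ?l = "intertwiner hbar \<Gamma>0 i (K_prime \<Gamma>1 j (intertwiner hbar \<Gamma>2 i F))"
  let ?r = "K_prime \<Gamma>0 j (K_prime \<Gamma>4 i (K_prime \<Gamma>5 j F))"
  have eq': "intertwiner hbar \<Gamma>0 i (intertwiner hbar \<Gamma>1 j (intertwiner hbar \<Gamma>2 i G))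
      = cscale c (intertwiner hbar \<Gamma>0 j (intertwiner hbar \<Gamma>4 i (intertwiner hbar \<Gamma>5 j G)))" for G
    using fun_cong[OF eq, of G] by simp
  have R: "(\<lambda>n. norm (cscale c (intertwiner hbar \<Gamma>0 j (intertwiner hbar \<Gamma>4 i (intertwiner hbar \<Gamma>5 j (modulation (escape_frequency n) F))))
      - cscale c (?W n ?r))) \<longlonglongrightarrow> 0"
    using modulation_limit_right[of F]
    by (simp add: frequencies_agree norm_cscale c flip: cscale_diff_right)
  have "(\<lambda>n. norm (?W n ?l - cscale c (?W n ?r))) \<longlonglongrightarrow> 0"
    by (rule norm_diff_null_trans[OF _ R]) (use modulation_limit_left[of F] in \<open>simp add: eq' norm_minus_commute\<close>)
  moreover have "norm (?W n ?l - cscale c (?W n ?r)) = norm (?l - cscale c ?r)" for n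
    using norm_unitary_diff[OF unitary_modulation, of "pull_frequency \<Gamma>1 j (escape_frequency n)" ?l "cscale c ?r"]
    by (simp add: clinear_cscale[OF unitary_clinear[OF unitary_modulation]])
  ultimately show ?thesis by (simp add: LIMSEQ_const_iff)
qed

lemma volume_preserving_comp:
  assumes "scaling 1 A" "scaling 1 B"
  shows "scaling 1 (\<lambda>a. A (B a))"
proof -
  have [measurable]: "A \<in> borel_measurable borel" "B \<in> borel_measurable borel"
    and d: "distr lborel borel A = lborel" "distr lborel borel B = lborel"
    using assms by (auto simp: scaling_def density_1 simp flip: one_ennreal_def)
  have "distr lborel borel (\<lambda>a. A (B a)) = distr (distr lborel borel B) borel A"
    by (subst distr_distr) (auto simp: comp_def)
  then show ?thesis by (simp add: scaling_def d density_1 flip: one_ennreal_def)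
qed

section \<open>Reflection of the remaining dilogarithm factor\<close>

text \<open>
  The composed substitution sends \<open>e\<^sub>i\<close> to \<open>-e\<^sub>i\<close> and pulls row \<open>i\<close> of the exchange matrix of
  \<open>\<Gamma>2\<close> back to the negative of row \<open>i\<close> for \<open>\<Gamma>0\<close>; both the derivative and the linear form
  change sign. The factor \<open>\<sigma>\<close> covers \<open>x\<close> and \<open>x~\<close> simultaneously.
\<close>

lemma reflected_group:
  "first_order_group \<kappa> (\<lambda>m. \<sigma> * exch_row \<Gamma>0 i m) i s (K_prime \<Gamma>0 i (K_prime \<Gamma>1 j F))
   = K_prime \<Gamma>0 i (K_prime \<Gamma>1 j (first_order_group \<kappa> (\<lambda>m. \<sigma> * exch_row \<Gamma>2 i m) i (- s) F))"
proof -
  define B where "B a = mutation_coords \<Gamma>1 j (mutation_coords \<Gamma>0 i a)" for a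
  note sA = scaling_mutation_coords[where k = i and \<Gamma> = \<Gamma>0, OF diagonal_entries(1)] scaling_mutation_coords[where k = j and \<Gamma> = \<Gamma>1, OF diagonal_entries(3)]
  have sB: "scaling 1 B" unfolding B_def[abs_def] by (rule volume_preserving_comp[OF sA(2,1)])
  have L: "K_prime \<Gamma>0 i (K_prime \<Gamma>1 j G) = subst_op 1 B G" for G
    unfolding K_prime_subst[where k = i, OF diagonal_entries(1)] K_prime_subst[where k = j, OF diagonal_entries(3)] B_def[abs_def]
    using subst_op_subst_op[OF sA(1) sA(2)] by simp
  have lin: "linform (\<lambda>m. \<sigma> * exch_row \<Gamma>2 i m) (B a) = - linform (\<lambda>m. \<sigma> * exch_row \<Gamma>0 i m) a" for a
  proof -
    have row: "pull_frequency \<Gamma>0 i (pull_frequency \<Gamma>1 j (exch_row \<Gamma>2 i)) m = - exch_row \<Gamma>0 i m" for m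
    proof -
      consider "m = i" | "m = j" | "m \<noteq> i" "m \<noteq> j" by blast
      then show ?thesis
      proof cases
        case 3
        have "pull_frequency \<Gamma>0 i (pull_frequency \<Gamma>1 j (exch_row \<Gamma>2 i)) m
            = real_of_int (exch \<Gamma>2 i m) + real_of_int (max (- exch \<Gamma>1 j m) 0) * real_of_int p"
          using 3 ij pq by (simp add: pull_frequency_def exch_row_def rank_two_entries diagonal_entries)
        then show ?thesis using mutated_rows(2)[OF 3] by (simp add: exch_row_def del: of_int_max)
      qed (use ij pq in \<open>simp_all add: pull_frequency_def exch_row_def rank_two_entries diagonal_entries\<close>)
    qed
    have "linform (exch_row \<Gamma>2 i) (B a) = linform (\<lambda>m. - exch_row \<Gamma>0 i m) a"
      unfolding B_def linform_mutation_coords[where k = i, OF diagonal_entries(1)] linform_mutation_coords[where k = j, OF diagonal_entries(3)] row ..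
    then show ?thesis by (simp add: linform_scale linform_def sum_negf)
  qed
  let ?w = "axis i (\<kappa> * s) :: real ^ 'n"
  have Bw: "B (a - ?w) = B a - axis i (\<kappa> * (- s))" for a
  proof -
    have l: "linform e (a - axis i r) = linform e a" if "e i = 0" for e a and r :: real
      unfolding linform_diff linform_axis using that by simp
    have 0: "mutation_coords \<Gamma>0 i (a - ?w) = mutation_coords \<Gamma>0 i a - axis i (\<kappa> * (- s))"
      unfolding mutation_coords_alt[where \<Gamma> = \<Gamma>0 and k = i, OF diagonal_entries(1)]
      by (subst l) (auto simp: vec_eq_iff axis_def diagonal_entries)
    have 1: "mutation_coords \<Gamma>1 j (a - axis i r) = mutation_coords \<Gamma>1 j a - axis i r" for a and r :: real
      unfolding mutation_coords_alt[where \<Gamma> = \<Gamma>1 and k = j, OF diagonal_entries(3)]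
      by (subst l) (use ij pq in \<open>auto simp: vec_eq_iff axis_def rank_two_entries\<close>)
    show ?thesis unfolding B_def 0 1 ..
  qed
  have b: "bounded_borel (\<lambda>a :: real ^ 'n. exp (- \<i> * of_real ((- s) * linform (\<lambda>m. \<sigma> * exch_row \<Gamma>2 i m) a)))"
    by (rule bounded_borel_unimodular) auto
  have "subst_op 1 B (first_order_group \<kappa> (\<lambda>m. \<sigma> * exch_row \<Gamma>2 i m) i (- s) F)
     = mulop (\<lambda>a. exp (- \<i> * of_real (s * linform (\<lambda>m. \<sigma> * exch_row \<Gamma>0 i m) a))) (subst_op 1 B (translate (axis i (\<kappa> * (- s))) F))"
    unfolding first_order_group_def subst_op_mulop[OF sB b] lin by simp
  also have "subst_op 1 B (translate (axis i (\<kappa> * (- s))) F) = translate ?w (subst_op 1 B F)"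
    unfolding translate_def subst_op_subst_op[OF sB scaling_translation] subst_op_subst_op[OF scaling_translation sB] Bw by simp
  finally show ?thesis by (simp add: L first_order_group_def)
qed

lemma reflected_dilog_factor:
  "first_order_quotient (momentum_coeff hbar \<Gamma>0 i) (exch_row \<Gamma>0 i) i (\<lambda>t. quantum_dilog (hbar / real (skew \<Gamma>0 i)) (- t)) (K_prime \<Gamma>0 i (K_prime \<Gamma>1 j F))
   = K_prime \<Gamma>0 i (K_prime \<Gamma>1 j (dilog_factor hbar \<Gamma>2 i F))"
proof -
  let ?\<Phi> = "quantum_dilog (hbar / real (skew \<Gamma>0 i))" and ?L = "\<lambda>F. K_prime \<Gamma>0 i (K_prime \<Gamma>1 j F)"
  have U: "unitary ?L"
    using unitary_comp[OF unitary_K_prime[where k = i, OF diagonal_entries(1)] unitary_K_prime[where k = j, OF diagonal_entries(3)]] by (simp add: comp_def)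
  have u: "unimodular (\<lambda>t. ?\<Phi> (- t))"
    using unimodular_affine[OF unimodular_dilog[where \<Gamma> = \<Gamma>0 and k = i, OF hbar skew_pos diagonal_entries(1)], of "-1" 0] by simp
  have "first_order_quotient (momentum_coeff hbar \<Gamma>0 i) (exch_row \<Gamma>0 i) i (\<lambda>t. ?\<Phi> (- t)) (?L F)
      = ?L (first_order_quotient (momentum_coeff hbar \<Gamma>0 i) (exch_row \<Gamma>2 i) i (\<lambda>t. ?\<Phi> (- ((- 1) * t + 0))) F)"
  proof (rule first_order_quotient_conjugate[where W = ?L and e = "exch_row \<Gamma>2 i" and e' = "exch_row \<Gamma>0 i" and k = i and \<phi> = "\<lambda>t. ?\<Phi> (- t)", OF _ _ _ u U])
    show "momentum_coeff hbar \<Gamma>0 i \<noteq> 0" using momentum_coeff_pos[where \<Gamma> = \<Gamma>0 and k = i, OF hbar skew_pos diagonal_entries(1)] by simp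
    show "exch_row \<Gamma>2 i i = 0" "exch_row \<Gamma>0 i i = 0" by (simp_all add: exch_row_def diagonal_entries)
  qed (simp add: reflected_group)
  then show ?thesis by (simp add: dilog_factor_def momentum_coeff_def skew_constant)
qed

text \<open>
  The case \<open>\<epsilon>\<^sub>i\<^sub>j > 0\<close>.
\<close>

lemma constant_eq_1:
  assumes eq: "intertwiner hbar \<Gamma>0 i \<circ> intertwiner hbar \<Gamma>1 j \<circ> intertwiner hbar \<Gamma>2 i
       = cscale c \<circ> (intertwiner hbar \<Gamma>0 j \<circ> intertwiner hbar \<Gamma>4 i \<circ> intertwiner hbar \<Gamma>5 j)"
    and c: "cmod c = 1"
  shows "c = 1"
proof -
  let ?\<Phi> = "quantum_dilog (hbar / real (skew \<Gamma>0 i))" and ?\<kappa> = "momentum_coeff hbar \<Gamma>0 i" and ?e = "exch_row \<Gamma>0 i"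
  define P where "P = first_order_quotient ?\<kappa> ?e i ?\<Phi>"
  define Q where "Q = first_order_quotient ?\<kappa> ?e i (\<lambda>t. ?\<Phi> (- t))"
  define y where "y n = squeeze i n (abs_l2 (gauss (\<lambda>_. 0)))" for n
  \<comment> \<open>Since the \<open>K_prime\<close> are involutions, the substitutions on the left take \<open>f n\<close> back to \<open>y n\<close>.\<close>
  define f where "f n = K_prime \<Gamma>2 i (K_prime \<Gamma>1 j (K_prime \<Gamma>0 i (y n)))" for n
  define h where "h n = K_prime \<Gamma>0 j (K_prime \<Gamma>4 i (K_prime \<Gamma>5 j (f n)))" for n
  have \<kappa>: "?\<kappa> \<noteq> 0" using momentum_coeff_pos[where \<Gamma> = \<Gamma>0 and k = i, OF hbar skew_pos diagonal_entries(1)] by simp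
  have e0: "?e i = 0" by (simp add: exch_row_def diagonal_entries)
  have u: "unimodular ?\<Phi>" by (rule unimodular_dilog[where \<Gamma> = \<Gamma>0 and k = i, OF hbar skew_pos diagonal_entries(1)])
  have u': "unimodular (\<lambda>t. ?\<Phi> (- t))" using unimodular_affine[OF u, of "-1" 0] by simp
  have hy: "cscale c (h n) = P (Q (y n))" for n
  proof -
    have "cscale c (h n) = intertwiner hbar \<Gamma>0 i (K_prime \<Gamma>1 j (intertwiner hbar \<Gamma>2 i (f n)))"
      unfolding h_def by (rule identity_after_modulation_limit[OF eq c, symmetric])
    also have "\<dots> = P (K_prime \<Gamma>0 i (K_prime \<Gamma>1 j (dilog_factor hbar \<Gamma>2 i (K_prime \<Gamma>2 i (f n)))))"
      by (simp add: intertwiner_eq dilog_factor_def[of hbar \<Gamma>0] P_def)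
    also have "\<dots> = P (Q (K_prime \<Gamma>0 i (K_prime \<Gamma>1 j (K_prime \<Gamma>2 i (f n)))))"
      by (simp add: reflected_dilog_factor Q_def)
    also have "K_prime \<Gamma>0 i (K_prime \<Gamma>1 j (K_prime \<Gamma>2 i (f n))) = y n"
      by (simp add: f_def K_prime_involution diagonal_entries)
    finally show ?thesis .
  qed
  have "pos_l2 (y n)" for n
  proof -
    define d where "d l = (if l = i then 1 else real (Suc n))" for l
    have "d l \<noteq> 0" for l by (simp add: d_def del: of_nat_Suc)
    from pos_l2_subst[OF scaling_diagonal[of d, OF this] pos_l2_gauss]
    show ?thesis by (simp add: y_def squeeze_def Let_def d_def del: of_nat_Suc)
  qed
  moreover from this have "pos_l2 (h n)" for n
    unfolding h_def f_def by (intro pos_K_prime diagonal_entries)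
  moreover have "norm (y n) = norm (abs_l2 (gauss (\<lambda>_. 0)) :: 'n l2)" for n
    unfolding y_def by (rule unitary_norm[OF unitary_squeeze])
  moreover have "(\<lambda>n. norm (cscale c (h n) - y n)) \<longlonglongrightarrow> 0"
    unfolding hy
  proof (rule norm_diff_null_trans[where Y = "\<lambda>n. P (y n)"])
    show "(\<lambda>n. norm (P (Q (y n)) - P (y n))) \<longlonglongrightarrow> 0"
      unfolding P_def Q_def y_def
      by (rule norm_diff_null_unitary[OF unitary_first_order_quotient[where e = "exch_row \<Gamma>0 i" and k = i, OF \<kappa> e0 u] first_order_quotient_squeeze_tendsto[where e = "exch_row \<Gamma>0 i" and k = i, OF \<kappa> e0 u']])
    show "(\<lambda>n. norm (P (y n) - y n)) \<longlonglongrightarrow> 0"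
      unfolding P_def y_def by (rule first_order_quotient_squeeze_tendsto[where e = "exch_row \<Gamma>0 i" and k = i, OF \<kappa> e0 u])
  qed
  ultimately show ?thesis
    using phase_eq_1_if_pos[where y = y and h = h, OF _ _ _ gauss_nonzero c] by blast
qed

end

theorem proposition138:
  fixes \<Gamma>0 \<Gamma>1 \<Gamma>2 \<Gamma>3 \<Gamma>4 \<Gamma>5 :: "('n::finite) seed" and i j :: 'n
    and hbar :: real and c :: complex
  assumes "hbar > 0" and "hbar \<notin> \<rat>"
    and "D_seed \<Gamma>0"
    and "exch \<Gamma>0 i j = - 2 * exch \<Gamma>0 j i" and "\<bar>exch \<Gamma>0 i j\<bar> = 2"
    and "\<Gamma>1 = mutate i \<Gamma>0" and "\<Gamma>2 = mutate j \<Gamma>1" and "\<Gamma>3 = mutate i \<Gamma>2"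
    and "\<Gamma>4 = mutate j \<Gamma>0" and "\<Gamma>5 = mutate i \<Gamma>4"
    and "cmod c = 1"
    and "intertwiner hbar \<Gamma>0 i \<circ> intertwiner hbar \<Gamma>1 j \<circ> intertwiner hbar \<Gamma>2 i
       = cscale c \<circ> (intertwiner hbar \<Gamma>0 j \<circ> intertwiner hbar \<Gamma>4 i \<circ> intertwiner hbar \<Gamma>5 j)"
  shows "c = 1"
proof -
  have skew_pos: "skew \<Gamma>0 k > 0" for k using \<open>D_seed \<Gamma>0\<close> by (simp add: D_seed_def)
  note d = D_seed_diagonal[OF \<open>D_seed \<Gamma>0\<close>]
  have ij: "i \<noteq> j" using assms(5) d by auto
  show ?thesis
  proof (cases "exch \<Gamma>0 i j > 0")
    case True
    then have "rank_two \<Gamma>0 i j 2 1" using assms(4,5) d by (simp add: rank_two_def)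
    from constant_eq_1[OF assms(1) skew_pos ij this _ _ _ assms(6,7,9,10,12,11)] show ?thesis by simp
  next
    case False
    then have r: "rank_two \<Gamma>0 j i 1 2" using assms(4,5) d by (simp add: rank_two_def)
    \<comment> \<open>Exchanging \<open>i\<close> and \<open>j\<close> exchanges the two sides of the identity.\<close>
    have cc: "inverse c * c = 1" "cmod (inverse c) = 1" using assms(11) by (auto simp: norm_inverse intro!: left_inverse)
    have "intertwiner hbar \<Gamma>0 j \<circ> intertwiner hbar \<Gamma>4 i \<circ> intertwiner hbar \<Gamma>5 j
      = cscale (inverse c) \<circ> (intertwiner hbar \<Gamma>0 i \<circ> intertwiner hbar \<Gamma>1 j \<circ> intertwiner hbar \<Gamma>2 i)"
      unfolding assms(12) using cc(1) by (simp add: fun_eq_iff cscale_cscale)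
    from constant_eq_1[OF assms(1) skew_pos ij[symmetric] r _ _ _ assms(9,10,6,7) this cc(2)]
    have "inverse c = 1" by simp
    then show ?thesis by simp
  qed
qed

end
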